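(* Let $a>0$ and $\gamma:\mathbb{R}\to\mathbb{R}$, $\gamma\not\equiv 0$, define a curved planar waveguide $\Sigma$ satisfying assumptions (i)–(iv) of the context, and let $S\in\{\tfrac12,\tfrac32,\tfrac52,\dots\}$. Then the number $N$ of neutral particles of half-integer spin $S$ which the curved quantum waveguide can bind satisfies the inequality $$N\le (2S+1)\left\{ 1+\delta_+^2\,\frac{\int_{\mathbb{R}^2}\tilde W(s)\,|s-t|\,\tilde W(t)\,ds\,dt}{\int_{\mathbb{R}}\tilde W(s)\,ds}+\sum_{j=2}^{\infty}\frac{a\,\delta_+^2}{\pi\sqrt{j^2-1}}\int_{\mathbb{R}}\tilde W_j(s)\,ds\right\}.$$
   Context: Waveguide. Let $a>0$ and let $\Gamma:\mathbb{R}\to\mathbb{R}^2$ be an infinite planar curve parametrized by arc length $s$ with signed curvature $\gamma(s)$; up to Euclidean transformations $\Gamma'(s)=(\cos\theta(s),\sin\theta(s))$ with $\theta(s)=\int_0^s\gamma(t)\,dt$. With the unit normal $n(s)=(\sin\theta(s),-\cos\theta(s))$, put $\vec r(s,u)=\Gamma(s)+u\,n(s)$ (the Jacobian of this map is $1+u\gamma(s)$) and let $\Sigma=\vec r(\mathbb{R}\times(-a,a))$ be the strip of width $2a$ with axis $\Gamma$. Assumptions: (i) $\Sigma$ is not self-intersecting (the map $\vec r$ is injective on $\mathbb{R}\times(-a,a)$); (ii) $a\|\gamma\|_\infty<1$; (iii) $\gamma$ is piecewise $C^2$ with $\gamma',\gamma''$ bounded; (iv) there is $b>0$ such that $\gamma(s)=0$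 for $|s|>b$, and $b$ is chosen so that $2b>a$. One-particle Hamiltonian (units $\hbar=2m=1$). It is the Dirichlet Laplacian $-\Delta_D^\Sigma$ on $L^2(\Sigma)$, which in the coordinates $(s,u)$ is unitarily equivalent to the operator $$H_1=-\partial_s(1+u\gamma)^{-2}\partial_s-\partial_u^2+V(s,u)$$ on $L^2(\mathbb{R}\times(-a,a))$ with Dirichlet conditions at $u=\pm a$, where $$V(s,u)=-\frac{\gamma(s)^2}{4(1+u\gamma(s))^2}+\frac{u\gamma''(s)}{2(1+u\gamma(s))^3}-\frac54\,\frac{u^2\gamma'(s)^2}{(1+u\gamma(s))^4}.$$ One has $\inf\sigma_{\rm ess}(H_1)=\left(\frac{\pi}{2a}\right)^2$. Number of bound neutral particles. The neutral fermions do not interact, and by the Pauli principle each one-particle eigenstate can be occupied by at most $2S+1$ particles of spin $S$. Accordingly, the (maximum) number $N$ of neutral particles of spin $S$ which the waveguide can bind is $(2S+1)$ times the number of eigenvalues, counted with multiplicity, of $H_1$ below $\left(\frac{\pi}{2a}\right)^2$. Notation. $\delta_\pm:=1\pm a\|\gamma\|_\infty$, $$\tilde W(s):=\frac{\gamma(s)^2}{4\delta_-^2}+\frac{a|\gamma''(s)|}{2\delta_-^3}+\frac{5a^2\gamma'(s)^2}{4\delta_-^4},$$ $$\tilde W_j(s):=\max\left\{0,\ \tilde W(s)+\left(\frac{\pi}{2a}\right)^2(1-j^2)\right\},\qquad j=2,3,\dots$$ (only finitely many of the $\tilde W_j$ are not identically zero). *)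

theory Defs
  imports "HOL-Analysis.Analysis"
begin

section \<open>The curved strip\<close>

definition tangent_angle :: "(real \<Rightarrow> real) \<Rightarrow> real \<Rightarrow> real" where
  "tangent_angle \<gamma> s = (LBINT t=0..s. \<gamma> t)"

text \<open>Position and direction at parameter 0 are normalised to the origin and (1, 0);
  any other curve with signed curvature \<open>\<gamma>\<close> is a Euclidean image of this one.\<close>

definition axis_curve :: "(real \<Rightarrow> real) \<Rightarrow> real \<Rightarrow> real \<times> real" where
  "axis_curve \<gamma> s =
     ((LBINT t=0..s. cos (tangent_angle \<gamma> t)), (LBINT t=0..s. sin (tangent_angle \<gamma> t)))"

definition axis_normal :: "(real \<Rightarrow> real) \<Rightarrow> real \<Rightarrow> real \<times> real" where
  "axis_normal \<gamma> s = (sin (tangent_angle \<gamma> s), - cos (tangent_angle \<gamma> s))"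

definition strip_map :: "(real \<Rightarrow> real) \<Rightarrow> real \<times> real \<Rightarrow> real \<times> real" where
  "strip_map \<gamma> = (\<lambda>(s, u). axis_curve \<gamma> s + u *\<^sub>R axis_normal \<gamma> s)"

definition straight_strip :: "real \<Rightarrow> (real \<times> real) set" where
  "straight_strip a = UNIV \<times> {-a<..<a}"

definition sup_norm :: "(real \<Rightarrow> real) \<Rightarrow> real" where
  "sup_norm \<gamma> = (SUP s. \<bar>\<gamma> s\<bar>)"

text \<open>At the finitely many break points neither \<open>\<gamma>\<close> nor its derivatives are required to be
  continuous or even to exist.\<close>

definition piecewise_C2_bounded_derivs :: "(real \<Rightarrow> real) \<Rightarrow> bool" where
  "piecewise_C2_bounded_derivs \<gamma> \<longleftrightarrow>
     (\<exists>P. finite P \<and>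
        (\<forall>s\<in>-P. \<gamma> differentiable (at s) \<and> deriv \<gamma> differentiable (at s)) \<and>
        continuous_on (-P) (deriv (deriv \<gamma>)) \<and>
        bounded (deriv \<gamma> ` (-P)) \<and> bounded (deriv (deriv \<gamma>) ` (-P)))"

definition curved_waveguide :: "real \<Rightarrow> (real \<Rightarrow> real) \<Rightarrow> bool" where
  "curved_waveguide a \<gamma> \<longleftrightarrow>
     inj_on (strip_map \<gamma>) (straight_strip a) \<and>
     bounded (range \<gamma>) \<and> a * sup_norm \<gamma> < 1 \<and>
     piecewise_C2_bounded_derivs \<gamma> \<and>
     (\<exists>b>0. (\<forall>s. \<bar>s\<bar> > b \<longrightarrow> \<gamma> s = 0) \<and> 2 * b > a)"


section \<open>Square-integrable functions and the Dirichlet form domain\<close>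

abbreviation strip_measure :: "real \<Rightarrow> (real \<times> real) measure" where
  "strip_measure a \<equiv> restrict_space lborel (straight_strip a)"

text \<open>Elements of \<open>L\<^sup>2\<close> are represented by functions; identification of functions that agree
  almost everywhere is built into the notions of linear independence and dimension below.\<close>

definition L2 :: "'a measure \<Rightarrow> ('a \<Rightarrow> complex) set" where
  "L2 M = {f \<in> borel_measurable M. integrable M (\<lambda>x. (norm (f x))\<^sup>2)}"

definition L2_tendsto :: "'a measure \<Rightarrow> (nat \<Rightarrow> 'a \<Rightarrow> complex) \<Rightarrow> ('a \<Rightarrow> complex) \<Rightarrow> bool" where
  "L2_tendsto M h f \<longleftrightarrow> (\<lambda>n. LINT x|M. (norm (h n x - f x))\<^sup>2) \<longlonglongrightarrow> 0"

definition partial_s :: "(real \<times> real \<Rightarrow> complex) \<Rightarrow> real \<times> real \<Rightarrow> complex" where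
  "partial_s f = (\<lambda>(s, u). vector_derivative (\<lambda>t. f (t, u)) (at s))"

definition partial_u :: "(real \<times> real \<Rightarrow> complex) \<Rightarrow> real \<times> real \<Rightarrow> complex" where
  "partial_u f = (\<lambda>(s, u). vector_derivative (\<lambda>t. f (s, t)) (at u))"

text \<open>\<open>C\<^sup>\<infinity>\<close>: all iterated partial derivatives exist and are (Frechet) differentiable,
  hence continuous.\<close>

coinductive smooth :: "(real \<times> real \<Rightarrow> complex) \<Rightarrow> bool" where
  "(\<And>p. f differentiable (at p)) \<Longrightarrow> smooth (partial_s f) \<Longrightarrow> smooth (partial_u f) \<Longrightarrow> smooth f"

definition test_functions :: "(real \<times> real) set \<Rightarrow> (real \<times> real \<Rightarrow> complex) set" where
  "test_functions \<Omega> = {\<eta>. smooth \<eta> \<and> (\<exists>K. compact K \<and> K \<subseteq> \<Omega> \<and> (\<forall>p. p \<notin> K \<longrightarrow> \<eta> p = 0))}"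

text \<open>\<open>H01_gradient a \<phi> g\<^sub>s g\<^sub>u\<close>: \<open>\<phi>\<close> belongs to \<open>H\<^sup>1\<^sub>0\<close> of the strip, the closure of the test
  functions in the Sobolev norm, and has weak gradient \<open>(g\<^sub>s, g\<^sub>u)\<close>.\<close>

definition H01_gradient ::
  "real \<Rightarrow> (real \<times> real \<Rightarrow> complex) \<Rightarrow> (real \<times> real \<Rightarrow> complex) \<Rightarrow> (real \<times> real \<Rightarrow> complex) \<Rightarrow> bool"
where
  "H01_gradient a \<phi> gs gu \<longleftrightarrow>
     \<phi> \<in> L2 (strip_measure a) \<and> gs \<in> L2 (strip_measure a) \<and> gu \<in> L2 (strip_measure a) \<and>
     (\<exists>\<eta>. (\<forall>n. \<eta> n \<in> test_functions (straight_strip a)) \<and>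
          L2_tendsto (strip_measure a) \<eta> \<phi> \<and>
          L2_tendsto (strip_measure a) (\<lambda>n. partial_s (\<eta> n)) gs \<and>
          L2_tendsto (strip_measure a) (\<lambda>n. partial_u (\<eta> n)) gu)"


section \<open>The one-particle Hamiltonian and its bound states\<close>

definition effective_potential :: "(real \<Rightarrow> real) \<Rightarrow> real \<times> real \<Rightarrow> real" where
  "effective_potential \<gamma> = (\<lambda>(s, u).
     - (\<gamma> s)\<^sup>2 / (4 * (1 + u * \<gamma> s)\<^sup>2)
     + u * deriv (deriv \<gamma>) s / (2 * (1 + u * \<gamma> s) ^ 3)
     - 5 / 4 * (u\<^sup>2 * (deriv \<gamma> s)\<^sup>2 / (1 + u * \<gamma> s) ^ 4))"

text \<open>\<open>hamiltonian a \<gamma> \<phi> f\<close> means that \<open>\<phi>\<close> is in the domain of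
  \<open>H\<^sub>1 = - \<partial>\<^sub>s (1 + u \<gamma>)\<^sup>-\<^sup>2 \<partial>\<^sub>s - \<partial>\<^sub>u\<^sup>2 + V\<close> and \<open>H\<^sub>1 \<phi> = f\<close>. It is the self-adjoint operator
  associated with the closed form
  \<open>\<integral> (1 + u \<gamma>)\<^sup>-\<^sup>2 \<bar>\<partial>\<^sub>s \<phi>\<bar>\<^sup>2 + \<bar>\<partial>\<^sub>u \<phi>\<bar>\<^sup>2 + V \<bar>\<phi>\<bar>\<^sup>2\<close> on \<open>H\<^sup>1\<^sub>0\<close>; the Dirichlet conditions are those
  of \<open>H\<^sup>1\<^sub>0\<close>.\<close>

definition hamiltonian ::
  "real \<Rightarrow> (real \<Rightarrow> real) \<Rightarrow> (real \<times> real \<Rightarrow> complex) \<Rightarrow> (real \<times> real \<Rightarrow> complex) \<Rightarrow> bool"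
where
  "hamiltonian a \<gamma> \<phi> f \<longleftrightarrow>
     f \<in> L2 (strip_measure a) \<and>
     (\<exists>gs gu. H01_gradient a \<phi> gs gu \<and>
        (\<forall>\<eta> \<in> test_functions (straight_strip a).
           (LINT p|strip_measure a.
              cnj (partial_s \<eta> p) * gs p / of_real ((1 + snd p * \<gamma> (fst p))\<^sup>2)
              + cnj (partial_u \<eta> p) * gu p
              + cnj (\<eta> p) * of_real (effective_potential \<gamma> p) * \<phi> p)
           = (LINT p|strip_measure a. cnj (\<eta> p) * f p)))"

definition eigenspace :: "real \<Rightarrow> (real \<Rightarrow> real) \<Rightarrow> real \<Rightarrow> (real \<times> real \<Rightarrow> complex) set" where
  "eigenspace a \<gamma> E = {\<phi>. hamiltonian a \<gamma> \<phi> (\<lambda>p. of_real E * \<phi> p)}"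

definition eigenvalues :: "real \<Rightarrow> (real \<Rightarrow> real) \<Rightarrow> real set" where
  "eigenvalues a \<gamma> =
     {E. \<exists>\<phi> \<in> eigenspace a \<gamma> E. \<not> (AE p in strip_measure a. \<phi> p = 0)}"

definition AE_independent :: "'a measure \<Rightarrow> nat \<Rightarrow> (nat \<Rightarrow> 'a \<Rightarrow> complex) \<Rightarrow> bool" where
  "AE_independent M n \<phi> \<longleftrightarrow>
     (\<forall>c :: nat \<Rightarrow> complex. (AE x in M. (\<Sum>i<n. c i * \<phi> i x) = 0) \<longrightarrow> (\<forall>i<n. c i = 0))"

text \<open>The complex dimension modulo almost-everywhere equality, possibly infinite.\<close>

definition eigenvalue_multiplicity :: "real \<Rightarrow> (real \<Rightarrow> real) \<Rightarrow> real \<Rightarrow> ennreal" where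
  "eigenvalue_multiplicity a \<gamma> E =
     Sup {of_nat n | n. \<exists>\<phi>. (\<forall>i<n. \<phi> i \<in> eigenspace a \<gamma> E) \<and> AE_independent (strip_measure a) n \<phi>}"

definition bound_state_count :: "real \<Rightarrow> (real \<Rightarrow> real) \<Rightarrow> ennreal" where
  "bound_state_count a \<gamma> =
     (\<Sum>\<^sub>\<infinity>E \<in> {E \<in> eigenvalues a \<gamma>. E < (pi / (2 * a))\<^sup>2}. eigenvalue_multiplicity a \<gamma> E)"

definition neutral_particle_number :: "real \<Rightarrow> real \<Rightarrow> (real \<Rightarrow> real) \<Rightarrow> ennreal" where
  "neutral_particle_number S a \<gamma> = ennreal (2 * S + 1) * bound_state_count a \<gamma>"


section \<open>The quantities in the bound\<close>

definition delta_plus :: "real \<Rightarrow> (real \<Rightarrow> real) \<Rightarrow> real" where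
  "delta_plus a \<gamma> = 1 + a * sup_norm \<gamma>"

definition delta_minus :: "real \<Rightarrow> (real \<Rightarrow> real) \<Rightarrow> real" where
  "delta_minus a \<gamma> = 1 - a * sup_norm \<gamma>"

definition W_tilde :: "real \<Rightarrow> (real \<Rightarrow> real) \<Rightarrow> real \<Rightarrow> real" where
  "W_tilde a \<gamma> s =
     (\<gamma> s)\<^sup>2 / (4 * (delta_minus a \<gamma>)\<^sup>2)
     + a * \<bar>deriv (deriv \<gamma>) s\<bar> / (2 * delta_minus a \<gamma> ^ 3)
     + 5 * a\<^sup>2 * (deriv \<gamma> s)\<^sup>2 / (4 * delta_minus a \<gamma> ^ 4)"

definition W_tilde_mode :: "real \<Rightarrow> (real \<Rightarrow> real) \<Rightarrow> nat \<Rightarrow> real \<Rightarrow> real" where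
  "W_tilde_mode a \<gamma> j s = max 0 (W_tilde a \<gamma> s + (pi / (2 * a))\<^sup>2 * (1 - (real j)\<^sup>2))"

end

theory Submission
  imports Defs
begin

text \<open>
  Below the threshold \<open>E\<^sub>1 = (\<pi> / (2 a))\<^sup>2\<close> the form of \<open>H\<^sub>1 - E\<^sub>1\<close> is negative definite on the span of
  the eigenfunctions, because eigenfunctions of different eigenvalues are orthogonal. Negative
  definiteness is an open condition, so it survives the approximation of the eigenfunctions by test
  functions (\<open>eigenfunction_count_bound\<close>). The counting problem is thus one about negative
  directions of a quadratic form.

  On the strip \<open>1 + u \<gamma> \<le> \<delta>\<^sub>+\<close> and \<open>V \<ge> - W\<close>, where \<open>W\<close> stands for \<open>W_tilde\<close>. Multiplying the form
  by \<open>\<delta>\<^sub>+\<^sup>2\<close> therefore leaves something at least as large as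
  \<open>\<integral> \<bar>\<partial>\<^sub>s f\<bar>\<^sup>2 + \<delta>\<^sub>+\<^sup>2 (\<bar>\<partial>\<^sub>u f\<bar>\<^sup>2 - E\<^sub>1 \<bar>f\<bar>\<^sup>2) - w \<bar>f\<bar>\<^sup>2\<close> with \<open>w = \<delta>\<^sub>+\<^sup>2 W\<close>, in which the variables separate.
  The coefficient of the \<open>j\<close>-th Dirichlet sine sees the form of \<open>- d\<^sup>2/ds\<^sup>2 + t\<^sub>j\<^sup>2 - w\<close> on the line, with
  \<open>t\<^sub>j\<^sup>2 = \<delta>\<^sub>+\<^sup>2 E\<^sub>1 (j\<^sup>2 - 1)\<close>. If \<open>n\<^sub>j\<close> is the largest dimension of a negative subspace of this form, then
  the number of eigenvalues is at most \<open>n\<^sub>1 + n\<^sub>2 + \<dots>\<close> (\<open>strip_count_bound\<close>).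

  It remains to bound \<open>n\<^sub>1 + n\<^sub>2 + \<dots>\<close> by \<open>1 + T + b\<^sub>2 + b\<^sub>3 + b\<^sub>4\<close>, where
  \<open>T = \<integral>\<integral> w(s) \<bar>s - t\<bar> w(t) / \<integral> w\<close> (\<open>spread\<close>) and \<open>b\<^sub>i = \<integral> max 0 (w - t\<^sub>i\<^sup>2) / (2 t\<^sub>i)\<close> (\<open>excess\<close>); multiplied
  by \<open>\<delta>\<^sub>+ \<ge> 1\<close>, the \<open>b\<^sub>i\<close> are terms of the sum in the theorem. A single mode \<open>j \<ge> 2\<close> can bind although
  \<open>b\<^sub>j\<close> is small: a wide well only slightly deeper than \<open>t\<^sub>j\<^sup>2\<close> does. Such a well has a large \<open>T\<close>, and so
  all modes are counted together. Since \<open>n\<^sub>1 \<ge> n\<^sub>2 \<ge> \<dots>\<close>, the sum is also \<open>\<Sum> J\<^sub>k\<close> over the levels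
  \<open>k = 1, \<dots>, n\<^sub>1\<close>, where \<open>J\<^sub>k\<close> is the number of modes with \<open>n\<^sub>j \<ge> k\<close>. Three facts about the line are used.

  \<^item> An \<open>n\<close>-dimensional negative subspace with background \<open>t\<^sup>2\<close> forces
    \<open>2 (n - 1) (1 + t T / (2 m)) \<le> T\<close>, \<open>m = \<integral> w\<close>: a function with \<open>\<integral> w f = 0\<close> meets \<open>w\<close> only through its
    increments (\<open>negative_system_spread\<close>).

  \<^item> If \<open>- d\<^sup>2/dx\<^sup>2 - q\<close> has eigenvalues \<open>\<lambda>\<^sub>1 \<le> \<lambda>\<^sub>2 \<le> \<dots>\<close> with \<open>\<lambda>\<^sub>k < - \<sigma>\<^sub>k\<^sup>2\<close> and the \<open>\<sigma>\<^sub>k\<close> decrease, then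
    \<open>2 \<Sum> \<sigma>\<^sub>k \<le> \<integral> q\<close>, the sharp Lieb--Thirring bound of Hundertmark, Lieb and Thomas (\<open>sum_sqrt_eigenvalues_le\<close>). For
    \<open>q = max 0 (w - t\<^sub>i\<^sup>2)\<close> it says that \<open>b\<^sub>i\<close> is at least the sum of \<open>sqrt ((J\<^sub>k\<^sup>2 - i\<^sup>2) / (i\<^sup>2 - 1))\<close> over the
    levels with \<open>J\<^sub>k > i\<close>.

  \<^item> The part of \<open>w\<close> below a level is spread out: \<open>b\<^sub>i \<ge> m / (2 t\<^sub>i) - sqrt (3 T) / 2\<close> (\<open>excess_lower\<close>), and
    \<open>T + b\<^sub>2 + b\<^sub>3 \<ge> m / (2 t\<^sub>2)\<close> once \<open>m \<ge> 2 t\<^sub>2\<close> (\<open>spread_plus_excess_lower\<close>).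

  A level is paid for by 1 and by its contributions to \<open>b\<^sub>2, b\<^sub>3, b\<^sub>4\<close>; what is missing is its deficit,
  which is 0 for \<open>J = 1\<close>, at most 1 for \<open>J = 2, 3, 4\<close> and nonpositive from \<open>J = 5\<close> on. The first fact
  gives \<open>T \<ge> 2 (n\<^sub>1 - 1)\<close>, which pays for a total deficit up to \<open>n\<^sub>1 - 1\<close>. A larger total deficit
  forces every \<open>J\<^sub>k\<close> to be 2, 3 or 4, all but at most three of them 2; these configurations are settled with the
  third fact (\<open>exceptional_levels\<close>).
\<close>

section \<open>Hermitian forms on spaces of functions\<close>

lemma homogeneous_system_nontrivial:
  fixes A :: "nat \<Rightarrow> 'i \<Rightarrow> 'a::field"
  assumes "finite I" "k < card I"
  shows "\<exists>c. (\<exists>i\<in>I. c i \<noteq> 0) \<and> (\<forall>j<k. (\<Sum>i\<in>I. A j i * c i) = 0)"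
  using assms
proof (induction k arbitrary: I A)
  case 0
  then have "I \<noteq> {}" by auto
  then show ?case by (intro exI[of _ "\<lambda>_. 1"]) auto
next
  case (Suc k)
  show ?case
  proof (cases "\<forall>i\<in>I. A k i = 0")
    case True
    obtain c where "\<exists>i\<in>I. c i \<noteq> 0" "\<forall>j<k. (\<Sum>i\<in>I. A j i * c i) = 0"
      using Suc.IH[OF Suc.prems(1), of A] Suc.prems(2) by auto
    moreover have "(\<Sum>i\<in>I. A k i * c i) = 0" using True by (intro sum.neutral) auto
    ultimately show ?thesis by (auto simp: less_Suc_eq)
  next
    case False
    then obtain p where p: "p \<in> I" "A k p \<noteq> 0" by auto
    define B where "B j i = A j i - A j p * A k i / A k p" for j i
    have "k < card (I - {p})" using Suc.prems p by simp
    then obtain c where c: "\<exists>i\<in>I - {p}. c i \<noteq> 0" "\<forall>j<k. (\<Sum>i\<in>I - {p}. B j i * c i) = 0"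
      using Suc.IH[of "I - {p}" B] Suc.prems(1) by auto
    define t where "t = - (\<Sum>i\<in>I - {p}. A k i * c i) / A k p"
    define d where "d = c(p := t)"
    have split: "(\<Sum>i\<in>I. A j i * d i) = A j p * t + (\<Sum>i\<in>I - {p}. A j i * c i)" for j
      unfolding sum.remove[OF Suc.prems(1) p(1)] d_def by (auto intro!: sum.cong)
    have "(\<Sum>i\<in>I. A k i * d i) = 0"
      unfolding split t_def using p(2) by simp
    moreover have "(\<Sum>i\<in>I. A j i * d i) = 0" if "j < k" for j
    proof -
      have "(\<Sum>i\<in>I - {p}. B j i * c i)
          = (\<Sum>i\<in>I - {p}. A j i * c i) - A j p / A k p * (\<Sum>i\<in>I - {p}. A k i * c i)"
        by (simp add: B_def algebra_simps sum_subtractf sum_distrib_left)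
      then show ?thesis using c(2) that unfolding split t_def by (simp add: divide_simps)
    qed
    moreover have "\<exists>i\<in>I. d i \<noteq> 0" using c(1) by (auto simp: d_def)
    ultimately show ?thesis by (intro exI[of _ d]) (auto simp: less_Suc_eq)
  qed
qed

definition lin_comb :: "nat \<Rightarrow> (nat \<Rightarrow> complex) \<Rightarrow> (nat \<Rightarrow> 'x \<Rightarrow> complex) \<Rightarrow> 'x \<Rightarrow> complex" where
  "lin_comb n c \<psi> = (\<lambda>x. \<Sum>i<n. c i * \<psi> i x)"

definition function_space :: "('x \<Rightarrow> complex) set \<Rightarrow> bool" where
  "function_space V \<longleftrightarrow> (\<lambda>_. 0) \<in> V \<and> (\<forall>f\<in>V. \<forall>g\<in>V. \<forall>c. (\<lambda>x. f x + c * g x) \<in> V)"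

definition linear_functional :: "('x \<Rightarrow> complex) set \<Rightarrow> (('x \<Rightarrow> complex) \<Rightarrow> complex) \<Rightarrow> bool" where
  "linear_functional V L \<longleftrightarrow> (\<forall>f\<in>V. \<forall>g\<in>V. \<forall>c. L (\<lambda>x. f x + c * g x) = L f + c * L g)"

type_synonym 'x form = "('x \<Rightarrow> complex) \<Rightarrow> ('x \<Rightarrow> complex) \<Rightarrow> complex"

definition hermitian_form :: "('x \<Rightarrow> complex) set \<Rightarrow> 'x form \<Rightarrow> bool" where
  "hermitian_form V B \<longleftrightarrow>
     (\<forall>f\<in>V. linear_functional V (B f)) \<and> (\<forall>f\<in>V. \<forall>g\<in>V. B g f = cnj (B f g))"

definition nonzero_coeffs :: "nat \<Rightarrow> (nat \<Rightarrow> complex) \<Rightarrow> bool" where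
  "nonzero_coeffs n c \<longleftrightarrow> (\<exists>i<n. c i \<noteq> 0)"

definition negative_system :: "'x form \<Rightarrow> nat \<Rightarrow> (nat \<Rightarrow> 'x \<Rightarrow> complex) \<Rightarrow> bool" where
  "negative_system B n \<psi> \<longleftrightarrow>
     (\<forall>c. nonzero_coeffs n c \<longrightarrow> Re (B (lin_comb n c \<psi>) (lin_comb n c \<psi>)) < 0)"

definition orthonormal_system :: "'x form \<Rightarrow> nat \<Rightarrow> (nat \<Rightarrow> 'x \<Rightarrow> complex) \<Rightarrow> bool" where
  "orthonormal_system B n \<phi> \<longleftrightarrow> (\<forall>i<n. \<forall>j<n. B (\<phi> i) (\<phi> j) = (if i = j then 1 else 0))"

lemma lin_comb_Suc: "lin_comb (Suc n) c \<psi> = (\<lambda>x. lin_comb n c \<psi> x + c n * \<psi> n x)"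
  by (simp add: lin_comb_def)

lemma lin_comb_0: "lin_comb 0 c \<psi> = (\<lambda>x. 0)"
  by (simp add: lin_comb_def)

lemma lin_comb_cong: "(\<And>i. i < n \<Longrightarrow> c i = d i) \<Longrightarrow> (\<And>i. i < n \<Longrightarrow> \<psi> i = \<phi> i) \<Longrightarrow>
    lin_comb n c \<psi> = lin_comb n d \<phi>"
  by (auto simp: lin_comb_def)

lemma lin_comb_in: "function_space V \<Longrightarrow> (\<And>i. i < n \<Longrightarrow> \<psi> i \<in> V) \<Longrightarrow> lin_comb n c \<psi> \<in> V"
proof (induction n)
  case 0 then show ?case by (simp add: lin_comb_0 function_space_def)
next
  case (Suc n)
  have "lin_comb n c \<psi> \<in> V" "\<psi> n \<in> V" using Suc by auto
  then show ?case using Suc(2) unfolding lin_comb_Suc function_space_def by blast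
qed

lemma linear_functional_zero:
  "linear_functional V L \<Longrightarrow> (\<lambda>_. 0) \<in> V \<Longrightarrow> L (\<lambda>_. 0) = 0"
  unfolding linear_functional_def by (drule bspec, assumption, drule bspec, assumption, drule spec[of _ 1]) simp

lemma linear_functional_lin_comb:
  assumes "function_space V" "linear_functional V L" "\<And>i. i < n \<Longrightarrow> \<psi> i \<in> V"
  shows "L (lin_comb n c \<psi>) = (\<Sum>i<n. c i * L (\<psi> i))"
  using assms(3)
proof (induction n)
  case 0
  then show ?case using assms(1,2) by (simp add: lin_comb_0 function_space_def linear_functional_zero)
next
  case (Suc n)
  have "lin_comb n c \<psi> \<in> V" "\<psi> n \<in> V" using Suc assms(1) by (auto intro!: lin_comb_in)
  then show ?case using Suc assms(2) unfolding lin_comb_Suc linear_functional_def by simp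
qed

lemma hermitian_form_sym: "hermitian_form V B \<Longrightarrow> f \<in> V \<Longrightarrow> g \<in> V \<Longrightarrow> B g f = cnj (B f g)"
  unfolding hermitian_form_def by blast

lemma hermitian_form_linear: "hermitian_form V B \<Longrightarrow> f \<in> V \<Longrightarrow> linear_functional V (B f)"
  unfolding hermitian_form_def by blast

lemma hermitian_form_right:
  assumes "function_space V" "hermitian_form V B" "f \<in> V" "\<And>i. i < n \<Longrightarrow> \<psi> i \<in> V"
  shows "B f (lin_comb n c \<psi>) = (\<Sum>i<n. c i * B f (\<psi> i))"
  using assms by (intro linear_functional_lin_comb hermitian_form_linear)

lemma hermitian_form_left:
  assumes "function_space V" "hermitian_form V B" "f \<in> V" "\<And>i. i < n \<Longrightarrow> \<psi> i \<in> V"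
  shows "B (lin_comb n c \<psi>) f = (\<Sum>i<n. cnj (c i) * B (\<psi> i) f)"
proof -
  note sym = hermitian_form_sym[OF assms(2)]
  have "B (lin_comb n c \<psi>) f = cnj (B f (lin_comb n c \<psi>))"
    using assms by (intro sym lin_comb_in)
  also have "\<dots> = (\<Sum>i<n. cnj (c i) * cnj (B f (\<psi> i)))"
    by (simp add: hermitian_form_right[OF assms])
  also have "\<dots> = (\<Sum>i<n. cnj (c i) * B (\<psi> i) f)"
    using assms by (intro sum.cong refl) (simp add: sym[of f "\<psi> _", symmetric])
  finally show ?thesis .
qed

lemma hermitian_form_both:
  assumes "function_space V" "hermitian_form V B" "\<And>i. i < n \<Longrightarrow> \<psi> i \<in> V"
  shows "B (lin_comb n c \<psi>) (lin_comb n d \<psi>) = (\<Sum>i<n. \<Sum>j<n. cnj (c i) * d j * B (\<psi> i) (\<psi> j))"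
proof -
  have "B (lin_comb n c \<psi>) (lin_comb n d \<psi>) = (\<Sum>i<n. cnj (c i) * B (\<psi> i) (lin_comb n d \<psi>))"
    by (rule hermitian_form_left[OF assms(1,2) lin_comb_in[OF assms(1,3)] assms(3)])
  also have "\<dots> = (\<Sum>i<n. \<Sum>j<n. cnj (c i) * d j * B (\<psi> i) (\<psi> j))"
    by (intro sum.cong refl)
       (simp add: hermitian_form_right[OF assms(1,2) assms(3) assms(3)] sum_distrib_left mult.assoc)
  finally show ?thesis .
qed

lemma hermitian_form_real: "hermitian_form V B \<Longrightarrow> f \<in> V \<Longrightarrow> B f f = of_real (Re (B f f))"
  by (metis Reals_cnj_iff of_real_Re hermitian_form_sym)

lemma orthonormal_system_lin_comb:
  assumes "function_space V" "hermitian_form V B" "\<And>i. i < n \<Longrightarrow> \<phi> i \<in> V" "orthonormal_system B n \<phi>"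
  shows "B (lin_comb n c \<phi>) (lin_comb n d \<phi>) = (\<Sum>i<n. cnj (c i) * d i)"
proof -
  have "(\<Sum>j<n. cnj (c i) * d j * B (\<phi> i) (\<phi> j)) = cnj (c i) * d i" if "i < n" for i
  proof -
    have "(\<Sum>j<n. cnj (c i) * d j * B (\<phi> i) (\<phi> j)) = (\<Sum>j<n. if j = i then cnj (c i) * d i else 0)"
      using assms(4) that by (intro sum.cong) (auto simp: orthonormal_system_def)
    then show ?thesis using that by simp
  qed
  then show ?thesis by (simp add: hermitian_form_both[OF assms(1-3)])
qed

text \<open>Gram--Schmidt with side conditions: a new vector has to satisfy \<open>k\<close> orthogonality relations and \<open>p\<close>
  further linear ones, fewer than the \<open>n\<close> available coefficients. Positivity on the span makes it
  normalisable. The vectors are returned as coefficients, so that they can be transported to another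
  family.\<close>

lemma orthonormal_system_exists:
  assumes V: "function_space V" and B: "hermitian_form V B" and \<psi>: "\<And>i. i < n \<Longrightarrow> \<psi> i \<in> V"
    and pos: "\<And>c. nonzero_coeffs n c \<Longrightarrow> Re (B (lin_comb n c \<psi>) (lin_comb n c \<psi>)) > 0"
    and L: "\<And>l. l < p \<Longrightarrow> linear_functional V (L l)" and kp: "k + p \<le> n"
  shows "\<exists>e. orthonormal_system B k (\<lambda>a. lin_comb n (e a) \<psi>) \<and>
             (\<forall>a<k. \<forall>l<p. L l (lin_comb n (e a) \<psi>) = 0)"
  using kp
proof (induction k)
  case 0
  show ?case by (auto simp: orthonormal_system_def)
next
  case (Suc k)
  then obtain e where e: "orthonormal_system B k (\<lambda>a. lin_comb n (e a) \<psi>)"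
      "\<forall>a<k. \<forall>l<p. L l (lin_comb n (e a) \<psi>) = 0" by auto
  define A where "A j i = (if j < k then B (lin_comb n (e j) \<psi>) (\<psi> i) else L (j - k) (\<psi> i))" for j i
  obtain c where c: "\<exists>i\<in>{..<n}. c i \<noteq> 0" "\<forall>j<k + p. (\<Sum>i<n. A j i * c i) = 0"
    using homogeneous_system_nontrivial[of "{..<n}" "k + p" A] Suc.prems by auto
  let ?f = "lin_comb n c \<psi>"
  have in_V: "lin_comb n d \<psi> \<in> V" for d using V \<psi> by (intro lin_comb_in)
  have orth: "B (lin_comb n (e j) \<psi>) ?f = 0" if "j < k" for j
  proof -
    have "B (lin_comb n (e j) \<psi>) ?f = (\<Sum>i<n. A j i * c i)"
      using that by (simp add: hermitian_form_right[OF V B in_V \<psi>] A_def mult.commute)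
    then show ?thesis using c(2) that by simp
  qed
  have ker: "L l ?f = 0" if "l < p" for l
  proof -
    have "L l ?f = (\<Sum>i<n. A (k + l) i * c i)"
      using that by (simp add: linear_functional_lin_comb[OF V L \<psi>] A_def mult.commute)
    then show ?thesis using c(2) that by simp
  qed
  define r where "r = Re (B ?f ?f)"
  have r: "r > 0" using pos c(1) by (auto simp: r_def nonzero_coeffs_def)
  have Bff: "B ?f ?f = of_real r" unfolding r_def by (rule hermitian_form_real[OF B in_V])
  define t where "t = complex_of_real (1 / sqrt r)"
  have t: "t * (t * of_real r) = 1" "cnj t = t"
    using r unfolding t_def of_real_mult[symmetric] by (simp_all add: divide_simps)
  define d where "d i = t * c i" for i
  have d_f: "lin_comb n d \<psi> = (\<lambda>x. t * ?f x)"
    by (simp add: lin_comb_def d_def sum_distrib_left mult.assoc)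
  have lf_scale: "M (\<lambda>x. t * ?f x) = t * M ?f" if "linear_functional V M" for M t
  proof -
    have z: "(\<lambda>_. 0) \<in> V" using V by (auto simp: function_space_def)
    have "M (\<lambda>x. (\<lambda>_. 0) x + t * ?f x) = M (\<lambda>_. 0) + t * M ?f"
      using that[unfolded linear_functional_def, rule_format, OF z in_V[of c], of t] .
    then show ?thesis using linear_functional_zero[OF that z] by simp
  qed
  note lfB = hermitian_form_linear[OF B] and sym = hermitian_form_sym[OF B]
  have od: "B (lin_comb n (e j) \<psi>) (lin_comb n d \<psi>) = 0" if "j < k" for j
    using lf_scale[OF lfB[OF in_V]] orth[OF that] unfolding d_f by simp
  have ed: "B (lin_comb n d \<psi>) (lin_comb n (e j) \<psi>) = 0" if "j < k" for j
    using od[OF that] sym[OF in_V[of "e j"] in_V[of d]] by simp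
  have "B ?f (lin_comb n d \<psi>) = t * of_real r"
    using lf_scale[OF lfB[OF in_V[of c]]] Bff unfolding d_f by simp
  then have df: "B (lin_comb n d \<psi>) ?f = t * of_real r"
    using sym[OF in_V[of c] in_V[of d]] t(2) by simp
  have "B (lin_comb n d \<psi>) (lin_comb n d \<psi>) = t * (t * of_real r)"
    using lf_scale[OF lfB[OF in_V[of d]], of t] unfolding d_f[symmetric] df .
  then have dd: "B (lin_comb n d \<psi>) (lin_comb n d \<psi>) = 1" using t(1) by simp
  have Ld: "L l (lin_comb n d \<psi>) = 0" if "l < p" for l
    using lf_scale[OF L[OF that]] ker[OF that] unfolding d_f by simp
  show ?case
  proof (intro exI[of _ "e(k := d)"] conjI allI impI)
    show "orthonormal_system B (Suc k) (\<lambda>a. lin_comb n ((e(k := d)) a) \<psi>)"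
      using e(1) od ed dd unfolding orthonormal_system_def by (auto simp: less_Suc_eq)
    show "L l (lin_comb n ((e(k := d)) a) \<psi>) = 0" if "a < Suc k" "l < p" for a l
      using that e(2) Ld by (auto simp: less_Suc_eq)
  qed
qed

text \<open>Bessel's inequality in dual form: for an orthonormal system of a form \<open>B\<close>, the squares of the
  values of a functional add up to at most its squared \<open>B\<close>-norm, because the extremal
  combination is itself a competitor.\<close>

lemma orthonormal_system_bessel:
  assumes V: "function_space V" and B: "hermitian_form V B" and \<phi>: "\<And>i. i < n \<Longrightarrow> \<phi> i \<in> V"
    and on: "orthonormal_system B n \<phi>" and L: "linear_functional V L"
    and C: "C \<ge> 0" and bound: "\<And>f. f \<in> V \<Longrightarrow> (cmod (L f))\<^sup>2 \<le> C * Re (B f f)"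
  shows "(\<Sum>i<n. (cmod (L (\<phi> i)))\<^sup>2) \<le> C"
proof -
  define G where "G = (\<Sum>i<n. (cmod (L (\<phi> i)))\<^sup>2)"
  let ?f = "lin_comb n (\<lambda>i. cnj (L (\<phi> i))) \<phi>"
  have "B ?f ?f = (\<Sum>i<n. L (\<phi> i) * cnj (L (\<phi> i)))"
    using orthonormal_system_lin_comb[OF V B \<phi> on] by simp
  then have B1: "B ?f ?f = of_real G"
    unfolding G_def by (simp add: complex_norm_square del: of_real_power)
  have "L ?f = (\<Sum>i<n. cnj (L (\<phi> i)) * L (\<phi> i))"
    by (rule linear_functional_lin_comb[OF V L \<phi>])
  then have L1: "L ?f = of_real G"
    unfolding G_def by (simp add: complex_norm_square mult.commute del: of_real_power)
  have "?f \<in> V" using V \<phi> by (rule lin_comb_in)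
  from bound[OF this] have "G\<^sup>2 \<le> C * G" by (simp add: B1 L1 power2_abs)
  moreover have "G \<ge> 0" unfolding G_def by (intro sum_nonneg) auto
  ultimately show ?thesis unfolding G_def[symmetric] using C
    by (cases "G = 0") (auto simp: power2_eq_square)
qed

lemma hermitian_form_zero: "hermitian_form V B \<Longrightarrow> function_space V \<Longrightarrow> B (\<lambda>_. 0) (\<lambda>_. 0) = 0"
  by (rule linear_functional_zero[of V]) (auto simp: function_space_def intro: hermitian_form_linear)

lemma lin_comb_lin_comb:
  "lin_comb k d (\<lambda>a. lin_comb n (e a) \<psi>) = lin_comb n (\<lambda>i. \<Sum>a<k. d a * e a i) \<psi>"
proof
  fix x
  have "(\<Sum>a<k. \<Sum>i<n. d a * (e a i * \<psi> i x)) = (\<Sum>i<n. \<Sum>a<k. d a * (e a i * \<psi> i x))"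
    by (rule sum.swap)
  then show "lin_comb k d (\<lambda>a. lin_comb n (e a) \<psi>) x = lin_comb n (\<lambda>i. \<Sum>a<k. d a * e a i) \<psi> x"
    by (simp add: lin_comb_def sum_distrib_left sum_distrib_right mult.assoc)
qed

text \<open>Inside a negative system of \<open>q\<close> one may orthonormalise with respect to any form that is
  positive there, discard as many dimensions as there are linear conditions, and keep
  negativity.\<close>

lemma negative_system_orthonormalise:
  assumes V: "function_space V" and B: "hermitian_form V B" and q: "hermitian_form V q"
    and \<psi>: "\<And>i. i < n \<Longrightarrow> \<psi> i \<in> V" and neg: "negative_system q n \<psi>"
    and pos: "\<And>f. f \<in> V \<Longrightarrow> Re (q f f) < 0 \<Longrightarrow> Re (B f f) > 0"
    and L: "\<And>l. l < p \<Longrightarrow> linear_functional V (L l)" and kp: "k + p \<le> n"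
  shows "\<exists>\<phi>. (\<forall>a<k. \<phi> a \<in> V) \<and> orthonormal_system B k \<phi> \<and> negative_system q k \<phi> \<and>
             (\<forall>a<k. \<forall>l<p. L l (\<phi> a) = 0)"
proof -
  have in_V: "lin_comb n d \<psi> \<in> V" for d using V \<psi> by (intro lin_comb_in)
  have pos': "Re (B (lin_comb n c \<psi>) (lin_comb n c \<psi>)) > 0" if "nonzero_coeffs n c" for c
    using neg that in_V pos unfolding negative_system_def by blast
  have "\<exists>e. orthonormal_system B k (\<lambda>a. lin_comb n (e a) \<psi>) \<and>
      (\<forall>a<k. \<forall>l<p. L l (lin_comb n (e a) \<psi>) = 0)"
    using V B \<psi> pos' L kp by (rule orthonormal_system_exists)
  then obtain e where e: "orthonormal_system B k (\<lambda>a. lin_comb n (e a) \<psi>)"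
      "\<forall>a<k. \<forall>l<p. L l (lin_comb n (e a) \<psi>) = 0" by blast
  let ?\<phi> = "\<lambda>a. lin_comb n (e a) \<psi>"
  have "Re (q (lin_comb k d ?\<phi>) (lin_comb k d ?\<phi>)) < 0" if d: "nonzero_coeffs k d" for d
  proof -
    have "B (lin_comb k d ?\<phi>) (lin_comb k d ?\<phi>) = (\<Sum>a<k. cnj (d a) * d a)"
      by (rule orthonormal_system_lin_comb[OF V B in_V e(1)])
    also have "\<dots> = of_real (\<Sum>a<k. (cmod (d a))\<^sup>2)"
      by (simp add: complex_norm_square mult.commute del: of_real_power)
    finally have norm: "B (lin_comb k d ?\<phi>) (lin_comb k d ?\<phi>) = of_real (\<Sum>a<k. (cmod (d a))\<^sup>2)" .
    obtain a where "a < k" "d a \<noteq> 0" using d by (auto simp: nonzero_coeffs_def)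
    then have "(\<Sum>a<k. (cmod (d a))\<^sup>2) > 0" by (intro sum_pos2[of _ a]) auto
    then have nz: "lin_comb k d ?\<phi> \<noteq> (\<lambda>_. 0)"
      using norm hermitian_form_zero[OF B V] by (metis less_irrefl of_real_eq_0_iff)
    let ?c = "\<lambda>i. \<Sum>a<k. d a * e a i"
    have "nonzero_coeffs n ?c"
    proof (rule ccontr)
      assume "\<not> ?thesis"
      then have "lin_comb n ?c \<psi> = (\<lambda>_. 0)" by (auto simp: lin_comb_def nonzero_coeffs_def)
      then show False using nz unfolding lin_comb_lin_comb by simp
    qed
    then show ?thesis using neg unfolding lin_comb_lin_comb negative_system_def by blast
  qed
  then show ?thesis using in_V e unfolding negative_system_def by (intro exI[of _ ?\<phi>]) auto
qed

text \<open>The enlarged system stays negative because the cross terms vanish. This is how maximality of a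
  negative system is exploited: no function orthogonal to it has negative energy.\<close>

lemma negative_system_extend:
  assumes V: "function_space V" and q: "hermitian_form V q" and \<psi>: "\<And>i. i < n \<Longrightarrow> \<psi> i \<in> V"
    and neg: "negative_system q n \<psi>" and f: "f \<in> V" "Re (q f f) < 0"
    and orth: "\<And>i. i < n \<Longrightarrow> q (\<psi> i) f = 0"
  shows "negative_system q (Suc n) (\<psi>(n := f))"
  unfolding negative_system_def
proof (intro allI impI)
  fix c assume c: "nonzero_coeffs (Suc n) c"
  let ?g = "lin_comb n c \<psi>" and ?h = "lin_comb (Suc n) c (\<psi>(n := f))"
  have g: "?g \<in> V" using V \<psi> by (rule lin_comb_in)
  have h: "?h = (\<lambda>x. ?g x + c n * f x)"
    unfolding lin_comb_Suc by (simp add: lin_comb_cong[of n c c "\<psi>(n := f)" \<psi>])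
  have hV: "?h \<in> V" unfolding h using V g f by (auto simp: function_space_def)
  have lin: "q k ?h = q k ?g + c n * q k f" if "k \<in> V" for k
    unfolding h using hermitian_form_linear[OF q that] g f(1) unfolding linear_functional_def by blast
  have gf: "q ?g f = 0" by (simp add: hermitian_form_left[OF V q f(1) \<psi>] orth)
  have fg: "q f ?g = 0" using hermitian_form_sym[OF q g f(1)] gf by simp
  have 1: "q ?h ?g = q ?g ?g" using lin[OF g] gf hermitian_form_sym[OF q g hV] hermitian_form_sym[OF q g g] by simp
  have "q ?h f = cnj (c n) * q f f"
    using lin[OF f(1)] fg hermitian_form_sym[OF q f(1) hV] hermitian_form_sym[OF q f(1) f(1)] by simp
  then have "q ?h ?h = q ?g ?g + (c n * cnj (c n)) * q f f" using lin[OF hV] 1 by simp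
  then have eq: "Re (q ?h ?h) = Re (q ?g ?g) + (cmod (c n))\<^sup>2 * Re (q f f)"
    by (simp add: complex_mult_cnj cmod_power2)
  show "Re (q ?h ?h) < 0"
  proof (cases "nonzero_coeffs n c")
    case True
    then have "Re (q ?g ?g) < 0" using neg by (auto simp: negative_system_def)
    then show ?thesis unfolding eq using f(2) by (smt (verit) mult_nonneg_nonpos zero_le_power2)
  next
    case False
    then have "c n \<noteq> 0" "?g = (\<lambda>_. 0)"
      using c by (auto simp: nonzero_coeffs_def less_Suc_eq lin_comb_def)
    then show ?thesis unfolding eq using f(2) hermitian_form_zero[OF q V] by (simp add: mult_pos_neg)
  qed
qed

section \<open>Bounded functions and Dirichlet forms on the line\<close>

definition bounded_borel :: "('b::topological_space \<Rightarrow> 'c::real_normed_vector) \<Rightarrow> bool" where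
  "bounded_borel h \<longleftrightarrow> h \<in> borel_measurable borel \<and> (\<exists>C. \<forall>x. norm (h x) \<le> C)"

text \<open>Products, marginals and sums of such functions are again of this kind, and Fubini's theorem holds for
  them without further conditions.\<close>

definition compact_borel :: "('b::real_normed_vector \<Rightarrow> 'c::real_normed_vector) \<Rightarrow> bool" where
  "compact_borel h \<longleftrightarrow> bounded_borel h \<and> (\<exists>R. \<forall>x. R < norm x \<longrightarrow> h x = 0)"

lemma bounded_borelD: "bounded_borel h \<Longrightarrow> h \<in> borel_measurable borel"
  by (simp add: bounded_borel_def)

lemma bounded_borel_bound: "bounded_borel h \<Longrightarrow> \<exists>C\<ge>0. \<forall>x. norm (h x) \<le> C"
  unfolding bounded_borel_def by (meson norm_ge_zero order_trans)

lemma compact_borel_bounded: "compact_borel h \<Longrightarrow> bounded_borel h"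
  by (simp add: compact_borel_def)

lemma compact_borel_support: "compact_borel h \<Longrightarrow> \<exists>R>0. \<forall>x. R < norm x \<longrightarrow> h x = 0"
  unfolding compact_borel_def by (meson gt_ex less_trans order_le_less_trans less_le_trans not_le)

lemma bounded_borel_const: "bounded_borel (\<lambda>_. c)"
  by (auto simp: bounded_borel_def)

lemma bounded_borel_add:
  fixes f g :: "'b::topological_space \<Rightarrow> 'c::{real_normed_vector, second_countable_topology}"
  assumes "bounded_borel f" "bounded_borel g"
  shows "bounded_borel (\<lambda>x. f x + g x)"
proof -
  obtain C D where "\<forall>x. norm (f x) \<le> C" "\<forall>x. norm (g x) \<le> D"
    using assms by (auto simp: bounded_borel_def)
  then have "\<forall>x. norm (f x + g x) \<le> C + D" by (meson add_mono norm_triangle_le)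
  then show ?thesis using assms by (auto simp: bounded_borel_def)
qed

lemma bounded_borel_mult:
  fixes f g :: "'b::topological_space \<Rightarrow> 'c::{real_normed_algebra, second_countable_topology}"
  assumes "bounded_borel f" "bounded_borel g"
  shows "bounded_borel (\<lambda>x. f x * g x)"
proof -
  obtain C D where C: "\<forall>x. norm (f x) \<le> C" "\<forall>x. norm (g x) \<le> D" "C \<ge> 0"
    using assms bounded_borel_bound by (metis bounded_borel_def)
  have "norm (f x * g x) \<le> C * D" for x
    using C by (intro order_trans[OF norm_mult_ineq] mult_mono) auto
  then show ?thesis using assms by (auto simp: bounded_borel_def)
qed

lemma bounded_borel_cnj: "bounded_borel f \<Longrightarrow> bounded_borel (\<lambda>x. cnj (f x))"
  unfolding bounded_borel_def
  by (auto intro: borel_measurable_continuous_on[of cnj] continuous_on_cnj continuous_on_id)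

lemma bounded_borel_of_real: "bounded_borel f \<Longrightarrow> bounded_borel (\<lambda>x. complex_of_real (f x))"
  unfolding bounded_borel_def by auto

lemma bounded_borel_norm: "bounded_borel f \<Longrightarrow> bounded_borel (\<lambda>x. norm (f x) ^ k)"
proof -
  assume f: "bounded_borel f"
  then obtain C where "\<forall>x. norm (f x) \<le> C" by (auto simp: bounded_borel_def)
  then have "\<forall>x. norm (norm (f x) ^ k) \<le> C ^ k" by (auto intro: power_mono)
  then show ?thesis using f unfolding bounded_borel_def by (auto intro!: borel_measurable_power borel_measurable_norm)
qed

lemma compact_borel_mult:
  fixes f g :: "'b::real_normed_vector \<Rightarrow> 'c::{real_normed_algebra, second_countable_topology}"
  assumes f: "compact_borel f" and g: "bounded_borel g"
  shows "compact_borel (\<lambda>x. f x * g x)" "compact_borel (\<lambda>x. g x * f x)"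
proof -
  from f obtain R where "\<forall>x. R < norm x \<longrightarrow> f x = 0" by (auto simp: compact_borel_def)
  then have "\<forall>x. R < norm x \<longrightarrow> f x * g x = 0" "\<forall>x. R < norm x \<longrightarrow> g x * f x = 0" by auto
  then show "compact_borel (\<lambda>x. f x * g x)" "compact_borel (\<lambda>x. g x * f x)"
    using f g bounded_borel_mult[of f g] bounded_borel_mult[of g f] unfolding compact_borel_def by blast+
qed

lemma compact_borel_of_real: "compact_borel f \<Longrightarrow> compact_borel (\<lambda>x. complex_of_real (f x))"
  unfolding compact_borel_def by (auto intro: bounded_borel_of_real)

lemma compact_borel_cnj: "compact_borel f \<Longrightarrow> compact_borel (\<lambda>x. cnj (f x))"
  unfolding compact_borel_def by (auto intro: bounded_borel_cnj)

lemma compact_borel_norm: "compact_borel f \<Longrightarrow> k > 0 \<Longrightarrow> compact_borel (\<lambda>x. norm (f x) ^ k)"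
  unfolding compact_borel_def by (auto intro: bounded_borel_norm)

lemma compact_borel_add:
  fixes f g :: "'b::real_normed_vector \<Rightarrow> 'c::{real_normed_vector, second_countable_topology}"
  assumes "compact_borel f" "compact_borel g"
  shows "compact_borel (\<lambda>x. f x + g x)"
proof -
  obtain R S where "\<forall>x. R < norm x \<longrightarrow> f x = 0" "\<forall>x. S < norm x \<longrightarrow> g x = 0"
    using assms by (auto simp: compact_borel_def)
  then have "\<forall>x. max R S < norm x \<longrightarrow> f x + g x = 0" by simp
  then show ?thesis using assms bounded_borel_add unfolding compact_borel_def by blast
qed

lemma compact_borel_integrable:
  fixes h :: "'b::euclidean_space \<Rightarrow> 'c::{banach, second_countable_topology}"
  assumes "compact_borel h"
  shows "integrable lborel h"
proof -
  obtain C where C: "\<forall>x. norm (h x) \<le> C" using assms by (auto simp: compact_borel_def bounded_borel_def)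
  obtain R where R: "\<forall>x. R < norm x \<longrightarrow> h x = 0" using compact_borel_support[OF assms] by auto
  have m: "h \<in> borel_measurable lborel" using assms by (simp add: compact_borel_def bounded_borel_def)
  have fin: "emeasure lborel (cball (0::'b) R) < \<infinity>"
    using emeasure_bounded_finite[of "cball (0::'b) R"] by auto
  have "integrable lborel (\<lambda>x::'b. C * indicator (cball 0 R) x)"
    using fin by (intro integrable_mult_right integrable_real_indicator) auto
  then show ?thesis
  proof (rule Bochner_Integration.integrable_bound[OF _ m], intro AE_I2)
    fix x show "norm (h x) \<le> norm (C * indicator (cball 0 R) x)"
      using C[rule_format, of x] R[rule_format, of x] by (auto simp: indicator_def not_le)
  qed
qed

lemma continuous_compact_borel:
  fixes h :: "real \<Rightarrow> 'c::{real_normed_vector, second_countable_topology}"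
  assumes "continuous_on UNIV h" "\<forall>x. R < \<bar>x\<bar> \<longrightarrow> h x = 0"
  shows "compact_borel h"
proof -
  have "compact (h ` {-R..R})"
    using assms(1) by (intro compact_continuous_image) (auto intro: continuous_on_subset)
  then obtain C where C: "\<forall>y\<in>h ` {-R..R}. norm y \<le> C" using compact_imp_bounded bounded_iff by blast
  have "norm (h x) \<le> max C 0" for x
  proof (cases "R < \<bar>x\<bar>")
    case False
    then have "x \<in> {-R..R}" by auto
    then show ?thesis using C by (simp add: le_max_iff_disj)
  qed (use assms(2) in auto)
  then show ?thesis
    using assms unfolding compact_borel_def bounded_borel_def
    by (auto intro: borel_measurable_continuous_onI)
qed

lemma lborel_integral_interval:
  fixes h :: "real \<Rightarrow> real"
  assumes "compact_borel h" "\<And>x. R < \<bar>x\<bar> \<Longrightarrow> h x = 0"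
  shows "h integrable_on {-R..R}" "(LINT x|lborel. h x) = integral {-R..R} h"
proof -
  have "integrable lborel h" using compact_borel_integrable[OF assms(1)] .
  then have 1: "(h has_integral (LINT x|lborel. h x)) UNIV" by (rule has_integral_integral_lborel)
  moreover have "(\<lambda>x. if x \<in> {-R..R} then h x else 0) = h"
    using assms(2) by (auto simp: fun_eq_iff abs_le_iff not_le[symmetric])
  ultimately have "(h has_integral (LINT x|lborel. h x)) {-R..R}"
    by (metis has_integral_restrict_UNIV)
  then show "h integrable_on {-R..R}" "(LINT x|lborel. h x) = integral {-R..R} h"
    by (auto simp: integral_unique has_integral_integrable)
qed

lemma compact_borel_integral_lin:
  fixes f g :: "'b::euclidean_space \<Rightarrow> complex"
  assumes "compact_borel f" "compact_borel g"
  shows "(LINT x|lborel. f x + c * g x) = (LINT x|lborel. f x) + c * (LINT x|lborel. g x)"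
  using assms by (subst Bochner_Integration.integral_add) (auto intro!: compact_borel_integrable integrable_mult_right)

definition weight_form :: "(real \<Rightarrow> real) \<Rightarrow> real form" where
  "weight_form w f g = (LINT x|lborel. of_real (w x) * (cnj (f x) * g x))"

lemma function_space_bounded_borel:
  "function_space {f :: 'b::topological_space \<Rightarrow> complex. bounded_borel f}"
  unfolding function_space_def
  by (auto intro!: bounded_borel_add bounded_borel_mult bounded_borel_const)

lemma weight_form_integrand:
  assumes "compact_borel w" "bounded_borel f" "bounded_borel g"
  shows "compact_borel (\<lambda>x. complex_of_real (w x) * (cnj (f x) * g x))"
  using assms by (intro compact_borel_mult(1) compact_borel_of_real bounded_borel_mult bounded_borel_cnj)

lemma hermitian_weight_form:
  assumes "compact_borel w"
  shows "hermitian_form {f. bounded_borel f} (weight_form w)"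
  unfolding hermitian_form_def linear_functional_def
proof (intro conjI ballI allI)
  fix f g h :: "real \<Rightarrow> complex" and c
  assume a: "f \<in> {f. bounded_borel f}" "g \<in> {f. bounded_borel f}" "h \<in> {f. bounded_borel f}"
  have "weight_form w f (\<lambda>x. g x + c * h x)
      = (LINT x|lborel. of_real (w x) * (cnj (f x) * g x) + c * (of_real (w x) * (cnj (f x) * h x)))"
    unfolding weight_form_def by (intro Bochner_Integration.integral_cong) (auto simp: algebra_simps)
  also have "\<dots> = weight_form w f g + c * weight_form w f h"
    unfolding weight_form_def using a assms by (intro compact_borel_integral_lin weight_form_integrand) auto
  finally show "weight_form w f (\<lambda>x. g x + c * h x) = weight_form w f g + c * weight_form w f h" .
next
  fix f g :: "real \<Rightarrow> complex"
  show "weight_form w g f = cnj (weight_form w f g)"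
    unfolding weight_form_def Bochner_Integration.integral_cnj[symmetric]
    by (rule Bochner_Integration.integral_cong) (auto simp: algebra_simps)
qed

lemma weight_form_diag: "Re (weight_form w f f) = (LINT x|lborel. w x * (cmod (f x))\<^sup>2)"
proof -
  have "weight_form w f f = (LINT x|lborel. complex_of_real (w x * (cmod (f x))\<^sup>2))"
    unfolding weight_form_def
    by (intro Bochner_Integration.integral_cong) (auto simp: complex_norm_square mult_ac simp del: of_real_power)
  then show ?thesis unfolding integral_complex_of_real by simp
qed

abbreviation vderiv :: "(real \<Rightarrow> complex) \<Rightarrow> real \<Rightarrow> complex" where
  "vderiv f x \<equiv> vector_derivative f (at x)"

definition C1_compact :: "(real \<Rightarrow> complex) set" where
  "C1_compact = {f. (\<forall>x. f differentiable (at x)) \<and> continuous_on UNIV (vderiv f) \<and>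
                    (\<exists>R. \<forall>x. R < \<bar>x\<bar> \<longrightarrow> f x = 0)}"

lemma C1_compactI:
  assumes "\<And>x. (f has_vector_derivative f' x) (at x)" "continuous_on UNIV f'" "\<And>x. R < \<bar>x\<bar> \<Longrightarrow> f x = 0"
  shows "f \<in> C1_compact" "vderiv f x = f' x"
proof -
  have eq: "vderiv f = f'" using assms(1) by (auto simp: fun_eq_iff intro: vector_derivative_at)
  show "vderiv f x = f' x" using eq by (rule fun_cong)
  show "f \<in> C1_compact" using assms unfolding C1_compact_def mem_Collect_eq eq
    by (auto simp: has_vector_derivative_def differentiable_def)
qed

lemma C1_compact_deriv: "f \<in> C1_compact \<Longrightarrow> (f has_vector_derivative vderiv f x) (at x)"
  by (simp add: C1_compact_def vector_derivative_works)

lemma C1_compact_continuous: "f \<in> C1_compact \<Longrightarrow> continuous_on A f"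
  by (meson C1_compact_deriv continuous_at_imp_continuous_on has_vector_derivative_continuous)

lemma C1_compact_continuous_deriv: "f \<in> C1_compact \<Longrightarrow> continuous_on A (vderiv f)"
  by (auto simp: C1_compact_def intro: continuous_on_subset)

lemma C1_compact_support:
  assumes "f \<in> C1_compact"
  obtains R where "R > 0" "\<And>x. R \<le> \<bar>x\<bar> \<Longrightarrow> f x = 0" "\<And>x. R \<le> \<bar>x\<bar> \<Longrightarrow> vderiv f x = 0"
proof -
  obtain R where R: "\<forall>x. R < \<bar>x\<bar> \<longrightarrow> f x = 0" using assms by (auto simp: C1_compact_def)
  define S where "S = max R 0 + 1"
  have "vderiv f x = 0" if "S \<le> \<bar>x\<bar>" for x
  proof -
    have "open {y. R < \<bar>y::real\<bar>}" by (intro open_Collect_less continuous_intros)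
    moreover have "x \<in> {y. R < \<bar>y\<bar>}" using that by (auto simp: S_def)
    ultimately have "(f has_vector_derivative 0) (at x)"
      using R by (intro has_vector_derivative_transform_within_open[of "\<lambda>_. 0" 0 x "{y. R < \<bar>y\<bar>}" f]) auto
    then show ?thesis by (rule vector_derivative_at)
  qed
  then show ?thesis using that[of S] R by (auto simp: S_def)
qed

lemma C1_compact_borel:
  assumes "f \<in> C1_compact" shows "compact_borel f" "compact_borel (vderiv f)"
proof -
  obtain R where "\<And>x. R \<le> \<bar>x\<bar> \<Longrightarrow> f x = 0" "\<And>x. R \<le> \<bar>x\<bar> \<Longrightarrow> vderiv f x = 0"
    using C1_compact_support[OF assms] by metis
  then show "compact_borel f" "compact_borel (vderiv f)"
    using assms
    by (auto intro!: continuous_compact_borel[of _ R] C1_compact_continuous C1_compact_continuous_deriv)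
qed

lemma C1_compact_lin:
  assumes "f \<in> C1_compact" "g \<in> C1_compact"
  shows "(\<lambda>x. f x + c * g x) \<in> C1_compact" "vderiv (\<lambda>x. f x + c * g x) x = vderiv f x + c * vderiv g x"
proof -
  obtain R S where R: "\<And>x. R \<le> \<bar>x\<bar> \<Longrightarrow> f x = 0" "\<And>x. S \<le> \<bar>x\<bar> \<Longrightarrow> g x = 0"
    using C1_compact_support assms by metis
  have d: "((\<lambda>x. f x + c * g x) has_vector_derivative (vderiv f x + c * vderiv g x)) (at x)" for x
    using assms by (intro has_vector_derivative_add has_vector_derivative_mult_right C1_compact_deriv)
  have c: "continuous_on UNIV (\<lambda>x. vderiv f x + c * vderiv g x)"
    using assms by (intro continuous_intros C1_compact_continuous_deriv)
  show "(\<lambda>x. f x + c * g x) \<in> C1_compact" "vderiv (\<lambda>x. f x + c * g x) x = vderiv f x + c * vderiv g x"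
    using C1_compactI[OF d c, of "max R S"] R by auto
qed

lemma function_space_C1_compact: "function_space C1_compact"
proof -
  have "(\<lambda>_. 0) \<in> C1_compact" by (rule C1_compactI[of _ "\<lambda>_. 0" 0]) auto
  then show ?thesis using C1_compact_lin(1) by (auto simp: function_space_def)
qed

definition energy_form :: "real \<Rightarrow> real form" where
  "energy_form k f g =
     (LINT x|lborel. cnj (vderiv f x) * vderiv g x + of_real (k\<^sup>2) * (cnj (f x) * g x))"

definition schrodinger_form :: "real \<Rightarrow> (real \<Rightarrow> real) \<Rightarrow> real form" where
  "schrodinger_form k w f g = energy_form k f g - weight_form w f g"

lemma energy_form_integrand:
  assumes "f \<in> C1_compact" "g \<in> C1_compact"
  shows "compact_borel (\<lambda>x. cnj (vderiv f x) * vderiv g x + of_real (k\<^sup>2) * (cnj (f x) * g x))"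
proof -
  have "compact_borel (\<lambda>x. cnj (vderiv f x) * vderiv g x)" "compact_borel (\<lambda>x. cnj (f x) * g x)"
    by (rule compact_borel_mult(1)[OF compact_borel_cnj compact_borel_bounded];
        rule C1_compact_borel[OF assms(1)] C1_compact_borel[OF assms(2)])+
  then show ?thesis by (rule compact_borel_add[OF _ compact_borel_mult(2)[OF _ bounded_borel_const]])
qed

lemma hermitian_energy_form: "hermitian_form C1_compact (energy_form k)"
  unfolding hermitian_form_def linear_functional_def
proof (intro conjI ballI allI)
  fix f g h :: "real \<Rightarrow> complex" and c
  assume a: "f \<in> C1_compact" "g \<in> C1_compact" "h \<in> C1_compact"
  have lin: "vderiv (\<lambda>x. g x + c * h x) x = vderiv g x + c * vderiv h x" for x
    by (rule C1_compact_lin(2)[OF a(2,3)])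
  have ring: "p * (q + c * r) + K * (t * (u + c * v)) = (p * q + K * (t * u)) + c * (p * r + K * (t * v))"
    for p q r K t u v :: complex by algebra
  have "energy_form k f (\<lambda>x. g x + c * h x)
      = (LINT x|lborel. (cnj (vderiv f x) * vderiv g x + of_real (k\<^sup>2) * (cnj (f x) * g x)) +
           c * (cnj (vderiv f x) * vderiv h x + of_real (k\<^sup>2) * (cnj (f x) * h x)))"
    unfolding energy_form_def lin ring ..
  also have "\<dots> = energy_form k f g + c * energy_form k f h"
    unfolding energy_form_def
    by (rule compact_borel_integral_lin[OF energy_form_integrand[OF a(1,2)] energy_form_integrand[OF a(1,3)]])
  finally show "energy_form k f (\<lambda>x. g x + c * h x) = energy_form k f g + c * energy_form k f h" .
next
  fix f g :: "real \<Rightarrow> complex"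
  show "energy_form k g f = cnj (energy_form k f g)"
    unfolding energy_form_def Bochner_Integration.integral_cnj[symmetric]
    by (rule Bochner_Integration.integral_cong) (auto simp: algebra_simps)
qed

lemma energy_form_diag:
  "Re (energy_form k f f) = (LINT x|lborel. (cmod (vderiv f x))\<^sup>2 + k\<^sup>2 * (cmod (f x))\<^sup>2)"
proof -
  have "energy_form k f f = (LINT x|lborel. complex_of_real ((cmod (vderiv f x))\<^sup>2 + k\<^sup>2 * (cmod (f x))\<^sup>2))"
    unfolding energy_form_def of_real_add of_real_mult complex_norm_square
    by (simp add: mult.commute)
  then show ?thesis unfolding integral_complex_of_real by simp
qed

lemma hermitian_form_subset: "hermitian_form V B \<Longrightarrow> W \<subseteq> V \<Longrightarrow> hermitian_form W B"
  unfolding hermitian_form_def linear_functional_def by blast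

lemma C1_compact_subset: "C1_compact \<subseteq> {f. bounded_borel f}"
  using C1_compact_borel(1) compact_borel_bounded by blast

lemma hermitian_form_diff:
  assumes A: "hermitian_form V A" and B: "hermitian_form V B"
  shows "hermitian_form V (\<lambda>f g. A f g - B f g)"
  unfolding hermitian_form_def
proof (intro conjI ballI)
  fix f assume f: "f \<in> V"
  show "linear_functional V (\<lambda>g. A f g - B f g)"
    using hermitian_form_linear[OF A f] hermitian_form_linear[OF B f]
    unfolding linear_functional_def by (simp add: algebra_simps)
  fix g assume g: "g \<in> V"
  show "A g f - B g f = cnj (A f g - B f g)"
    using hermitian_form_sym[OF A f g] hermitian_form_sym[OF B f g] by simp
qed

lemma hermitian_schrodinger_form:
  "compact_borel w \<Longrightarrow> hermitian_form C1_compact (schrodinger_form k w)"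
  using hermitian_form_diff[OF hermitian_energy_form
      hermitian_form_subset[OF hermitian_weight_form C1_compact_subset]]
  unfolding schrodinger_form_def[abs_def] by blast

section \<open>Pointwise control by the energy\<close>

text \<open>The Cauchy--Schwarz inequality for \<open>\<integral> \<bar>f'\<bar>\<close>, from \<open>\<integral> (\<bar>f'\<bar> - c)\<^sup>2 \<ge> 0\<close> at the mean value \<open>c\<close>.\<close>

lemma C1_increment_le:
  assumes f: "f \<in> C1_compact" and st: "s \<le> t"
  shows "(cmod (f t - f s))\<^sup>2 \<le> (t - s) * integral {s..t} (\<lambda>x. (cmod (vderiv f x))\<^sup>2)"
proof (cases "s = t")
  case False
  then have L: "t - s > 0" using st by simp
  have cont: "continuous_on {s..t} (vderiv f)" by (rule C1_compact_continuous_deriv[OF f])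
  define I where "I = integral {s..t} (\<lambda>x. cmod (vderiv f x))"
  have "(vderiv f has_integral f t - f s) {s..t}"
    by (rule fundamental_theorem_of_calculus[OF st has_vector_derivative_at_within[OF C1_compact_deriv[OF f]]])
  then have "cmod (f t - f s) \<le> I"
    unfolding I_def
    by (subst integral_unique[symmetric], assumption)
       (intro integral_norm_bound_integral integrable_continuous_interval continuous_on_norm cont order_refl)
  then have 1: "(cmod (f t - f s))\<^sup>2 \<le> I\<^sup>2" by (intro power_mono) auto
  define c where "c = I / (t - s)"
  have "0 \<le> integral {s..t} (\<lambda>x. (cmod (vderiv f x) - c)\<^sup>2)"
    by (intro integral_nonneg integrable_continuous_interval continuous_intros cont) auto
  also have "\<dots> = integral {s..t} (\<lambda>x. (cmod (vderiv f x))\<^sup>2 - (2 * c * cmod (vderiv f x) - c\<^sup>2))"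
    by (intro integral_cong) (simp add: power2_diff algebra_simps)
  also have "\<dots> = integral {s..t} (\<lambda>x. (cmod (vderiv f x))\<^sup>2)
      - integral {s..t} (\<lambda>x. 2 * c * cmod (vderiv f x) - c\<^sup>2)"
    by (rule integral_diff; intro integrable_continuous_interval continuous_intros cont)
  also have "integral {s..t} (\<lambda>x. 2 * c * cmod (vderiv f x) - c\<^sup>2)
      = integral {s..t} (\<lambda>x. 2 * c * cmod (vderiv f x)) - integral {s..t} (\<lambda>x. c\<^sup>2)"
    by (rule integral_diff; intro integrable_continuous_interval continuous_intros cont)
  also have "\<dots> = 2 * c * I - c\<^sup>2 * (t - s)"
    unfolding I_def using st by simp
  also have "2 * c * I - c\<^sup>2 * (t - s) = I\<^sup>2 / (t - s)"
  proof -
    have "2 * c * I - c\<^sup>2 * (t - s) = 2 * c * I - c * (c * (t - s))" by (simp add: power2_eq_square)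
    also have "c * (t - s) = I" using L by (simp add: c_def)
    also have "2 * c * I - c * I = I\<^sup>2 / (t - s)" by (simp add: c_def power2_eq_square)
    finally show ?thesis .
  qed
  finally have "0 \<le> integral {s..t} (\<lambda>x. (cmod (vderiv f x))\<^sup>2) - I\<^sup>2 / (t - s)" .
  then show ?thesis using 1 L by (simp add: field_simps)
qed simp

text \<open>By \<open>(k \<bar>f\<bar>\<^sup>2)' \<le> \<bar>f'\<bar>\<^sup>2 + k\<^sup>2 \<bar>f\<bar>\<^sup>2\<close>.\<close>

lemma C1_half_line_left:
  assumes f: "f \<in> C1_compact" and ab: "a \<le> b" and a: "f a = 0"
  shows "k * (cmod (f b))\<^sup>2 \<le> integral {a..b} (\<lambda>x. (cmod (vderiv f x))\<^sup>2 + k\<^sup>2 * (cmod (f x))\<^sup>2)"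
proof -
  have d: "((\<lambda>x. k * (f x \<bullet> f x)) has_vector_derivative k * (2 * (f x \<bullet> vderiv f x))) (at x within {a..b})" for x
  proof -
    have "(f has_derivative (\<lambda>h. h *\<^sub>R vderiv f x)) (at x within {a..b})"
      using has_vector_derivative_at_within[OF C1_compact_deriv[OF f]] by (simp add: has_vector_derivative_def)
    from has_derivative_inner[OF this this]
    have "((\<lambda>x. f x \<bullet> f x) has_vector_derivative (2 * (f x \<bullet> vderiv f x))) (at x within {a..b})"
      unfolding has_vector_derivative_def
      by (rule has_derivative_eq_rhs) (auto simp: fun_eq_iff inner_commute algebra_simps)
    then show ?thesis by (rule has_vector_derivative_mult_right)
  qed
  have I: "((\<lambda>x. k * (2 * (f x \<bullet> vderiv f x))) has_integral k * (f b \<bullet> f b) - k * (f a \<bullet> f a)) {a..b}"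
    by (rule fundamental_theorem_of_calculus[OF ab d])
  have "k * (2 * (f x \<bullet> vderiv f x)) \<le> (cmod (vderiv f x))\<^sup>2 + k\<^sup>2 * (cmod (f x))\<^sup>2" for x
  proof -
    have "0 \<le> (vderiv f x - k *\<^sub>R f x) \<bullet> (vderiv f x - k *\<^sub>R f x)" by simp
    then show ?thesis
      unfolding power2_norm_eq_inner
      by (simp add: inner_diff_left inner_diff_right inner_commute power2_eq_square algebra_simps)
  qed
  then have "integral {a..b} (\<lambda>x. k * (2 * (f x \<bullet> vderiv f x)))
      \<le> integral {a..b} (\<lambda>x. (cmod (vderiv f x))\<^sup>2 + k\<^sup>2 * (cmod (f x))\<^sup>2)"
    using I f by (intro integral_le) (auto intro!: integrable_continuous_interval continuous_intros
        C1_compact_continuous C1_compact_continuous_deriv)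
  then show ?thesis unfolding integral_unique[OF I] by (simp add: a power2_norm_eq_inner)
qed

lemma C1_compact_reflect:
  assumes "f \<in> C1_compact"
  shows "(\<lambda>x. f (- x)) \<in> C1_compact" "vderiv (\<lambda>x. f (- x)) x = - vderiv f (- x)"
proof -
  obtain R where R: "\<And>x. R \<le> \<bar>x\<bar> \<Longrightarrow> f x = 0" using C1_compact_support[OF assms] by metis
  have d: "((\<lambda>x. f (- x)) has_vector_derivative - vderiv f (- x)) (at x)" for x
  proof -
    have "((\<lambda>x::real. - x) has_vector_derivative -1) (at x)"
      by (auto intro!: derivative_eq_intros simp: has_vector_derivative_minus)
    from vector_diff_chain_at[OF this, of f "vderiv f (- x)"] show ?thesis
      using C1_compact_deriv[OF assms] by (simp add: o_def)
  qed
  have c: "continuous_on UNIV (\<lambda>x. - vderiv f (- x))"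
    by (intro continuous_on_minus continuous_on_compose2[OF C1_compact_continuous_deriv[OF assms, of UNIV]]
        continuous_on_id) auto
  show "(\<lambda>x. f (- x)) \<in> C1_compact" "vderiv (\<lambda>x. f (- x)) x = - vderiv f (- x)"
    using C1_compactI[OF d c, of R] R by auto
qed

lemma C1_half_line_right:
  assumes f: "f \<in> C1_compact" and ab: "a \<le> b" and b: "f b = 0"
  shows "k * (cmod (f a))\<^sup>2 \<le> integral {a..b} (\<lambda>x. (cmod (vderiv f x))\<^sup>2 + k\<^sup>2 * (cmod (f x))\<^sup>2)"
proof -
  have "k * (cmod (f (- (- a))))\<^sup>2 \<le> integral {-b..-a} (\<lambda>x. (cmod (- vderiv f (- x)))\<^sup>2 + k\<^sup>2 * (cmod (f (- x)))\<^sup>2)"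
    using C1_half_line_left[OF C1_compact_reflect(1)[OF f], of "-b" "-a" k] ab b
    by (simp add: C1_compact_reflect(2)[OF f])
  also have "\<dots> = integral {a..b} (\<lambda>x. (cmod (vderiv f x))\<^sup>2 + k\<^sup>2 * (cmod (f x))\<^sup>2)"
    unfolding norm_minus_cancel by (rule Henstock_Kurzweil_Integration.integral_reflect_real)
  finally show ?thesis by simp
qed

text \<open>The increment of \<open>f\<close> between two points costs energy in three places: the gradient between
  the points, and the two half lines on which \<open>f\<close> has to decay from its end values.\<close>

lemma energy_increment:
  assumes f: "f \<in> C1_compact" and k: "k \<ge> 0"
  shows "(cmod (f t - f s))\<^sup>2 * (1 + k * \<bar>t - s\<bar> / 2) \<le> \<bar>t - s\<bar> * Re (energy_form k f f)"
proof -
  have main: "(cmod (f t - f s))\<^sup>2 * (1 + k * (t - s) / 2) \<le> (t - s) * Re (energy_form k f f)"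
    if st: "s < t" for s t
  proof -
    let ?e = "\<lambda>x. (cmod (vderiv f x))\<^sup>2 + k\<^sup>2 * (cmod (f x))\<^sup>2"
    obtain R0 where R0: "\<And>x. R0 \<le> \<bar>x\<bar> \<Longrightarrow> f x = 0" "\<And>x. R0 \<le> \<bar>x\<bar> \<Longrightarrow> vderiv f x = 0"
      using C1_compact_support[OF f] by metis
    define R where "R = max R0 (max \<bar>s\<bar> \<bar>t\<bar>)"
    have R: "\<And>x. R \<le> \<bar>x\<bar> \<Longrightarrow> f x = 0" "\<And>x. R \<le> \<bar>x\<bar> \<Longrightarrow> vderiv f x = 0" "-R \<le> s" "t \<le> R"
      using R0 by (auto simp: R_def)
    have ce: "continuous_on A ?e" for A
      by (intro continuous_intros C1_compact_continuous[OF f] C1_compact_continuous_deriv[OF f])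
    have int: "?e integrable_on {x..y}" for x y by (intro integrable_continuous_interval ce)
    have cb: "compact_borel ?e" using R(1,2) by (intro continuous_compact_borel[of _ R] ce) auto
    have E: "Re (energy_form k f f) = integral {-R..R} ?e"
      unfolding energy_form_diag using R(1,2) by (intro lborel_integral_interval(2)[OF cb]) auto
    also have "\<dots> = integral {-R..s} ?e + (integral {s..t} ?e + integral {t..R} ?e)"
    proof -
      have "integral {-R..s} ?e + integral {s..R} ?e = integral {-R..R} ?e"
        using R st by (intro Henstock_Kurzweil_Integration.integral_combine int) auto
      moreover have "integral {s..t} ?e + integral {t..R} ?e = integral {s..R} ?e"
        using R st by (intro Henstock_Kurzweil_Integration.integral_combine int) auto
      ultimately show ?thesis by simp
    qed
    finally have E: "Re (energy_form k f f) = integral {-R..s} ?e + (integral {s..t} ?e + integral {t..R} ?e)" .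
    have 1: "k * (cmod (f s))\<^sup>2 \<le> integral {-R..s} ?e"
      using R by (intro C1_half_line_left f) auto
    have 2: "k * (cmod (f t))\<^sup>2 \<le> integral {t..R} ?e"
      using R st by (intro C1_half_line_right f) auto
    have "integral {s..t} (\<lambda>x. (cmod (vderiv f x))\<^sup>2) \<le> integral {s..t} ?e"
      by (intro integral_le int integrable_continuous_interval continuous_intros C1_compact_continuous_deriv[OF f]) auto
    then have 3: "(cmod (f t - f s))\<^sup>2 \<le> (t - s) * integral {s..t} ?e"
      using C1_increment_le[OF f, of s t] st by (smt (verit, best) mult_left_mono)
    have "(cmod (f t - f s))\<^sup>2 \<le> (cmod (f t) + cmod (f s))\<^sup>2"
      by (intro power_mono norm_triangle_ineq4) auto
    also have "\<dots> \<le> 2 * ((cmod (f s))\<^sup>2 + (cmod (f t))\<^sup>2)"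
      using sum_squares_bound[of "cmod (f t)" "cmod (f s)"] by (simp add: power2_sum)
    finally have "k * (cmod (f t - f s))\<^sup>2 \<le> k * (2 * ((cmod (f s))\<^sup>2 + (cmod (f t))\<^sup>2))"
      using k by (rule mult_left_mono)
    then have "k * (cmod (f t - f s))\<^sup>2 / 2 \<le> integral {-R..s} ?e + integral {t..R} ?e"
      using 1 2 by (simp add: algebra_simps)
    then have "(t - s) * (k * (cmod (f t - f s))\<^sup>2 / 2) \<le> (t - s) * (integral {-R..s} ?e + integral {t..R} ?e)"
      using st by (intro mult_left_mono) auto
    then show ?thesis unfolding E using 3 by (simp add: algebra_simps)
  qed
  show ?thesis
    using main[of s t] main[of t s] by (cases s t rule: linorder_cases) (auto simp: norm_minus_commute)
qed

lemma energy_form_nonneg: "Re (energy_form k f f) \<ge> 0"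
  unfolding energy_form_diag by (intro integral_nonneg_AE AE_I2) auto

lemma energy_form_pos:
  assumes f: "f \<in> C1_compact" and k: "k \<ge> 0" and neg: "Re (schrodinger_form k w f f) < 0"
  shows "Re (energy_form k f f) > 0"
proof (rule ccontr)
  assume "\<not> ?thesis"
  then have 0: "Re (energy_form k f f) = 0" using energy_form_nonneg[of k f] by linarith
  obtain R where R: "\<And>x. R \<le> \<bar>x\<bar> \<Longrightarrow> f x = 0" using C1_compact_support[OF f] by metis
  have "f x = 0" for x
  proof -
    have "(cmod (f x - f \<bar>R\<bar>))\<^sup>2 * (1 + k * \<bar>x - \<bar>R\<bar>\<bar> / 2) \<le> 0"
      using energy_increment[OF f k, of x "\<bar>R\<bar>"] unfolding 0 by simp
    moreover have "1 + k * \<bar>x - \<bar>R\<bar>\<bar> / 2 > 0" using k by (simp add: add_pos_nonneg)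
    ultimately have "(cmod (f x - f \<bar>R\<bar>))\<^sup>2 \<le> 0" by (simp add: mult_le_0_iff)
    then show ?thesis using R[of "\<bar>R\<bar>"] by simp
  qed
  then have "weight_form w f f = 0" by (simp add: weight_form_def)
  then show False using neg 0 by (simp add: schrodinger_form_def)
qed

lemma borel_pair_fst: "f \<in> borel_measurable borel \<Longrightarrow>
    (\<lambda>p::'a::second_countable_topology \<times> 'b::second_countable_topology. f (fst p)) \<in> borel_measurable borel"
  by (rule measurable_compose[OF borel_measurable_continuous_onI[OF continuous_on_fst[OF continuous_on_id]]])

lemma borel_pair_snd: "f \<in> borel_measurable borel \<Longrightarrow>
    (\<lambda>p::'a::second_countable_topology \<times> 'b::second_countable_topology. f (snd p)) \<in> borel_measurable borel"
  by (rule measurable_compose[OF borel_measurable_continuous_onI[OF continuous_on_snd[OF continuous_on_id]]])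

lemma bounded_borel_fst: "bounded_borel f \<Longrightarrow>
    bounded_borel (\<lambda>p::'a::second_countable_topology \<times> 'b::second_countable_topology. f (fst p))"
  unfolding bounded_borel_def by (auto intro: borel_pair_fst)

lemma bounded_borel_snd: "bounded_borel f \<Longrightarrow>
    bounded_borel (\<lambda>p::'a::second_countable_topology \<times> 'b::second_countable_topology. f (snd p))"
  unfolding bounded_borel_def by (auto intro: borel_pair_snd)

lemma compact_borel_product:
  fixes f :: "'a::euclidean_space \<Rightarrow> 'c::{real_normed_algebra, second_countable_topology}"
    and g :: "'b::euclidean_space \<Rightarrow> 'c"
  assumes f: "compact_borel f" and g: "compact_borel g"
  shows "compact_borel (\<lambda>p. f (fst p) * g (snd p))"
proof -
  obtain R S where R: "\<forall>x. R < norm x \<longrightarrow> f x = 0" "\<forall>x. S < norm x \<longrightarrow> g x = 0"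
    using f g by (auto simp: compact_borel_def)
  have "f (fst p) * g (snd p) = 0" if "R + S < norm p" for p
  proof -
    have "norm p \<le> norm (fst p) + norm (snd p)" by (metis norm_Pair_le prod.collapse)
    then have "R < norm (fst p) \<or> S < norm (snd p)" using that by linarith
    then show ?thesis using R by auto
  qed
  moreover have "bounded_borel (\<lambda>p. f (fst p) * g (snd p))"
    using f g by (intro bounded_borel_mult bounded_borel_fst bounded_borel_snd compact_borel_bounded)
  ultimately show ?thesis unfolding compact_borel_def by blast
qed

lemma compact_borel_mult_continuous:
  fixes f g :: "'b::euclidean_space \<Rightarrow> real"
  assumes f: "compact_borel f" and g: "continuous_on UNIV g"
  shows "compact_borel (\<lambda>x. f x * g x)"
proof -
  obtain R where R: "\<forall>x. R < norm x \<longrightarrow> f x = 0" using f by (auto simp: compact_borel_def)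
  obtain C where C: "\<forall>x. norm (f x) \<le> C" "C \<ge> 0" using bounded_borel_bound f by (metis compact_borel_def)
  have "compact (g ` cball 0 R)"
    using g by (intro compact_continuous_image) (auto intro: continuous_on_subset)
  then obtain D where "\<forall>y\<in>g ` cball 0 R. norm y \<le> D" using compact_imp_bounded bounded_iff by blast
  then have D: "norm (g x) \<le> D" if "norm x \<le> R" for x using that by auto
  have "norm (f x * g x) \<le> C * \<bar>D\<bar>" for x
  proof (cases "R < norm x")
    case False
    then have "norm (f x) * norm (g x) \<le> C * \<bar>D\<bar>" using C D[of x] by (intro mult_mono) auto
    then show ?thesis by (simp add: abs_mult)
  qed (use R C in auto)
  moreover have "(\<lambda>x. f x * g x) \<in> borel_measurable borel"
    by (intro borel_measurable_times borel_measurable_continuous_onI[OF g] bounded_borelD compact_borel_bounded f)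
  ultimately show ?thesis using R unfolding compact_borel_def bounded_borel_def by auto
qed

lemma compact_borel_measurable: "compact_borel h \<Longrightarrow> h \<in> borel_measurable borel"
  by (rule bounded_borelD[OF compact_borel_bounded])

lemma compact_borel_fubini:
  fixes h :: "'a::euclidean_space \<times> 'b::euclidean_space \<Rightarrow> 'c::{banach, second_countable_topology}"
  assumes "compact_borel h"
  shows "(LINT x|lborel. LINT y|lborel. h (x, y)) = (LINT p|lborel. h p)"
    and "(LINT y|lborel. LINT x|lborel. h (x, y)) = (LINT p|lborel. h p)"
proof -
  have i: "integrable (lborel \<Otimes>\<^sub>M lborel) (case_prod (\<lambda>x y. h (x, y)))"
    using compact_borel_integrable[OF assms] unfolding lborel_prod by simp
  show "(LINT x|lborel. LINT y|lborel. h (x, y)) = (LINT p|lborel. h p)"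
    using lborel_pair.integral_fst[OF i] unfolding lborel_prod by simp
  show "(LINT y|lborel. LINT x|lborel. h (x, y)) = (LINT p|lborel. h p)"
    using lborel_pair.integral_snd[OF i] unfolding lborel_prod by simp
qed

lemma lborel_integral_product:
  fixes f :: "'a::euclidean_space \<Rightarrow> 'c::{banach, real_normed_field, second_countable_topology}"
    and g :: "'b::euclidean_space \<Rightarrow> 'c"
  assumes "compact_borel f" "compact_borel g"
  shows "(LINT p|lborel. f (fst p) * g (snd p)) = (LINT x|lborel. f x) * (LINT y|lborel. g y)"
  using compact_borel_fubini(1)[OF compact_borel_product[OF assms]] by simp

lemma compact_borel_marginal:
  fixes h :: "'a::euclidean_space \<times> 'b::euclidean_space \<Rightarrow> 'c::{banach, second_countable_topology}"
  assumes h: "compact_borel h"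
  shows "compact_borel (\<lambda>x. LINT y|lborel. h (x, y))"
proof -
  obtain C where C: "C \<ge> 0" "\<And>p. norm (h p) \<le> C"
    using bounded_borel_bound[OF compact_borel_bounded[OF h]] by blast
  obtain R where R: "R > 0" "\<And>p. R < norm p \<Longrightarrow> h p = 0" using compact_borel_support[OF h] by blast
  have ind: "integrable lborel (indicator (cball (0::'b) R) :: 'b \<Rightarrow> real)"
    using emeasure_bounded_finite[of "cball (0::'b) R"] by (intro integrable_real_indicator) auto
  have "norm (LINT y|lborel. h (x, y)) \<le> (LINT y|lborel. C * indicator (cball (0::'b) R) y)" for x
  proof (rule Bochner_Integration.integral_norm_bound_integral)
    have pt: "norm (h (x, y)) \<le> C * indicator (cball (0::'b) R) y" for y
      using C(2)[of "(x, y)"] R(2)[of "(x, y)"] norm_snd_le[of y x] by (auto simp: indicator_def not_le)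
    show ib: "integrable lborel (\<lambda>y. C * indicator (cball (0::'b) R) y)"
      by (rule integrable_mult_right[OF ind])
    have "(\<lambda>y. h (x, y)) \<in> borel_measurable borel"
      by (rule measurable_compose[OF borel_measurable_continuous_onI compact_borel_measurable[OF h]])
         (intro continuous_intros)
    then show "integrable lborel (\<lambda>y. h (x, y))"
      by (intro Bochner_Integration.integrable_bound[OF ib] AE_I2 order_trans[OF pt]) auto
    show "norm (h (x, y)) \<le> C * indicator (cball (0::'b) R) y" for y by (rule pt)
  qed
  moreover have "(\<lambda>x. LINT y|lborel. h (x, y)) \<in> borel_measurable borel"
  proof -
    have "case_prod (\<lambda>x y. h (x, y)) \<in> borel_measurable (lborel \<Otimes>\<^sub>M lborel)"
      unfolding lborel_prod using compact_borel_measurable[OF h] by simp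
    from lborel.borel_measurable_lebesgue_integral[OF this] show ?thesis by simp
  qed
  moreover have "(LINT y|lborel. h (x, y)) = 0" if "R < norm x" for x
  proof -
    have "h (x, y) = 0" for y using R(2)[of "(x, y)"] norm_fst_le[of x y] that by linarith
    then show ?thesis by simp
  qed
  ultimately show ?thesis unfolding compact_borel_def bounded_borel_def by blast
qed

section \<open>Potentials\<close>

definition potential :: "(real \<Rightarrow> real) \<Rightarrow> bool" where
  "potential w \<longleftrightarrow> compact_borel w \<and> (\<forall>x. 0 \<le> w x)"

definition mass :: "(real \<Rightarrow> real) \<Rightarrow> real" where
  "mass w = (LINT x|lborel. w x)"

text \<open>The mass times the mean distance of two independent points distributed like \<open>w\<close>.\<close>

definition spread :: "(real \<Rightarrow> real) \<Rightarrow> real" where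
  "spread w = (LINT p|lborel. w (fst p) * \<bar>fst p - snd p\<bar> * w (snd p)) / mass w"

lemma potential_compact: "potential w \<Longrightarrow> compact_borel w"
  and potential_nonneg: "potential w \<Longrightarrow> 0 \<le> w x"
  by (auto simp: potential_def)

lemma mass_nonneg: "potential w \<Longrightarrow> mass w \<ge> 0"
  unfolding mass_def by (intro integral_nonneg_AE AE_I2) (simp add: potential_nonneg)

lemma mass_scaled: "mass (\<lambda>x. c * w x) = c * mass w"
  by (simp add: mass_def)

lemma negative_system_single:
  assumes "negative_system q n \<phi>" "a < n"
  shows "Re (q (\<phi> a) (\<phi> a)) < 0"
proof -
  let ?c = "\<lambda>i. if i = a then 1 else (0::complex)"
  have "lin_comb n ?c \<phi> = \<phi> a"
    using assms(2) by (auto simp: lin_comb_def fun_eq_iff if_distrib[of "\<lambda>t. t * _"] sum.delta cong: if_cong)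
  moreover have "nonzero_coeffs n ?c" using assms(2) by (auto simp: nonzero_coeffs_def)
  ultimately show ?thesis using assms(1) unfolding negative_system_def by metis
qed

text \<open>If \<open>w\<close> vanishes almost everywhere, only the nonnegative energy is left.\<close>

lemma mass_pos:
  assumes w: "potential w" and f: "f \<in> C1_compact" "Re (schrodinger_form k w f f) < 0"
  shows "mass w > 0"
proof (rule ccontr)
  assume "\<not> ?thesis"
  then have "(LINT x|lborel. w x) = 0" using mass_nonneg[OF w] by (simp add: mass_def)
  then have ae: "AE x in lborel. w x = 0"
    using integral_nonneg_eq_0_iff_AE[OF compact_borel_integrable[OF potential_compact[OF w]]]
      potential_nonneg[OF w] by auto
  have "(LINT x|lborel. w x * (cmod (f x))\<^sup>2) = (LINT x::real|lborel. 0)"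
  proof (rule Bochner_Integration.integral_cong_AE)
    show "(\<lambda>x. w x * (cmod (f x))\<^sup>2) \<in> borel_measurable lborel"
      using bounded_borelD[OF compact_borel_bounded[OF potential_compact[OF w]]]
        bounded_borelD[OF compact_borel_bounded[OF C1_compact_borel(1)[OF f(1)]]] by simp
    show "AE x in lborel. w x * (cmod (f x))\<^sup>2 = 0" using ae by eventually_elim simp
  qed simp
  then show False using f(2) energy_form_nonneg[of k f]
    by (simp add: schrodinger_form_def weight_form_diag)
qed

lemma weight_form_variance:
  assumes w: "potential w" and f: "bounded_borel f"
  shows "(LINT p|lborel. w (fst p) * w (snd p) * (cmod (f (fst p) - f (snd p)))\<^sup>2)
      = 2 * mass w * (LINT x|lborel. w x * (cmod (f x))\<^sup>2)
        - 2 * (cmod (LINT x|lborel. complex_of_real (w x) * f x))\<^sup>2"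
proof -
  have wc: "compact_borel w" using w by (rule potential_compact)
  let ?A = "\<lambda>x. w x * (cmod (f x))\<^sup>2" and ?F = "\<lambda>x. complex_of_real (w x) * f x"
  have cA: "compact_borel ?A" using wc f by (intro compact_borel_mult(1) bounded_borel_norm)
  have cF: "compact_borel ?F" using wc f by (intro compact_borel_mult(1) compact_borel_of_real)
  have cF': "compact_borel (\<lambda>x. cnj (?F x))" using cF by (rule compact_borel_cnj)
  have pt: "w s * w t * (cmod (x - y))\<^sup>2 = w s * (cmod x)\<^sup>2 * w t + w s * (w t * (cmod y)\<^sup>2)
      - 2 * Re (cnj (of_real (w s) * x) * (of_real (w t) * y))" for s t x y
  proof -
    have "(cmod (x - y))\<^sup>2 = (cmod x)\<^sup>2 + (cmod y)\<^sup>2 - 2 * Re (cnj x * y)"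
      by (simp add: cmod_power2 power2_diff algebra_simps)
    then show ?thesis by (simp only:) (simp add: algebra_simps)
  qed
  have i1: "integrable lborel (\<lambda>p. ?A (fst p) * w (snd p))" (is "integrable _ ?i1")
    by (rule compact_borel_integrable[OF compact_borel_product[OF cA wc]])
  have i2: "integrable lborel (\<lambda>p. w (fst p) * ?A (snd p))" (is "integrable _ ?i2")
    by (rule compact_borel_integrable[OF compact_borel_product[OF wc cA]])
  have i3: "integrable lborel (\<lambda>p. cnj (?F (fst p)) * ?F (snd p))" (is "integrable _ ?i3")
    by (rule compact_borel_integrable[OF compact_borel_product[OF cF' cF]])
  have "(LINT p|lborel. ?i3 p) = cnj (LINT x|lborel. ?F x) * (LINT x|lborel. ?F x)"
    using lborel_integral_product[OF cF' cF] by (simp only: Bochner_Integration.integral_cnj)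
  then have "Re (LINT p|lborel. ?i3 p) = Re (cnj (LINT x|lborel. ?F x) * (LINT x|lborel. ?F x))"
    by (rule arg_cong)
  also have "\<dots> = (cmod (LINT x|lborel. ?F x))\<^sup>2"
    unfolding cmod_power2 by (simp add: power2_eq_square)
  finally have v3: "Re (LINT p|lborel. ?i3 p) = (cmod (LINT x|lborel. ?F x))\<^sup>2" .
  have "(LINT p|lborel. w (fst p) * w (snd p) * (cmod (f (fst p) - f (snd p)))\<^sup>2)
      = (LINT p|lborel. ?i1 p + ?i2 p - 2 * Re (?i3 p))"
    unfolding pt ..
  also have "\<dots> = (LINT p|lborel. ?i1 p) + (LINT p|lborel. ?i2 p) - 2 * Re (LINT p|lborel. ?i3 p)"
  proof -
    have i3': "integrable lborel (\<lambda>p. Re (?i3 p))" using i3 by (rule integrable_Re)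
    have "(LINT p|lborel. ?i1 p + ?i2 p - 2 * Re (?i3 p))
        = (LINT p|lborel. ?i1 p + ?i2 p) - (LINT p|lborel. 2 * Re (?i3 p))"
      by (intro Bochner_Integration.integral_diff Bochner_Integration.integrable_add integrable_mult_right i1 i2 i3')
    also have "(LINT p|lborel. ?i1 p + ?i2 p) = (LINT p|lborel. ?i1 p) + (LINT p|lborel. ?i2 p)"
      by (intro Bochner_Integration.integral_add i1 i2)
    also have "(LINT p|lborel. 2 * Re (?i3 p)) = 2 * Re (LINT p|lborel. ?i3 p)"
      unfolding integral_mult_right_zero integral_Re[OF i3] ..
    finally show ?thesis .
  qed
  also have "\<dots> = 2 * mass w * (LINT x|lborel. ?A x) - 2 * (cmod (LINT x|lborel. ?F x))\<^sup>2"
    unfolding v3 lborel_integral_product[OF cA wc] lborel_integral_product[OF wc cA] by (simp add: mass_def)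
  finally show ?thesis .
qed

text \<open>Many negative directions force the potential to be spread out. The functions with
  vanishing \<open>w\<close>-mean see \<open>w\<close> only through increments, and increments cost energy. For functions
  orthonormal in energy, Bessel's inequality bounds the sum of all squared increments between \<open>s\<close> and
  \<open>t\<close> by what a single function can achieve, so the bound does not lose a factor in the dimension.\<close>

lemma negative_system_spread:
  assumes w: "potential w" and k: "k \<ge> 0" and \<psi>: "\<And>i. i < n \<Longrightarrow> \<psi> i \<in> C1_compact" and n: "n \<ge> 1"
    and neg: "negative_system (schrodinger_form k w) n \<psi>"
  shows "2 * (real n - 1) * (1 + k * spread w / (2 * mass w)) \<le> spread w"
proof -
  let ?q = "schrodinger_form k w" and ?m = "mass w"
  have wc: "compact_borel w" using w by (rule potential_compact)
  have m: "?m > 0" using n by (intro mass_pos[OF w \<psi>[of 0] negative_system_single[OF neg]]) auto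
  have fs: "function_space C1_compact" by (rule function_space_C1_compact)
  have lin: "linear_functional C1_compact (\<lambda>f. LINT x|lborel. complex_of_real (w x) * f x)"
  proof -
    have "linear_functional {f. bounded_borel f} (weight_form w (\<lambda>_. 1))"
      by (rule hermitian_form_linear[OF hermitian_weight_form[OF wc]]) (simp add: bounded_borel_const)
    then show ?thesis using C1_compact_subset by (auto simp: linear_functional_def weight_form_def subset_iff)
  qed
  obtain \<phi> where \<phi>: "\<And>a. a < n - 1 \<Longrightarrow> \<phi> a \<in> C1_compact" "orthonormal_system (energy_form k) (n - 1) \<phi>"
      "negative_system ?q (n - 1) \<phi>"
      "\<And>a. a < n - 1 \<Longrightarrow> (LINT x|lborel. complex_of_real (w x) * \<phi> a x) = 0"
  proof -
    have "\<exists>\<phi>. (\<forall>a<n - 1. \<phi> a \<in> C1_compact) \<and> orthonormal_system (energy_form k) (n - 1) \<phi> \<and>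
        negative_system ?q (n - 1) \<phi> \<and>
        (\<forall>a<n - 1. \<forall>l<(1::nat). (LINT x|lborel. complex_of_real (w x) * \<phi> a x) = 0)"
      using fs hermitian_energy_form hermitian_schrodinger_form[OF wc] \<psi> neg energy_form_pos[OF _ k] lin
      by (rule negative_system_orthonormalise) (use n in auto)
    then show ?thesis using that by auto
  qed
  let ?X = "\<lambda>a. LINT x|lborel. w x * (cmod (\<phi> a x))\<^sup>2"
  have X1: "1 \<le> ?X a" if "a < n - 1" for a
  proof -
    have "Re (energy_form k (\<phi> a) (\<phi> a)) = 1" using \<phi>(2) that by (simp add: orthonormal_system_def)
    then show ?thesis using negative_system_single[OF \<phi>(3) that]
      by (simp add: schrodinger_form_def weight_form_diag)
  qed
  define b where "b = k / 2"
  have b: "b \<ge> 0" using k by (simp add: b_def)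
  define d where "d = spread w / ?m"
  let ?I = "\<lambda>p. w (fst p) * \<bar>fst p - snd p\<bar> * w (snd p)"
  have "spread w \<ge> 0" unfolding spread_def using m w
    by (intro divide_nonneg_pos integral_nonneg_AE AE_I2 mult_nonneg_nonneg) (auto simp: potential_nonneg)
  then have d: "d \<ge> 0" using m by (simp add: d_def)
  have I: "(LINT p|lborel. ?I p) = ?m\<^sup>2 * d"
    using m by (simp add: d_def spread_def power2_eq_square)
  have incr: "(\<Sum>a<n - 1. (cmod (\<phi> a s - \<phi> a t))\<^sup>2) \<le> \<bar>s - t\<bar> / (1 + b * \<bar>s - t\<bar>)" for s t
  proof (rule orthonormal_system_bessel[OF fs hermitian_energy_form \<phi>(1,2), where L = "\<lambda>f. f s - f t"])
    show "linear_functional C1_compact (\<lambda>f. f s - f t)"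
      by (simp add: linear_functional_def algebra_simps)
    show "0 \<le> \<bar>s - t\<bar> / (1 + b * \<bar>s - t\<bar>)" using b by simp
    fix f assume f: "f \<in> C1_compact"
    have "1 + b * \<bar>s - t\<bar> > 0" using b by (simp add: add_pos_nonneg)
    then show "(cmod (f s - f t))\<^sup>2 \<le> \<bar>s - t\<bar> / (1 + b * \<bar>s - t\<bar>) * Re (energy_form k f f)"
      using energy_increment[OF f k, of s t] by (simp add: b_def field_simps)
  qed
  \<comment> \<open>The function \<open>x / (1 + b x)\<close> is concave; its tangent at the mean distance \<open>d\<close> gives Jensen's inequality.\<close>
  have tangent: "x / (1 + b * x) \<le> d / (1 + b * d) + (x - d) / (1 + b * d)\<^sup>2" if "x \<ge> 0" for x
  proof -
    have p: "1 + b * x > 0" "1 + b * d > 0" using b d that by (auto simp: add_pos_nonneg)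
    have "d / (1 + b * d) + (x - d) / (1 + b * d)\<^sup>2 - x / (1 + b * x)
        = b * (x - d)\<^sup>2 / ((1 + b * d)\<^sup>2 * (1 + b * x))"
      using p by (simp add: divide_simps) (simp add: power2_eq_square algebra_simps)
    also have "\<dots> \<ge> 0" using p b by simp
    finally show ?thesis by simp
  qed
  define \<alpha> where "\<alpha> = d / (1 + b * d) - d / (1 + b * d)\<^sup>2"
  define \<beta> where "\<beta> = 1 / (1 + b * d)\<^sup>2"
  have bound: "w s * w t * (\<Sum>a<n - 1. (cmod (\<phi> a s - \<phi> a t))\<^sup>2) \<le> \<alpha> * (w s * w t) + \<beta> * (w s * \<bar>s - t\<bar> * w t)" for s t
  proof -
    have "(\<Sum>a<n - 1. (cmod (\<phi> a s - \<phi> a t))\<^sup>2) \<le> \<alpha> + \<beta> * \<bar>s - t\<bar>"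
      using incr[of s t] tangent[of "\<bar>s - t\<bar>"] by (simp add: \<alpha>_def \<beta>_def diff_divide_distrib)
    then have "w s * w t * (\<Sum>a<n - 1. (cmod (\<phi> a s - \<phi> a t))\<^sup>2) \<le> w s * w t * (\<alpha> + \<beta> * \<bar>s - t\<bar>)"
      using potential_nonneg[OF w] by (intro mult_left_mono) auto
    then show ?thesis by (simp add: algebra_simps)
  qed
  have cww: "compact_borel (\<lambda>p. w (fst p) * w (snd p))" by (rule compact_borel_product[OF wc wc])
  have cI: "compact_borel ?I"
    using compact_borel_mult_continuous[OF cww, of "\<lambda>p. \<bar>fst p - snd p\<bar>"]
    by (simp add: mult_ac continuous_intros)
  have cV: "compact_borel (\<lambda>p. w (fst p) * w (snd p) * (cmod (\<phi> a (fst p) - \<phi> a (snd p)))\<^sup>2)" if "a < n - 1" for a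
  proof -
    have "continuous_on UNIV (\<phi> a)" by (rule C1_compact_continuous[OF \<phi>(1)[OF that]])
    then show ?thesis
      by (intro compact_borel_mult_continuous[OF cww] continuous_intros)
         (auto intro!: continuous_intros continuous_on_compose2[of UNIV "\<phi> a"])
  qed
  have "2 * ?m * (real n - 1) \<le> 2 * ?m * (\<Sum>a<n - 1. ?X a)"
  proof -
    have "real (n - 1) \<le> (\<Sum>a<n - 1. ?X a)" using sum_mono[of "{..<n - 1}" "\<lambda>_. 1" ?X] X1 by simp
    then show ?thesis using m n by (intro mult_left_mono) (auto simp: of_nat_diff)
  qed
  also have "\<dots> = (\<Sum>a<n - 1. LINT p|lborel. w (fst p) * w (snd p) * (cmod (\<phi> a (fst p) - \<phi> a (snd p)))\<^sup>2)"
    unfolding sum_distrib_left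
  proof (intro sum.cong refl)
    fix a assume "a \<in> {..<n - 1}"
    then have a: "a < n - 1" by simp
    show "2 * ?m * ?X a = (LINT p|lborel. w (fst p) * w (snd p) * (cmod (\<phi> a (fst p) - \<phi> a (snd p)))\<^sup>2)"
      using weight_form_variance[OF w compact_borel_bounded[OF C1_compact_borel(1)[OF \<phi>(1)[OF a]]]]
      unfolding \<phi>(4)[OF a] by simp
  qed
  also have "\<dots> = (LINT p|lborel. (\<Sum>a<n - 1. w (fst p) * w (snd p) * (cmod (\<phi> a (fst p) - \<phi> a (snd p)))\<^sup>2))"
    by (rule Bochner_Integration.integral_sum[symmetric]) (auto intro!: compact_borel_integrable cV)
  also have "\<dots> \<le> (LINT p|lborel. \<alpha> * (w (fst p) * w (snd p)) + \<beta> * ?I p)"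
    using bound
    by (intro integral_mono Bochner_Integration.integrable_sum Bochner_Integration.integrable_add integrable_mult_right
          compact_borel_integrable cV cww cI) (auto simp: sum_distrib_left[symmetric])
  also have "\<dots> = \<alpha> * ?m\<^sup>2 + \<beta> * (?m\<^sup>2 * d)"
    using compact_borel_integrable[OF cww] compact_borel_integrable[OF cI] lborel_integral_product[OF wc wc] I
    by (simp add: mass_def power2_eq_square)
  also have "\<dots> = ?m * (?m * (d / (1 + b * d)))"
    by (simp add: \<alpha>_def \<beta>_def algebra_simps power2_eq_square)
  finally have "?m * (2 * (real n - 1)) \<le> ?m * (?m * (d / (1 + b * d)))"
    by (simp only: mult.commute mult.left_commute)
  then have "2 * (real n - 1) \<le> ?m * (d / (1 + b * d))"
    using m by (rule mult_left_le_imp_le)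
  moreover have "?m * d = spread w" using m by (simp add: d_def)
  moreover have "1 + b * d > 0" using b d by (simp add: add_pos_nonneg)
  ultimately have "2 * (real n - 1) * (1 + b * d) \<le> spread w"
    by (simp add: divide_simps)
  then show ?thesis by (simp add: b_def d_def)
qed

section \<open>A sharp bound for sums of square roots of eigenvalues\<close>

definition cut :: "real \<Rightarrow> real \<Rightarrow> real" where
  "cut z x = (if x < z then 1 else - 1)"

definition sign_function :: "(real \<Rightarrow> real) \<Rightarrow> bool" where
  "sign_function s \<longleftrightarrow> s \<in> borel_measurable borel \<and> (\<forall>x. s x = 1 \<or> s x = - 1)"

lemma sign_function_bounded:
  assumes "sign_function s" shows "bounded_borel s"
proof -
  have "norm (s x) \<le> 1" for x
  proof -
    have "s x = 1 \<or> s x = - 1" using assms by (simp add: sign_function_def)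
    then show ?thesis by auto
  qed
  then show ?thesis using assms unfolding sign_function_def bounded_borel_def by blast
qed

lemma sign_function_mult:
  assumes "sign_function s" "sign_function t" shows "sign_function (\<lambda>x. s x * t x)"
proof -
  have "s x * t x = 1 \<or> s x * t x = - 1" for x
  proof -
    have "s x = 1 \<or> s x = - 1" "t x = 1 \<or> t x = - 1" using assms by (simp_all add: sign_function_def)
    then show ?thesis by auto
  qed
  then show ?thesis using assms unfolding sign_function_def by (auto intro: borel_measurable_times)
qed

lemma sign_function_square:
  assumes "sign_function s" shows "s x * s x = 1"
proof -
  have "s x = 1 \<or> s x = - 1" using assms by (simp add: sign_function_def)
  then show ?thesis by auto
qed

lemma sign_function_cut: "sign_function (cut z)"
  unfolding sign_function_def cut_def by auto

lemma bounded_borel_pair: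
  fixes f g :: "real \<Rightarrow> 'c::{real_normed_algebra, second_countable_topology}"
  assumes "bounded_borel f" "bounded_borel g"
  shows "bounded_borel (\<lambda>p. f (fst p) * g (snd p))"
  by (rule bounded_borel_mult[OF bounded_borel_fst[OF assms(1)] bounded_borel_snd[OF assms(2)]])

lemma norm_components_le: "norm (fst p) \<le> norm p" "norm (snd p) \<le> norm p"
  by (metis norm_fst_le prod.collapse, metis norm_snd_le prod.collapse)

lemma cut_product_integral:
  assumes "\<bar>x\<bar> \<le> r" "\<bar>y\<bar> \<le> r"
  shows "(LINT z|lborel. indicator {-r..r} z * (cut z x * cut z y)) = 2 * r * (1 - \<bar>x - y\<bar> / r)"
proof -
  have "(LINT z|lborel. indicator {-r..r} z * (cut z x * cut z y))
      = (LINT z|lborel. indicator {-r..r} z - 2 * indicator {min x y<..max x y} z)"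
    using assms by (intro Bochner_Integration.integral_cong) (auto simp: cut_def indicator_def)
  also have "\<dots> = 2 * r - 2 * \<bar>x - y\<bar>"
    using assms by (subst Bochner_Integration.integral_diff) (auto simp: min_def max_def)
  also have "\<dots> = 2 * r * (1 - \<bar>x - y\<bar> / r)"
    using assms by (cases "r = 0") (simp_all add: right_diff_distrib)
  finally show ?thesis .
qed

text \<open>Averaging the position of a cut multiplies a kernel by a tent function, so some cut does at least
  as well as the tent.\<close>

lemma exists_cut:
  fixes \<Phi> :: "real \<times> real \<Rightarrow> real"
  assumes \<Phi>: "compact_borel \<Phi>" and supp: "\<And>p. R < norm p \<Longrightarrow> \<Phi> p = 0" and r: "R \<le> r" "0 < r"
  shows "\<exists>z. (LINT p|lborel. \<Phi> p * (1 - \<bar>fst p - snd p\<bar> / r))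
           \<le> (LINT p|lborel. \<Phi> p * (cut z (fst p) * cut z (snd p)))"
proof (rule ccontr)
  let ?c = "LINT p|lborel. \<Phi> p * (1 - \<bar>fst p - snd p\<bar> / r)"
  let ?F = "\<lambda>z. LINT p|lborel. \<Phi> p * (cut z (fst p) * cut z (snd p))"
  let ?h = "\<lambda>q::real \<times> (real \<times> real). indicator {-r..r} (fst q) * \<Phi> (snd q) *
              (cut (fst q) (fst (snd q)) * cut (fst q) (snd (snd q)))"
  assume "\<not> ?thesis"
  then have less: "?F z < ?c" for z by (auto simp: not_le)
  have ind: "compact_borel (indicator {-r..r} :: real \<Rightarrow> real)"
  proof -
    have "\<forall>x::real. norm (indicator {-r..r} x :: real) \<le> 1" by (simp add: indicator_def)
    moreover have "\<forall>x::real. r < norm x \<longrightarrow> (indicator {-r..r} x :: real) = 0" by (auto simp: indicator_def)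
    ultimately show ?thesis unfolding compact_borel_def bounded_borel_def by auto
  qed
  have meas: "(\<lambda>q::real \<times> (real \<times> real). cut (fst q) (fst (snd q)) * cut (fst q) (snd (snd q))) \<in> borel_measurable borel"
  proof -
    have 1: "{q::real \<times> (real \<times> real). fst (snd q) < fst q} \<in> sets borel"
      by (intro borel_open open_Collect_less continuous_intros)
    have 2: "{q::real \<times> (real \<times> real). snd (snd q) < fst q} \<in> sets borel"
      by (intro borel_open open_Collect_less continuous_intros)
    show ?thesis unfolding cut_def using 1 2
      by (intro borel_measurable_times measurable_If) (auto simp: Collect_neg_eq)
  qed
  have h: "compact_borel ?h"
  proof (rule compact_borel_mult(1)[OF compact_borel_product[OF ind \<Phi>]])
    show "bounded_borel (\<lambda>q::real \<times> (real \<times> real). cut (fst q) (fst (snd q)) * cut (fst q) (snd (snd q)))"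
      using meas unfolding bounded_borel_def by (auto intro!: exI[of _ 1] simp: cut_def)
  qed
  have "(LINT z|lborel. LINT p|lborel. ?h (z, p)) = (LINT p|lborel. LINT z|lborel. ?h (z, p))"
    using compact_borel_fubini[OF h] by simp
  also have "(\<lambda>z. LINT p|lborel. ?h (z, p)) = (\<lambda>z. indicator {-r..r} z * ?F z)"
    by (simp add: mult.assoc)
  also have "(\<lambda>p. LINT z|lborel. ?h (z, p)) = (\<lambda>p. 2 * r * (\<Phi> p * (1 - \<bar>fst p - snd p\<bar> / r)))"
  proof (rule ext)
    fix p :: "real \<times> real"
    show "(LINT z|lborel. ?h (z, p)) = 2 * r * (\<Phi> p * (1 - \<bar>fst p - snd p\<bar> / r))"
    proof (cases "R < norm p")
      case False
      then have "\<bar>fst p\<bar> \<le> r" "\<bar>snd p\<bar> \<le> r"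
        using norm_components_le[of p] r by simp_all
      from cut_product_integral[OF this]
      have "(LINT z|lborel. \<Phi> p * (indicator {-r..r} z * (cut z (fst p) * cut z (snd p))))
          = \<Phi> p * (2 * r * (1 - \<bar>fst p - snd p\<bar> / r))" by simp
      then show ?thesis by (simp add: mult_ac)
    qed (simp add: supp)
  qed
  finally have eq: "(LINT z|lborel. indicator {-r..r} z * ?F z) = 2 * r * ?c" by simp
  have iF: "integrable lborel (\<lambda>z. indicator {-r..r} z * ?F z)"
  proof -
    have "integrable (lborel \<Otimes>\<^sub>M lborel) (case_prod (\<lambda>z p. ?h (z, p)))"
      unfolding lborel_prod case_prod_beta' prod.collapse by (rule compact_borel_integrable[OF h])
    from lborel_pair.integrable_fst[OF this] show ?thesis by (simp add: mult.assoc)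
  qed
  have "integrable lborel (indicator {-r..r} :: real \<Rightarrow> real)" by (rule compact_borel_integrable[OF ind])
  then have ic: "integrable lborel (\<lambda>z. indicator {-r..r} z * ?c)" by (rule integrable_mult_left)
  have "(LINT z|lborel. indicator {-r..r} z * ?c - indicator {-r..r} z * ?F z) = 0"
  proof -
    have "(LINT z|lborel. indicator {-r..r} z * ?c) = (LINT z|lborel. indicator {-r..r} z) * ?c"
      by (rule integral_mult_left_zero)
    also have "(LINT z|lborel. indicator {-r..r} z) = 2 * r" using r by simp
    finally show ?thesis using eq Bochner_Integration.integral_diff[OF ic iF] by linarith
  qed
  moreover have "AE z in lborel. 0 \<le> indicator {-r..r} z * ?c - indicator {-r..r} z * ?F z"
    using less by (intro AE_I2) (simp add: indicator_def less_imp_le)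
  ultimately have "AE z in lborel. indicator {-r..r} z * ?c - indicator {-r..r} z * ?F z = 0"
    using integral_nonneg_eq_0_iff_AE[OF Bochner_Integration.integrable_diff[OF ic iF]] by blast
  then have "AE z in lborel. \<not> z \<in> {-r..r}"
  proof eventually_elim
    case (elim z)
    then show ?case using less[of z] by (auto simp: indicator_def split: if_splits)
  qed
  then have "emeasure lborel {z \<in> space lborel. z \<in> {-r..r}} = 0" by (rule emeasure_eq_0_AE)
  also have "{z \<in> space lborel. z \<in> {-r..r}} = {-r..r}" by auto
  finally show False using r by simp
qed

lemma tent_power_compact:
  assumes "compact_borel (\<Phi> :: real \<times> real \<Rightarrow> real)"
  shows "compact_borel (\<lambda>p. \<Phi> p * (1 - \<bar>fst p - snd p\<bar> / r) ^ k)"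
  unfolding divide_inverse by (rule compact_borel_mult_continuous[OF assms]) (intro continuous_intros)

lemma exists_cuts:
  fixes \<Phi> :: "real \<times> real \<Rightarrow> real"
  assumes "compact_borel \<Phi>" and "\<And>p. R < norm p \<Longrightarrow> \<Phi> p = 0" and r: "R \<le> r" "0 < r"
  shows "\<exists>s. sign_function s \<and> (LINT p|lborel. \<Phi> p * (1 - \<bar>fst p - snd p\<bar> / r) ^ k)
           \<le> (LINT p|lborel. \<Phi> p * (s (fst p) * s (snd p)))"
  using assms(1,2)
proof (induction k arbitrary: \<Phi>)
  case 0
  have "sign_function (\<lambda>_. 1)" by (simp add: sign_function_def)
  then show ?case by (intro exI[of _ "\<lambda>_. 1"]) simp
next
  case (Suc k)
  let ?T = "\<lambda>p::real \<times> real. (1 - \<bar>fst p - snd p\<bar> / r) ^ k"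
  have T0: "\<Phi> p * ?T p = 0" if "R < norm p" for p using Suc.prems(2)[OF that] by simp
  obtain z where z: "(LINT p|lborel. \<Phi> p * ?T p * (1 - \<bar>fst p - snd p\<bar> / r))
      \<le> (LINT p|lborel. \<Phi> p * ?T p * (cut z (fst p) * cut z (snd p)))"
    using exists_cut[OF tent_power_compact[OF Suc.prems(1)] T0 r] by blast
  let ?\<Psi> = "\<lambda>p. \<Phi> p * (cut z (fst p) * cut z (snd p))"
  have "compact_borel ?\<Psi>"
    by (rule compact_borel_mult(1)[OF Suc.prems(1) bounded_borel_pair[OF sign_function_bounded sign_function_bounded]])
       (rule sign_function_cut)+
  moreover have "?\<Psi> p = 0" if "R < norm p" for p using Suc.prems(2)[OF that] by simp
  ultimately obtain s where s: "sign_function s"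
      "(LINT p|lborel. ?\<Psi> p * ?T p) \<le> (LINT p|lborel. ?\<Psi> p * (s (fst p) * s (snd p)))"
    using Suc.IH[of ?\<Psi>] by blast
  have "(LINT p|lborel. \<Phi> p * (1 - \<bar>fst p - snd p\<bar> / r) ^ Suc k)
      \<le> (LINT p|lborel. \<Phi> p * ((cut z (fst p) * s (fst p)) * (cut z (snd p) * s (snd p))))"
    using z s(2) by (simp add: mult_ac)
  then show ?case using sign_function_mult[OF sign_function_cut s(1), of z]
    by (intro exI[of _ "\<lambda>x. cut z x * s x"]) simp
qed

text \<open>A product of many independent random cuts is a random telegraph signal, whose correlation
  function is exponential.\<close>

lemma exists_telegraph_signs:
  fixes \<Phi> :: "real \<times> real \<Rightarrow> real"
  assumes \<Phi>: "compact_borel \<Phi>" and \<delta>: "\<delta> \<ge> 0" and \<eta>: "\<eta> > 0"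
  shows "\<exists>s. sign_function s \<and> (LINT p|lborel. \<Phi> p * exp (- \<delta> * \<bar>fst p - snd p\<bar>)) - \<eta>
           \<le> (LINT p|lborel. \<Phi> p * (s (fst p) * s (snd p)))"
proof (cases "\<delta> = 0")
  case True
  have "sign_function (\<lambda>_. 1)" by (simp add: sign_function_def)
  then show ?thesis using \<eta> True by (intro exI[of _ "\<lambda>_. 1"]) simp
next
  case False
  then have d: "\<delta> > 0" using \<delta> by simp
  obtain R where R: "R > 0" "\<And>p. R < norm p \<Longrightarrow> \<Phi> p = 0" using compact_borel_support[OF \<Phi>] by auto
  obtain N :: nat where N: "2 * R * \<delta> < real N" using reals_Archimedean2 by blast
  have "0 < real N" using N R(1) d by (smt (verit) mult_pos_pos)
  then have N0: "real (k + N) / \<delta> > 0" for k using d by simp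
  let ?f = "\<lambda>k p. \<Phi> p * (1 - \<bar>fst p - snd p\<bar> / (real (k + N) / \<delta>)) ^ (k + N)"
  have "(\<lambda>k. LINT p|lborel. ?f k p) \<longlonglongrightarrow> (LINT p|lborel. \<Phi> p * exp (- \<delta> * \<bar>fst p - snd p\<bar>))"
  proof (rule integral_dominated_convergence)
    show "(\<lambda>p. \<Phi> p * exp (- \<delta> * \<bar>fst p - snd p\<bar>)) \<in> borel_measurable lborel"
      unfolding measurable_lborel2
      by (rule compact_borel_measurable[OF compact_borel_mult_continuous[OF \<Phi>]]) (intro continuous_intros)
    show "?f k \<in> borel_measurable lborel" for k
      using compact_borel_measurable[OF tent_power_compact[OF \<Phi>]] unfolding measurable_lborel2 .
    show "integrable lborel (\<lambda>p. \<bar>\<Phi> p\<bar>)" using compact_borel_integrable[OF \<Phi>] by simp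
    show "AE p in lborel. (\<lambda>k. ?f k p) \<longlonglongrightarrow> \<Phi> p * exp (- \<delta> * \<bar>fst p - snd p\<bar>)"
    proof (rule AE_I2, rule tendsto_mult_left)
      fix p :: "real \<times> real"
      have "(\<lambda>n. (1 + (- \<delta> * \<bar>fst p - snd p\<bar>) / real (n + N)) ^ (n + N)) \<longlonglongrightarrow> exp (- \<delta> * \<bar>fst p - snd p\<bar>)"
        by (rule LIMSEQ_ignore_initial_segment[OF tendsto_exp_limit_sequentially])
      then show "(\<lambda>k. (1 - \<bar>fst p - snd p\<bar> / (real (k + N) / \<delta>)) ^ (k + N)) \<longlonglongrightarrow> exp (- \<delta> * \<bar>fst p - snd p\<bar>)"
        by (simp add: mult.commute)
    qed
    show "AE p in lborel. norm (?f k p) \<le> \<bar>\<Phi> p\<bar>" for k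
    proof (rule AE_I2)
      fix p :: "real \<times> real"
      show "norm (?f k p) \<le> \<bar>\<Phi> p\<bar>"
      proof (cases "R < norm p")
        case False
        have "\<bar>fst p - snd p\<bar> \<le> 2 * R"
          using norm_components_le[of p] False by simp
        also have "\<dots> \<le> real (k + N) / \<delta>" using N d by (simp add: field_simps)
        finally have "\<bar>fst p - snd p\<bar> / (real (k + N) / \<delta>) \<le> 1"
          using divide_le_eq_1_pos[OF N0] by blast
        then have "\<bar>1 - \<bar>fst p - snd p\<bar> / (real (k + N) / \<delta>)\<bar> \<le> 1" using d by simp
        then have "\<bar>1 - \<bar>fst p - snd p\<bar> / (real (k + N) / \<delta>)\<bar> ^ (k + N) \<le> 1" by (intro power_le_one) auto
        then show ?thesis by (simp add: abs_mult power_abs mult_left_le)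
      qed (simp add: R)
    qed
  qed
  then have "\<forall>\<^sub>F k in sequentially. (LINT p|lborel. \<Phi> p * exp (- \<delta> * \<bar>fst p - snd p\<bar>)) - \<eta> < (LINT p|lborel. ?f k p)"
    using \<eta> by (intro order_tendstoD(1)) auto
  then obtain k where k: "(LINT p|lborel. \<Phi> p * exp (- \<delta> * \<bar>fst p - snd p\<bar>)) - \<eta> < (LINT p|lborel. ?f k p)"
    by (auto simp: eventually_sequentially)
  have RN: "R \<le> real (k + N) / \<delta>" using N d R by (simp add: field_simps)
  obtain s where "sign_function s" "(LINT p|lborel. ?f k p) \<le> (LINT p|lborel. \<Phi> p * (s (fst p) * s (snd p)))"
    using exists_cuts[where R = R, OF \<Phi> _ RN N0[of k]] R(2) by blast
  then show ?thesis using k by (intro exI[of _ s]) auto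
qed

text \<open>The resolvent \<open>(- d\<^sup>2/dx\<^sup>2 + e\<^sup>2)\<^sup>-\<^sup>1\<close> has the kernel \<open>exp (- e \<bar>x - y\<bar>) / (2 e)\<close>, so this is \<open>2 e\<close> times the
  quadratic form of the Birman--Schwinger operator. Without the singular factor \<open>1 / (2 e)\<close> it remains
  meaningful at \<open>e = 0\<close>.\<close>

definition exp_correlation :: "(real \<Rightarrow> real) \<Rightarrow> real \<Rightarrow> (real \<Rightarrow> complex) \<Rightarrow> real" where
  "exp_correlation q e u = (LINT p|lborel. q (fst p) * q (snd p) * Re (cnj (u (fst p)) * u (snd p))
                              * exp (- e * \<bar>fst p - snd p\<bar>))"

lemma pair_density_compact:
  fixes q :: "real \<Rightarrow> real" and u :: "real \<Rightarrow> complex"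
  assumes q: "compact_borel q" and u: "bounded_borel u"
  shows "compact_borel (\<lambda>p. q (fst p) * q (snd p) * Re (cnj (u (fst p)) * u (snd p)))"
proof (rule compact_borel_mult(1)[OF compact_borel_product[OF q q]])
  have *: "bounded_borel (\<lambda>p. cnj (u (fst p)) * u (snd p))"
    by (rule bounded_borel_pair[OF bounded_borel_cnj[OF u] u])
  then obtain C where C: "\<forall>p. cmod (cnj (u (fst p)) * u (snd p)) \<le> C" by (auto simp: bounded_borel_def)
  have "\<bar>Re (cnj (u (fst p)) * u (snd p))\<bar> \<le> C" for p
    using order_trans[OF abs_Re_le_cmod C[rule_format, of p]] .
  moreover have "(\<lambda>p. Re (cnj (u (fst p)) * u (snd p))) \<in> borel_measurable borel"
    by (rule measurable_compose[OF bounded_borelD[OF *] borel_measurable_Re])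
  ultimately show "bounded_borel (\<lambda>p. Re (cnj (u (fst p)) * u (snd p)))"
    unfolding bounded_borel_def real_norm_def by blast
qed

lemma exp_correlation_compact:
  assumes "compact_borel q" "bounded_borel u"
  shows "compact_borel (\<lambda>p. q (fst p) * q (snd p) * Re (cnj (u (fst p)) * u (snd p)) * exp (- e * \<bar>fst p - snd p\<bar>))"
  by (rule compact_borel_mult_continuous[OF pair_density_compact[OF assms]]) (intro continuous_intros)

text \<open>Lowering the rate from \<open>e\<close> to \<open>e'\<close> divides the kernel by \<open>exp (- (e - e') \<bar>x - y\<bar>)\<close>, the correlation of a
  random sign function. Some sign function does at least as well as the average, simultaneously for
  the whole sum.\<close>

lemma exp_correlation_signs:
  fixes n :: nat
  assumes q: "compact_borel q" and u: "\<And>i. i < n \<Longrightarrow> bounded_borel (u i)"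
    and e: "e' \<le> e" and \<eta>: "\<eta> > 0"
  shows "\<exists>s. sign_function s \<and>
    (\<Sum>i<n. exp_correlation q e (u i)) - \<eta> \<le> (\<Sum>i<n. exp_correlation q e' (\<lambda>x. of_real (s x) * u i x))"
proof -
  let ?k = "\<lambda>e p. exp (- e * \<bar>fst p - snd p\<bar>) :: real"
  let ?\<phi> = "\<lambda>i p. q (fst p) * q (snd p) * Re (cnj (u i (fst p)) * u i (snd p))"
  define \<Phi> where "\<Phi> p = (\<Sum>i<n. ?\<phi> i p * ?k e' p)" for p
  have c: "compact_borel (\<lambda>p. ?\<phi> i p * ?k e' p)" if "i < n" for i
    by (rule exp_correlation_compact[OF q u[OF that]])
  have sum: "compact_borel (\<lambda>p. \<Sum>i<m. ?\<phi> i p * ?k e' p)" if "m \<le> n" for m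
    using that
  proof (induction m)
    case 0 show ?case by (auto simp: compact_borel_def bounded_borel_def)
  next
    case (Suc m) then show ?case using c[of m] by (auto intro!: compact_borel_add)
  qed
  then have \<Phi>: "compact_borel \<Phi>" unfolding \<Phi>_def by blast
  obtain s where s: "sign_function s"
     "(LINT p|lborel. \<Phi> p * exp (- (e - e') * \<bar>fst p - snd p\<bar>)) - \<eta> \<le> (LINT p|lborel. \<Phi> p * (s (fst p) * s (snd p)))"
    using exists_telegraph_signs[OF \<Phi> _ \<eta>, of "e - e'"] e by auto
  have "(LINT p|lborel. \<Phi> p * exp (- (e - e') * \<bar>fst p - snd p\<bar>)) = (LINT p|lborel. (\<Sum>i<n. ?\<phi> i p * ?k e p))"
  proof -
    have "?k e' p * exp (- (e - e') * \<bar>fst p - snd p\<bar>) = ?k e p" for p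
      unfolding exp_add[symmetric] by (simp add: algebra_simps)
    then show ?thesis unfolding \<Phi>_def sum_distrib_right mult.assoc by (simp only:)
  qed
  also have "\<dots> = (\<Sum>i<n. exp_correlation q e (u i))"
    unfolding exp_correlation_def
    by (intro Bochner_Integration.integral_sum compact_borel_integrable exp_correlation_compact q u) auto
  finally have 1: "(LINT p|lborel. \<Phi> p * exp (- (e - e') * \<bar>fst p - snd p\<bar>)) = (\<Sum>i<n. exp_correlation q e (u i))" .
  let ?v = "\<lambda>i x. complex_of_real (s x) * u i x"
  have v: "bounded_borel (?v i)" if "i < n" for i
    by (rule bounded_borel_mult[OF bounded_borel_of_real[OF sign_function_bounded[OF s(1)]] u[OF that]])
  have "(LINT p|lborel. \<Phi> p * (s (fst p) * s (snd p)))
      = (LINT p|lborel. (\<Sum>i<n. q (fst p) * q (snd p) * Re (cnj (?v i (fst p)) * ?v i (snd p)) * ?k e' p))"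
  proof -
    have "x * y * Re (cnj u * v) * z * (s1 * s2)
        = x * y * Re (cnj (complex_of_real s1 * u) * (complex_of_real s2 * v)) * z" for x y z s1 s2 u v
      by (simp add: algebra_simps)
    then show ?thesis unfolding \<Phi>_def sum_distrib_right by (simp only:)
  qed
  also have "\<dots> = (\<Sum>i<n. exp_correlation q e' (?v i))"
    unfolding exp_correlation_def
    by (intro Bochner_Integration.integral_sum compact_borel_integrable exp_correlation_compact q v) auto
  finally show ?thesis using s 1 by (intro exI[of _ s]) auto
qed

text \<open>At \<open>e = 0\<close> the kernel has rank one and each term is \<open>\<bar>\<integral> q u\<bar>\<^sup>2\<close>, so Bessel's inequality against the
  constant function 1, whose squared norm is the mass, applies.\<close>

lemma exp_correlation_zero_le:
  assumes q: "potential q" and u: "\<And>i. i < n \<Longrightarrow> bounded_borel (u i)"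
    and on: "orthonormal_system (weight_form q) n u"
  shows "(\<Sum>i<n. exp_correlation q 0 (u i)) \<le> mass q"
proof -
  have qc: "compact_borel q" using q by (rule potential_compact)
  let ?L = "\<lambda>f. LINT x|lborel. complex_of_real (q x) * f x"
  have lin: "linear_functional {f. bounded_borel f} ?L"
    using hermitian_form_linear[OF hermitian_weight_form[OF qc], of "\<lambda>_. 1"]
    by (simp add: bounded_borel_const weight_form_def[abs_def])
  have "(\<Sum>i<n. (cmod (?L (u i)))\<^sup>2) \<le> mass q"
  proof (rule orthonormal_system_bessel[OF function_space_bounded_borel hermitian_weight_form[OF qc] _ on lin])
    show "u i \<in> {f. bounded_borel f}" if "i < n" for i using u[OF that] by simp
    show "0 \<le> mass q" by (rule mass_nonneg[OF q])
    fix f :: "real \<Rightarrow> complex" assume "f \<in> {f. bounded_borel f}"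
    then have f: "bounded_borel f" by simp
    have "0 \<le> (LINT p|lborel. q (fst p) * q (snd p) * (cmod (f (fst p) - f (snd p)))\<^sup>2)"
      using potential_nonneg[OF q] by (intro integral_nonneg_AE AE_I2) simp
    then show "(cmod (?L f))\<^sup>2 \<le> mass q * Re (weight_form q f f)"
      unfolding weight_form_variance[OF q f] weight_form_diag by simp
  qed
  moreover have "exp_correlation q 0 (u i) = (cmod (?L (u i)))\<^sup>2" if i: "i < n" for i
  proof -
    let ?F = "\<lambda>x. complex_of_real (q x) * u i x"
    have F: "compact_borel ?F" by (rule compact_borel_mult(1)[OF compact_borel_of_real[OF qc] u[OF i]])
    have int: "integrable lborel (\<lambda>p. cnj (?F (fst p)) * ?F (snd p))"
      by (rule compact_borel_integrable[OF compact_borel_product[OF compact_borel_cnj[OF F] F]])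
    have "exp_correlation q 0 (u i) = (LINT p|lborel. Re (cnj (?F (fst p)) * ?F (snd p)))"
      unfolding exp_correlation_def
      by (intro Bochner_Integration.integral_cong refl) (simp add: algebra_simps)
    also have "\<dots> = Re (LINT p|lborel. cnj (?F (fst p)) * ?F (snd p))" by (rule integral_Re[OF int])
    also have "(LINT p|lborel. cnj (?F (fst p)) * ?F (snd p)) = cnj (?L (u i)) * ?L (u i)"
      using lborel_integral_product[OF compact_borel_cnj[OF F] F] by (simp only: Bochner_Integration.integral_cnj)
    also have "Re \<dots> = (cmod (?L (u i)))\<^sup>2"
      unfolding cmod_power2 by (simp add: power2_eq_square)
    finally show ?thesis .
  qed
  ultimately show ?thesis by simp
qed

text \<open>The kernel \<open>exp (- s (x - z))\<close> on \<open>z \<le> x\<close> inverts \<open>d/dx + s\<close>, and composing it with its adjoint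
  gives the resolvent kernel. The second exponential is the boundary contribution of the cut-off at
  \<open>- R\<close>.\<close>

lemma exp_kernel_square:
  fixes s x y R :: real
  assumes s: "s > 0" and xy: "\<bar>x\<bar> \<le> R" "\<bar>y\<bar> \<le> R"
  shows "(LINT z|lborel. (indicator {-R..x} z * exp (- s * (x - z))) * (indicator {-R..y} z * exp (- s * (y - z))))
     = (exp (- s * \<bar>x - y\<bar>) - exp (- s * (R + x)) * exp (- s * (R + y))) / (2 * s)"
proof -
  let ?m = "min x y" and ?g = "\<lambda>z. exp (2 * s * z - s * (x + y))"
  have "(LINT z|lborel. (indicator {-R..x} z * exp (- s * (x - z))) * (indicator {-R..y} z * exp (- s * (y - z))))
      = (LINT z|lborel. indicator {-R..?m} z *\<^sub>R ?g z)"
  proof (intro Bochner_Integration.integral_cong refl)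
    fix z
    have "exp (- s * (x - z)) * exp (- s * (y - z)) = ?g z"
      unfolding exp_add[symmetric] by (rule arg_cong[of _ _ exp]) (simp add: algebra_simps)
    then show "(indicator {-R..x} z * exp (- s * (x - z))) * (indicator {-R..y} z * exp (- s * (y - z)))
        = indicator {-R..?m} z *\<^sub>R ?g z"
      by (auto simp: indicator_def)
  qed
  also have "\<dots> = ?g ?m / (2 * s) - ?g (- R) / (2 * s)"
  proof -
    have si: "set_integrable lborel {-R..?m} ?g"
      by (intro borel_integrable_atLeastAtMost' continuous_intros)
    have "(?g has_integral (?g ?m / (2 * s) - ?g (- R) / (2 * s))) {-R..?m}"
    proof (rule fundamental_theorem_of_calculus)
      show "-R \<le> ?m" using xy by auto
      show "((\<lambda>z. ?g z / (2 * s)) has_vector_derivative ?g z) (at z within {-R..?m})" for z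
        using s unfolding has_real_derivative_iff_has_vector_derivative[symmetric]
        by (auto intro!: derivative_eq_intros)
    qed
    then show ?thesis
      using set_borel_integral_eq_integral(2)[OF si] by (simp add: set_lebesgue_integral_def integral_unique)
  qed
  also have "?g ?m = exp (- s * \<bar>x - y\<bar>)"
    by (rule arg_cong[of _ _ exp]) (auto simp: min_def abs_if algebra_simps)
  also have "?g (- R) = exp (- s * (R + x)) * exp (- s * (R + y))"
    unfolding exp_add[symmetric] by (rule arg_cong[of _ _ exp]) (simp add: algebra_simps)
  finally show ?thesis by (simp add: diff_divide_distrib)
qed

text \<open>The factorisation \<open>- d\<^sup>2/dx\<^sup>2 + s\<^sup>2 = (- d/dx + s) (d/dx + s)\<close> turns the energy into
  \<open>\<integral> \<bar>f' + s f\<bar>\<^sup>2\<close>.\<close>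

lemma energy_form_factorised:
  assumes f: "f \<in> C1_compact"
  shows "Re (energy_form s f f) = (LINT x|lborel. (cmod (vderiv f x + of_real s * f x))\<^sup>2)"
proof -
  obtain R where R: "R > 0" "\<And>x. R \<le> \<bar>x\<bar> \<Longrightarrow> f x = 0" "\<And>x. R \<le> \<bar>x\<bar> \<Longrightarrow> vderiv f x = 0"
    using C1_compact_support[OF f] by metis
  let ?g = "\<lambda>x. 2 * (f x \<bullet> vderiv f x)"
  have cg: "continuous_on UNIV ?g"
    by (intro continuous_intros C1_compact_continuous C1_compact_continuous_deriv f)
  have g: "compact_borel ?g" using R by (intro continuous_compact_borel[of _ R] cg) auto
  have "(LINT x|lborel. ?g x) = integral {-R..R} ?g"
    using R by (intro lborel_integral_interval(2)[OF g]) auto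
  also have "\<dots> = f R \<bullet> f R - f (- R) \<bullet> f (- R)"
  proof (intro integral_unique fundamental_theorem_of_calculus)
    fix x
    have "(f has_derivative (\<lambda>h. h *\<^sub>R vderiv f x)) (at x within {-R..R})"
      using has_vector_derivative_at_within[OF C1_compact_deriv[OF f]] by (simp add: has_vector_derivative_def)
    from has_derivative_inner[OF this this]
    show "((\<lambda>x. f x \<bullet> f x) has_vector_derivative ?g x) (at x within {-R..R})"
      unfolding has_vector_derivative_def
      by (rule has_derivative_eq_rhs) (auto simp: fun_eq_iff inner_commute algebra_simps)
  qed (use R in auto)
  also have "\<dots> = 0" using R by simp
  finally have g0: "(LINT x|lborel. ?g x) = 0" .
  have pt: "(cmod (vderiv f x + of_real s * f x))\<^sup>2
      = ((cmod (vderiv f x))\<^sup>2 + s\<^sup>2 * (cmod (f x))\<^sup>2) + s * ?g x" for x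
    unfolding cmod_power2 inner_complex_def by (simp add: power2_eq_square algebra_simps)
  have ce: "compact_borel (\<lambda>x. (cmod (vderiv f x))\<^sup>2 + s\<^sup>2 * (cmod (f x))\<^sup>2)"
    using R by (intro continuous_compact_borel[of _ R] continuous_intros
        C1_compact_continuous C1_compact_continuous_deriv f) auto
  show ?thesis
    unfolding energy_form_diag pt
    using compact_borel_integrable[OF ce] compact_borel_integrable[OF g] g0 by simp
qed

lemma C1_exponential_representation:
  assumes f: "f \<in> C1_compact" and R: "\<And>x. R \<le> \<bar>x\<bar> \<Longrightarrow> f x = 0" and x: "-R \<le> x"
  shows "f x = (LINT z|lborel. of_real (indicator {-R..x} z * exp (- s * (x - z))) * (vderiv f z + of_real s * f z))"
proof -
  let ?g = "\<lambda>z. exp (- s * (x - z)) *\<^sub>R (vderiv f z + of_real s * f z)"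
  have si: "set_integrable lborel {-R..x} ?g"
    by (intro borel_integrable_atLeastAtMost' continuous_intros C1_compact_continuous C1_compact_continuous_deriv f)
  have "(?g has_integral (exp (- s * (x - x)) *\<^sub>R f x - exp (- s * (x - (- R))) *\<^sub>R f (- R))) {-R..x}"
  proof (rule fundamental_theorem_of_calculus[OF x])
    fix z
    have 1: "((\<lambda>z. exp (- s * (x - z))) has_real_derivative s * exp (- s * (x - z))) (at z within {-R..x})"
      by (auto intro!: derivative_eq_intros)
    have 2: "(f has_vector_derivative vderiv f z) (at z within {-R..x})"
      by (rule has_vector_derivative_at_within[OF C1_compact_deriv[OF f]])
    show "((\<lambda>z. exp (- s * (x - z)) *\<^sub>R f z) has_vector_derivative ?g z) (at z within {-R..x})"
      using has_vector_derivative_scaleR[OF 1 2] by (simp add: scaleR_conv_of_real algebra_simps)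
  qed
  then have "f x = integral {-R..x} ?g" using R[of "-R"] by (simp add: integral_unique)
  also have "\<dots> = (LINT z:{-R..x}|lborel. ?g z)" using set_borel_integral_eq_integral(2)[OF si] by simp
  also have "\<dots> = (LINT z|lborel. of_real (indicator {-R..x} z * exp (- s * (x - z))) * (vderiv f z + of_real s * f z))"
    unfolding set_lebesgue_integral_def
    by (intro Bochner_Integration.integral_cong refl) (simp add: scaleR_conv_of_real mult.assoc)
  finally show ?thesis .
qed

text \<open>With \<open>h = f' + s f\<close> one has \<open>f = E h\<close> for the one-sided exponential kernel \<open>E\<close>, hence
  \<open>\<langle>f, q f\<rangle> = \<langle>E\<^sup>* q f, h\<rangle> \<le> (\<parallel>E\<^sup>* q f\<parallel>\<^sup>2 + \<parallel>h\<parallel>\<^sup>2) / 2\<close>. Here \<open>\<parallel>h\<parallel>\<^sup>2\<close> is the energy, which is at most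
  \<open>\<langle>f, q f\<rangle>\<close> for a negative direction, and \<open>\<parallel>E\<^sup>* q f\<parallel>\<^sup>2\<close> is at most the correlation over \<open>2 s\<close>.\<close>

lemma exp_correlation_lower:
  assumes q: "potential q" and s: "s > 0" and f: "f \<in> C1_compact"
    and neg: "Re (schrodinger_form s q f f) < 0"
  shows "2 * s * Re (weight_form q f f) \<le> exp_correlation q s f"
proof -
  have qc: "compact_borel q" using q by (rule potential_compact)
  obtain R1 where R1: "R1 > 0" "\<And>x. R1 \<le> \<bar>x\<bar> \<Longrightarrow> f x = 0" "\<And>x. R1 \<le> \<bar>x\<bar> \<Longrightarrow> vderiv f x = 0"
    using C1_compact_support[OF f] by metis
  obtain R2 where R2: "R2 > 0" "\<And>x. R2 < norm x \<Longrightarrow> q x = 0" using compact_borel_support[OF qc] by blast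
  define R where "R = max R1 R2"
  have R: "R > 0" "\<And>x. R \<le> \<bar>x\<bar> \<Longrightarrow> f x = 0" "\<And>x. R \<le> \<bar>x\<bar> \<Longrightarrow> vderiv f x = 0" "\<And>x. R < \<bar>x\<bar> \<Longrightarrow> q x = 0"
    using R1 R2 by (auto simp: R_def)
  define E where "E x z = indicator {-R..x} z * exp (- s * (x - z))" for x z :: real
  define h where "h z = vderiv f z + of_real s * f z" for z
  define G where "G z = (LINT x|lborel. complex_of_real (q x * E x z) * f x)" for z
  let ?X = "Re (weight_form q f f)"
  have fb: "bounded_borel f" by (rule compact_borel_bounded[OF C1_compact_borel(1)[OF f]])
  have qf: "compact_borel (\<lambda>x. complex_of_real (q x) * f x)"
    by (rule compact_borel_mult(1)[OF compact_borel_of_real[OF qc] fb])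
  have qfc: "compact_borel (\<lambda>x. complex_of_real (q x) * cnj (f x))"
    by (rule compact_borel_mult(1)[OF compact_borel_of_real[OF qc] bounded_borel_cnj[OF fb]])
  have hc: "compact_borel h" unfolding h_def[abs_def]
    by (rule compact_borel_add[OF C1_compact_borel(2)[OF f] compact_borel_mult(2)[OF C1_compact_borel(1)[OF f] bounded_borel_const]])
  have E_le: "0 \<le> E x z \<and> E x z \<le> 1" for x z using s by (auto simp: E_def indicator_def)
  have E_meas: "(\<lambda>p::real \<times> real. E (snd p) (fst p)) \<in> borel_measurable borel"
  proof -
    have "closed {p::real \<times> real. - R \<le> fst p \<and> fst p \<le> snd p}"
      by (intro closed_Collect_conj closed_Collect_le continuous_intros)
    then have "(\<lambda>p::real \<times> real. indicator {p. - R \<le> fst p \<and> fst p \<le> snd p} p * exp (- s * (snd p - fst p))) \<in> borel_measurable borel"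
      by (intro borel_measurable_times borel_measurable_indicator borel_closed borel_measurable_continuous_onI continuous_intros)
    also have "(\<lambda>p::real \<times> real. indicator {p. - R \<le> fst p \<and> fst p \<le> snd p} p * exp (- s * (snd p - fst p))) = (\<lambda>p. E (snd p) (fst p))"
      by (auto simp: E_def indicator_def fun_eq_iff)
    finally show ?thesis .
  qed
  have Eb: "bounded_borel (\<lambda>p::real \<times> real. E (snd p) (fst p))"
  proof -
    have "\<forall>p::real \<times> real. norm (E (snd p) (fst p)) \<le> 1" using E_le by auto
    then show ?thesis using E_meas unfolding bounded_borel_def by blast
  qed
  note Ebc = bounded_borel_of_real[OF Eb]
  have Ez: "q x * E x z = 0" if "R < \<bar>z\<bar>" for x z
    using that R(4)[of x] by (cases "R < \<bar>x\<bar>") (auto simp: E_def indicator_def)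
  have ind: "compact_borel (indicator {-R..R} :: real \<Rightarrow> real)"
  proof -
    have "\<forall>x::real. norm (indicator {-R..R} x :: real) \<le> 1" by (simp add: indicator_def)
    moreover have "\<forall>x::real. R < norm x \<longrightarrow> (indicator {-R..R} x :: real) = 0" by (auto simp: indicator_def)
    ultimately show ?thesis unfolding compact_borel_def bounded_borel_def by auto
  qed
  have qE: "compact_borel (\<lambda>p. complex_of_real (q (snd p) * E (snd p) (fst p)) * f (snd p))"
  proof -
    have "compact_borel (\<lambda>p. complex_of_real (indicator {-R..R} (fst p)) * (complex_of_real (q (snd p)) * f (snd p))
        * complex_of_real (E (snd p) (fst p)))"
      by (rule compact_borel_mult(1)[OF compact_borel_product[OF compact_borel_of_real[OF ind] qf] Ebc])
    also have "(\<lambda>p. complex_of_real (indicator {-R..R} (fst p)) * (complex_of_real (q (snd p)) * f (snd p))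
        * complex_of_real (E (snd p) (fst p))) = (\<lambda>p. complex_of_real (q (snd p) * E (snd p) (fst p)) * f (snd p))"
    proof
      fix p :: "real \<times> real"
      show "complex_of_real (indicator {-R..R} (fst p)) * (complex_of_real (q (snd p)) * f (snd p))
        * complex_of_real (E (snd p) (fst p)) = complex_of_real (q (snd p) * E (snd p) (fst p)) * f (snd p)"
        using Ez[of "fst p" "snd p"] by (cases "\<bar>fst p\<bar> \<le> R") (auto simp: indicator_def abs_le_iff)
    qed
    finally show ?thesis .
  qed
  have Gc: "compact_borel G"
    using compact_borel_marginal[OF qE] unfolding G_def[abs_def] by simp
  have X_eq: "?X = Re (LINT z|lborel. cnj (G z) * h z)"
  proof -
    let ?H = "\<lambda>p. h (fst p) * (complex_of_real (q (snd p)) * cnj (f (snd p))) * complex_of_real (E (snd p) (fst p))"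
    have H: "compact_borel ?H"
      by (rule compact_borel_mult(1)[OF compact_borel_product[OF hc qfc] Ebc])
    have "weight_form q f f = (LINT x|lborel. LINT z|lborel. ?H (z, x))"
      unfolding weight_form_def
    proof (intro Bochner_Integration.integral_cong refl)
      fix x
      show "complex_of_real (q x) * (cnj (f x) * f x) = (LINT z|lborel. ?H (z, x))"
      proof (cases "R < \<bar>x\<bar>")
        case False
        then have "f x = (LINT z|lborel. of_real (E x z) * h z)"
          unfolding E_def h_def using R(2) by (intro C1_exponential_representation[OF f]) auto
        then have "complex_of_real (q x) * (cnj (f x) * f x)
            = (complex_of_real (q x) * cnj (f x)) * (LINT z|lborel. of_real (E x z) * h z)"
          by (simp add: mult.assoc)
        also have "\<dots> = (LINT z|lborel. (complex_of_real (q x) * cnj (f x)) * (of_real (E x z) * h z))"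
          by (rule integral_mult_right_zero[symmetric])
        also have "\<dots> = (LINT z|lborel. ?H (z, x))"
          by (intro Bochner_Integration.integral_cong refl) (simp add: mult_ac)
        finally show ?thesis .
      qed (simp add: R(4))
    qed
    also have "\<dots> = (LINT z|lborel. LINT x|lborel. ?H (z, x))" using compact_borel_fubini[OF H] by simp
    also have "(\<lambda>z. LINT x|lborel. ?H (z, x)) = (\<lambda>z. cnj (G z) * h z)"
    proof
      fix z
      have "(LINT x|lborel. ?H (z, x)) = (LINT x|lborel. cnj (complex_of_real (q x * E x z) * f x) * h z)"
        by (intro Bochner_Integration.integral_cong refl) (simp add: mult_ac)
      also have "\<dots> = cnj (G z) * h z" unfolding G_def by (simp only: integral_mult_left_zero Bochner_Integration.integral_cnj)
      finally show "(LINT x|lborel. ?H (z, x)) = cnj (G z) * h z" .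
    qed
    finally show ?thesis by simp
  qed
  have G_sq: "(LINT z|lborel. (cmod (G z))\<^sup>2) \<le> exp_correlation q s f / (2 * s)"
  proof -
    define \<Phi> where "\<Phi> p = q (fst p) * q (snd p) * Re (cnj (f (fst p)) * f (snd p))" for p
    have \<Phi>: "compact_borel \<Phi>" unfolding \<Phi>_def[abs_def] by (rule pair_density_compact[OF qc fb])
    have \<Phi>0: "\<Phi> p = 0" if "\<not> (\<bar>fst p\<bar> \<le> R \<and> \<bar>snd p\<bar> \<le> R)" for p
      using that R(4) by (auto simp: \<Phi>_def not_le)
    let ?E2 = "\<lambda>z p. E (fst p) z * E (snd p) z"
    let ?K = "\<lambda>w::real \<times> (real \<times> real). indicator {-R..R} (fst w) * \<Phi> (snd w) * ?E2 (fst w) (snd w)"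
    have E2m: "(\<lambda>w::real \<times> (real \<times> real). ?E2 (fst w) (snd w)) \<in> borel_measurable borel"
    proof -
      have "(\<lambda>w::real \<times> (real \<times> real). (fst w, fst (snd w))) \<in> borel_measurable borel"
           "(\<lambda>w::real \<times> (real \<times> real). (fst w, snd (snd w))) \<in> borel_measurable borel"
        by (intro borel_measurable_continuous_onI continuous_intros)+
      from measurable_compose[OF this(1) E_meas] measurable_compose[OF this(2) E_meas]
      show ?thesis by simp
    qed
    have E2b: "bounded_borel (\<lambda>w::real \<times> (real \<times> real). ?E2 (fst w) (snd w))"
    proof -
      have "\<forall>w::real \<times> (real \<times> real). norm (?E2 (fst w) (snd w)) \<le> 1"
        using E_le by (auto simp: abs_mult intro!: mult_le_one)
      then show ?thesis using E2m unfolding bounded_borel_def by blast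
    qed
    have K: "compact_borel ?K" by (rule compact_borel_mult(1)[OF compact_borel_product[OF ind \<Phi>] E2b])
    have Gz: "(cmod (G z))\<^sup>2 = (LINT p|lborel. ?K (z, p))" for z
    proof -
      let ?a = "\<lambda>x. complex_of_real (q x * E x z) * f x"
      have a: "compact_borel ?a"
      proof -
        have "(\<lambda>x. E x z) \<in> borel_measurable borel"
          using measurable_compose[OF borel_measurable_continuous_onI[of "\<lambda>x. (z, x)"] E_meas]
          by (simp add: continuous_intros)
        then have "bounded_borel (\<lambda>x. E x z)" using E_le unfolding bounded_borel_def
          by (intro conjI exI[of _ 1]) auto
        then show ?thesis
          by (intro compact_borel_mult(1)[OF compact_borel_of_real[OF compact_borel_mult(1)[OF qc]] fb])
      qed
      have int: "integrable lborel (\<lambda>p. cnj (?a (fst p)) * ?a (snd p))"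
        by (rule compact_borel_integrable[OF compact_borel_product[OF compact_borel_cnj[OF a] a]])
      have "(cmod (G z))\<^sup>2 = Re (cnj (G z) * G z)" unfolding cmod_power2 by (simp add: power2_eq_square)
      also have "cnj (G z) * G z = (LINT p|lborel. cnj (?a (fst p)) * ?a (snd p))"
        unfolding G_def using lborel_integral_product[OF compact_borel_cnj[OF a] a]
        by (simp only: Bochner_Integration.integral_cnj)
      also have "Re \<dots> = (LINT p|lborel. Re (cnj (?a (fst p)) * ?a (snd p)))"
        by (rule integral_Re[OF int, symmetric])
      also have "\<dots> = (LINT p|lborel. ?K (z, p))"
      proof (intro Bochner_Integration.integral_cong refl)
        fix p :: "real \<times> real"
        have alg: "Re (cnj (complex_of_real (a * b) * u) * (complex_of_real (c * d) * v))
            = a * c * Re (cnj u * v) * (b * d)" for a b c d u v by (simp add: algebra_simps)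
        have "\<Phi> p * ?E2 z p = indicator {-R..R} z * \<Phi> p * ?E2 z p"
          using Ez[of z "fst p"] by (cases "\<bar>z\<bar> \<le> R") (auto simp: \<Phi>_def indicator_def abs_le_iff)
        then show "Re (cnj (?a (fst p)) * ?a (snd p)) = ?K (z, p)"
          unfolding alg by (simp add: \<Phi>_def)
      qed
      finally show ?thesis .
    qed
    have inner: "(LINT z|lborel. ?K (z, p)) = \<Phi> p * ((exp (- s * \<bar>fst p - snd p\<bar>)
        - exp (- s * (R + fst p)) * exp (- s * (R + snd p))) / (2 * s))" for p
    proof (cases "\<bar>fst p\<bar> \<le> R \<and> \<bar>snd p\<bar> \<le> R")
      case True
      have "(LINT z|lborel. ?K (z, p)) = (LINT z|lborel. \<Phi> p * ?E2 z p)"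
        using True by (intro Bochner_Integration.integral_cong refl) (auto simp: indicator_def E_def)
      also have "\<dots> = \<Phi> p * (LINT z|lborel. ?E2 z p)" by (rule integral_mult_right_zero)
      finally show ?thesis unfolding E_def using exp_kernel_square[OF s, of "fst p" R "snd p"] True by simp
    qed (use \<Phi>0 in simp)
    let ?e = "\<lambda>x. exp (- s * (R + x))"
    have c1: "compact_borel (\<lambda>p. \<Phi> p * exp (- s * \<bar>fst p - snd p\<bar>))"
      unfolding \<Phi>_def by (rule exp_correlation_compact[OF qc fb])
    have c2: "compact_borel (\<lambda>p. \<Phi> p * (?e (fst p) * ?e (snd p)))"
      by (rule compact_borel_mult_continuous[OF \<Phi>]) (intro continuous_intros)
    \<comment> \<open>The boundary contribution has rank one and is nonnegative.\<close>
    have pos: "(LINT p|lborel. \<Phi> p * (?e (fst p) * ?e (snd p))) \<ge> 0"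
    proof -
      let ?a = "\<lambda>x. complex_of_real (q x * ?e x) * f x"
      have a: "compact_borel ?a"
        by (rule compact_borel_mult(1)[OF compact_borel_of_real[OF compact_borel_mult_continuous[OF qc]] fb])
           (intro continuous_intros)
      have int: "integrable lborel (\<lambda>p. cnj (?a (fst p)) * ?a (snd p))"
        by (rule compact_borel_integrable[OF compact_borel_product[OF compact_borel_cnj[OF a] a]])
      have alg: "Re (cnj (complex_of_real (a * b) * u) * (complex_of_real (c * d) * v))
            = a * c * Re (cnj u * v) * (b * d)" for a b c d u v by (simp add: algebra_simps)
      have "(LINT p|lborel. \<Phi> p * (?e (fst p) * ?e (snd p))) = (LINT p|lborel. Re (cnj (?a (fst p)) * ?a (snd p)))"
        unfolding alg \<Phi>_def ..
      also have "\<dots> = Re (LINT p|lborel. cnj (?a (fst p)) * ?a (snd p))" by (rule integral_Re[OF int])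
      also have "(LINT p|lborel. cnj (?a (fst p)) * ?a (snd p)) = cnj (LINT x|lborel. ?a x) * (LINT x|lborel. ?a x)"
        using lborel_integral_product[OF compact_borel_cnj[OF a] a] by (simp only: Bochner_Integration.integral_cnj)
      also have "Re \<dots> = (cmod (LINT x|lborel. ?a x))\<^sup>2" unfolding cmod_power2 by (simp add: power2_eq_square)
      finally show ?thesis by simp
    qed
    have "(LINT z|lborel. (cmod (G z))\<^sup>2) = (LINT p|lborel. LINT z|lborel. ?K (z, p))"
      unfolding Gz using compact_borel_fubini[OF K] by simp
    also have "\<dots> = (LINT p|lborel. (\<Phi> p * exp (- s * \<bar>fst p - snd p\<bar>) - \<Phi> p * (?e (fst p) * ?e (snd p))) / (2 * s))"
      unfolding inner by (simp add: right_diff_distrib)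
    also have "\<dots> = ((LINT p|lborel. \<Phi> p * exp (- s * \<bar>fst p - snd p\<bar>)) - (LINT p|lborel. \<Phi> p * (?e (fst p) * ?e (snd p)))) / (2 * s)"
      using Bochner_Integration.integral_diff[OF compact_borel_integrable[OF c1] compact_borel_integrable[OF c2]]
      by (simp only: integral_divide_zero)
    also have "\<dots> \<le> (LINT p|lborel. \<Phi> p * exp (- s * \<bar>fst p - snd p\<bar>)) / (2 * s)"
      using pos s by (intro divide_right_mono) auto
    also have "(LINT p|lborel. \<Phi> p * exp (- s * \<bar>fst p - snd p\<bar>)) = exp_correlation q s f"
      by (simp add: exp_correlation_def \<Phi>_def)
    finally show ?thesis .
  qed
  have "2 * ?X \<le> (LINT z|lborel. (cmod (G z))\<^sup>2) + (LINT z|lborel. (cmod (h z))\<^sup>2)"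
  proof -
    have i1: "integrable lborel (\<lambda>z. (cmod (G z))\<^sup>2)" "integrable lborel (\<lambda>z. (cmod (h z))\<^sup>2)"
      by (rule compact_borel_integrable[OF compact_borel_norm[OF Gc]] compact_borel_integrable[OF compact_borel_norm[OF hc]], simp)+
    have i2: "integrable lborel (\<lambda>z. cnj (G z) * h z)"
      by (rule compact_borel_integrable[OF compact_borel_mult(1)[OF compact_borel_cnj[OF Gc] compact_borel_bounded[OF hc]]])
    have "2 * Re (cnj x * y) \<le> (cmod x)\<^sup>2 + (cmod y)\<^sup>2" for x y
      using zero_le_power2[of "cmod (x - y)"] unfolding cmod_power2 by (simp add: power2_eq_square algebra_simps)
    then have "(LINT z|lborel. 2 * Re (cnj (G z) * h z)) \<le> (LINT z|lborel. (cmod (G z))\<^sup>2 + (cmod (h z))\<^sup>2)"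
      using i1 i2 by (intro integral_mono Bochner_Integration.integrable_add integrable_mult_right integrable_Re)
    moreover have "(LINT z|lborel. 2 * Re (cnj (G z) * h z)) = 2 * ?X"
      unfolding X_eq integral_mult_right_zero integral_Re[OF i2] ..
    ultimately show ?thesis using i1 by simp
  qed
  also have "(LINT z|lborel. (cmod (h z))\<^sup>2) = Re (energy_form s f f)"
    unfolding h_def by (rule energy_form_factorised[OF f, symmetric])
  also have "Re (energy_form s f f) \<le> ?X" using neg by (simp add: schrodinger_form_def)
  finally have "?X \<le> exp_correlation q s f / (2 * s)" using G_sq by linarith
  then show ?thesis using s by (simp add: field_simps)
qed

lemma orthonormal_signs:
  assumes s: "sign_function s" and on: "orthonormal_system (weight_form q) n u"
  shows "orthonormal_system (weight_form q) n (\<lambda>i x. of_real (s x) * u i x)"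
proof -
  have "cnj (of_real (s x) * a) * (of_real (s x) * b) = cnj a * b" for x a b
  proof -
    have "cnj (of_real (s x) * a) * (of_real (s x) * b) = of_real (s x * s x) * (cnj a * b)" by (simp add: mult_ac)
    then show ?thesis unfolding sign_function_square[OF s] by simp
  qed
  then have "weight_form q (\<lambda>x. of_real (s x) * f x) (\<lambda>x. of_real (s x) * g x) = weight_form q f g" for f g
    unfolding weight_form_def by (simp only:)
  then show ?thesis using on unfolding orthonormal_system_def by (simp only:)
qed

lemma orthonormal_extend:
  assumes on: "orthonormal_system B n u" and "B v v = 1"
    and "\<And>i. i < n \<Longrightarrow> B (u i) v = 0" and "\<And>i. i < n \<Longrightarrow> B v (u i) = 0"
  shows "orthonormal_system B (Suc n) (u(n := v))"
  using assms unfolding orthonormal_system_def by (auto simp: less_Suc_eq)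

text \<open>The system is built one level at a time. A negative system of size \<open>m + 1\<close> at \<open>\<sigma>\<^sub>m\<close> contains a
  direction orthogonal to the \<open>m\<close> functions found so far, and it contributes \<open>2 \<sigma>\<^sub>m\<close> to the correlation
  at the rate \<open>\<sigma>\<^sub>m\<close>. The rate is then lowered by a sign function, which costs an arbitrarily small amount
  and preserves orthonormality because signs have modulus 1.\<close>

lemma correlated_system_exists:
  assumes q: "potential q"
    and \<sigma>: "\<And>k. k < n \<Longrightarrow> \<sigma> k > 0" "\<And>k l. k \<le> l \<Longrightarrow> l < n \<Longrightarrow> \<sigma> l \<le> \<sigma> k"
    and \<psi>: "\<And>k i. k < n \<Longrightarrow> i \<le> k \<Longrightarrow> \<psi> k i \<in> C1_compact"
    and neg: "\<And>k. k < n \<Longrightarrow> negative_system (schrodinger_form (\<sigma> k) q) (Suc k) (\<psi> k)"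
    and "m \<le> n" "\<eta> > 0" "\<And>k. k < m \<Longrightarrow> e \<le> \<sigma> k"
  shows "\<exists>u. (\<forall>i<m. bounded_borel (u i)) \<and> orthonormal_system (weight_form q) m u \<and>
           2 * (\<Sum>k<m. \<sigma> k) - \<eta> \<le> (\<Sum>i<m. exp_correlation q e (u i))"
  using assms(6-8)
proof (induction m arbitrary: e \<eta>)
  case 0
  then show ?case by (auto simp: orthonormal_system_def)
next
  case (Suc m)
  let ?W = "weight_form q" and ?s = "\<sigma> m" and ?p = "\<psi> m"
  have qc: "compact_borel q" using q by (rule potential_compact)
  have m: "m < n" using Suc.prems(1) by simp
  have W: "hermitian_form {f. bounded_borel f} ?W" by (rule hermitian_weight_form[OF qc])
  have "\<exists>u. (\<forall>i<m. bounded_borel (u i)) \<and> orthonormal_system ?W m u \<and>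
      2 * (\<Sum>k<m. \<sigma> k) - \<eta> / 2 \<le> (\<Sum>i<m. exp_correlation q ?s (u i))"
    using Suc.prems(2) m by (intro Suc.IH \<sigma>(2)) auto
  then obtain u where u: "\<And>i. i < m \<Longrightarrow> bounded_borel (u i)" "orthonormal_system ?W m u"
      "2 * (\<Sum>k<m. \<sigma> k) - \<eta> / 2 \<le> (\<Sum>i<m. exp_correlation q ?s (u i))" by blast
  have p_in: "?p i \<in> C1_compact" if "i < Suc m" for i using \<psi>[OF m] that by simp
  have p_b: "?p i \<in> {f. bounded_borel f}" if "i < Suc m" for i using p_in[OF that] C1_compact_subset by blast
  obtain c where c: "\<exists>i\<in>{..<Suc m}. c i \<noteq> 0" "\<forall>j<m. (\<Sum>i<Suc m. ?W (u j) (?p i) * c i) = 0"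
    using homogeneous_system_nontrivial[of "{..<Suc m}" m "\<lambda>j i. ?W (u j) (?p i)"] by auto
  define f where "f = lin_comb (Suc m) c ?p"
  have f: "f \<in> C1_compact" unfolding f_def by (rule lin_comb_in[OF function_space_C1_compact p_in])
  then have fb: "bounded_borel f" using C1_compact_subset by blast
  have f_neg: "Re (schrodinger_form ?s q f f) < 0"
    using neg[OF m] c(1) unfolding f_def negative_system_def nonzero_coeffs_def by blast
  have f_orth: "?W (u j) f = 0" if "j < m" for j
  proof -
    have "?W (u j) f = (\<Sum>i<Suc m. c i * ?W (u j) (?p i))"
      unfolding f_def using u(1)[OF that] by (intro hermitian_form_right[OF function_space_bounded_borel W _ p_b]) auto
    then show ?thesis using c(2) that by (simp add: mult.commute)
  qed
  define N where "N = Re (?W f f)"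
  have N: "N > 0" using f_neg energy_form_nonneg[of ?s f] by (simp add: schrodinger_form_def N_def)
  define t where "t = 1 / sqrt N"
  have t: "t * t * N = 1" using N by (simp add: t_def divide_simps)
  define v where "v x = complex_of_real t * f x" for x
  have vb: "bounded_borel v" unfolding v_def[abs_def] by (rule bounded_borel_mult[OF bounded_borel_const fb])
  have W_scale: "?W g v = of_real t * ?W g f" for g
    unfolding weight_form_def v_def integral_mult_right_zero[symmetric] by (simp add: mult_ac)
  have v1: "?W v v = 1"
  proof -
    have "?W v v = (LINT x|lborel. complex_of_real (t * t) * (of_real (q x) * (cnj (f x) * f x)))"
      unfolding weight_form_def v_def by (intro Bochner_Integration.integral_cong refl) (simp add: mult_ac)
    also have "\<dots> = of_real (t * t) * ?W f f" unfolding weight_form_def by (rule integral_mult_right_zero)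
    also have "?W f f = of_real N" unfolding N_def by (rule hermitian_form_real[OF W]) (simp add: fb)
    also have "complex_of_real (t * t) * of_real N = of_real (t * t * N)" by simp
    finally show ?thesis using t by simp
  qed
  have uv: "?W (u i) v = 0" if "i < m" for i using W_scale f_orth[OF that] by simp
  have vu: "?W v (u i) = 0" if "i < m" for i
    using hermitian_form_sym[OF W, of "u i" v] uv[OF that] u(1)[OF that] vb by simp
  have v_corr: "2 * ?s \<le> exp_correlation q ?s v"
  proof -
    have "exp_correlation q ?s v = (LINT p|lborel. (t * t) * (q (fst p) * q (snd p) * Re (cnj (f (fst p)) * f (snd p))
        * exp (- ?s * \<bar>fst p - snd p\<bar>)))"
      unfolding exp_correlation_def v_def
      by (intro Bochner_Integration.integral_cong refl) (simp add: algebra_simps)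
    also have "\<dots> = t * t * exp_correlation q ?s f"
      unfolding exp_correlation_def by (rule integral_mult_right_zero)
    finally have eq: "exp_correlation q ?s v = t * t * exp_correlation q ?s f" .
    have "t * t * (2 * ?s * N) \<le> t * t * exp_correlation q ?s f"
      using exp_correlation_lower[OF q \<sigma>(1)[OF m] f f_neg] unfolding N_def by (intro mult_left_mono) auto
    moreover have "t * t * (2 * ?s * N) = 2 * ?s * (t * t * N)" by (simp only: mult_ac)
    ultimately show ?thesis unfolding eq using t by simp
  qed
  let ?w = "u(m := v)"
  have w: "bounded_borel (?w i)" if "i < Suc m" for i using that u(1) vb by (auto simp: less_Suc_eq)
  have w_on: "orthonormal_system ?W (Suc m) ?w" using u(2) v1 uv vu by (rule orthonormal_extend[where B = ?W and u = u and v = v])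
  have w_sum: "2 * (\<Sum>k<Suc m. \<sigma> k) - \<eta> / 2 \<le> (\<Sum>i<Suc m. exp_correlation q ?s (?w i))"
  proof -
    have "(\<Sum>i<Suc m. exp_correlation q ?s (?w i)) = (\<Sum>i<m. exp_correlation q ?s (?w i)) + exp_correlation q ?s v"
      by simp
    also have "(\<Sum>i<m. exp_correlation q ?s (?w i)) = (\<Sum>i<m. exp_correlation q ?s (u i))"
      by (intro sum.cong refl) auto
    finally show ?thesis using u(3) v_corr unfolding sum.lessThan_Suc distrib_left by linarith
  qed
  have "e \<le> ?s" using Suc.prems(3) by simp
  then obtain s where s: "sign_function s"
     "(\<Sum>i<Suc m. exp_correlation q ?s (?w i)) - \<eta> / 2 \<le> (\<Sum>i<Suc m. exp_correlation q e (\<lambda>x. of_real (s x) * ?w i x))"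
    using exp_correlation_signs[where u = ?w and n = "Suc m" and \<eta> = "\<eta> / 2", OF qc w _ half_gt_zero[OF Suc.prems(2)]]
    by blast
  have "bounded_borel (\<lambda>x. complex_of_real (s x) * ?w i x)" if "i < Suc m" for i
    by (rule bounded_borel_mult[OF bounded_borel_of_real[OF sign_function_bounded[OF s(1)]] w[OF that]])
  moreover have "2 * (\<Sum>k<Suc m. \<sigma> k) - \<eta> \<le> (\<Sum>i<Suc m. exp_correlation q e (\<lambda>x. of_real (s x) * ?w i x))"
    using s(2) w_sum by linarith
  ultimately show ?case using orthonormal_signs[OF s(1) w_on]
    by (intro exI[of _ "\<lambda>i x. of_real (s x) * ?w i x"]) auto
qed

text \<open>The correlated system at rate 0 meets the rank-one bound. For the negative eigenvalues \<open>E\<^sub>k\<close> of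
  \<open>- d\<^sup>2/dx\<^sup>2 - q\<close> it says that \<open>2 \<Sum> sqrt \<bar>E\<^sub>k\<bar> \<le> \<integral> q\<close>.\<close>

lemma sum_sqrt_eigenvalues_le:
  assumes q: "potential q"
    and \<sigma>: "\<And>k. k < n \<Longrightarrow> \<sigma> k > 0" "\<And>k l. k \<le> l \<Longrightarrow> l < n \<Longrightarrow> \<sigma> l \<le> \<sigma> k"
    and \<psi>: "\<And>k i. k < n \<Longrightarrow> i \<le> k \<Longrightarrow> \<psi> k i \<in> C1_compact"
    and neg: "\<And>k. k < n \<Longrightarrow> negative_system (schrodinger_form (\<sigma> k) q) (Suc k) (\<psi> k)"
  shows "2 * (\<Sum>k<n. \<sigma> k) \<le> mass q"
proof (rule field_le_epsilon)
  fix \<eta> :: real assume \<eta>: "\<eta> > 0"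
  have "\<exists>u. (\<forall>i<n. bounded_borel (u i)) \<and> orthonormal_system (weight_form q) n u \<and>
           2 * (\<Sum>k<n. \<sigma> k) - \<eta> \<le> (\<Sum>i<n. exp_correlation q 0 (u i))"
    using q \<sigma> \<psi> neg order_refl \<eta> less_imp_le[OF \<sigma>(1)]
    by (rule correlated_system_exists[where \<sigma> = \<sigma> and \<psi> = \<psi>])
  then obtain u where u: "\<And>i. i < n \<Longrightarrow> bounded_borel (u i)" "orthonormal_system (weight_form q) n u"
      "2 * (\<Sum>k<n. \<sigma> k) - \<eta> \<le> (\<Sum>i<n. exp_correlation q 0 (u i))" by blast
  then show "2 * (\<Sum>k<n. \<sigma> k) \<le> mass q + \<eta>"
    using exp_correlation_zero_le[where u = u and n = n, OF q u(1,2)] by linarith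
qed

section \<open>Spread and excess of a potential\<close>

definition piecewise_continuous :: "(real \<Rightarrow> real) \<Rightarrow> bool" where
  "piecewise_continuous w \<longleftrightarrow> (\<exists>P. finite P \<and> (\<forall>x. x \<notin> P \<longrightarrow> isCont w x))"

definition excess :: "real \<Rightarrow> (real \<Rightarrow> real) \<Rightarrow> real" where
  "excess k w = mass (\<lambda>x. max 0 (w x - k\<^sup>2)) / (2 * k)"

definition cumulative :: "(real \<Rightarrow> real) \<Rightarrow> real \<Rightarrow> real" where
  "cumulative w x = (LINT s|lborel. w s * indicator {..x} s)"

lemma cumulative_integrable:
  assumes w: "potential w" and A: "A \<in> sets borel"
  shows "integrable lborel (\<lambda>s. w s * indicator A s)"
proof (rule Bochner_Integration.integrable_bound[OF compact_borel_integrable[OF potential_compact[OF w]]])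
  show "(\<lambda>s. w s * indicator A s) \<in> borel_measurable lborel"
    using compact_borel_measurable[OF potential_compact[OF w]] A by simp
  show "AE s in lborel. norm (w s * indicator A s) \<le> norm (w s)" by (auto simp: indicator_def)
qed

lemma cumulative_mono:
  assumes "potential w" "x \<le> y" shows "cumulative w x \<le> cumulative w y"
  unfolding cumulative_def using assms
  by (intro integral_mono cumulative_integrable mult_left_mono) (auto simp: indicator_def potential_nonneg)

lemma cumulative_bounds:
  assumes "potential w" shows "0 \<le> cumulative w x" "cumulative w x \<le> mass w"
proof -
  show "0 \<le> cumulative w x" unfolding cumulative_def
    using assms by (intro integral_nonneg_AE AE_I2 mult_nonneg_nonneg) (auto simp: potential_nonneg)
  show "cumulative w x \<le> mass w" unfolding cumulative_def mass_def
    using assms by (intro integral_mono cumulative_integrable compact_borel_integrable potential_compact)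
      (auto simp: indicator_def potential_nonneg)
qed

lemma cumulative_complement:
  assumes "potential w" shows "(LINT s|lborel. w s * indicator {x<..} s) = mass w - cumulative w x"
proof -
  have "(LINT s|lborel. w s * indicator {x<..} s) + cumulative w x
      = (LINT s|lborel. w s * indicator {x<..} s + w s * indicator {..x} s)"
    unfolding cumulative_def using assms by (intro Bochner_Integration.integral_add[symmetric] cumulative_integrable) auto
  also have "\<dots> = mass w" unfolding mass_def
    by (intro Bochner_Integration.integral_cong refl) (auto simp: indicator_def)
  finally show ?thesis by simp
qed

text \<open>Writing \<open>\<bar>s - t\<bar>\<close> as the measure of the points between \<open>s\<close> and \<open>t\<close> reduces the double
  integral to a single one.\<close>

lemma spread_eq_cumulative:
  assumes w: "potential w" and R: "\<And>x. R < \<bar>x\<bar> \<Longrightarrow> w x = 0"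
  shows "(LINT p|lborel. w (fst p) * \<bar>fst p - snd p\<bar> * w (snd p))
     = (LINT x|lborel. indicator {-R..R} x * (2 * cumulative w x * (mass w - cumulative w x)))"
proof -
  have wc: "compact_borel w" using w by (rule potential_compact)
  let ?b = "\<lambda>x p. indicator {..x} (fst p) * indicator {x<..} (snd p) + indicator {x<..} (fst p) * indicator {..x} (snd p) :: real"
  let ?K = "\<lambda>q::real \<times> (real \<times> real). indicator {-R..R} (fst q) * (w (fst (snd q)) * w (snd (snd q))) * ?b (fst q) (snd q)"
  have ind: "compact_borel (indicator {-R..R} :: real \<Rightarrow> real)"
  proof -
    have "\<forall>x::real. norm (indicator {-R..R} x :: real) \<le> 1" by (simp add: indicator_def)
    moreover have "\<forall>x::real. R < norm x \<longrightarrow> (indicator {-R..R} x :: real) = 0" by (auto simp: indicator_def)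
    ultimately show ?thesis unfolding compact_borel_def bounded_borel_def by auto
  qed
  have bb: "bounded_borel (\<lambda>q::real \<times> (real \<times> real). ?b (fst q) (snd q))"
  proof -
    let ?A = "{q::real \<times> (real \<times> real). fst (snd q) \<le> fst q \<and> fst q < snd (snd q)}"
    let ?B = "{q::real \<times> (real \<times> real). fst q < fst (snd q) \<and> snd (snd q) \<le> fst q}"
    have "{q::real \<times> (real \<times> real). fst (snd q) \<le> fst q} \<in> sets borel"
         "{q::real \<times> (real \<times> real). snd (snd q) \<le> fst q} \<in> sets borel"
      by (intro borel_closed closed_Collect_le continuous_intros)+
    moreover have "{q::real \<times> (real \<times> real). fst q < snd (snd q)} \<in> sets borel"
         "{q::real \<times> (real \<times> real). fst q < fst (snd q)} \<in> sets borel"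
      by (intro borel_open open_Collect_less continuous_intros)+
    ultimately have "?A \<in> sets borel" "?B \<in> sets borel" by (simp_all add: Collect_conj_eq sets.Int)
    then have "(\<lambda>q. indicator ?A q + indicator ?B q :: real) \<in> borel_measurable borel"
      by (intro borel_measurable_add borel_measurable_indicator)
    also have "(\<lambda>q. indicator ?A q + indicator ?B q :: real) = (\<lambda>q. ?b (fst q) (snd q))"
      by (auto simp: indicator_def fun_eq_iff)
    finally have 1: "(\<lambda>q::real \<times> (real \<times> real). ?b (fst q) (snd q)) \<in> borel_measurable borel" .
    have "\<forall>q::real \<times> (real \<times> real). norm (?b (fst q) (snd q)) \<le> 1" by (auto simp: indicator_def)
    then show ?thesis using 1 unfolding bounded_borel_def by blast
  qed
  have K: "compact_borel ?K"
    by (rule compact_borel_mult(1)[OF compact_borel_product[OF ind compact_borel_product[OF wc wc]] bb])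
  have "(LINT p|lborel. w (fst p) * \<bar>fst p - snd p\<bar> * w (snd p)) = (LINT p|lborel. LINT x|lborel. ?K (x, p))"
  proof (intro Bochner_Integration.integral_cong refl)
    fix p :: "real \<times> real"
    show "w (fst p) * \<bar>fst p - snd p\<bar> * w (snd p) = (LINT x|lborel. ?K (x, p))"
    proof (cases "\<bar>fst p\<bar> \<le> R \<and> \<bar>snd p\<bar> \<le> R")
      case True
      have "(LINT x|lborel. ?K (x, p)) = (LINT x|lborel. w (fst p) * w (snd p) * indicator {min (fst p) (snd p)..<max (fst p) (snd p)} x)"
        using True by (intro Bochner_Integration.integral_cong refl) (auto simp: indicator_def)
      also have "\<dots> = w (fst p) * w (snd p) * (LINT x|lborel. indicator {min (fst p) (snd p)..<max (fst p) (snd p)} x)"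
        by (rule integral_mult_right_zero)
      also have "(LINT x|lborel. indicator {min (fst p) (snd p)..<max (fst p) (snd p)} x) = \<bar>fst p - snd p\<bar>"
        by (auto simp: min_def max_def)
      finally show ?thesis by simp
    next
      case False
      then have "w (fst p) = 0 \<or> w (snd p) = 0" using R by (meson not_le)
      then show ?thesis by auto
    qed
  qed
  also have "\<dots> = (LINT x|lborel. LINT p|lborel. ?K (x, p))" using compact_borel_fubini[OF K] by simp
  also have "\<dots> = (LINT x|lborel. indicator {-R..R} x * (2 * cumulative w x * (mass w - cumulative w x)))"
  proof (intro Bochner_Integration.integral_cong refl)
    fix x
    let ?l = "\<lambda>s. w s * indicator {..x} s" and ?r = "\<lambda>s. w s * indicator {x<..} s"
    have bi: "bounded_borel (indicator A :: real \<Rightarrow> real)" if "A \<in> sets borel" for A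
      using that unfolding bounded_borel_def by (auto simp: indicator_def intro!: exI[of _ 1])
    have l: "compact_borel ?l" and r: "compact_borel ?r"
      by (rule compact_borel_mult(1)[OF wc bi]; simp)+
    have "(LINT p|lborel. ?K (x, p)) = (LINT p|lborel. indicator {-R..R} x * (?l (fst p) * ?r (snd p) + ?r (fst p) * ?l (snd p)))"
      by (intro Bochner_Integration.integral_cong refl) (simp add: algebra_simps)
    also have "\<dots> = indicator {-R..R} x * (LINT p|lborel. ?l (fst p) * ?r (snd p) + ?r (fst p) * ?l (snd p))"
      by (rule integral_mult_right_zero)
    also have "(LINT p|lborel. ?l (fst p) * ?r (snd p) + ?r (fst p) * ?l (snd p))
        = (LINT p|lborel. ?l (fst p) * ?r (snd p)) + (LINT p|lborel. ?r (fst p) * ?l (snd p))"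
      by (rule Bochner_Integration.integral_add[OF compact_borel_integrable[OF compact_borel_product[OF l r]]
            compact_borel_integrable[OF compact_borel_product[OF r l]]])
    also have "\<dots> = 2 * cumulative w x * (mass w - cumulative w x)"
      unfolding lborel_integral_product[OF l r] lborel_integral_product[OF r l] cumulative_complement[OF w]
        cumulative_def[symmetric] by simp
    finally show "(LINT p|lborel. ?K (x, p)) = indicator {-R..R} x * (2 * cumulative w x * (mass w - cumulative w x))" .
  qed
  finally show ?thesis .
qed

lemma spread_eq_profile:
  assumes "potential w" "\<And>x. R < \<bar>x\<bar> \<Longrightarrow> w x = 0"
  shows "spread w = (LINT x|lborel. indicator {-R..R} x * (2 * cumulative w x * (mass w - cumulative w x)) / mass w)"
  using spread_eq_cumulative[OF assms] unfolding spread_def integral_divide_zero by simp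

text \<open>Off the break points \<open>w\<close> is the derivative of the cumulative mass \<open>M\<close>, so the integrand is the
  derivative of \<open>M\<^bsup>k+1\<^esup> / (k + 1)\<close>.\<close>

lemma cumulative_moment:
  assumes w: "potential w" and pc: "piecewise_continuous w"
  shows "(LINT x|lborel. w x * cumulative w x ^ k) = mass w ^ Suc k / real (Suc k)"
    and "compact_borel (\<lambda>x. w x * cumulative w x ^ k)"
proof -
  have wc: "compact_borel w" using w by (rule potential_compact)
  obtain R where R: "R > 0" "\<And>x. R < norm x \<Longrightarrow> w x = 0" using compact_borel_support[OF wc] by blast
  obtain P where P: "finite P" "\<And>x. x \<notin> P \<Longrightarrow> isCont w x" using pc by (auto simp: piecewise_continuous_def)
  have wR: "w integrable_on {-R..R}" "mass w = integral {-R..R} w"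
    using lborel_integral_interval[OF wc, of R] R(2) by (auto simp: mass_def)
  have cum: "cumulative w x = integral {-R..x} w" if x: "x \<in> {-R..R}" for x
  proof -
    have "((\<lambda>s. w s * indicator {..x} s) has_integral cumulative w x) UNIV"
      unfolding cumulative_def by (rule has_integral_integral_lborel[OF cumulative_integrable[OF w]]) simp
    moreover have "(\<lambda>s. w s * indicator {..x} s) = (\<lambda>s. if s \<in> {-R..x} then w s else 0)"
      using R(2) by (auto simp: indicator_def fun_eq_iff)
    ultimately have "(w has_integral cumulative w x) {-R..x}" by (metis has_integral_restrict_UNIV)
    then show ?thesis by (simp add: integral_unique)
  qed
  define C where "C x = integral {-R..x} w" for x
  have contC: "continuous_on {-R..R} C"
    unfolding C_def by (rule indefinite_integral_continuous_1[OF wR(1)])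
  have derC: "(C has_real_derivative w x) (at x)" if "x \<in> {-R<..<R} - P" for x
  proof -
    have "(C has_vector_derivative w x) (at x within {-R..R} - {})"
      unfolding C_def using that P(2)[of x]
      by (intro integral_has_vector_derivative_continuous_at[OF wR(1) _ finite.emptyI])
         (auto intro: continuous_at_imp_continuous_within)
    then have "(C has_vector_derivative w x) (at x within {-R..R})" by simp
    then have "(C has_vector_derivative w x) (at x within {-R<..<R})"
      by (rule has_vector_derivative_within_subset) auto
    then show ?thesis using that
      by (simp add: has_real_derivative_iff_has_vector_derivative at_within_open[of x "{-R<..<R}"])
  qed
  have "((\<lambda>x. w x * C x ^ k) has_integral (C R ^ Suc k / real (Suc k) - C (- R) ^ Suc k / real (Suc k))) {-R..R}"
  proof (rule fundamental_theorem_of_calculus_interior_strong[OF P(1)])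
    show "-R \<le> R" using R by simp
    show "continuous_on {-R..R} (\<lambda>x. C x ^ Suc k / real (Suc k))"
      by (intro continuous_intros contC) auto
    fix x assume x: "x \<in> {-R<..<R} - P"
    show "((\<lambda>x. C x ^ Suc k / real (Suc k)) has_vector_derivative w x * C x ^ k) (at x)"
      unfolding has_real_derivative_iff_has_vector_derivative[symmetric]
      using derC[OF x] by (auto intro!: derivative_eq_intros simp del: power_Suc)
  qed
  then have "integral {-R..R} (\<lambda>x. w x * C x ^ k) = mass w ^ Suc k / real (Suc k)"
    using wR(2) by (simp add: integral_unique C_def del: of_nat_Suc)
  moreover have "integral {-R..R} (\<lambda>x. w x * C x ^ k) = integral {-R..R} (\<lambda>x. w x * cumulative w x ^ k)"
    by (intro integral_cong) (simp add: C_def cum)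
  moreover show cb: "compact_borel (\<lambda>x. w x * cumulative w x ^ k)"
  proof (rule compact_borel_mult(1)[OF wc])
    have "mono (cumulative w)" by (intro monoI cumulative_mono w)
    then have "cumulative w \<in> borel_measurable borel" by (rule borel_measurable_mono)
    moreover have "\<forall>x. norm (cumulative w x ^ k) \<le> mass w ^ k"
      using cumulative_bounds[OF w] by (auto simp: power_mono abs_of_nonneg)
    ultimately show "bounded_borel (\<lambda>x. cumulative w x ^ k)" unfolding bounded_borel_def by auto
  qed
  moreover have "(LINT x|lborel. w x * cumulative w x ^ k) = integral {-R..R} (\<lambda>x. w x * cumulative w x ^ k)"
    using R(2) by (intro lborel_integral_interval(2)[OF cb]) auto
  ultimately show "(LINT x|lborel. w x * cumulative w x ^ k) = mass w ^ Suc k / real (Suc k)" by simp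
qed

lemma potential_min:
  assumes w: "potential w" and k: "c \<ge> 0" and pc: "piecewise_continuous w"
  shows "potential (\<lambda>x. min (w x) c)" "piecewise_continuous (\<lambda>x. min (w x) c)"
proof -
  have wc: "compact_borel w" using w by (rule potential_compact)
  obtain C where C: "\<And>x. norm (w x) \<le> C" using wc by (auto simp: compact_borel_def bounded_borel_def)
  obtain R where R: "\<And>x. R < norm x \<Longrightarrow> w x = 0" using compact_borel_support[OF wc] by blast
  have "norm (min (w x) c) \<le> C" for x using C[of x] potential_nonneg[OF w, of x] k by auto
  then have "\<forall>x. norm (min (w x) c) \<le> C" by blast
  moreover have "\<forall>x. R < norm x \<longrightarrow> min (w x) c = 0" using R k by simp
  moreover have "(\<lambda>x. min (w x) c) \<in> borel_measurable borel"
    using compact_borel_measurable[OF wc] by (intro borel_measurable_min) auto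
  ultimately have "compact_borel (\<lambda>x. min (w x) c)"
    unfolding compact_borel_def bounded_borel_def by blast
  then show "potential (\<lambda>x. min (w x) c)" using potential_nonneg[OF w] k by (simp add: potential_def)
  show "piecewise_continuous (\<lambda>x. min (w x) c)"
  proof -
    obtain P where P: "finite P" "\<And>x. x \<notin> P \<Longrightarrow> isCont w x" using pc by (auto simp: piecewise_continuous_def)
    have "isCont (\<lambda>x. min (w x) c) x" if "x \<notin> P" for x
      using P(2)[OF that] by (intro continuous_intros)
    then show ?thesis using P(1) unfolding piecewise_continuous_def by blast
  qed
qed

lemma potential_excess:
  assumes w: "potential w" and c: "c \<ge> 0"
  shows "potential (\<lambda>x. max 0 (w x - c))"
proof -
  have wc: "compact_borel w" using w by (rule potential_compact)
  obtain C where C: "\<And>x. norm (w x) \<le> C" using wc by (auto simp: compact_borel_def bounded_borel_def)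
  obtain R where R: "\<And>x. R < norm x \<Longrightarrow> w x = 0" using compact_borel_support[OF wc] by blast
  have "norm (max 0 (w x - c)) \<le> C" for x using C[of x] c potential_nonneg[OF w, of x] by auto
  moreover have "\<forall>x. R < norm x \<longrightarrow> max 0 (w x - c) = 0" using R c by simp
  moreover have "(\<lambda>x. max 0 (w x - c)) \<in> borel_measurable borel"
    using compact_borel_measurable[OF wc] by (intro borel_measurable_max borel_measurable_diff) auto
  ultimately have "compact_borel (\<lambda>x. max 0 (w x - c))"
    unfolding compact_borel_def bounded_borel_def by blast
  then show ?thesis by (simp add: potential_def)
qed

lemma excess_nonneg: "potential w \<Longrightarrow> k \<ge> 0 \<Longrightarrow> excess k w \<ge> 0"
  unfolding excess_def by (intro divide_nonneg_nonneg mass_nonneg potential_excess) auto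

lemma spread_nonneg: "potential w \<Longrightarrow> spread w \<ge> 0"
  unfolding spread_def
  by (intro divide_nonneg_nonneg mass_nonneg integral_nonneg_AE AE_I2 mult_nonneg_nonneg) (auto simp: potential_nonneg)

lemma cumulative_profile_compact:
  assumes w: "potential w"
  shows "compact_borel (\<lambda>x. indicator {-R..R} x * (2 * cumulative w x * (mass w - cumulative w x)))"
proof (rule compact_borel_mult(1))
  have "\<forall>x::real. norm (indicator {-R..R} x :: real) \<le> 1" by (simp add: indicator_def)
  moreover have "\<forall>x::real. R < norm x \<longrightarrow> (indicator {-R..R} x :: real) = 0" by (auto simp: indicator_def)
  ultimately show "compact_borel (indicator {-R..R} :: real \<Rightarrow> real)" unfolding compact_borel_def bounded_borel_def by auto
  have "mono (cumulative w)" by (intro monoI cumulative_mono w)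
  then have m: "cumulative w \<in> borel_measurable borel" by (rule borel_measurable_mono)
  have "norm (2 * cumulative w x * (mass w - cumulative w x)) \<le> 2 * mass w * mass w" for x
    using cumulative_bounds[OF w, of x] by (auto simp: abs_mult intro!: mult_mono)
  then show "bounded_borel (\<lambda>x. 2 * cumulative w x * (mass w - cumulative w x))"
    using m unfolding bounded_borel_def by (intro conjI exI allI borel_measurable_times borel_measurable_diff) auto
qed

text \<open>The part \<open>p = min w k\<^sup>2\<close> below the level can only be large if it is spread over a long interval.
  The spread is \<open>2 \<integral> M (m - M) / m\<close>, which is monotone in the potential, and \<open>p \<le> k\<^sup>2\<close> bounds the spread of
  \<open>p\<close> from below by an integral against \<open>p\<close> itself, a polynomial in its mass \<open>P\<close>. The outcome is
  \<open>P\<^sup>2 \<le> 3 k\<^sup>2 T\<close>.\<close>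

lemma excess_lower:
  assumes w: "potential w" and pc: "piecewise_continuous w" and k: "k > 0" and m: "mass w > 0"
  shows "mass w / (2 * k) - sqrt (3 * spread w) / 2 \<le> excess k w"
proof -
  define p where "p x = min (w x) (k\<^sup>2)" for x
  have p: "potential p" "piecewise_continuous p"
    unfolding p_def[abs_def] using potential_min[OF w _ pc, of "k\<^sup>2"] by auto
  have wc: "compact_borel w" using w by (rule potential_compact)
  obtain R where R: "R > 0" "\<And>x. R < \<bar>x\<bar> \<Longrightarrow> w x = 0" using compact_borel_support[OF wc] by auto
  let ?M = "cumulative w" and ?N = "cumulative p" and ?m = "mass w" and ?P = "mass p"
  have "mass (\<lambda>x. max 0 (w x - k\<^sup>2)) = ?m - ?P"
  proof -
    have "mass (\<lambda>x. max 0 (w x - k\<^sup>2)) = (LINT x|lborel. w x - p x)"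
      unfolding mass_def by (intro Bochner_Integration.integral_cong refl) (simp add: p_def)
    then show ?thesis unfolding mass_def
      using compact_borel_integrable[OF wc] compact_borel_integrable[OF potential_compact[OF p(1)]] by simp
  qed
  then have ex: "excess k w = (?m - ?P) / (2 * k)" by (simp add: excess_def)
  have P0: "?P \<ge> 0" by (rule mass_nonneg[OF p(1)])
  have main: "?P\<^sup>2 \<le> 3 * k\<^sup>2 * spread w"
  proof (cases "?P = 0")
    case True then show ?thesis using spread_nonneg[OF w] by simp
  next
    case False
    then have P: "?P > 0" using P0 by simp
    have pw: "p x \<le> w x" "0 \<le> p x" "p x \<le> k\<^sup>2" for x using potential_nonneg[OF p(1)] by (auto simp: p_def)
    have NM: "?N x \<le> ?M x" for x unfolding cumulative_def
      using p(1) w pw by (intro integral_mono cumulative_integrable mult_right_mono) auto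
    have NM': "?P - ?N x \<le> ?m - ?M x" for x
      unfolding cumulative_complement[OF w, symmetric] cumulative_complement[OF p(1), symmetric]
      using p(1) w pw by (intro integral_mono cumulative_integrable mult_right_mono) auto
    \<comment> \<open>Monotonicity of the harmonic mean of the masses to the left and to the right of a point.\<close>
    have harmonic: "n * n' / (n + n') \<le> a * b / (a + b)"
      if "0 \<le> n" "0 \<le> n'" "n \<le> a" "n' \<le> b" "n + n' > 0" for n n' a b :: real
    proof -
      have ab: "a + b > 0" using that by simp
      have "n * n' * (a + b) \<le> a * b * (n + n')"
      proof -
        have "n * (n' * a) \<le> n * (b * a)" "n' * (n * b) \<le> n' * (a * b)"
          using that by (auto intro!: mult_left_mono mult_right_mono)
        then show ?thesis by (simp add: algebra_simps)
      qed
      then show ?thesis using that(5) ab by (simp add: divide_simps)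
    qed
    have pt: "(2 / (?P * k\<^sup>2)) * (?P * (p x * ?N x ^ 1) - p x * ?N x ^ 2)
        \<le> indicator {-R..R} x * (2 * ?M x * (?m - ?M x)) / ?m" for x
    proof (cases "\<bar>x\<bar> \<le> R")
      case True
      have k2: "k\<^sup>2 > 0" using k by simp
      have NP: "0 \<le> ?N x" "?N x \<le> ?P" by (rule cumulative_bounds[OF p(1)])+
      have "(2 / (?P * k\<^sup>2)) * (?P * (p x * ?N x ^ 1) - p x * ?N x ^ 2) = (p x / k\<^sup>2) * (2 * (?N x * (?P - ?N x) / ?P))"
        by (simp add: power2_eq_square right_diff_distrib diff_divide_distrib mult_ac)
      also have "\<dots> \<le> 1 * (2 * (?N x * (?P - ?N x) / ?P))"
        using pw[of x] k2 NP P by (intro mult_right_mono) auto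
      also have "?N x * (?P - ?N x) / ?P \<le> ?M x * (?m - ?M x) / ?m"
        using harmonic[of "?N x" "?P - ?N x" "?M x" "?m - ?M x"] NP NM[of x] NM'[of x] P by simp
      finally show ?thesis using True by (simp add: indicator_def abs_le_iff mult_ac)
    next
      case False
      then have "w x = 0" using R by simp
      then have "p x = 0" by (simp add: p_def)
      moreover have "indicator {-R..R} x = (0::real)" using False by (auto simp: indicator_def)
      ultimately show ?thesis by simp
    qed
    have c1: "compact_borel (\<lambda>x. p x * ?N x ^ j)" for j by (rule cumulative_moment(2)[OF p])
    note i1 = compact_borel_integrable[OF c1]
    note i2 = compact_borel_integrable[OF cumulative_profile_compact[OF w]]
    have "(LINT x|lborel. (2 / (?P * k\<^sup>2)) * (?P * (p x * ?N x ^ 1) - p x * ?N x ^ 2))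
        = (2 / (?P * k\<^sup>2)) * (?P * (LINT x|lborel. p x * ?N x ^ 1) - (LINT x|lborel. p x * ?N x ^ 2))"
      using Bochner_Integration.integral_diff[OF integrable_mult_right[OF i1, of ?P 1] i1[of 2]]
      by (simp only: integral_mult_right_zero)
    also have "\<dots> = (2 / (?P * k\<^sup>2)) * (?P * (?P\<^sup>2 / 2) - ?P ^ 3 / 3)"
      unfolding cumulative_moment(1)[OF p] by (simp add: eval_nat_numeral)
    also have "\<dots> = ?P\<^sup>2 / (3 * k\<^sup>2)"
      using P k by (simp add: field_simps eval_nat_numeral)
    finally have eq: "(LINT x|lborel. (2 / (?P * k\<^sup>2)) * (?P * (p x * ?N x ^ 1) - p x * ?N x ^ 2)) = ?P\<^sup>2 / (3 * k\<^sup>2)" .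
    have "(LINT x|lborel. (2 / (?P * k\<^sup>2)) * (?P * (p x * ?N x ^ 1) - p x * ?N x ^ 2))
        \<le> (LINT x|lborel. indicator {-R..R} x * (2 * ?M x * (?m - ?M x)) / ?m)"
      by (rule integral_mono[OF _ _ pt])
         (intro integrable_mult_right Bochner_Integration.integrable_diff integrable_divide i1 i2)+
    also have "\<dots> = spread w" by (rule spread_eq_profile[OF w R(2), symmetric])
    finally show ?thesis unfolding eq using k by (simp add: field_simps)
  qed
  have "?P = sqrt (?P\<^sup>2)" using P0 by simp
  also have "\<dots> \<le> sqrt (3 * k\<^sup>2 * spread w)" using main by (rule real_sqrt_le_mono)
  also have "\<dots> = k * sqrt (3 * spread w)" using k by (simp add: real_sqrt_mult)
  finally show ?thesis unfolding ex using k by (simp add: field_simps)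
qed

text \<open>This is to be used with \<open>x = w / k\<^sup>2\<close> and \<open>y = 4 t (1 - t)\<close>, where \<open>t\<close> is the fraction of the mass to the left
  of a point. The coefficient \<open>5 / 16\<close> makes the average of \<open>y - 5 y\<^sup>2 / 16\<close> over \<open>t\<close> in the unit interval
  equal to \<open>1 / 2\<close>, and equality holds at \<open>y = 1\<close>, \<open>x = 8 / 3\<close>; the latter is the ratio of the squared
  thresholds of the modes 3 and 2.\<close>

lemma level_inequality:
  fixes x y :: real
  assumes "0 \<le> x" "0 \<le> y" "y \<le> 1"
  shows "x * (y - 5 * y\<^sup>2 / 16) \<le> y + max 0 (x - 1) / 2 + 3 / 16 * max 0 (x - 8 / 3)"
proof -
  have y2: "y\<^sup>2 \<le> 1" using assms by (simp add: power_le_one)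
  have g: "y - 5 * y\<^sup>2 / 16 \<le> 11 / 16"
  proof -
    have "0 \<le> (1 - y) * (11 - 5 * y)" using assms by (intro mult_nonneg_nonneg) auto
    then show ?thesis by (simp add: algebra_simps power2_eq_square)
  qed
  consider "x \<le> 1" | "1 \<le> x" "x \<le> 8 / 3" | "8 / 3 \<le> x" by linarith
  then show ?thesis
  proof cases
    case 1
    have "x * (y - 5 * y\<^sup>2 / 16) \<le> x * y" using assms(1) by (intro mult_left_mono) auto
    also have "\<dots> \<le> 1 * y" using 1 assms(2) by (intro mult_right_mono) auto
    finally show ?thesis using 1 by simp
  next
    case 2
    have e: "0 \<le> (8 / 3 - x) * (5 * y\<^sup>2 / 16) * (3 / 5) + (x - 1) * (3 / 5) * (5 / 6 * (1 - y)\<^sup>2)"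
      using 2 by (intro add_nonneg_nonneg mult_nonneg_nonneg) auto
    have "y + (x - 1) / 2 - x * (y - 5 * y\<^sup>2 / 16)
        = (8 / 3 - x) * (5 * y\<^sup>2 / 16) * (3 / 5) + (x - 1) * (3 / 5) * (5 / 6 * (1 - y)\<^sup>2)"
      by (simp add: power2_eq_square field_simps)
    then have "x * (y - 5 * y\<^sup>2 / 16) \<le> y + (x - 1) / 2" using e by linarith
    then show ?thesis using 2 by simp
  next
    case 3
    define h where "h = y - 5 * y\<^sup>2 / 16"
    have "(x - 8 / 3) * h \<le> (x - 8 / 3) * (11 / 16)"
      using g 3 unfolding h_def by (intro mult_left_mono) auto
    moreover have "8 / 3 * h \<le> y + 5 / 6"
    proof -
      have "0 \<le> 5 / 6 * (1 - y)\<^sup>2" by simp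
      then show ?thesis unfolding h_def by (simp add: power2_eq_square algebra_simps)
    qed
    moreover have "x * h = (x - 8 / 3) * h + 8 / 3 * h" by (simp add: left_diff_distrib)
    moreover have "(x - 8 / 3) * (11 / 16) = (x - 1) / 2 + 3 / 16 * (x - 8 / 3) - 5 / 6" by (simp add: field_simps)
    ultimately have "x * h \<le> y + (x - 1) / 2 + 3 / 16 * (x - 8 / 3)" by linarith
    moreover have "max 0 (x - 1) = x - 1" "max 0 (x - 8 / 3) = x - 8 / 3" using 3 by auto
    ultimately show ?thesis unfolding h_def by simp
  qed
qed

text \<open>For a narrow potential, where \<open>excess_lower\<close> loses too much. The pointwise inequality is integrated
  along the line; the condition \<open>m \<ge> 2 k\<close> allows \<open>k y\<close> to be replaced by the density \<open>m y / 2\<close> of the spread.\<close>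

lemma spread_plus_excess_lower:
  assumes w: "potential w" and pc: "piecewise_continuous w" and k: "k > 0"
    and m: "mass w \<ge> 2 * k" and k': "k'\<^sup>2 = 8 / 3 * k\<^sup>2" "k' > 0"
  shows "mass w / (2 * k) \<le> spread w + excess k w + excess k' w"
proof -
  have wc: "compact_borel w" using w by (rule potential_compact)
  obtain R where R: "R > 0" "\<And>x. R < \<bar>x\<bar> \<Longrightarrow> w x = 0" using compact_borel_support[OF wc] by auto
  let ?M = "cumulative w" and ?m = "mass w"
  have m0: "?m > 0" using m k by linarith
  let ?y = "\<lambda>x. 4 * (?M x / ?m) * (1 - ?M x / ?m)"
  let ?F = "\<lambda>x. indicator {-R..R} x * (2 * ?M x * (?m - ?M x)) / ?m"
  let ?e = "\<lambda>k x. max 0 (w x - k\<^sup>2) / (2 * k)"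
  have k'_le: "k' \<le> 8 / 3 * k"
  proof -
    have "k'\<^sup>2 \<le> (8 / 3 * k)\<^sup>2" unfolding k'(1) by (simp add: power2_eq_square)
    then show ?thesis using k by (intro power2_le_imp_le[of k']) auto
  qed
  have pt: "w x * (?y x - 5 * (?y x)\<^sup>2 / 16) / k \<le> ?F x + ?e k x + ?e k' x" for x
  proof (cases "\<bar>x\<bar> \<le> R")
    case True
    have b: "0 \<le> ?M x / ?m" "?M x / ?m \<le> 1" using cumulative_bounds[OF w, of x] m0 by auto
    have y0: "0 \<le> ?y x" using b by (intro mult_nonneg_nonneg) auto
    have y1: "?y x \<le> 1" 
    proof -
      have "4 * t * (1 - t) \<le> 1" for t :: real
        using zero_le_power2[of "2 * t - 1"] by (simp add: power2_eq_square algebra_simps)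
      then show ?thesis .
    qed
    define X where "X = w x / k\<^sup>2"
    have X: "X \<ge> 0" "w x = k\<^sup>2 * X" using potential_nonneg[OF w, of x] k by (auto simp: X_def)
    have 1: "w x * (?y x - 5 * (?y x)\<^sup>2 / 16) / k = k * (X * (?y x - 5 * (?y x)\<^sup>2 / 16))"
      unfolding X(2) using k by (simp add: power2_eq_square)
    have 2: "k * ?y x \<le> ?F x"
    proof -
      have "?F x = ?m / 2 * ?y x" using True m0 by (simp add: indicator_def abs_le_iff field_simps)
      moreover have "k * ?y x \<le> ?m / 2 * ?y x" using m y0 by (intro mult_right_mono) auto
      ultimately show ?thesis by simp
    qed
    have 3: "?e k x = k * (max 0 (X - 1) / 2)"
    proof -
      have "w x - k\<^sup>2 = k\<^sup>2 * (X - 1)" unfolding X(2) by (simp add: algebra_simps)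
      then have "max 0 (w x - k\<^sup>2) = k\<^sup>2 * max 0 (X - 1)"
        using k by (simp add: max_def zero_le_mult_iff)
      then show ?thesis using k by (simp add: power2_eq_square)
    qed
    have 4: "k * (3 / 16 * max 0 (X - 8 / 3)) \<le> ?e k' x"
    proof -
      have "w x - k'\<^sup>2 = k\<^sup>2 * (X - 8 / 3)" unfolding X(2) k'(1) by (simp add: algebra_simps)
      then have "max 0 (w x - k'\<^sup>2) = k\<^sup>2 * max 0 (X - 8 / 3)"
        using k by (simp add: max_def zero_le_mult_iff)
      moreover have "k * (3 / 16 * max 0 (X - 8 / 3)) \<le> k\<^sup>2 * max 0 (X - 8 / 3) / (2 * k')"
      proof -
        have "k * 3 / 16 \<le> k\<^sup>2 / (2 * k')" using k'_le k k'(2) by (simp add: field_simps power2_eq_square)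
        then have "k * 3 / 16 * max 0 (X - 8 / 3) \<le> k\<^sup>2 / (2 * k') * max 0 (X - 8 / 3)" by (rule mult_right_mono) simp
        then show ?thesis by simp
      qed
      ultimately show ?thesis by simp
    qed
    have "k * (X * (?y x - 5 * (?y x)\<^sup>2 / 16)) \<le> k * (?y x + max 0 (X - 1) / 2 + 3 / 16 * max 0 (X - 8 / 3))"
      using level_inequality[OF X(1) y0 y1] k by (intro mult_left_mono) auto
    then show ?thesis unfolding 1 using 2 3 4 by (simp add: distrib_left)
  next
    case False
    then have "w x = 0" using R by simp
    moreover have "indicator {-R..R} x = (0::real)" using False by (auto simp: indicator_def)
    ultimately show ?thesis using k k'(2) by simp
  qed
  have c1: "compact_borel (\<lambda>x. w x * ?M x ^ j)" for j by (rule cumulative_moment(2)[OF w pc])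
  note i1 = compact_borel_integrable[OF c1]
  note i2 = compact_borel_integrable[OF cumulative_profile_compact[OF w, of R]]
  note i3 = compact_borel_integrable[OF potential_compact[OF potential_excess[OF w zero_le_power2]]]
  \<comment> \<open>Expanding in powers of the cumulative mass makes the left side exactly integrable.\<close>
  have poly: "w x * (?y x - 5 * (?y x)\<^sup>2 / 16) / k
     = (4 / (?m * k)) * (w x * ?M x ^ 1) - (9 / (?m ^ 2 * k)) * (w x * ?M x ^ 2)
       + (10 / (?m ^ 3 * k)) * (w x * ?M x ^ 3) - (5 / (?m ^ 4 * k)) * (w x * ?M x ^ 4)" for x
    using m0 k by (simp add: field_simps eval_nat_numeral)
  let ?I = "\<lambda>j. LINT x|lborel. w x * ?M x ^ j"
  have "(LINT x|lborel. w x * (?y x - 5 * (?y x)\<^sup>2 / 16) / k)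
      = (4 / (?m * k)) * ?I 1 - (9 / (?m ^ 2 * k)) * ?I 2 + (10 / (?m ^ 3 * k)) * ?I 3 - (5 / (?m ^ 4 * k)) * ?I 4"
    unfolding poly using i1[of 1] i1[of 2] i1[of 3] i1[of 4] by simp
  also have "\<dots> = ?m / (2 * k)"
    unfolding cumulative_moment(1)[OF w pc] using m0 k by (simp add: field_simps eval_nat_numeral)
  finally have L: "(LINT x|lborel. w x * (?y x - 5 * (?y x)\<^sup>2 / 16) / k) = ?m / (2 * k)" .
  have iF: "integrable lborel ?F" using i2 by (rule integrable_divide)
  have ie: "integrable lborel (?e j)" for j using i3 by (rule integrable_divide)
  have "(LINT x|lborel. w x * (?y x - 5 * (?y x)\<^sup>2 / 16) / k) \<le> (LINT x|lborel. ?F x + ?e k x + ?e k' x)"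
  proof (rule integral_mono[OF _ _ pt])
    show "integrable lborel (\<lambda>x. w x * (?y x - 5 * (?y x)\<^sup>2 / 16) / k)"
      unfolding poly using i1 by (intro Bochner_Integration.integrable_add Bochner_Integration.integrable_diff integrable_mult_right)
    show "integrable lborel (\<lambda>x. ?F x + ?e k x + ?e k' x)"
      by (intro Bochner_Integration.integrable_add iF ie)
  qed
  also have "\<dots> = (LINT x|lborel. ?F x) + (LINT x|lborel. ?e k x) + (LINT x|lborel. ?e k' x)"
    using Bochner_Integration.integral_add[OF Bochner_Integration.integrable_add[OF iF ie] ie]
      Bochner_Integration.integral_add[OF iF ie] by simp
  also have "(LINT x|lborel. ?F x) = spread w"
    by (rule spread_eq_profile[OF w R(2), symmetric])
  finally have "?m / (2 * k) \<le> spread w + (LINT x|lborel. ?e k x) + (LINT x|lborel. ?e k' x)" unfolding L .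
  moreover have "(LINT x|lborel. ?e j x) = excess j w" for j
    unfolding excess_def mass_def by (rule integral_divide_zero)
  ultimately show ?thesis by simp
qed

section \<open>Counting negative directions in all modes\<close>

text \<open>By the sharp bound, a level that is bound in exactly \<open>j\<close> modes adds this to the excess over the threshold
  of mode \<open>i\<close>.\<close>

definition level_gain :: "nat \<Rightarrow> nat \<Rightarrow> real" where
  "level_gain i j = (if i < j then sqrt (((real j)\<^sup>2 - (real i)\<^sup>2) / ((real i)\<^sup>2 - 1)) else 0)"

text \<open>The number \<open>j - 1\<close> of higher modes of such a level, less what it adds to the three excesses.\<close>

definition level_deficit :: "nat \<Rightarrow> real" where
  "level_deficit j = real j - 1 - (level_gain 2 j + level_gain 3 j + level_gain 4 j)"

lemma level_gain_3: "level_gain 2 3 = sqrt (5 / 3)" "level_gain 3 3 = 0" "level_gain 4 3 = 0"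
  and level_gain_4: "level_gain 2 4 = 2" "level_gain 3 4 = sqrt (7 / 8)" "level_gain 4 4 = 0"
  and level_gain_2: "level_gain 2 2 = 0" "level_gain 3 2 = 0" "level_gain 4 2 = 0"
  by (auto simp: level_gain_def power2_eq_square real_sqrt_unique)

lemma level_deficit_1: "level_deficit (Suc 0) = 0" and level_deficit_2: "level_deficit 2 = 1"
  and level_deficit_3: "level_deficit 3 = 2 - sqrt (5 / 3)" and level_deficit_4: "level_deficit 4 = 1 - sqrt (7 / 8)"
  by (auto simp: level_deficit_def level_gain_2 level_gain_3 level_gain_4) (auto simp: level_gain_def)

text \<open>Each square root is bounded below by a linear function of \<open>j\<close>; the sum of the three exceeds
  \<open>j - 1\<close> at \<open>j = 5\<close> and has a slope above 1.\<close>

lemma level_deficit_ge_5: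
  assumes "5 \<le> j" shows "level_deficit j \<le> 0"
proof -
  let ?x = "real j"
  have x: "?x \<ge> 5" using assms by simp
  have sq: "t / c \<le> sqrt (X / d)" if "t \<ge> 0" "c > 0" "d > 0" "t\<^sup>2 \<le> X" "d \<le> c\<^sup>2" for t c X d :: real
  proof (rule real_le_rsqrt)
    have "(t / c)\<^sup>2 = t\<^sup>2 / c\<^sup>2" by (simp add: power_divide)
    also have "\<dots> \<le> X / d" using that order_trans[OF zero_le_power2 that(4)] by (intro frac_le) auto
    finally show "(t / c)\<^sup>2 \<le> X / d" .
  qed
  have "(?x - 0.42) / 1.7321 \<le> sqrt ((?x\<^sup>2 - 4) / 3)"
    using x by (intro sq) (auto simp: power2_eq_square algebra_simps)
  moreover have "(?x - 1) / 2.8285 \<le> sqrt ((?x\<^sup>2 - 9) / 8)"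
    using x by (intro sq) (auto simp: power2_eq_square algebra_simps)
  moreover have "(?x - 2) / 3.873 \<le> sqrt ((?x\<^sup>2 - 16) / 15)"
    using x by (intro sq) (auto simp: power2_eq_square algebra_simps)
  moreover have "level_gain 2 j = sqrt ((?x\<^sup>2 - 4) / 3)" "level_gain 3 j = sqrt ((?x\<^sup>2 - 9) / 8)"
      "level_gain 4 j = sqrt ((?x\<^sup>2 - 16) / 15)"
    using assms by (auto simp: level_gain_def)
  moreover have "?x - 1 \<le> (?x - 0.42) / 1.7321 + (?x - 1) / 2.8285 + (?x - 2) / 3.873"
    using x by (simp add: field_simps)
  ultimately show ?thesis unfolding level_deficit_def by linarith
qed

lemma sqrt_numeric:
  "1.2909 \<le> sqrt (5 / 3)" "0.93 \<le> sqrt (7 / 8)" "1.6329 \<le> sqrt (8 / 3)" "0.6123 \<le> sqrt (3 / 8)"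
  "0.4472 \<le> sqrt (1 / 5)"
  by (rule real_le_rsqrt; simp add: power2_eq_square)+

lemma quadratic_increase:
  fixes c c0 p q :: real
  assumes "c0 \<le> c" "0 \<le> p" "q \<le> 2 * p * c0"
  shows "p * c0\<^sup>2 - q * c0 \<le> p * c\<^sup>2 - q * c"
proof -
  have "p * (2 * c0) \<le> p * (c + c0)" using assms by (intro mult_left_mono) auto
  then have "0 \<le> (c - c0) * (p * (c + c0) - q)" using assms by (intro mult_nonneg_nonneg) auto
  then show ?thesis by (simp add: power2_eq_square algebra_simps)
qed

text \<open>The configurations whose total deficit is larger than \<open>n - 1\<close>, the number of levels less one:
  \<open>x\<close>, \<open>y\<close>, \<open>z\<close> count the levels that are bound in exactly two, three and four modes. The remaining
  variables stand for the spread \<open>T\<close>, the excesses \<open>b\<^sub>i\<close> over the thresholds \<open>t\<^sub>i\<close>, the quotients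
  \<open>u\<^sub>i = m / (2 t\<^sub>i)\<close>, and \<open>c = sqrt (3 T) / 2\<close>. A single level bound in two modes is the thin case. Every
  other case comes down to a quadratic inequality in \<open>c\<close>, which holds by completing the square or by
  monotonicity to the right of the vertex.\<close>

lemma exceptional_levels:
  fixes T b2 b3 b4 u2 u3 u4 :: real and x y z :: nat
  assumes n: "n = x + y + z" "n \<ge> 1" and few: "y * (sqrt (5 / 3) - 1) + z * sqrt (7 / 8) < 1"
    and T: "T \<ge> 2 * (real n - 1)" and T2: "n = 2 \<Longrightarrow> 2 \<le> T * (1 - 1 / (2 * u2))"
    and b2: "b2 \<ge> y * sqrt (5 / 3) + z * 2" and b3: "b3 \<ge> z * sqrt (7 / 8)"
    and c: "c \<ge> 0" "c\<^sup>2 = 3 / 4 * T" and bc: "b2 \<ge> u2 - c" "b3 \<ge> u3 - c" "b4 \<ge> u4 - c" and b4: "b4 \<ge> 0"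
    and u2: "u2 \<ge> x + y * sqrt (8 / 3) + z" and u3: "u3 \<ge> x * sqrt (3 / 8) + y" "u3 = u2 * sqrt (3 / 8)"
    and u4: "u4 \<ge> x * sqrt (1 / 5) + z"
    and thin: "u2 \<ge> 1 \<Longrightarrow> T + b2 + b3 \<ge> u2"
  shows "2 * real x + 3 * real y + 4 * real z \<le> 1 + T + b2 + b3 + b4"
proof -
  note sq = sqrt_numeric
  have Tc: "T = 4 / 3 * c\<^sup>2" using c by simp
  have few': "0.29 * real y + 0.93 * real z < 1"
  proof -
    have "0.29 * real y \<le> y * (sqrt (5 / 3) - 1)" using sq(1) mult_left_mono[of "0.29" "sqrt (5 / 3) - 1" "real y"] by simp
    moreover have "0.93 * real z \<le> z * sqrt (7 / 8)" using sq(2) mult_left_mono[of "0.93" "sqrt (7 / 8)" "real z"] by simp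
    ultimately show ?thesis using few by linarith
  qed
  then have z_le: "z \<le> 1" by auto
  have c_ge: "c0 \<le> c" if "c0\<^sup>2 \<le> 3 / 4 * T" for c0
    using that c by (metis power2_le_imp_le)
  have b3_0: "b3 \<ge> 0" using b3 by (smt (verit) mult_nonneg_nonneg of_nat_0_le_iff real_sqrt_ge_zero divide_nonneg_nonneg)
  \<comment> \<open>The smallness condition leaves at most one level with four modes, and then none with three.\<close>
  consider (z) "z = 1" "y = 0" | (y0) "z = 0" "y = 0" | (y1) "z = 0" "y = 1" | (y2) "z = 0" "y \<ge> 2"
  proof -
    have "z = 1 \<longrightarrow> y = 0" using few' by auto
    then have "z = 1 \<and> y = 0 \<or> z = 0 \<and> y = 0 \<or> z = 0 \<and> y = 1 \<or> z = 0 \<and> y \<ge> 2"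
      using z_le by arith
    then show ?thesis using that by blast
  qed
  then show ?thesis
  proof cases
    case z
    have x: "real x \<le> T / 2" using T n z by simp
    have "x * 0.4472 \<le> x * sqrt (1 / 5)" using sq(5) by (intro mult_left_mono) auto
    then have "b4 \<ge> x * 0.4472 + 1 - c" using u4 bc z by simp
    moreover have "b3 \<ge> 0.93" "b2 \<ge> 2" using b3 b2 z sq(2) by auto
    moreover have "0 \<le> 0.298 * (c - 1.678)\<^sup>2" "0 \<le> c\<^sup>2" by simp_all
    then have "0 \<le> 0.2236 * T - c + 0.93" unfolding Tc power2_diff using c(1) by (simp add: power2_eq_square)
    ultimately show ?thesis using x z by simp
  next
    case y0
    have xn: "x = n" using n y0 by simp
    have u2n: "u2 \<ge> real n" using u2 y0 xn by simp
    consider "n = 1" | "n = 2" | "n \<ge> 3" using n(2) by linarith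
    then show ?thesis
    proof cases
      case 1
      then show ?thesis using thin u2n y0 xn b4 by simp
    next
      case 2
      have T0: "T \<ge> 2" using T 2 by simp
      have "T + b2 \<ge> 3"
      \<comment> \<open>Either \<open>u\<^sub>2\<close> is large enough by itself, or the sharper form of the spread inequality increases \<open>T\<close>.\<close>
      proof (cases "u2 \<ge> 2.25")
        case True
        have "4 / 3 * (1.2247)\<^sup>2 - 1 * 1.2247 \<le> 4 / 3 * c\<^sup>2 - 1 * c"
          by (rule quadratic_increase[OF c_ge]) (use T0 in \<open>auto simp: power2_eq_square\<close>)
        then show ?thesis using True bc(1) unfolding Tc by (simp add: power2_eq_square)
      next
        case False
        have "1 / (2 * u2) \<ge> 1 / 4.5" using False u2n 2 by (intro divide_left_mono) auto
        then have "T * (1 - 1 / (2 * u2)) \<le> T * (1 - 1 / 4.5)" using T0 by (intro mult_left_mono) auto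
        then have T1: "T \<ge> 2.57" using T2[OF 2] by simp
        have "4 / 3 * (1.388)\<^sup>2 - 1 * 1.388 \<le> 4 / 3 * c\<^sup>2 - 1 * c"
          by (rule quadratic_increase[OF c_ge]) (use T1 in \<open>auto simp: power2_eq_square\<close>)
        then show ?thesis using u2n 2 bc(1) unfolding Tc by (simp add: power2_eq_square)
      qed
      then show ?thesis using 2 y0 xn b3_0 b4 by simp
    next
      case 3
      have "c \<le> T / 2"
      proof (rule power2_le_imp_le)
        have "T * 3 \<le> T * T" using T 3 by (intro mult_left_mono) auto
        then show "c\<^sup>2 \<le> (T / 2)\<^sup>2" unfolding c(2) by (simp add: power2_eq_square)
      qed (use T 3 in simp)
      then show ?thesis using T u2n bc(1) y0 xn b3_0 b4 by simp
    qed
  next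
    case y1
    have xn: "real x = real n - 1" using n y1 by simp
    have x6: "x * 0.6123 \<le> x * sqrt (3 / 8)" using sq(4) by (intro mult_left_mono) auto
    then have u3': "u3 \<ge> 0.6123 * x + 1" using u3(1) y1 by simp
    have u2': "u2 \<ge> x + 1.6329" using u2 y1 sq(3) by simp
    have b2': "b2 \<ge> 1.2909" using b2 y1 sq(1) by simp
    consider "n = 1" | "n = 2" | "n \<ge> 3" using n(2) by linarith
    then show ?thesis
    proof cases
      case 1
      have "0 \<le> 4 / 3 * (c - 3 / 8)\<^sup>2" by simp
      then have "T - c \<ge> - 3 / 16" unfolding Tc by (simp add: power2_eq_square algebra_simps)
      then show ?thesis using 1 y1 xn u3' bc(2) b2' b4 by simp
    next
      case 2
      have T0: "T \<ge> 2" using T 2 by simp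
      have u2n: "u2 \<ge> 2.6329" using u2' xn 2 by simp
      have u36: "u3 \<ge> 0.6123 * u2" unfolding u3(2) using sq(4) u2n mult_left_mono[of "0.6123" "sqrt (3 / 8)" u2] by simp
      have T_ge: "2 \<le> T * (1 - 1 / (2 * U))" if "u2 \<le> U" for U
      proof -
        have "1 / (2 * u2) \<ge> 1 / (2 * U)" using that u2n by (intro divide_left_mono) auto
        then have "T * (1 - 1 / (2 * u2)) \<le> T * (1 - 1 / (2 * U))" using T0 by (intro mult_left_mono) auto
        then show ?thesis using T2[OF 2] by linarith
      qed
      have "T + b2 + b3 \<ge> 4"
      proof -
        consider "u2 \<ge> 2.8" | "2.68 \<le> u2" "u2 \<le> 2.8" | "u2 \<le> 2.68" by linarith
        then show ?thesis
        proof cases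
          case 1
          have "4 / 3 * (1.2247)\<^sup>2 - 2 * 1.2247 \<le> 4 / 3 * c\<^sup>2 - 2 * c"
            by (rule quadratic_increase[OF c_ge]) (use T0 in \<open>auto simp: power2_eq_square\<close>)
          then show ?thesis using 1 u36 bc(1,2) unfolding Tc by (simp add: power2_eq_square)
        next
          case 2
          have T1: "T \<ge> 2.434" using T_ge[OF 2(2)] by simp
          have "4 / 3 * (1.351)\<^sup>2 - 2 * 1.351 \<le> 4 / 3 * c\<^sup>2 - 2 * c"
            by (rule quadratic_increase[OF c_ge]) (use T1 in \<open>auto simp: power2_eq_square\<close>)
          then show ?thesis using 2 u36 bc(1,2) unfolding Tc by (simp add: power2_eq_square)
        next
          case 3
          have T1: "T \<ge> 2.4586" using T_ge[OF 3] by simp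
          have "4 / 3 * (1.3579)\<^sup>2 - 1 * 1.3579 \<le> 4 / 3 * c\<^sup>2 - 1 * c"
            by (rule quadratic_increase[OF c_ge]) (use T1 in \<open>auto simp: power2_eq_square\<close>)
          then show ?thesis using u2n u36 b2' bc(2) unfolding Tc by (simp add: power2_eq_square)
        qed
      qed
      then show ?thesis using 2 y1 xn b4 by simp
    next
      case 3
      have nT: "real n \<le> T / 2 + 1" using T by simp
      have "1.0748 * (1.7)\<^sup>2 - 2 * 1.7 \<le> 1.0748 * c\<^sup>2 - 2 * c"
        by (rule quadratic_increase[OF c_ge]) (use T 3 in \<open>auto simp: power2_eq_square\<close>)
      then have "0 \<le> 0.8061 * T - 2 * c + 0.6328" unfolding Tc by (simp add: power2_eq_square)
      moreover have "T \<ge> 4" using T 3 by simp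
      moreover have "u2 \<ge> real n + 0.6329" "u3 \<ge> 0.6123 * real n + 0.3877" using u2' u3' unfolding xn by (simp_all add: field_simps)
      ultimately have "2 * real n \<le> T + b2 + b3 + b4" using nT bc(1,2) b4 by simp
      then show ?thesis using y1 xn by simp
    qed
  next
    case y2
    have xn: "real x = real n - real y" using n y2 by simp
    have x6: "x * 0.6123 \<le> x * sqrt (3 / 8)" using sq(4) by (intro mult_left_mono) auto
    then have u3': "u3 \<ge> 0.6123 * x + y" using u3(1) by simp
    have "y * 1.2909 \<le> y * sqrt (5 / 3)" using sq(1) by (intro mult_left_mono) auto
    moreover have "y * sqrt (5 / 3) \<le> b2" using b2 y2 by simp
    ultimately have b2': "b2 \<ge> 1.2909 * y" by (simp only: mult.commute order_trans)
    have nT: "real n \<le> T / 2 + 1" and T0: "T \<ge> 0" using T n(2) by simp_all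
    have "0 \<le> 0.4082 * (c - 1.225)\<^sup>2" "0 \<le> c\<^sup>2" by simp_all
    then have "0 \<le> 0.30615 * T - c + 0.967" unfolding Tc power2_diff using c(1) by (simp add: power2_eq_square)
    moreover have "real y \<ge> 2" using y2 by simp
    moreover have "u3 \<ge> 0.6123 * real n + 0.3877 * real y" using u3' unfolding xn by (simp add: field_simps)
    ultimately have "2 * real n + real y \<le> 1 + T + b2 + b3 + b4" using nT b2' bc(2) b4 T0 by simp
    then show ?thesis using y2 xn by simp
  qed
qed

definition binds :: "(real \<Rightarrow> real) \<Rightarrow> real \<Rightarrow> nat \<Rightarrow> bool" where
  "binds w k n \<longleftrightarrow> (\<exists>\<psi>. (\<forall>i<n. \<psi> i \<in> C1_compact) \<and> negative_system (schrodinger_form k w) n \<psi>)"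

lemma energy_form_split:
  assumes f: "f \<in> C1_compact"
  shows "Re (energy_form k f f) = (LINT x|lborel. (cmod (vderiv f x))\<^sup>2) + k\<^sup>2 * (LINT x|lborel. (cmod (f x))\<^sup>2)"
proof -
  have "integrable lborel (\<lambda>x. (cmod (vderiv f x))\<^sup>2)" "integrable lborel (\<lambda>x. (cmod (f x))\<^sup>2)"
    using compact_borel_integrable[OF compact_borel_norm[OF C1_compact_borel(2)[OF f], of 2]]
      compact_borel_integrable[OF compact_borel_norm[OF C1_compact_borel(1)[OF f], of 2]] by simp_all
  then show ?thesis unfolding energy_form_diag by simp
qed

lemma binds_antimono:
  assumes b: "binds w k n" and k: "0 \<le> k'" "k' \<le> k" and n: "n' \<le> n"
  shows "binds w k' n'"
proof -
  obtain \<psi> where \<psi>: "\<And>i. i < n \<Longrightarrow> \<psi> i \<in> C1_compact" "negative_system (schrodinger_form k w) n \<psi>"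
    using b by (auto simp: binds_def)
  have "Re (schrodinger_form k' w (lin_comb n' c \<psi>) (lin_comb n' c \<psi>)) < 0" if c: "nonzero_coeffs n' c" for c
  proof -
    define d where "d i = (if i < n' then c i else 0)" for i
    have eq: "lin_comb n' c \<psi> = lin_comb n d \<psi>"
      unfolding lin_comb_def d_def using n by (intro ext sum.mono_neutral_cong_left) auto
    have "nonzero_coeffs n d" using c n by (auto simp: nonzero_coeffs_def d_def intro: less_le_trans)
    then have neg: "Re (schrodinger_form k w (lin_comb n d \<psi>) (lin_comb n d \<psi>)) < 0"
      using \<psi>(2) by (simp add: negative_system_def)
    have f: "lin_comb n d \<psi> \<in> C1_compact" using function_space_C1_compact \<psi>(1) by (rule lin_comb_in)
    have "k'\<^sup>2 * (LINT x|lborel. (cmod (lin_comb n d \<psi> x))\<^sup>2) \<le> k\<^sup>2 * (LINT x|lborel. (cmod (lin_comb n d \<psi> x))\<^sup>2)"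
      using k by (intro mult_right_mono power_mono integral_nonneg_AE AE_I2) auto
    then show ?thesis using neg unfolding eq schrodinger_form_def by (simp add: energy_form_split[OF f])
  qed
  then show ?thesis unfolding binds_def negative_system_def using \<psi>(1) n
    by (intro exI[of _ \<psi>]) (auto intro: less_le_trans)
qed

text \<open>Binding with background \<open>k\<^sup>2\<close> only uses the part of the potential above any lower level.\<close>

lemma binds_excess:
  assumes w: "potential w" and b: "binds w k n" and l: "0 \<le> l" "l \<le> k"
  shows "binds (\<lambda>x. max 0 (w x - l\<^sup>2)) (sqrt (k\<^sup>2 - l\<^sup>2)) n"
proof -
  obtain \<psi> where \<psi>: "\<And>i. i < n \<Longrightarrow> \<psi> i \<in> C1_compact" "negative_system (schrodinger_form k w) n \<psi>"
    using b by (auto simp: binds_def)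
  let ?q = "\<lambda>x. max 0 (w x - l\<^sup>2)"
  have le: "Re (schrodinger_form (sqrt (k\<^sup>2 - l\<^sup>2)) ?q f f) \<le> Re (schrodinger_form k w f f)" if f: "f \<in> C1_compact" for f
  proof -
    have fb: "bounded_borel (\<lambda>x. (cmod (f x))\<^sup>2)" and fc: "compact_borel (\<lambda>x. (cmod (f x))\<^sup>2)"
      using compact_borel_norm[OF C1_compact_borel(1)[OF f], of 2] compact_borel_bounded by auto
    have k2: "(sqrt (k\<^sup>2 - l\<^sup>2))\<^sup>2 = k\<^sup>2 - l\<^sup>2" using l by (simp add: power_mono)
    have iq: "integrable lborel (\<lambda>x. ?q x * (cmod (f x))\<^sup>2)"
      by (rule compact_borel_integrable[OF compact_borel_mult(1)[OF potential_compact[OF potential_excess[OF w zero_le_power2]] fb]])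
    have iw: "integrable lborel (\<lambda>x. w x * (cmod (f x))\<^sup>2)"
      by (rule compact_borel_integrable[OF compact_borel_mult(1)[OF potential_compact[OF w] fb]])
    have il: "integrable lborel (\<lambda>x. l\<^sup>2 * (cmod (f x))\<^sup>2)"
      by (rule integrable_mult_right[OF compact_borel_integrable[OF fc]])
    have "(LINT x|lborel. w x * (cmod (f x))\<^sup>2) \<le> (LINT x|lborel. ?q x * (cmod (f x))\<^sup>2 + l\<^sup>2 * (cmod (f x))\<^sup>2)"
    proof (rule integral_mono[OF iw Bochner_Integration.integrable_add[OF iq il]])
      fix x
      have "w x * (cmod (f x))\<^sup>2 \<le> (?q x + l\<^sup>2) * (cmod (f x))\<^sup>2" by (intro mult_right_mono) auto
      then show "w x * (cmod (f x))\<^sup>2 \<le> ?q x * (cmod (f x))\<^sup>2 + l\<^sup>2 * (cmod (f x))\<^sup>2" by (simp add: distrib_right)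
    qed
    also have "\<dots> = (LINT x|lborel. ?q x * (cmod (f x))\<^sup>2) + l\<^sup>2 * (LINT x|lborel. (cmod (f x))\<^sup>2)"
      using iq il by simp
    finally show ?thesis
      unfolding schrodinger_form_def minus_complex.sel energy_form_split[OF f] weight_form_diag k2
      by (simp add: left_diff_distrib)
  qed
  have "Re (schrodinger_form (sqrt (k\<^sup>2 - l\<^sup>2)) ?q (lin_comb n c \<psi>) (lin_comb n c \<psi>)) < 0" if "nonzero_coeffs n c" for c
  proof -
    have "Re (schrodinger_form k w (lin_comb n c \<psi>) (lin_comb n c \<psi>)) < 0"
      using \<psi>(2) that by (simp add: negative_system_def)
    moreover have "lin_comb n c \<psi> \<in> C1_compact" using function_space_C1_compact \<psi>(1) by (rule lin_comb_in)
    ultimately show ?thesis using le[of "lin_comb n c \<psi>"] by linarith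
  qed
  then show ?thesis unfolding binds_def negative_system_def using \<psi>(1) by blast
qed

text \<open>The sharp bound applied to the part of the potential above \<open>l\<^sup>2\<close>, relative to which the background \<open>(k a)\<^sup>2\<close> is
  only \<open>(k a)\<^sup>2 - l\<^sup>2\<close>.\<close>

lemma sum_levels_le:
  assumes w: "potential w" and b: "\<And>a. a < n \<Longrightarrow> binds w (k a) (Suc a)"
    and k: "\<And>a. a < n \<Longrightarrow> l < k a" "\<And>a b. a \<le> b \<Longrightarrow> b < n \<Longrightarrow> k b \<le> k a" and l: "0 \<le> l"
  shows "2 * (\<Sum>a<n. sqrt ((k a)\<^sup>2 - l\<^sup>2)) \<le> mass (\<lambda>x. max 0 (w x - l\<^sup>2))"
proof -
  let ?q = "\<lambda>x. max 0 (w x - l\<^sup>2)"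
  have "\<forall>a\<in>{..<n}. \<exists>\<psi>. (\<forall>i<Suc a. \<psi> i \<in> C1_compact) \<and> negative_system (schrodinger_form (sqrt ((k a)\<^sup>2 - l\<^sup>2)) ?q) (Suc a) \<psi>"
  proof
    fix a assume "a \<in> {..<n}"
    then have "binds ?q (sqrt ((k a)\<^sup>2 - l\<^sup>2)) (Suc a)"
      using k(1)[of a] by (intro binds_excess[OF w b l]) auto
    then show "\<exists>\<psi>. (\<forall>i<Suc a. \<psi> i \<in> C1_compact) \<and> negative_system (schrodinger_form (sqrt ((k a)\<^sup>2 - l\<^sup>2)) ?q) (Suc a) \<psi>"
      unfolding binds_def .
  qed
  then obtain \<psi> where \<psi>: "\<And>a. a < n \<Longrightarrow> (\<forall>i<Suc a. \<psi> a i \<in> C1_compact) \<and>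
      negative_system (schrodinger_form (sqrt ((k a)\<^sup>2 - l\<^sup>2)) ?q) (Suc a) (\<psi> a)"
    by (metis lessThan_iff)
  show ?thesis
  proof (rule sum_sqrt_eigenvalues_le[where \<psi> = \<psi>])
    show "potential ?q" by (rule potential_excess[OF w]) simp
    show "sqrt ((k a)\<^sup>2 - l\<^sup>2) > 0" if "a < n" for a using k(1)[OF that] l by (simp add: power_strict_mono)
    show "sqrt ((k b)\<^sup>2 - l\<^sup>2) \<le> sqrt ((k a)\<^sup>2 - l\<^sup>2)" if "a \<le> b" "b < n" for a b
      using k(1)[OF that(2)] k(2)[OF that] l by (simp add: power_mono)
    show "\<psi> a i \<in> C1_compact" if "a < n" "i \<le> a" for a i using \<psi>[OF that(1)] that(2) by (auto simp: less_Suc_eq_le)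
    show "negative_system (schrodinger_form (sqrt ((k a)\<^sup>2 - l\<^sup>2)) ?q) (Suc a) (\<psi> a)" if "a < n" for a
      using \<psi>[OF that] by simp
  qed
qed

definition threshold :: "real \<Rightarrow> nat \<Rightarrow> real" where
  "threshold \<alpha> j = \<alpha> * sqrt ((real j)\<^sup>2 - 1)"

lemma threshold_mono: "\<alpha> > 0 \<Longrightarrow> i \<le> j \<Longrightarrow> threshold \<alpha> i \<le> threshold \<alpha> j"
  unfolding threshold_def by (intro mult_left_mono real_sqrt_le_mono diff_right_mono power_mono) auto

lemma threshold_pos: "\<alpha> > 0 \<Longrightarrow> j \<ge> 2 \<Longrightarrow> threshold \<alpha> j > 0"
  unfolding threshold_def by (intro mult_pos_pos) (auto intro!: one_less_power)

lemma threshold_nonneg: "\<alpha> > 0 \<Longrightarrow> j \<ge> 1 \<Longrightarrow> threshold \<alpha> j \<ge> 0"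
  unfolding threshold_def by simp

lemma threshold_square: "j \<ge> 1 \<Longrightarrow> (threshold \<alpha> j)\<^sup>2 = \<alpha>\<^sup>2 * ((real j)\<^sup>2 - 1)"
  unfolding threshold_def by (simp add: power_mult_distrib)

lemma threshold_ratio:
  assumes "\<alpha> > 0" "i \<ge> 2" "j \<ge> 1"
  shows "threshold \<alpha> j / threshold \<alpha> i = sqrt (((real j)\<^sup>2 - 1) / ((real i)\<^sup>2 - 1))"
  using assms unfolding threshold_def by (simp add: real_sqrt_divide)

text \<open>Levels bound in at most \<open>i\<close> modes gain nothing, and since the \<open>J a\<close> decrease, the others come first and
  the sharp bound applies to them.\<close>

lemma excess_ge_level_gains:
  assumes w: "potential w" and \<alpha>: "\<alpha> > 0" and i: "i \<ge> 2"
    and J: "\<And>a. a < n \<Longrightarrow> J a \<ge> 1" "\<And>a b. a \<le> b \<Longrightarrow> b < n \<Longrightarrow> J b \<le> J a"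
    and b: "\<And>a. a < n \<Longrightarrow> binds w (threshold \<alpha> (J a)) (Suc a)"
  shows "(\<Sum>a<n. level_gain i (J a)) \<le> excess (threshold \<alpha> i) w"
proof -
  let ?t = "threshold \<alpha>"
  define m where "m = (LEAST a. \<not> (a < n \<and> i < J a))"
  have m: "a < n \<and> i < J a" if "a < m" for a using not_less_Least that unfolding m_def by blast
  have m_not: "\<not> (m < n \<and> i < J m)" unfolding m_def by (rule LeastI[of _ n]) simp
  have mn: "m \<le> n"
  proof (rule ccontr)
    assume "\<not> m \<le> n"
    then have "n < m" by simp
    from m[OF this] show False by simp
  qed
  have rest: "level_gain i (J a) = 0" if "a < n" "\<not> a < m" for a
    using m_not that J(2)[of m a] by (auto simp: level_gain_def)
  have "(\<Sum>a<n. level_gain i (J a)) = (\<Sum>a<m. level_gain i (J a))"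
    using mn rest by (intro sum.mono_neutral_right) auto
  also have "\<dots> = (\<Sum>a<m. sqrt ((?t (J a))\<^sup>2 - (?t i)\<^sup>2) / ?t i)"
  proof (intro sum.cong refl)
    fix a assume "a \<in> {..<m}"
    then have a: "i < J a" using m by simp
    have "(?t (J a))\<^sup>2 - (?t i)\<^sup>2 = \<alpha>\<^sup>2 * ((real (J a))\<^sup>2 - (real i)\<^sup>2)"
      using a i by (simp add: threshold_square algebra_simps)
    then have "sqrt ((?t (J a))\<^sup>2 - (?t i)\<^sup>2) = \<alpha> * sqrt ((real (J a))\<^sup>2 - (real i)\<^sup>2)"
      using \<alpha> by (simp add: real_sqrt_mult)
    then show "level_gain i (J a) = sqrt ((?t (J a))\<^sup>2 - (?t i)\<^sup>2) / ?t i"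
      using a \<alpha> by (simp add: level_gain_def threshold_def real_sqrt_divide)
  qed
  also have "\<dots> = (\<Sum>a<m. sqrt ((?t (J a))\<^sup>2 - (?t i)\<^sup>2)) / ?t i" by (rule sum_divide_distrib[symmetric])
  also have "\<dots> \<le> excess (?t i) w"
  proof -
    have "2 * (\<Sum>a<m. sqrt ((?t (J a))\<^sup>2 - (?t i)\<^sup>2)) \<le> mass (\<lambda>x. max 0 (w x - (?t i)\<^sup>2))"
    proof (rule sum_levels_le[OF w])
      show "binds w (?t (J a)) (Suc a)" if "a < m" for a using b m[OF that] by blast
      show "?t i < ?t (J a)" if "a < m" for a
        using m[OF that] \<alpha> i unfolding threshold_def
        by (intro mult_strict_left_mono real_sqrt_less_mono diff_strict_right_mono power_strict_mono) auto
      show "?t (J b) \<le> ?t (J a)" if "a \<le> b" "b < m" for a b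
        using J(2)[OF that(1)] m[OF that(2)] by (intro threshold_mono \<alpha>) auto
      show "0 \<le> ?t i" using threshold_pos[OF \<alpha> i] by simp
    qed
    then show ?thesis unfolding excess_def using threshold_pos[OF \<alpha> i] by (simp add: field_simps)
  qed
  finally show ?thesis .
qed

lemma sum_by_value:
  fixes F :: "nat \<Rightarrow> real" and J :: "nat \<Rightarrow> nat"
  assumes "\<And>a. a < n \<Longrightarrow> J a \<in> {2, 3, 4}"
  shows "(\<Sum>a<n. F (J a)) = card {a. a < n \<and> J a = 2} * F 2 + card {a. a < n \<and> J a = 3} * F 3 + card {a. a < n \<and> J a = 4} * F 4"
proof -
  have one: "(\<Sum>a<n. if J a = j then F j else 0) = card {a. a < n \<and> J a = j} * F j" for j
  proof -
    have "(\<Sum>a<n. if J a = j then F j else 0) = (\<Sum>a\<in>{a \<in> {..<n}. J a = j}. F j)"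
      by (rule sum.inter_filter[symmetric]) simp
    then show ?thesis by simp
  qed
  have "(\<Sum>a<n. F (J a)) = (\<Sum>a<n. (if J a = 2 then F 2 else 0) + (if J a = 3 then F 3 else 0) + (if J a = 4 then F 4 else 0))"
    using assms by (intro sum.cong refl) auto
  then show ?thesis by (simp add: sum.distrib one)
qed

text \<open>Level \<open>a\<close> of the one-dimensional problem is bound in the modes \<open>1, \<dots>, J a\<close>, so the total number of negative directions is the sum of the \<open>J a\<close>.\<close>

lemma sum_levels_bound:
  assumes w: "potential w" and pc: "piecewise_continuous w" and \<alpha>: "\<alpha> > 0"
    and J: "\<And>a. a < n \<Longrightarrow> J a \<ge> 1" "\<And>a b. a \<le> b \<Longrightarrow> b < n \<Longrightarrow> J b \<le> J a"
    and b: "\<And>a. a < n \<Longrightarrow> binds w (threshold \<alpha> (J a)) (Suc a)"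
  shows "(\<Sum>a<n. real (J a)) \<le> 1 + spread w + excess (threshold \<alpha> 2) w + excess (threshold \<alpha> 3) w + excess (threshold \<alpha> 4) w"
proof (cases "n = 0")
  case True
  have "excess (threshold \<alpha> j) w \<ge> 0" if "j \<ge> 2" for j
    using that threshold_pos[OF \<alpha> that] by (intro excess_nonneg[OF w]) simp
  then show ?thesis using True spread_nonneg[OF w] by (simp add: add_nonneg_nonneg)
next
  case False
  let ?t = "threshold \<alpha>"
  define T where "T = spread w"
  define e where "e i = excess (?t i) w" for i
  define u where "u i = mass w / (2 * ?t i)" for i
  define c where "c = sqrt (3 * T) / 2"
  have T0: "T \<ge> 0" unfolding T_def by (rule spread_nonneg[OF w])
  have e0: "e j \<ge> 0" if "j \<ge> 2" for j
    using that threshold_pos[OF \<alpha> that] unfolding e_def by (intro excess_nonneg[OF w]) simp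
  have pos: "mass w > 0"
  proof -
    obtain \<psi> where \<psi>: "\<psi> (0::nat) \<in> C1_compact" "negative_system (schrodinger_form (?t (J 0)) w) (Suc 0) \<psi>"
      using b[of 0] False by (auto simp: binds_def)
    have "Re (schrodinger_form (?t (J 0)) w (\<psi> 0) (\<psi> 0)) < 0"
      using \<psi>(2) by (rule negative_system_single) simp
    then show ?thesis by (rule mass_pos[OF w \<psi>(1)])
  qed
  have sp: "2 * (real k - 1) * (1 + ?t j * T / (2 * mass w)) \<le> T" if "binds w (?t j) k" "k \<ge> 1" "j \<ge> 1" for k j
    using that negative_system_spread[OF w threshold_nonneg[OF \<alpha>]] unfolding binds_def T_def by blast
  have bn: "binds w (?t (J (n - 1))) n" using b[of "n - 1"] False by simp
  have T_n: "T \<ge> 2 * (real n - 1)"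
  proof -
    have "1 * (2 * (real n - 1)) \<le> (1 + ?t (J (n - 1)) * T / (2 * mass w)) * (2 * (real n - 1))"
      using False T0 pos threshold_nonneg[OF \<alpha> J(1)[of "n - 1"]]
      by (intro mult_right_mono) (auto intro!: divide_nonneg_pos mult_nonneg_nonneg)
    then show ?thesis using sp[OF bn] J(1)[of "n - 1"] False by (simp add: mult.commute)
  qed
  have gains: "(\<Sum>a<n. level_gain i (J a)) \<le> e i" if "i \<ge> 2" for i
    unfolding e_def by (rule excess_ge_level_gains[OF w \<alpha> that J b])
  have low: "u i - c \<le> e i" if "i \<ge> 2" for i
    unfolding u_def c_def e_def T_def by (rule excess_lower[OF w pc threshold_pos[OF \<alpha> that] pos])
  have u_ge: "(\<Sum>a<n. sqrt (((real (J a))\<^sup>2 - 1) / ((real i)\<^sup>2 - 1))) \<le> u i"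
    if i: "i \<ge> 2" and J2: "\<And>a. a < n \<Longrightarrow> J a \<ge> 2" for i
  proof -
    have "2 * (\<Sum>a<n. sqrt ((?t (J a))\<^sup>2 - 0\<^sup>2)) \<le> mass (\<lambda>x. max 0 (w x - 0\<^sup>2))"
      by (rule sum_levels_le[OF w b]) (use J(2) J2 in \<open>auto intro: threshold_mono[OF \<alpha>] threshold_pos[OF \<alpha>]\<close>)
    also have "mass (\<lambda>x. max 0 (w x - 0\<^sup>2)) = mass w"
      using potential_nonneg[OF w] by (simp add: mass_def)
    also have "(\<Sum>a<n. sqrt ((?t (J a))\<^sup>2 - 0\<^sup>2)) = (\<Sum>a<n. ?t (J a))"
      using threshold_nonneg[OF \<alpha> J(1)] by (intro sum.cong refl) simp
    finally have "(\<Sum>a<n. ?t (J a)) / ?t i \<le> u i"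
      using threshold_pos[OF \<alpha> i] unfolding u_def by (simp add: field_simps)
    moreover have "(\<Sum>a<n. ?t (J a)) / ?t i = (\<Sum>a<n. sqrt (((real (J a))\<^sup>2 - 1) / ((real i)\<^sup>2 - 1)))"
      unfolding sum_divide_distrib using threshold_ratio[OF \<alpha> i J(1)] by (intro sum.cong refl) simp
    ultimately show ?thesis by simp
  qed
  let ?D = "\<Sum>a<n. level_deficit (J a)"
  have D: "?D = (\<Sum>a<n. real (J a)) - real n
      - ((\<Sum>a<n. level_gain 2 (J a)) + (\<Sum>a<n. level_gain 3 (J a)) + (\<Sum>a<n. level_gain 4 (J a)))"
    unfolding level_deficit_def by (simp add: sum_subtractf sum.distrib)
  have goal: "(\<Sum>a<n. real (J a)) \<le> 1 + T + e 2 + e 3 + e 4"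
  \<comment> \<open>The spread, which is at least twice \<open>n - 1\<close>, pays for a total deficit of \<open>n - 1\<close>. As no deficit
    exceeds 1, a larger total leaves no level whose deficit is \<open>\<le> 0\<close>.\<close>
  proof (cases "?D \<le> real n - 1")
    case True
    then show ?thesis using T_n gains[of 2] gains[of 3] gains[of 4] unfolding D by simp
  next
    case D_gt: False
    have def_le: "level_deficit j \<le> 1" and def_pos: "level_deficit j > 0 \<Longrightarrow> j \<in> {2, 3, 4}" if "j \<ge> 1" for j
    proof -
      have "j = 1 \<or> j = 2 \<or> j = 3 \<or> j = 4 \<or> j \<ge> 5" using that by presburger
      then consider "j = 1" | "j = 2" | "j = 3" | "j = 4" | "j \<ge> 5" by blast
      then have "level_deficit j \<le> 1 \<and> (level_deficit j > 0 \<longrightarrow> j \<in> {2, 3, 4})"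
        using level_deficit_ge_5[of j] sqrt_numeric
        by cases (auto simp: level_deficit_1 level_deficit_2 level_deficit_3 level_deficit_4)
      then show "level_deficit j \<le> 1" "level_deficit j > 0 \<Longrightarrow> j \<in> {2, 3, 4}" by blast+
    qed
    have J234: "J a \<in> {2, 3, 4}" if a: "a < n" for a
    proof (rule def_pos[OF J(1)[OF a]])
      have "?D = level_deficit (J a) + (\<Sum>x\<in>{..<n} - {a}. level_deficit (J x))"
        using a by (intro sum.remove) auto
      moreover have "(\<Sum>x\<in>{..<n} - {a}. level_deficit (J x)) \<le> (\<Sum>x\<in>{..<n} - {a}. 1)"
        using def_le J(1) by (intro sum_mono) auto
      moreover have "(\<Sum>x\<in>{..<n} - {a}. 1) = real n - 1" using a by (simp add: of_nat_diff)
      ultimately show "level_deficit (J a) > 0" using D_gt by linarith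
    qed
    let ?x = "card {a. a < n \<and> J a = 2}" and ?y = "card {a. a < n \<and> J a = 3}" and ?z = "card {a. a < n \<and> J a = 4}"
    have val: "(\<Sum>a<n. F (J a)) = ?x * F 2 + ?y * F 3 + ?z * F 4" for F :: "nat \<Rightarrow> real"
      using J234 by (rule sum_by_value)
    have nxyz: "n = ?x + ?y + ?z" using val[of "\<lambda>_. 1"] by (simp flip: of_nat_add)
    have J2: "J a \<ge> 2" if "a < n" for a using J234[OF that] by auto
    have "2 * real ?x + 3 * real ?y + 4 * real ?z \<le> 1 + T + e 2 + e 3 + e 4"
    proof (rule exceptional_levels[where n = n and c = c])
      show "n = ?x + ?y + ?z" by (rule nxyz)
      show "1 \<le> n" using False by simp
      have "?D = ?x * 1 + ?y * (2 - sqrt (5 / 3)) + ?z * (1 - sqrt (7 / 8))"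
        using val[of level_deficit] by (simp add: level_deficit_2 level_deficit_3 level_deficit_4)
      then show "?y * (sqrt (5 / 3) - 1) + ?z * sqrt (7 / 8) < 1"
        using D_gt arg_cong[OF nxyz, of real] by (simp add: algebra_simps)
      show "T \<ge> 2 * (real n - 1)" by (rule T_n)
      show "2 \<le> T * (1 - 1 / (2 * u 2))" if n2: "n = 2"
      proof -
        have "binds w (?t 2) 2"
          using binds_antimono[OF bn threshold_nonneg[OF \<alpha>, of 2] threshold_mono[OF \<alpha>, of 2 "J (n - 1)"], of 2] J2[of "n - 1"] n2 by simp
        from sp[OF this] have "2 + ?t 2 * T / mass w \<le> T" by simp
        moreover have "T * (1 - 1 / (2 * u 2)) = T - ?t 2 * T / mass w"
          using pos threshold_pos[OF \<alpha>, of 2] by (simp add: u_def field_simps)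
        ultimately show ?thesis by linarith
      qed
      show "e 2 \<ge> ?y * sqrt (5 / 3) + ?z * 2"
        using gains[of 2] val[of "level_gain 2"] by (simp add: level_gain_2 level_gain_3 level_gain_4)
      show "e 3 \<ge> ?z * sqrt (7 / 8)"
        using gains[of 3] val[of "level_gain 3"] by (simp add: level_gain_2 level_gain_3 level_gain_4)
      show "c \<ge> 0" using T0 by (simp add: c_def)
      show "c\<^sup>2 = 3 / 4 * T" using T0 by (simp add: c_def power_divide)
      show "e 2 \<ge> u 2 - c" "e 3 \<ge> u 3 - c" "e 4 \<ge> u 4 - c" using low by simp_all
      show "e 4 \<ge> 0" by (rule e0) simp
      show "u 2 \<ge> ?x + ?y * sqrt (8 / 3) + ?z"
      proof -
        have "u 2 \<ge> ?x + ?y * sqrt (8 / 3) + ?z * sqrt 5"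
          using u_ge[of 2] J2 val[of "\<lambda>j. sqrt (((real j)\<^sup>2 - 1) / ((real 2)\<^sup>2 - 1))"] by simp
        moreover have "real ?z * 1 \<le> ?z * sqrt 5" by (intro mult_left_mono) auto
        ultimately show ?thesis by simp
      qed
      show "u 3 \<ge> ?x * sqrt (3 / 8) + ?y"
      proof -
        have "u 3 \<ge> ?x * sqrt (3 / 8) + ?y + ?z * sqrt (15 / 8)"
          using u_ge[of 3] J2 val[of "\<lambda>j. sqrt (((real j)\<^sup>2 - 1) / ((real 3)\<^sup>2 - 1))"] by simp
        moreover have "0 \<le> ?z * sqrt (15 / 8)" by simp
        ultimately show ?thesis by linarith
      qed
      show "u 3 = u 2 * sqrt (3 / 8)"
      proof -
        have "?t 2 / ?t 3 = sqrt (3 / 8)" using threshold_ratio[OF \<alpha>, of 3 2] by simp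
        moreover have "u 3 = u 2 * (?t 2 / ?t 3)"
          using threshold_pos[OF \<alpha>, of 2] threshold_pos[OF \<alpha>, of 3] by (simp add: u_def field_simps)
        ultimately show ?thesis by simp
      qed
      show "u 4 \<ge> ?x * sqrt (1 / 5) + ?z"
      proof -
        have "u 4 \<ge> ?x * sqrt (1 / 5) + ?y * sqrt (8 / 15) + ?z"
          using u_ge[of 4] J2 val[of "\<lambda>j. sqrt (((real j)\<^sup>2 - 1) / ((real 4)\<^sup>2 - 1))"] by simp
        moreover have "0 \<le> ?y * sqrt (8 / 15)" by simp
        ultimately show ?thesis by linarith
      qed
      show "T + e 2 + e 3 \<ge> u 2" if "u 2 \<ge> 1"
      proof -
        have "mass w \<ge> 2 * ?t 2" using that threshold_pos[OF \<alpha>, of 2] by (simp add: u_def field_simps)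
        then show ?thesis unfolding T_def e_def u_def
          by (intro spread_plus_excess_lower[OF w pc]) (use \<alpha> in \<open>auto simp: threshold_square threshold_pos\<close>)
      qed
    qed
    moreover have "(\<Sum>a<n. real (J a)) = 2 * real ?x + 3 * real ?y + 4 * real ?z" using val[of real] by simp
    ultimately show ?thesis by simp
  qed
  then show ?thesis by (simp add: T_def e_def)
qed

text \<open>Summation by levels instead of modes: the sets of modes with \<open>N j > a\<close> are initial segments.\<close>

lemma mode_count_bound:
  assumes w: "potential w" and pc: "piecewise_continuous w" and \<alpha>: "\<alpha> > 0"
    and N: "\<And>i j. 1 \<le> i \<Longrightarrow> i \<le> j \<Longrightarrow> N j \<le> N i"
    and b: "\<And>j. 1 \<le> j \<Longrightarrow> j \<le> K \<Longrightarrow> binds w (threshold \<alpha> j) (N j)"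
  shows "(\<Sum>j=1..K. real (N j)) \<le> 1 + spread w + excess (threshold \<alpha> 2) w + excess (threshold \<alpha> 3) w + excess (threshold \<alpha> 4) w"
proof -
  define J where "J a = card {j \<in> {1..K}. a < N j}" for a
  have set_eq: "{j \<in> {1..K}. a < N j} = {1..J a}" for a
  proof -
    have fin: "finite {j \<in> {1..K}. a < N j}" by simp
    show ?thesis
    proof (cases "{j \<in> {1..K}. a < N j} = {}")
      case True then show ?thesis by (simp add: J_def)
    next
      case False
      define M where "M = Max {j \<in> {1..K}. a < N j}"
      have M: "M \<in> {j \<in> {1..K}. a < N j}" unfolding M_def by (rule Max_in[OF fin False])
      have "{j \<in> {1..K}. a < N j} = {1..M}"
      proof (intro equalityI subsetI)
        fix j assume "j \<in> {j \<in> {1..K}. a < N j}"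
        then show "j \<in> {1..M}" using Max_ge[OF fin, of j] by (simp add: M_def)
      next
        fix j assume j: "j \<in> {1..M}"
        then have "N M \<le> N j" by (intro N) auto
        then show "j \<in> {j \<in> {1..K}. a < N j}" using M j by auto
      qed
      then show ?thesis by (simp add: J_def)
    qed
  qed
  define n where "n = (if K = 0 then 0 else N 1)"
  have "(\<Sum>j=1..K. real (N j)) = (\<Sum>j=1..K. \<Sum>a<n. if a < N j then 1 else 0)"
  proof (intro sum.cong refl)
    fix j assume j: "j \<in> {1..K}"
    then have "N j \<le> n" using N[of 1 j] by (auto simp: n_def)
    then have "{..<n} \<inter> {a. a < N j} = {..<N j}" by auto
    then show "real (N j) = (\<Sum>a<n. if a < N j then 1 else 0)" by (simp add: sum.If_cases)
  qed
  also have "\<dots> = (\<Sum>a<n. \<Sum>j=1..K. if a < N j then 1 else 0)" by (rule sum.swap)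
  also have "\<dots> = (\<Sum>a<n. real (J a))"
  proof (intro sum.cong refl)
    fix a
    have "{1..K} \<inter> {j. a < N j} = {j \<in> {1..K}. a < N j}" by auto
    then show "(\<Sum>j=1..K. if a < N j then 1 else 0) = real (J a)" by (simp add: sum.If_cases J_def)
  qed
  also have "\<dots> \<le> 1 + spread w + excess (threshold \<alpha> 2) w + excess (threshold \<alpha> 3) w + excess (threshold \<alpha> 4) w"
  proof (rule sum_levels_bound[OF w pc \<alpha>])
    show J1: "J a \<ge> 1" if "a < n" for a
    proof -
      have "1 \<in> {j \<in> {1..K}. a < N j}" using that by (auto simp: n_def split: if_splits)
      then show ?thesis unfolding set_eq by simp
    qed
    show "J b \<le> J a" if "a \<le> b" "b < n" for a b
      unfolding J_def using that by (intro card_mono) auto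
    show "binds w (threshold \<alpha> (J a)) (Suc a)" if a: "a < n" for a
    proof -
      have "J a \<in> {j \<in> {1..K}. a < N j}" unfolding set_eq using J1[OF a] by simp
      then have Ja: "1 \<le> J a" "J a \<le> K" "Suc a \<le> N (J a)" by auto
      show ?thesis by (rule binds_antimono[OF b[OF Ja(1,2)] threshold_nonneg[OF \<alpha> Ja(1)] order_refl Ja(3)])
    qed
  qed
  finally show ?thesis .
qed

section \<open>Sine modes on the cross-section\<close>

text \<open>A function without zeros inside the interval, here a cosine, gives the lower bound: the square
  \<open>(f' + \<nu> tan(\<nu>(x - m)) f)\<^sup>2\<close> differs from \<open>f'\<^sup>2 - \<nu>\<^sup>2 f\<^sup>2\<close> by an exact derivative, whose integral vanishes by the boundary
  conditions.\<close>

lemma dirichlet_interval: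
  fixes f f' :: "real \<Rightarrow> real"
  assumes pq: "p \<le> q" and \<nu>: "\<nu> > 0" "\<nu> * (q - p) < pi"
    and f: "\<And>x. (f has_vector_derivative f' x) (at x)" "continuous_on {p..q} f'"
    and z: "f p = 0" "f q = 0"
  shows "integral {p..q} (\<lambda>x. (f' x)\<^sup>2 - \<nu>\<^sup>2 * (f x)\<^sup>2) \<ge> 0"
proof -
  define m where "m = (p + q) / 2"
  define t where "t x = tan (\<nu> * (x - m))" for x
  have cf: "continuous_on {p..q} f"
    by (meson continuous_at_imp_continuous_on f(1) has_vector_derivative_continuous)
  have pos: "cos (\<nu> * (x - m)) \<noteq> 0" if x: "x \<in> {p..q}" for x
  proof -
    have "\<bar>x - m\<bar> \<le> (q - p) / 2" using x by (auto simp: m_def abs_le_iff field_simps)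
    then have "\<nu> * \<bar>x - m\<bar> \<le> \<nu> * ((q - p) / 2)" using \<nu> by (intro mult_left_mono) auto
    moreover have "\<nu> * ((q - p) / 2) < pi / 2" using \<nu>(2) by simp
    ultimately have "\<nu> * \<bar>x - m\<bar> < pi / 2" by linarith
    then have "\<bar>\<nu> * (x - m)\<bar> < pi / 2" using \<nu>(1) by (simp add: abs_mult)
    then have "- (pi / 2) < \<nu> * (x - m)" "\<nu> * (x - m) < pi / 2" unfolding abs_less_iff by linarith+
    then show ?thesis using cos_gt_zero_pi[of "\<nu> * (x - m)"] by simp
  qed
  have ct: "continuous_on {p..q} t"
    unfolding t_def using pos by (intro continuous_intros) auto
  have dt: "(t has_real_derivative \<nu> * (1 + (t x)\<^sup>2)) (at x)" if x: "x \<in> {p..q}" for x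
  proof -
    have "inverse ((cos (\<nu> * (x - m)))\<^sup>2) = 1 + (t x)\<^sup>2"
      using tan_sec[OF pos[OF x]] by (simp add: t_def power_inverse)
    then show ?thesis unfolding t_def
      by (auto intro!: derivative_eq_intros pos[OF x] simp: t_def divide_inverse)
  qed
  have dF: "((\<lambda>x. (f x)\<^sup>2 * (\<nu> * t x)) has_vector_derivative
      (2 * f x * f' x * (\<nu> * t x) + (f x)\<^sup>2 * (\<nu> * (\<nu> * (1 + (t x)\<^sup>2))))) (at x within {p..q})" if x: "x \<in> {p..q}" for x
  proof -
    have "(f has_real_derivative f' x) (at x)" using f(1) by (simp add: has_real_derivative_iff_has_vector_derivative)
    then have "((\<lambda>x. (f x)\<^sup>2 * (\<nu> * t x)) has_real_derivative
      (2 * f x * f' x * (\<nu> * t x) + (f x)\<^sup>2 * (\<nu> * (\<nu> * (1 + (t x)\<^sup>2))))) (at x)"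
      by (auto intro!: derivative_eq_intros dt[OF x] simp: algebra_simps)
    then show ?thesis by (simp add: has_real_derivative_iff_has_vector_derivative has_vector_derivative_at_within)
  qed
  have 1: "((\<lambda>x. 2 * f x * f' x * (\<nu> * t x) + (f x)\<^sup>2 * (\<nu> * (\<nu> * (1 + (t x)\<^sup>2)))) has_integral 0) {p..q}"
    using fundamental_theorem_of_calculus[OF pq dF] z by simp
  have 2: "((\<lambda>x. (f' x)\<^sup>2 - \<nu>\<^sup>2 * (f x)\<^sup>2) has_integral integral {p..q} (\<lambda>x. (f' x)\<^sup>2 - \<nu>\<^sup>2 * (f x)\<^sup>2)) {p..q}"
    by (intro integrable_integral integrable_continuous_interval continuous_intros f(2) cf)
  have 3: "((f' x)\<^sup>2 - \<nu>\<^sup>2 * (f x)\<^sup>2) + (2 * f x * f' x * (\<nu> * t x) + (f x)\<^sup>2 * (\<nu> * (\<nu> * (1 + (t x)\<^sup>2))))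
      = (f' x + \<nu> * t x * f x)\<^sup>2" for x by (simp add: power2_eq_square algebra_simps)
  have "((\<lambda>x. (f' x + \<nu> * t x * f x)\<^sup>2) has_integral integral {p..q} (\<lambda>x. (f' x)\<^sup>2 - \<nu>\<^sup>2 * (f x)\<^sup>2)) {p..q}"
    using has_integral_add[OF 2 1] unfolding 3 by simp
  then show ?thesis by (rule has_integral_nonneg) simp
qed

text \<open>The endpoints are nodes number 0 and \<open>K + 1\<close>.\<close>

lemma dirichlet_nodes:
  fixes f f' :: "real \<Rightarrow> real"
  assumes a: "a > 0" and f: "\<And>x. (f has_vector_derivative f' x) (at x)" "continuous_on UNIV f'"
    and z: "\<And>i. i \<le> Suc K \<Longrightarrow> f (- a + real i * (2 * a / Suc K)) = 0"
    and \<nu>: "\<nu> > 0" "\<nu> * (2 * a) < pi * Suc K"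
  shows "integral {-a..a} (\<lambda>x. (f' x)\<^sup>2 - \<nu>\<^sup>2 * (f x)\<^sup>2) \<ge> 0"
proof -
  let ?l = "2 * a / Suc K" and ?h = "\<lambda>x. (f' x)\<^sup>2 - \<nu>\<^sup>2 * (f x)\<^sup>2"
  have cf: "continuous_on A f" for A
    by (meson continuous_at_imp_continuous_on f(1) has_vector_derivative_continuous)
  have cf': "continuous_on A f'" for A using f(2) continuous_on_subset by blast
  have int: "?h integrable_on {p..q}" for p q
    by (intro integrable_continuous_interval continuous_intros cf cf')
  have "integral {-a..-a + real m * ?l} ?h \<ge> 0" if "m \<le> Suc K" for m
    using that
  proof (induction m)
    case (Suc m)
    let ?p = "-a + real m * ?l" and ?q = "-a + real (Suc m) * ?l"
    have l: "?l > 0" using a by simp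
    have "integral {-a..?p} ?h + integral {?p..?q} ?h = integral {-a..?q} ?h"
    proof (intro Henstock_Kurzweil_Integration.integral_combine int)
      have "0 \<le> real m * ?l" "real m * ?l \<le> real (Suc m) * ?l"
        using l by (intro mult_nonneg_nonneg mult_right_mono; simp)+
      then show "- a \<le> ?p" "?p \<le> ?q" by linarith+
    qed
    moreover have "integral {?p..?q} ?h \<ge> 0"
    proof (rule dirichlet_interval[OF _ \<nu>(1)])
      have "?q - ?p = ?l" unfolding of_nat_Suc[of m] distrib_right by simp
      moreover have "\<nu> * ?l = \<nu> * (2 * a) / Suc K" by simp
      moreover have "\<dots> < pi" using \<nu>(2) by (subst pos_divide_less_eq) auto
      ultimately show "\<nu> * (?q - ?p) < pi" by simp
      show "?p \<le> ?q" using l by (intro add_left_mono mult_right_mono) simp_all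
      show "f ?p = 0" "f ?q = 0" using Suc.prems by (intro z; simp)+
    qed (rule f cf')+
    ultimately show ?case using Suc by simp
  qed simp
  from this[of "Suc K"] show ?thesis by simp
qed

definition sine_freq :: "real \<Rightarrow> nat \<Rightarrow> real" where
  "sine_freq a j = real j * pi / (2 * a)"

definition sine_mode :: "real \<Rightarrow> nat \<Rightarrow> real \<Rightarrow> real" where
  "sine_mode a j u = sin (sine_freq a j * (u + a)) / sqrt a"

definition sine_mode_deriv :: "real \<Rightarrow> nat \<Rightarrow> real \<Rightarrow> real" where
  "sine_mode_deriv a j u = sine_freq a j * cos (sine_freq a j * (u + a)) / sqrt a"

lemma sine_mode_has_deriv: "(sine_mode a j has_real_derivative sine_mode_deriv a j u) (at u)"
  unfolding sine_mode_def sine_mode_deriv_def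
  by (rule DERIV_cdivide) (auto intro!: derivative_eq_intros)

lemma sine_mode_deriv_has_deriv:
  "(sine_mode_deriv a j has_real_derivative - ((sine_freq a j)\<^sup>2 * sine_mode a j u)) (at u)"
  unfolding sine_mode_def sine_mode_deriv_def times_divide_eq_right minus_divide_left
  by (rule DERIV_cdivide) (auto intro!: derivative_eq_intros simp: power2_eq_square)

lemma sine_mode_continuous: "continuous_on A (sine_mode a j)" "continuous_on A (sine_mode_deriv a j)"
  by (meson DERIV_continuous continuous_at_imp_continuous_on sine_mode_has_deriv sine_mode_deriv_has_deriv)+

lemma sine_mode_boundary: "a > 0 \<Longrightarrow> sine_mode a j (-a) = 0" "a > 0 \<Longrightarrow> sine_mode a j a = 0"
proof -
  assume a: "a > 0"
  have "sine_freq a j * (a + a) = real j * pi" using a by (simp add: sine_freq_def field_simps)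
  then show "sine_mode a j a = 0" unfolding sine_mode_def by simp
qed (simp add: sine_mode_def)

text \<open>Integration by parts moves the derivative from a Dirichlet function to the mode.\<close>

lemma sine_mode_by_parts:
  fixes f f' :: "real \<Rightarrow> real"
  assumes a: "a > 0" and f: "\<And>x. (f has_vector_derivative f' x) (at x)" "continuous_on UNIV f'"
    and z: "f (-a) = 0" "f a = 0"
  shows "integral {-a..a} (\<lambda>x. f' x * sine_mode_deriv a j x)
       = (sine_freq a j)\<^sup>2 * integral {-a..a} (\<lambda>x. f x * sine_mode a j x)"
proof -
  let ?k = "sine_freq a j"
  have cf: "continuous_on A f" for A
    by (meson continuous_at_imp_continuous_on f(1) has_vector_derivative_continuous)
  have cf': "continuous_on A f'" for A using f(2) continuous_on_subset by blast
  have d: "((\<lambda>x. f x * sine_mode_deriv a j x) has_vector_derivative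
      (f' x * sine_mode_deriv a j x - ?k\<^sup>2 * (f x * sine_mode a j x))) (at x within {-a..a})" for x
  proof -
    have "(f has_real_derivative f' x) (at x)" using f(1) by (simp add: has_real_derivative_iff_has_vector_derivative)
    then have "((\<lambda>x. f x * sine_mode_deriv a j x) has_real_derivative
      (f' x * sine_mode_deriv a j x - ?k\<^sup>2 * (f x * sine_mode a j x))) (at x)"
      by (rule DERIV_cong[OF DERIV_mult[OF _ sine_mode_deriv_has_deriv]]) (simp add: algebra_simps)
    then show ?thesis by (simp add: has_real_derivative_iff_has_vector_derivative has_vector_derivative_at_within)
  qed
  have "((\<lambda>x. f' x * sine_mode_deriv a j x - ?k\<^sup>2 * (f x * sine_mode a j x)) has_integral 0) {-a..a}"
    using fundamental_theorem_of_calculus[OF _ d] a z by simp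
  then have "integral {-a..a} (\<lambda>x. f' x * sine_mode_deriv a j x - ?k\<^sup>2 * (f x * sine_mode a j x)) = 0"
    by (rule integral_unique)
  then show ?thesis
    by (subst (asm) Henstock_Kurzweil_Integration.integral_diff)
       (auto intro!: integrable_continuous_interval continuous_intros sine_mode_continuous cf cf')
qed

text \<open>Orthogonality comes from integrating by parts in both orders, since the frequencies differ.\<close>

lemma sine_mode_orthonormal:
  assumes a: "a > 0" and ij: "i \<ge> 1" "j \<ge> 1"
  shows "integral {-a..a} (\<lambda>u. sine_mode a i u * sine_mode a j u) = (if i = j then 1 else 0)"
proof (cases "i = j")
  case False
  let ?I = "integral {-a..a} (\<lambda>u. sine_mode a i u * sine_mode a j u)"
  have d: "(sine_mode a k has_vector_derivative sine_mode_deriv a k x) (at x)" for x k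
    using sine_mode_has_deriv by (simp add: has_real_derivative_iff_has_vector_derivative)
  have "(sine_freq a j)\<^sup>2 * ?I = (sine_freq a i)\<^sup>2 * ?I"
    using sine_mode_by_parts[OF a d sine_mode_continuous(2) sine_mode_boundary[OF a], of i j]
      sine_mode_by_parts[OF a d sine_mode_continuous(2) sine_mode_boundary[OF a], of j i]
    by (simp add: mult.commute)
  moreover have "(sine_freq a j)\<^sup>2 \<noteq> (sine_freq a i)\<^sup>2"
    using a False by (simp add: sine_freq_def power2_eq_iff divide_simps)
  ultimately show ?thesis using False by simp
next
  case True
  let ?k = "sine_freq a j"
  have k: "?k > 0" using a ij by (simp add: sine_freq_def)
  let ?F = "\<lambda>u. ((u + a) / 2 - sin (2 * ?k * (u + a)) / (4 * ?k)) / a"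
  have d: "(?F has_vector_derivative sine_mode a j u * sine_mode a j u) (at u within {-a..a})" for u
  proof -
    have "cos (2 * ?k * (u + a)) = 1 - 2 * (sin (?k * (u + a)))\<^sup>2"
      using cos_double_sin[of "?k * (u + a)"] by (simp add: mult.assoc)
    then have eq: "(1 / 2 - cos (2 * ?k * (u + a)) * (2 * ?k) / (4 * ?k)) / a = sine_mode a j u * sine_mode a j u"
      using a k unfolding sine_mode_def by (simp add: power2_eq_square diff_divide_distrib)
    have "(?F has_real_derivative (1 / 2 - cos (2 * ?k * (u + a)) * (2 * ?k) / (4 * ?k)) / a) (at u)"
      by (rule DERIV_cdivide) (use k in \<open>auto intro!: derivative_eq_intros\<close>)
    then show ?thesis unfolding eq by (simp add: has_real_derivative_iff_has_vector_derivative has_vector_derivative_at_within)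
  qed
  have "2 * ?k * (a + a) = 2 * real j * pi" using a by (simp add: sine_freq_def field_simps)
  then have s: "sin (2 * ?k * (a + a)) = 0" using sin_2npi[of j] by (simp only:)
  have "((\<lambda>u. sine_mode a j u * sine_mode a j u) has_integral (?F a - ?F (-a))) {-a..a}"
    using a by (intro fundamental_theorem_of_calculus d) auto
  moreover have "?F a - ?F (-a) = 1" unfolding s using a by simp
  ultimately show ?thesis using True by (simp add: integral_unique)
qed

text \<open>\<open>K\<close> interior nodes can be imposed on the \<open>K + 1\<close>-dimensional span of \<open>h\<close> and the first
  \<open>K\<close> modes. Between consecutive nodes the Dirichlet bound with the frequency \<open>\<nu>\<close> applies, while
  the modes alone lie strictly below it; so the nodal combination contains \<open>h\<close>, and what is left
  of \<open>h\<close> after removing the modes obeys the bound.\<close>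

lemma sine_gap:
  fixes h h' :: "real \<Rightarrow> real"
  assumes a: "a > 0" and h: "\<And>x. (h has_vector_derivative h' x) (at x)" "continuous_on UNIV h'"
    and z: "h (-a) = 0" "h a = 0"
    and \<nu>: "\<nu> = (real K + 1 / 2) * pi / (2 * a)"
    and c: "\<And>j. c j = integral {-a..a} (\<lambda>u. h u * sine_mode a j u)"
  shows "integral {-a..a} (\<lambda>u. (h' u)\<^sup>2)
     \<ge> \<nu>\<^sup>2 * integral {-a..a} (\<lambda>u. (h u)\<^sup>2) + (\<Sum>j=1..K. ((sine_freq a j)\<^sup>2 - \<nu>\<^sup>2) * (c j)\<^sup>2)"
proof -
  define I where "I g = integral {-a..a} g" for g :: "real \<Rightarrow> real"
  have ch: "continuous_on A h" for A
    by (meson continuous_at_imp_continuous_on h(1) has_vector_derivative_continuous)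
  have ch': "continuous_on A h'" for A using h(2) continuous_on_subset by blast
  have Ilin: "I (\<lambda>u. x * g u + (\<Sum>j=1..K. y j * k j u)) = x * I g + (\<Sum>j=1..K. y j * I (k j))"
    if "continuous_on UNIV g" "\<And>j. continuous_on UNIV (k j)" for x g y k
  proof -
    have c: "continuous_on {-a..a} g" "continuous_on {-a..a} (k j)" for j
      using that continuous_on_subset by blast+
    then have "g integrable_on {-a..a}" "k j integrable_on {-a..a}" for j
      by (auto intro: integrable_continuous_interval)
    then have "((\<lambda>u. x * g u + (\<Sum>j=1..K. y j * k j u)) has_integral x * I g + (\<Sum>j=1..K. y j * I (k j))) {-a..a}"
      unfolding I_def
      by (intro has_integral_add has_integral_mult_right has_integral_sum integrable_integral) auto
    then show ?thesis unfolding I_def by (rule integral_unique)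
  qed
  define node where "node i = - a + real i * (2 * a / Suc K)" for i
  have "\<exists>d. (\<exists>i\<in>{0..K}. d i \<noteq> 0) \<and>
      (\<forall>l<K. (\<Sum>i\<in>{0..K}. (if i = 0 then h (node (Suc l)) else sine_mode a i (node (Suc l))) * d i) = 0)"
    by (rule homogeneous_system_nontrivial) auto
  then obtain d :: "nat \<Rightarrow> real" where d: "\<exists>i\<in>{0..K}. d i \<noteq> 0"
    and d0: "\<And>l. l < K \<Longrightarrow> (\<Sum>i\<in>{0..K}. (if i = 0 then h (node (Suc l)) else sine_mode a i (node (Suc l))) * d i) = 0"
    by blast
  define f where "f u = d 0 * h u + (\<Sum>j=1..K. d j * sine_mode a j u)" for u
  define f' where "f' u = d 0 * h' u + (\<Sum>j=1..K. d j * sine_mode_deriv a j u)" for u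
  have node0: "f (node (Suc l)) = 0" if "l < K" for l
  proof -
    have "{0..K} = insert 0 {1..K}" by auto
    then have "(\<Sum>i\<in>{0..K}. (if i = 0 then h (node (Suc l)) else sine_mode a i (node (Suc l))) * d i) = f (node (Suc l))"
      unfolding f_def by (auto intro!: sum.cong)
    then show ?thesis using d0[OF that] by simp
  qed
  have fa: "f (-a) = 0" "f a = 0" unfolding f_def using z sine_mode_boundary[OF a] by simp_all
  have f: "(f has_vector_derivative f' x) (at x)" for x
    unfolding f_def f'_def
    by (intro has_vector_derivative_add has_vector_derivative_mult_right has_vector_derivative_sum h(1))
       (use sine_mode_has_deriv in \<open>simp add: has_real_derivative_iff_has_vector_derivative\<close>)
  have cf': "continuous_on UNIV f'" unfolding f'_def by (intro continuous_intros ch' sine_mode_continuous)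
  have cf: "continuous_on UNIV f" unfolding f_def by (intro continuous_intros ch sine_mode_continuous)
  let ?q = "\<lambda>j. (sine_freq a j)\<^sup>2 - \<nu>\<^sup>2"
  have K0: "\<nu> > 0" using a unfolding \<nu> by (intro divide_pos_pos mult_pos_pos) auto
  have fm: "I (\<lambda>u. sine_mode a j u * f u) = d 0 * c j + d j" if j: "j \<in> {1..K}" for j
  proof -
    have "I (\<lambda>u. sine_mode a j u * f u)
        = I (\<lambda>u. d 0 * (h u * sine_mode a j u) + (\<Sum>i=1..K. d i * (sine_mode a i u * sine_mode a j u)))"
      unfolding f_def by (simp add: algebra_simps sum_distrib_left)
    also have "\<dots> = d 0 * c j + (\<Sum>i=1..K. d i * I (\<lambda>u. sine_mode a i u * sine_mode a j u))"
      unfolding c I_def[symmetric] by (intro Ilin continuous_intros ch sine_mode_continuous)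
    also have "(\<Sum>i=1..K. d i * I (\<lambda>u. sine_mode a i u * sine_mode a j u)) = (\<Sum>i=1..K. if i = j then d i else 0)"
      unfolding I_def using sine_mode_orthonormal[OF a] j by (intro sum.cong) auto
    finally show ?thesis using j by simp
  qed
  have by_parts: "I (\<lambda>u. sine_mode_deriv a j u * f' u) - \<nu>\<^sup>2 * I (\<lambda>u. sine_mode a j u * f u) = ?q j * (d 0 * c j + d j)"
    if j: "j \<in> {1..K}" for j
    using sine_mode_by_parts[OF a f cf' fa, of j] fm[OF j] unfolding I_def
    by (simp add: algebra_simps)
  have hm: "I (\<lambda>u. h' u * sine_mode_deriv a j u) = (sine_freq a j)\<^sup>2 * c j" for j
    unfolding c I_def by (rule sine_mode_by_parts[OF a h z])
  have hf': "I (\<lambda>u. h' u * f' u) = d 0 * I (\<lambda>u. (h' u)\<^sup>2) + (\<Sum>j=1..K. d j * ((sine_freq a j)\<^sup>2 * c j))"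
  proof -
    have "I (\<lambda>u. h' u * f' u) = I (\<lambda>u. d 0 * (h' u)\<^sup>2 + (\<Sum>j=1..K. d j * (h' u * sine_mode_deriv a j u)))"
      unfolding f'_def by (simp add: algebra_simps sum_distrib_left power2_eq_square)
    then show ?thesis using Ilin[of "\<lambda>u. (h' u)\<^sup>2" "\<lambda>j u. h' u * sine_mode_deriv a j u" "d 0" d]
      by (simp add: hm ch' continuous_on_power continuous_on_mult sine_mode_continuous)
  qed
  have hf: "I (\<lambda>u. h u * f u) = d 0 * I (\<lambda>u. (h u)\<^sup>2) + (\<Sum>j=1..K. d j * c j)"
  proof -
    have "I (\<lambda>u. h u * f u) = I (\<lambda>u. d 0 * (h u)\<^sup>2 + (\<Sum>j=1..K. d j * (h u * sine_mode a j u)))"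
      unfolding f_def by (simp add: algebra_simps sum_distrib_left power2_eq_square)
    then show ?thesis using Ilin[of "\<lambda>u. (h u)\<^sup>2" "\<lambda>j u. h u * sine_mode a j u" "d 0" d]
      by (simp add: c I_def ch continuous_on_power continuous_on_mult sine_mode_continuous)
  qed
  have ff': "I (\<lambda>u. (f' u)\<^sup>2) = d 0 * I (\<lambda>u. h' u * f' u) + (\<Sum>j=1..K. d j * I (\<lambda>u. sine_mode_deriv a j u * f' u))"
  proof -
    have "I (\<lambda>u. (f' u)\<^sup>2) = I (\<lambda>u. d 0 * (h' u * f' u) + (\<Sum>j=1..K. d j * (sine_mode_deriv a j u * f' u)))"
      unfolding power2_eq_square by (subst (2) f'_def) (simp add: algebra_simps sum_distrib_left)
    also have "\<dots> = d 0 * I (\<lambda>u. h' u * f' u) + (\<Sum>j=1..K. d j * I (\<lambda>u. sine_mode_deriv a j u * f' u))"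
      by (intro Ilin continuous_intros cf' ch' sine_mode_continuous)
    finally show ?thesis .
  qed
  have ff: "I (\<lambda>u. (f u)\<^sup>2) = d 0 * I (\<lambda>u. h u * f u) + (\<Sum>j=1..K. d j * I (\<lambda>u. sine_mode a j u * f u))"
  proof -
    have "I (\<lambda>u. (f u)\<^sup>2) = I (\<lambda>u. d 0 * (h u * f u) + (\<Sum>j=1..K. d j * (sine_mode a j u * f u)))"
      unfolding power2_eq_square by (subst (2) f_def) (simp add: algebra_simps sum_distrib_left)
    also have "\<dots> = d 0 * I (\<lambda>u. h u * f u) + (\<Sum>j=1..K. d j * I (\<lambda>u. sine_mode a j u * f u))"
      by (intro Ilin continuous_intros cf ch sine_mode_continuous)
    finally show ?thesis .
  qed
  \<comment> \<open>Completing squares in the coefficients \<open>d j\<close> isolates the asserted difference \<open>?X\<close>; the squares carry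
    negative factors.\<close>
  let ?X = "I (\<lambda>u. (h' u)\<^sup>2) - \<nu>\<^sup>2 * I (\<lambda>u. (h u)\<^sup>2) - (\<Sum>j=1..K. ?q j * (c j)\<^sup>2)"
  have "I (\<lambda>u. (f' u)\<^sup>2) - \<nu>\<^sup>2 * I (\<lambda>u. (f u)\<^sup>2)
      = d 0 * (I (\<lambda>u. h' u * f' u) - \<nu>\<^sup>2 * I (\<lambda>u. h u * f u))
      + (\<Sum>j=1..K. d j * (I (\<lambda>u. sine_mode_deriv a j u * f' u) - \<nu>\<^sup>2 * I (\<lambda>u. sine_mode a j u * f u)))"
    unfolding ff ff' by (simp add: algebra_simps sum_subtractf sum_distrib_left)
  also have "(\<Sum>j=1..K. d j * (I (\<lambda>u. sine_mode_deriv a j u * f' u) - \<nu>\<^sup>2 * I (\<lambda>u. sine_mode a j u * f u)))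
      = (\<Sum>j=1..K. d j * (?q j * (d 0 * c j + d j)))"
    using by_parts by (intro sum.cong refl) simp
  also have "I (\<lambda>u. h' u * f' u) - \<nu>\<^sup>2 * I (\<lambda>u. h u * f u)
      = d 0 * (I (\<lambda>u. (h' u)\<^sup>2) - \<nu>\<^sup>2 * I (\<lambda>u. (h u)\<^sup>2)) + (\<Sum>j=1..K. d j * (?q j * c j))"
    unfolding hf hf' by (simp add: algebra_simps sum_subtractf sum_distrib_left)
  also have "d 0 * (d 0 * (I (\<lambda>u. (h' u)\<^sup>2) - \<nu>\<^sup>2 * I (\<lambda>u. (h u)\<^sup>2)) + (\<Sum>j=1..K. d j * (?q j * c j)))
        + (\<Sum>j=1..K. d j * (?q j * (d 0 * c j + d j)))
      = (d 0)\<^sup>2 * ?X + (\<Sum>j=1..K. ?q j * (d j + d 0 * c j)\<^sup>2)"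
    unfolding power2_sum power_mult_distrib distrib_left right_diff_distrib sum.distrib sum_distrib_left
    by (simp add: power2_eq_square algebra_simps sum.distrib[symmetric] sum_subtractf[symmetric])
  finally have expand: "I (\<lambda>u. (f' u)\<^sup>2) - \<nu>\<^sup>2 * I (\<lambda>u. (f u)\<^sup>2)
      = (d 0)\<^sup>2 * ?X + (\<Sum>j=1..K. ?q j * (d j + d 0 * c j)\<^sup>2)" .
  have "integral {-a..a} (\<lambda>x. (f' x)\<^sup>2 - \<nu>\<^sup>2 * (f x)\<^sup>2) \<ge> 0"
  proof (rule dirichlet_nodes[OF a f cf' _ K0])
    show "f (- a + real i * (2 * a / real (Suc K))) = 0" if "i \<le> Suc K" for i
    proof -
      have "node 0 = - a" "node (Suc K) = a" unfolding node_def by simp_all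
      then have "f (node i) = 0"
        using that node0 fa by (cases i) (auto simp: le_less)
      then show ?thesis unfolding node_def .
    qed
    show "\<nu> * (2 * a) < pi * real (Suc K)" 
    proof -
      have "\<nu> * (2 * a) = (real K + 1 / 2) * pi" using a unfolding \<nu> by simp
      also have "\<dots> < real (Suc K) * pi" by (intro mult_strict_right_mono) auto
      finally show ?thesis by (simp only: mult.commute)
    qed
  qed
  moreover have "integral {-a..a} (\<lambda>x. (f' x)\<^sup>2 - \<nu>\<^sup>2 * (f x)\<^sup>2) = I (\<lambda>u. (f' u)\<^sup>2) - \<nu>\<^sup>2 * I (\<lambda>u. (f u)\<^sup>2)"
    unfolding I_def using cf cf' 
    by (subst Henstock_Kurzweil_Integration.integral_diff)
       (auto intro!: integrable_continuous_interval continuous_intros intro: continuous_on_subset)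
  ultimately have nn: "(d 0)\<^sup>2 * ?X + (\<Sum>j=1..K. ?q j * (d j + d 0 * c j)\<^sup>2) \<ge> 0" using expand by simp
  have q_neg: "?q j < 0" if "j \<in> {1..K}" for j
  proof -
    have "sine_freq a j < \<nu>" using that a unfolding \<nu> sine_freq_def
      by (intro divide_strict_right_mono mult_strict_right_mono) auto
    moreover have "0 \<le> sine_freq a j" using a by (simp add: sine_freq_def)
    ultimately show ?thesis by (simp add: power_strict_mono)
  qed
  have "?X \<ge> 0"
  proof (rule ccontr)
    assume X: "\<not> ?X \<ge> 0"
    have le: "?q j * (d j + d 0 * c j)\<^sup>2 \<le> 0" if "j \<in> {1..K}" for j
      using q_neg[OF that] by (intro mult_nonpos_nonneg) auto
    then have s: "(\<Sum>j=1..K. ?q j * (d j + d 0 * c j)\<^sup>2) \<le> 0" by (rule sum_nonpos)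
    have "(d 0)\<^sup>2 * ?X \<le> 0" using X by (intro mult_nonneg_nonpos) auto
    then have 0: "(d 0)\<^sup>2 * ?X = 0" "(\<Sum>j=1..K. ?q j * (d j + d 0 * c j)\<^sup>2) = 0" using s nn by linarith+
    then have d00: "d 0 = 0" using X by (simp only: mult_eq_0_iff power_eq_0_iff) auto
    have "d j = 0" if j: "j \<in> {1..K}" for j
    proof -
      have "?q j * (d j + d 0 * c j)\<^sup>2 = 0"
      proof -
        have "(\<Sum>j=1..K. - (?q j * (d j + d 0 * c j)\<^sup>2)) = 0" using 0(2) by (simp add: sum_negf)
        moreover have "\<forall>j\<in>{1..K}. 0 \<le> - (?q j * (d j + d 0 * c j)\<^sup>2)" using le by fastforce
        ultimately have "\<forall>j\<in>{1..K}. - (?q j * (d j + d 0 * c j)\<^sup>2) = 0"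
          using sum_nonneg_eq_0_iff[of "{1..K}" "\<lambda>j. - (?q j * (d j + d 0 * c j)\<^sup>2)"] by simp
        then show ?thesis using j by fastforce
      qed
      then show ?thesis using q_neg[OF j] d00 by simp
    qed
    then show False using d d00 by (metis One_nat_def atLeastAtMost_iff le_0_eq not_less_eq_eq)
  qed
  then show ?thesis unfolding I_def by simp
qed

lemma sine_bessel:
  fixes h :: "real \<Rightarrow> real"
  assumes a: "a > 0" and ch: "continuous_on {-a..a} h"
    and c: "\<And>j. c j = integral {-a..a} (\<lambda>u. h u * sine_mode a j u)"
  shows "(\<Sum>j=1..K. (c j)\<^sup>2) \<le> integral {-a..a} (\<lambda>u. (h u)\<^sup>2)"
proof -
  define I where "I g = integral {-a..a} g" for g :: "real \<Rightarrow> real"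
  define p where "p u = (\<Sum>j=1..K. c j * sine_mode a j u)" for u
  have cp: "continuous_on {-a..a} p" unfolding p_def by (intro continuous_intros sine_mode_continuous)
  have lin: "I (\<lambda>u. \<Sum>j=1..K. c j * (g u * sine_mode a j u)) = (\<Sum>j=1..K. c j * I (\<lambda>u. g u * sine_mode a j u))"
    if "continuous_on {-a..a} g" for g
    unfolding I_def using that
    by (subst integral_sum) (auto intro!: integrable_continuous_interval continuous_intros sine_mode_continuous)
  have hp: "I (\<lambda>u. h u * p u) = (\<Sum>j=1..K. (c j)\<^sup>2)"
  proof -
    have "I (\<lambda>u. h u * p u) = I (\<lambda>u. \<Sum>j=1..K. c j * (h u * sine_mode a j u))"
      unfolding p_def by (simp add: sum_distrib_left algebra_simps)
    then show ?thesis using lin[OF ch] by (simp add: c I_def power2_eq_square)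
  qed
  have mp: "I (\<lambda>u. p u * sine_mode a j u) = c j" if j: "j \<in> {1..K}" for j
  proof -
    have "I (\<lambda>u. p u * sine_mode a j u) = I (\<lambda>u. \<Sum>i=1..K. c i * (sine_mode a j u * sine_mode a i u))"
      unfolding p_def by (simp add: sum_distrib_left sum_distrib_right algebra_simps)
    also have "\<dots> = (\<Sum>i=1..K. c i * I (\<lambda>u. sine_mode a j u * sine_mode a i u))"
      by (rule lin) (rule sine_mode_continuous)
    also have "\<dots> = (\<Sum>i=1..K. if i = j then c i else 0)"
      unfolding I_def using sine_mode_orthonormal[OF a] j by (intro sum.cong) auto
    finally show ?thesis using j by simp
  qed
  have pp: "I (\<lambda>u. p u * p u) = (\<Sum>j=1..K. (c j)\<^sup>2)"
  proof -
    have "I (\<lambda>u. p u * p u) = I (\<lambda>u. \<Sum>j=1..K. c j * (p u * sine_mode a j u))"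
      by (subst (2) p_def) (simp add: sum_distrib_left algebra_simps)
    also have "\<dots> = (\<Sum>j=1..K. c j * I (\<lambda>u. p u * sine_mode a j u))" by (rule lin[OF cp])
    also have "\<dots> = (\<Sum>j=1..K. (c j)\<^sup>2)" using mp by (intro sum.cong) (auto simp: power2_eq_square)
    finally show ?thesis .
  qed
  have "0 \<le> I (\<lambda>u. (h u - p u)\<^sup>2)" unfolding I_def by (rule integral_nonneg)
    (auto intro!: integrable_continuous_interval continuous_intros ch cp)
  also have "I (\<lambda>u. (h u - p u)\<^sup>2) = I (\<lambda>u. (h u)\<^sup>2 - 2 * (h u * p u) + p u * p u)"
    by (simp add: power2_eq_square algebra_simps)
  also have "\<dots> = I (\<lambda>u. (h u)\<^sup>2) - 2 * I (\<lambda>u. h u * p u) + I (\<lambda>u. p u * p u)"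
  proof -
    have "(\<lambda>u. (h u)\<^sup>2) integrable_on {-a..a}" "(\<lambda>u. h u * p u) integrable_on {-a..a}" "(\<lambda>u. p u * p u) integrable_on {-a..a}"
      by (intro integrable_continuous_interval continuous_intros ch cp)+
    then have "((\<lambda>u. (h u)\<^sup>2 - 2 * (h u * p u) + p u * p u) has_integral
        I (\<lambda>u. (h u)\<^sup>2) - 2 * I (\<lambda>u. h u * p u) + I (\<lambda>u. p u * p u)) {-a..a}"
      unfolding I_def by (intro has_integral_add has_integral_diff has_integral_mult_right integrable_integral)
    then show ?thesis unfolding I_def by (rule integral_unique)
  qed
  finally show ?thesis unfolding hp pp I_def by simp
qed

text \<open>The complex versions follow by treating real and imaginary parts separately.\<close>

definition sine_coeff :: "real \<Rightarrow> nat \<Rightarrow> (real \<Rightarrow> complex) \<Rightarrow> complex" where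
  "sine_coeff a j h = integral {-a..a} (\<lambda>u. of_real (sine_mode a j u) * h u)"

lemma sine_coeff_parts:
  assumes "continuous_on {-a..a} h"
  shows "Re (sine_coeff a j h) = integral {-a..a} (\<lambda>u. Re (h u) * sine_mode a j u)"
    and "Im (sine_coeff a j h) = integral {-a..a} (\<lambda>u. Im (h u) * sine_mode a j u)"
proof -
  have "((\<lambda>u. of_real (sine_mode a j u) * h u) has_integral sine_coeff a j h) {-a..a}"
    unfolding sine_coeff_def
    by (intro integrable_integral integrable_continuous_interval continuous_intros assms sine_mode_continuous)
  from has_integral_Re[OF this] has_integral_Im[OF this]
  show "Re (sine_coeff a j h) = integral {-a..a} (\<lambda>u. Re (h u) * sine_mode a j u)"
    "Im (sine_coeff a j h) = integral {-a..a} (\<lambda>u. Im (h u) * sine_mode a j u)"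
    by (simp_all add: integral_unique mult.commute)
qed

lemma integral_cmod_square:
  fixes h :: "real \<Rightarrow> complex"
  assumes "continuous_on {-a..a} h"
  shows "integral {-a..a} (\<lambda>u. (cmod (h u))\<^sup>2)
     = integral {-a..a} (\<lambda>u. (Re (h u))\<^sup>2) + integral {-a..a} (\<lambda>u. (Im (h u))\<^sup>2)"
  unfolding cmod_power2
  by (intro Henstock_Kurzweil_Integration.integral_add integrable_continuous_interval continuous_intros assms)

lemma complex_sine_bessel:
  assumes a: "a > 0" and h: "continuous_on {-a..a} h"
  shows "(\<Sum>j=1..K. (cmod (sine_coeff a j h))\<^sup>2) \<le> integral {-a..a} (\<lambda>u. (cmod (h u))\<^sup>2)"
proof -
  have "continuous_on {-a..a} (\<lambda>u. Re (h u))" "continuous_on {-a..a} (\<lambda>u. Im (h u))"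
    using h by (auto intro: continuous_intros)
  from sine_bessel[OF a this(1) refl, of K] sine_bessel[OF a this(2) refl, of K]
  show ?thesis
    unfolding integral_cmod_square[OF h] unfolding cmod_power2 sum.distrib sine_coeff_parts[OF h] by (rule add_mono)
qed

lemma complex_sine_gap:
  fixes h h' :: "real \<Rightarrow> complex"
  assumes a: "a > 0" and h: "\<And>x. (h has_vector_derivative h' x) (at x)" "continuous_on UNIV h'"
    and z: "h (-a) = 0" "h a = 0"
    and \<nu>: "\<nu> = (real K + 1 / 2) * pi / (2 * a)"
  shows "integral {-a..a} (\<lambda>u. (cmod (h' u))\<^sup>2) \<ge> \<nu>\<^sup>2 * integral {-a..a} (\<lambda>u. (cmod (h u))\<^sup>2)
     + (\<Sum>j=1..K. ((sine_freq a j)\<^sup>2 - \<nu>\<^sup>2) * (cmod (sine_coeff a j h))\<^sup>2)"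
proof -
  have ch: "continuous_on A h" for A
    by (meson continuous_at_imp_continuous_on h(1) has_vector_derivative_continuous)
  have ch': "continuous_on A h'" for A using h(2) continuous_on_subset by blast
  have re: "((\<lambda>x. Re (h x)) has_vector_derivative Re (h' x)) (at x)"
    and im: "((\<lambda>x. Im (h x)) has_vector_derivative Im (h' x)) (at x)" for x
    using h(1)[of x] by (auto intro: bounded_linear.has_vector_derivative bounded_linear_Re bounded_linear_Im)
  have "continuous_on UNIV (\<lambda>x. Re (h' x))" "continuous_on UNIV (\<lambda>x. Im (h' x))"
    by (intro continuous_intros ch')+
  from sine_gap[OF a re this(1) _ _ \<nu> refl] sine_gap[OF a im this(2) _ _ \<nu> refl] z
  have "integral {-a..a} (\<lambda>u. (Re (h' u))\<^sup>2) + integral {-a..a} (\<lambda>u. (Im (h' u))\<^sup>2)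
      \<ge> (\<nu>\<^sup>2 * integral {-a..a} (\<lambda>u. (Re (h u))\<^sup>2)
          + (\<Sum>j=1..K. ((sine_freq a j)\<^sup>2 - \<nu>\<^sup>2) * (integral {-a..a} (\<lambda>u. Re (h u) * sine_mode a j u))\<^sup>2))
        + (\<nu>\<^sup>2 * integral {-a..a} (\<lambda>u. (Im (h u))\<^sup>2)
          + (\<Sum>j=1..K. ((sine_freq a j)\<^sup>2 - \<nu>\<^sup>2) * (integral {-a..a} (\<lambda>u. Im (h u) * sine_mode a j u))\<^sup>2))"
    by (intro add_mono) auto
  then show ?thesis
    unfolding integral_cmod_square[OF ch] integral_cmod_square[OF ch'] sine_coeff_parts[OF ch, symmetric]
    unfolding cmod_power2 distrib_left sum.distrib by linarith
qed

section \<open>Functions on the strip\<close>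

text \<open>Linear combinations and sine coefficients of test functions only involve first derivatives, so this
  class, on which the partial derivatives are visibly linear, replaces the smooth functions.\<close>

definition strip_C1 :: "real \<Rightarrow> (real \<times> real \<Rightarrow> complex) set" where
  "strip_C1 a = {f. (\<forall>s u. ((\<lambda>t. f (t, u)) has_vector_derivative partial_s f (s, u)) (at s)) \<and>
     (\<forall>s u. ((\<lambda>t. f (s, t)) has_vector_derivative partial_u f (s, u)) (at u)) \<and>
     continuous_on UNIV f \<and> continuous_on UNIV (partial_s f) \<and> continuous_on UNIV (partial_u f) \<and>
     (\<exists>K. compact K \<and> K \<subseteq> straight_strip a \<and> (\<forall>p. p \<notin> K \<longrightarrow> f p = 0))}"

lemma strip_C1_I:
  assumes "\<And>s u. ((\<lambda>t. f (t, u)) has_vector_derivative fs (s, u)) (at s)"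
    and "\<And>s u. ((\<lambda>t. f (s, t)) has_vector_derivative fu (s, u)) (at u)"
    and "continuous_on UNIV f" "continuous_on UNIV fs" "continuous_on UNIV fu"
    and "compact K" "K \<subseteq> straight_strip a" "\<And>p. p \<notin> K \<Longrightarrow> f p = 0"
  shows "f \<in> strip_C1 a" "partial_s f = fs" "partial_u f = fu"
proof -
  show 1: "partial_s f = fs" using assms(1) by (auto simp: partial_s_def fun_eq_iff intro: vector_derivative_at)
  show 2: "partial_u f = fu" using assms(2) by (auto simp: partial_u_def fun_eq_iff intro: vector_derivative_at)
  show "f \<in> strip_C1 a" using assms unfolding strip_C1_def mem_Collect_eq 1 2 by blast
qed

lemma test_function_strip_C1:
  assumes "f \<in> test_functions (straight_strip a)" shows "f \<in> strip_C1 a"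
proof -
  have sm: "smooth f" using assms by (simp add: test_functions_def)
  have d: "g differentiable (at p)" if "smooth g" for g p using that by (cases rule: smooth.cases) auto
  have cont: "continuous_on UNIV g" if "smooth g" for g
    by (intro continuous_at_imp_continuous_on ballI differentiable_imp_continuous_within d[OF that])
  have sm': "smooth (partial_s f)" "smooth (partial_u f)" using sm by (auto elim: smooth.cases)
  have "(\<lambda>t. f (t, u)) differentiable (at s)" for s u
  proof -
    have "(f \<circ> (\<lambda>t. (t, u))) differentiable (at s)"
      by (rule differentiable_chain_at[OF _ d[OF sm]])
         (auto simp: differentiable_def intro!: derivative_eq_intros exI)
    then show ?thesis by (simp add: o_def)
  qed
  moreover have "(\<lambda>t. f (s, t)) differentiable (at u)" for s u
  proof -
    have "(f \<circ> (\<lambda>t. (s, t))) differentiable (at u)"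
      by (rule differentiable_chain_at[OF _ d[OF sm]])
         (auto simp: differentiable_def intro!: derivative_eq_intros exI)
    then show ?thesis by (simp add: o_def)
  qed
  ultimately show ?thesis
    using cont[OF sm] cont[OF sm'(1)] cont[OF sm'(2)] assms
    by (auto simp: strip_C1_def test_functions_def partial_s_def partial_u_def vector_derivative_works)
qed

lemma strip_C1_support:
  assumes "f \<in> strip_C1 a"
  shows "\<exists>K. compact K \<and> K \<subseteq> straight_strip a \<and>
           (\<forall>p. p \<notin> K \<longrightarrow> f p = 0 \<and> partial_s f p = 0 \<and> partial_u f p = 0)"
proof -
  obtain K where K: "compact K" "K \<subseteq> straight_strip a" "\<And>p. p \<notin> K \<Longrightarrow> f p = 0"
    using assms by (auto simp: strip_C1_def)
  have op: "open (- K)" using K(1) by (simp add: compact_imp_closed open_Compl)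
  have "partial_s f (s, u) = 0 \<and> partial_u f (s, u) = 0" if p: "(s, u) \<notin> K" for s u
  proof -
    have "open ((\<lambda>t. (t, u)) -` (- K))" "open ((\<lambda>t. (s, t)) -` (- K))"
      by (intro open_vimage op continuous_intros)+
    then have "((\<lambda>t. f (t, u)) has_vector_derivative 0) (at s)" "((\<lambda>t. f (s, t)) has_vector_derivative 0) (at u)"
      using p K(3)
      by (auto intro: has_vector_derivative_transform_within_open[of "\<lambda>_. 0" 0 s "(\<lambda>t. (t, u)) -` (- K)"]
          has_vector_derivative_transform_within_open[of "\<lambda>_. 0" 0 u "(\<lambda>t. (s, t)) -` (- K)"])
    then show ?thesis by (simp add: partial_s_def partial_u_def vector_derivative_at)
  qed
  then show ?thesis using K by (intro exI[of _ K]) auto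
qed

lemma continuous_support_compact_borel:
  fixes h :: "'b::euclidean_space \<Rightarrow> 'c::{real_normed_vector, second_countable_topology}"
  assumes h: "continuous_on UNIV h" and K: "compact K" "\<And>p. p \<notin> K \<Longrightarrow> h p = 0"
  shows "compact_borel h"
proof -
  have "compact (h ` K)" using h K(1) by (intro compact_continuous_image) (auto intro: continuous_on_subset)
  then obtain C where C: "\<forall>y\<in>h ` K. norm y \<le> C" using compact_imp_bounded bounded_iff by blast
  obtain R where R: "\<forall>p\<in>K. norm p \<le> R" using compact_imp_bounded[OF K(1)] bounded_iff by blast
  have "norm (h p) \<le> max C 0" for p
    using C K(2)[of p] by (cases "p \<in> K") (auto simp: le_max_iff_disj)
  moreover have "h p = 0" if "R < norm p" for p using R K(2) that not_less by blast
  ultimately show ?thesis unfolding compact_borel_def bounded_borel_def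
    using h by (auto intro: borel_measurable_continuous_onI)
qed

lemma strip_C1_borel:
  assumes "f \<in> strip_C1 a"
  shows "compact_borel f" "compact_borel (partial_s f)" "compact_borel (partial_u f)"
proof -
  obtain K where K: "compact K" "\<And>p. p \<notin> K \<Longrightarrow> f p = 0 \<and> partial_s f p = 0 \<and> partial_u f p = 0"
    using strip_C1_support[OF assms] by metis
  have "continuous_on UNIV f" "continuous_on UNIV (partial_s f)" "continuous_on UNIV (partial_u f)"
    using assms by (auto simp: strip_C1_def)
  then show "compact_borel f" "compact_borel (partial_s f)" "compact_borel (partial_u f)"
    using K by (auto intro!: continuous_support_compact_borel[OF _ K(1)])
qed

lemma strip_C1_outside:
  assumes "f \<in> strip_C1 a" "\<not> (- a < u \<and> u < a)"
  shows "f (s, u) = 0" "partial_s f (s, u) = 0" "partial_u f (s, u) = 0"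
  using strip_C1_support[OF assms(1)] assms(2) by (force simp: straight_strip_def)+

lemma strip_C1_lin:
  assumes f: "f \<in> strip_C1 a" and g: "g \<in> strip_C1 a"
  shows "(\<lambda>p. f p + c * g p) \<in> strip_C1 a"
    and "partial_s (\<lambda>p. f p + c * g p) = (\<lambda>p. partial_s f p + c * partial_s g p)"
    and "partial_u (\<lambda>p. f p + c * g p) = (\<lambda>p. partial_u f p + c * partial_u g p)"
proof -
  obtain K where K: "compact K" "K \<subseteq> straight_strip a" "\<And>p. p \<notin> K \<Longrightarrow> f p = 0"
    using f by (auto simp: strip_C1_def)
  obtain L where L: "compact L" "L \<subseteq> straight_strip a" "\<And>p. p \<notin> L \<Longrightarrow> g p = 0"
    using g by (auto simp: strip_C1_def)
  have z: "f p + c * g p = 0" if "p \<notin> K \<union> L" for p using that K(3) L(3) by simp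
  have c: "continuous_on UNIV (\<lambda>p. f p + c * g p)" "continuous_on UNIV (\<lambda>p. partial_s f p + c * partial_s g p)"
      "continuous_on UNIV (\<lambda>p. partial_u f p + c * partial_u g p)"
    using f g by (auto simp: strip_C1_def intro!: continuous_on_add continuous_on_mult continuous_on_const)
  have d: "((\<lambda>t. f (t, u) + c * g (t, u)) has_vector_derivative partial_s f (s, u) + c * partial_s g (s, u)) (at s)"
    "((\<lambda>t. f (s, t) + c * g (s, t)) has_vector_derivative partial_u f (s, u) + c * partial_u g (s, u)) (at u)" for s u
    using f g by (auto simp: strip_C1_def intro!: has_vector_derivative_add has_vector_derivative_mult_right)
  have KL: "K \<union> L \<subseteq> straight_strip a" using K L by auto
  note * = strip_C1_I[OF d c compact_Un[OF K(1) L(1)] KL z]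
  show "(\<lambda>p. f p + c * g p) \<in> strip_C1 a"
    "partial_s (\<lambda>p. f p + c * g p) = (\<lambda>p. partial_s f p + c * partial_s g p)"
    "partial_u (\<lambda>p. f p + c * g p) = (\<lambda>p. partial_u f p + c * partial_u g p)"
    by (rule *; assumption)+
qed

lemma function_space_strip_C1: "function_space (strip_C1 a)"
proof -
  have "(\<lambda>_. 0) \<in> strip_C1 a" by (rule strip_C1_I(1)[of _ "\<lambda>_. 0" "\<lambda>_. 0" "{}"]) auto
  then show ?thesis using strip_C1_lin(1) by (auto simp: function_space_def)
qed

lemma linear_sine_coeff:
  assumes "continuous_on {-a..a} f" "continuous_on {-a..a} g"
  shows "sine_coeff a j (\<lambda>u. f u + c * g u) = sine_coeff a j f + c * sine_coeff a j g"
proof -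
  have "((\<lambda>u. of_real (sine_mode a j u) * f u + c * (of_real (sine_mode a j u) * g u))
      has_integral sine_coeff a j f + c * sine_coeff a j g) {-a..a}"
    unfolding sine_coeff_def
    by (intro has_integral_add has_integral_mult_right integrable_integral
        integrable_continuous_interval continuous_intros assms sine_mode_continuous)
  then show ?thesis unfolding sine_coeff_def by (intro integral_unique) (simp add: algebra_simps)
qed

definition mode_part :: "real \<Rightarrow> nat \<Rightarrow> (real \<times> real \<Rightarrow> complex) \<Rightarrow> real \<Rightarrow> complex" where
  "mode_part a j f s = sine_coeff a j (\<lambda>u. f (s, u))"

lemma strip_C1_section:
  assumes "f \<in> strip_C1 a"
  shows "continuous_on A (\<lambda>u. f (s, u))" "continuous_on A (\<lambda>u. partial_s f (s, u))" "continuous_on A (\<lambda>u. partial_u f (s, u))"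
proof -
  have c: "continuous_on UNIV f" "continuous_on UNIV (partial_s f)" "continuous_on UNIV (partial_u f)"
    using assms by (auto simp: strip_C1_def)
  show "continuous_on A (\<lambda>u. f (s, u))" "continuous_on A (\<lambda>u. partial_s f (s, u))" "continuous_on A (\<lambda>u. partial_u f (s, u))"
    by (auto intro!: continuous_on_compose2[OF c(1)] continuous_on_compose2[OF c(2)] continuous_on_compose2[OF c(3)] continuous_intros)
qed

lemma mode_part_lin:
  assumes "f \<in> strip_C1 a" "g \<in> strip_C1 a"
  shows "mode_part a j (\<lambda>p. f p + c * g p) = (\<lambda>s. mode_part a j f s + c * mode_part a j g s)"
  unfolding mode_part_def using assms by (auto intro!: linear_sine_coeff strip_C1_section)

lemma mode_part_lin_comb:
  assumes "\<And>i. i < n \<Longrightarrow> \<psi> i \<in> strip_C1 a"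
  shows "mode_part a j (lin_comb n c \<psi>) = lin_comb n c (\<lambda>i. mode_part a j (\<psi> i))"
  using assms
proof (induction n)
  case 0
  then show ?case by (simp add: lin_comb_0 mode_part_def sine_coeff_def)
next
  case (Suc n)
  have "lin_comb n c \<psi> \<in> strip_C1 a"
    by (rule lin_comb_in[OF function_space_strip_C1]) (simp add: Suc.prems)
  then show ?case unfolding lin_comb_Suc using Suc by (subst mode_part_lin) auto
qed

lemma mode_part_C1:
  assumes f: "f \<in> strip_C1 a"
  shows "mode_part a j f \<in> C1_compact" "vderiv (mode_part a j f) s = sine_coeff a j (\<lambda>u. partial_s f (s, u))"
proof -
  have cs: "continuous_on UNIV (partial_s f)" using f by (simp add: strip_C1_def)
  have csw: "continuous_on (UNIV \<times> {-a..a}) (\<lambda>(s, u). of_real (sine_mode a j u) * partial_s f (s, u))"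
  proof -
    have "continuous_on (UNIV \<times> {-a..a}) (\<lambda>p::real \<times> real. of_real (sine_mode a j (snd p)) * partial_s f p)"
      by (intro continuous_intros continuous_on_compose2[OF sine_mode_continuous(1)[of UNIV]] continuous_on_subset[OF cs]) auto
    then show ?thesis by (simp add: case_prod_beta')
  qed
  obtain R where R: "\<And>s u. R < \<bar>s\<bar> \<Longrightarrow> f (s, u) = 0"
  proof -
    obtain R where "\<And>p. R < norm p \<Longrightarrow> f p = 0" using compact_borel_support[OF strip_C1_borel(1)[OF f]] by blast
    then have "f (s, u) = 0" if "R < \<bar>s\<bar>" for s u
      using that norm_fst_le[of s u] by (intro \<open>\<And>p. R < norm p \<Longrightarrow> f p = 0\<close>) simp
    then show ?thesis using that by blast
  qed
  have d: "(mode_part a j f has_vector_derivative sine_coeff a j (\<lambda>u. partial_s f (s, u))) (at s)" for s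
  proof -
    have "((\<lambda>s. integral (cbox (-a) a) (\<lambda>u. of_real (sine_mode a j u) * f (s, u))) has_vector_derivative
        integral (cbox (-a) a) (\<lambda>u. of_real (sine_mode a j u) * partial_s f (s, u))) (at s within UNIV)"
    proof (rule leibniz_rule_vector_derivative)
      show "((\<lambda>s. of_real (sine_mode a j u) * f (s, u)) has_vector_derivative
          of_real (sine_mode a j u) * partial_s f (s, u)) (at s within UNIV)" for s u
        using f by (intro has_vector_derivative_mult_right) (simp add: strip_C1_def)
      show "(\<lambda>u. of_real (sine_mode a j u) * f (s, u)) integrable_on cbox (-a) a" for s
        by (intro integrable_continuous continuous_intros sine_mode_continuous strip_C1_section(1)[OF f])
    qed (use csw in auto)
    then show ?thesis by (simp add: mode_part_def[abs_def] sine_coeff_def cbox_interval)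
  qed
  have "continuous_on UNIV (\<lambda>s. integral (cbox (-a) a) (\<lambda>u. of_real (sine_mode a j u) * partial_s f (s, u)))"
    by (rule integral_continuous_on_param) (use csw in \<open>simp add: cbox_interval\<close>)
  then have c: "continuous_on UNIV (\<lambda>s. sine_coeff a j (\<lambda>u. partial_s f (s, u)))"
    by (simp add: sine_coeff_def cbox_interval)
  have z: "mode_part a j f s = 0" if "R < \<bar>s\<bar>" for s
    unfolding mode_part_def sine_coeff_def using R[OF that] by simp
  show "mode_part a j f \<in> C1_compact" by (rule C1_compactI(1)[OF d c z])
  show "vderiv (mode_part a j f) s = sine_coeff a j (\<lambda>u. partial_s f (s, u))" by (rule C1_compactI(2)[OF d c z])
qed

text \<open>The separable lower bound of \<open>\<delta>\<^sub>+\<^sup>2 (H\<^sub>1 - (\<pi> / (2 a))\<^sup>2)\<close>, to be used with \<open>D = \<delta>\<^sub>+\<^sup>2\<close> and \<open>w = D * W_tilde\<close>.\<close>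

definition strip_energy :: "real \<Rightarrow> real \<Rightarrow> (real \<Rightarrow> real) \<Rightarrow> (real \<times> real \<Rightarrow> complex) \<Rightarrow> real" where
  "strip_energy a D w f = (LINT p|lborel. (cmod (partial_s f p))\<^sup>2
     + D * ((cmod (partial_u f p))\<^sup>2 - (pi / (2 * a))\<^sup>2 * (cmod (f p))\<^sup>2) - w (fst p) * (cmod (f p))\<^sup>2)"

lemma section_integral:
  fixes h :: "real \<times> real \<Rightarrow> complex"
  assumes h: "continuous_on UNIV h" and z: "\<And>u. \<not> (- a < u \<and> u < a) \<Longrightarrow> h (s, u) = 0"
  shows "integrable lborel (\<lambda>u. (cmod (h (s, u)))\<^sup>2)"
    "(LINT u|lborel. (cmod (h (s, u)))\<^sup>2) = integral {-a..a} (\<lambda>u. (cmod (h (s, u)))\<^sup>2)"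
proof -
  have "continuous_on UNIV (\<lambda>u. h (s, u))"
    by (auto intro!: continuous_on_compose2[OF h] continuous_intros)
  then have c: "compact_borel (\<lambda>u. (cmod (h (s, u)))\<^sup>2)"
    by (intro continuous_compact_borel[where R = a] continuous_intros) (use z in \<open>auto simp: abs_if split: if_splits\<close>)
  show "integrable lborel (\<lambda>u. (cmod (h (s, u)))\<^sup>2)" by (rule compact_borel_integrable[OF c])
  show "(LINT u|lborel. (cmod (h (s, u)))\<^sup>2) = integral {-a..a} (\<lambda>u. (cmod (h (s, u)))\<^sup>2)"
    by (rule lborel_integral_interval(2)[OF c]) (use z in \<open>auto simp: abs_if split: if_splits\<close>)
qed

text \<open>On each cross-section, the modes up to \<open>K\<close> carry their own energy, and the remainder has
  transverse energy at least \<open>\<nu>\<^sup>2\<close>, which beats the potential once \<open>K\<close> is large.\<close>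

lemma strip_energy_modes:
  assumes a: "a > 0" and D: "D > 0" and w: "potential w" "\<And>s. w s \<le> C" and f: "f \<in> strip_C1 a"
    and K: "C \<le> D * (((real K + 1 / 2) * pi / (2 * a))\<^sup>2 - (pi / (2 * a))\<^sup>2)"
  shows "(\<Sum>j=1..K. Re (schrodinger_form (threshold (sqrt D * pi / (2 * a)) j) w (mode_part a j f) (mode_part a j f)))
      \<le> strip_energy a D w f"
proof -
  define \<nu> where "\<nu> = (real K + 1 / 2) * pi / (2 * a)"
  let ?t = "\<lambda>j. threshold (sqrt D * pi / (2 * a)) j" and ?m = "\<lambda>j. mode_part a j f" and ?E = "(pi / (2 * a))\<^sup>2"
  let ?F = "\<lambda>p. (cmod (partial_s f p))\<^sup>2
     + D * ((cmod (partial_u f p))\<^sup>2 - ?E * (cmod (f p))\<^sup>2) - w (fst p) * (cmod (f p))\<^sup>2"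
  let ?G = "\<lambda>j s. (cmod (vderiv (?m j) s))\<^sup>2 + (?t j)\<^sup>2 * (cmod (?m j s))\<^sup>2 - w s * (cmod (?m j s))\<^sup>2"
  have wc: "compact_borel w" by (rule potential_compact[OF w(1)])
  note cb = strip_C1_borel[OF f]
  have F: "compact_borel ?F"
  proof -
    have n: "compact_borel (\<lambda>p. (cmod (partial_s f p))\<^sup>2)" "compact_borel (\<lambda>p. (cmod (partial_u f p))\<^sup>2)" "compact_borel (\<lambda>p. (cmod (f p))\<^sup>2)"
      by (rule compact_borel_norm[OF cb(2)] compact_borel_norm[OF cb(3)] compact_borel_norm[OF cb(1)]; simp)+
    have wb: "bounded_borel (\<lambda>p::real \<times> real. w (fst p))" by (rule bounded_borel_fst[OF compact_borel_bounded[OF wc]])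
    have "compact_borel (\<lambda>p. (cmod (partial_s f p))\<^sup>2
       + (D * ((cmod (partial_u f p))\<^sup>2 + (- ?E) * (cmod (f p))\<^sup>2) + (- 1) * (w (fst p) * (cmod (f p))\<^sup>2)))"
      by (rule compact_borel_add[OF n(1) compact_borel_add[OF compact_borel_mult(2)[OF compact_borel_add[OF n(2)
            compact_borel_mult(2)[OF n(3) bounded_borel_const]] bounded_borel_const]
            compact_borel_mult(2)[OF compact_borel_mult(2)[OF n(3) wb] bounded_borel_const]]])
    then show ?thesis by (simp add: algebra_simps)
  qed
  have mb: "compact_borel (\<lambda>s. (cmod (vderiv (?m j) s))\<^sup>2)" "compact_borel (\<lambda>s. (cmod (?m j s))\<^sup>2)" for j
    using C1_compact_borel[OF mode_part_C1(1)[OF f]] by (auto intro: compact_borel_norm)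
  have wm: "integrable lborel (\<lambda>s. w s * (cmod (?m j s))\<^sup>2)" for j
    by (rule compact_borel_integrable[OF compact_borel_mult(1)[OF wc compact_borel_bounded[OF mb(2)]]])
  have em: "integrable lborel (\<lambda>s. (cmod (vderiv (?m j) s))\<^sup>2 + (?t j)\<^sup>2 * (cmod (?m j s))\<^sup>2)" for j
    by (intro Bochner_Integration.integrable_add integrable_mult_right compact_borel_integrable mb)
  have G: "integrable lborel (?G j)" for j by (rule Bochner_Integration.integrable_diff[OF em wm])
  have q: "Re (schrodinger_form (?t j) w (?m j) (?m j)) = (LINT s|lborel. ?G j s)" for j
    unfolding schrodinger_form_def minus_complex.simps energy_form_diag weight_form_diag
    by (rule Bochner_Integration.integral_diff[OF em wm, symmetric])
  have pt: "(\<Sum>j=1..K. ?G j s) \<le> (LINT u|lborel. ?F (s, u))" for s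
  proof -
    let ?A = "integral {-a..a} (\<lambda>u. (cmod (partial_s f (s, u)))\<^sup>2)" and ?B = "integral {-a..a} (\<lambda>u. (cmod (partial_u f (s, u)))\<^sup>2)"
      and ?N = "integral {-a..a} (\<lambda>u. (cmod (f (s, u)))\<^sup>2)" and ?c = "\<lambda>j. (cmod (?m j s))\<^sup>2"
    have cf: "continuous_on UNIV f" "continuous_on UNIV (partial_s f)" "continuous_on UNIV (partial_u f)"
      using f by (auto simp: strip_C1_def)
    note si = section_integral[OF cf(1), of a s, OF strip_C1_outside(1)[OF f]]
      section_integral[OF cf(2), of a s, OF strip_C1_outside(2)[OF f]]
      section_integral[OF cf(3), of a s, OF strip_C1_outside(3)[OF f]]
    have "(LINT u|lborel. ?F (s, u)) = ?A + D * (?B - ?E * ?N) - w s * ?N"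
      using si by simp
    moreover have "(\<Sum>j=1..K. (cmod (vderiv (?m j) s))\<^sup>2) \<le> ?A"
      unfolding mode_part_C1(2)[OF f] by (rule complex_sine_bessel[OF a strip_C1_section(2)[OF f]])
    moreover have N: "(\<Sum>j=1..K. ?c j) \<le> ?N"
      unfolding mode_part_def by (rule complex_sine_bessel[OF a strip_C1_section(1)[OF f]])
    moreover have "D * (\<nu>\<^sup>2 * ?N + (\<Sum>j=1..K. ((sine_freq a j)\<^sup>2 - \<nu>\<^sup>2) * ?c j)) \<le> D * ?B"
      unfolding mode_part_def
    proof (intro mult_left_mono complex_sine_gap[OF a _ strip_C1_section(3)[OF f] _ _ \<nu>_def])
      show "((\<lambda>u. f (s, u)) has_vector_derivative partial_u f (s, u)) (at u)" for u
        using f by (simp add: strip_C1_def)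
    qed (use D strip_C1_outside(1)[OF f] in auto)
    \<comment> \<open>The part of the function orthogonal to the first \<open>K\<close> modes has nonnegative energy.\<close>
    moreover have "0 \<le> (D * \<nu>\<^sup>2 - D * ?E - w s) * (?N - (\<Sum>j=1..K. ?c j))"
    proof (intro mult_nonneg_nonneg)
      have "w s \<le> D * (\<nu>\<^sup>2 - ?E)" using w(2)[of s] K unfolding \<nu>_def by linarith
      then show "0 \<le> D * \<nu>\<^sup>2 - D * ?E - w s" by (simp add: right_diff_distrib)
    qed (use N in simp)
    moreover have "(\<Sum>j=1..K. ?G j s) = (\<Sum>j=1..K. (cmod (vderiv (?m j) s))\<^sup>2)
        + (\<Sum>j=1..K. D * ((sine_freq a j)\<^sup>2 - ?E) * ?c j) - w s * (\<Sum>j=1..K. ?c j)"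
    proof -
      have "(?t j)\<^sup>2 = D * ((sine_freq a j)\<^sup>2 - ?E)" if "j \<in> {1..K}" for j
        using that D by (simp add: threshold_square sine_freq_def power_mult_distrib power_divide right_diff_distrib diff_divide_distrib)
      then have "(\<Sum>j=1..K. ?G j s) = (\<Sum>j=1..K. (cmod (vderiv (?m j) s))\<^sup>2 + D * ((sine_freq a j)\<^sup>2 - ?E) * ?c j - w s * ?c j)"
        by (intro sum.cong refl) simp
      then show ?thesis by (simp add: sum.distrib sum_subtractf sum_distrib_left)
    qed
    moreover have "D * (\<Sum>j=1..K. ((sine_freq a j)\<^sup>2 - \<nu>\<^sup>2) * ?c j)
        = (\<Sum>j=1..K. D * ((sine_freq a j)\<^sup>2 - ?E) * ?c j) + (D * ?E - D * \<nu>\<^sup>2) * (\<Sum>j=1..K. ?c j)"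
      by (simp add: sum_distrib_left sum.distrib[symmetric] algebra_simps)
    ultimately show ?thesis by (simp add: algebra_simps)
  qed
  have "(\<Sum>j=1..K. Re (schrodinger_form (?t j) w (?m j) (?m j))) = (LINT s|lborel. (\<Sum>j=1..K. ?G j s))"
    unfolding q by (rule Bochner_Integration.integral_sum[symmetric]) (rule G)
  also have "\<dots> \<le> (LINT s|lborel. LINT u|lborel. ?F (s, u))"
    by (intro integral_mono Bochner_Integration.integrable_sum G compact_borel_integrable[OF compact_borel_marginal[OF F]] pt)
  also have "\<dots> = strip_energy a D w f"
    unfolding strip_energy_def by (rule compact_borel_fubini(1)[OF F])
  finally show ?thesis .
qed

text \<open>If there were more test functions than the modes can accommodate, some nontrivial combination
  would be orthogonal, mode by mode, to maximal negative systems, and one of these could be enlarged.\<close>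

lemma strip_count_le_modes:
  assumes a: "a > 0" and D: "D > 0" and w: "potential w" and \<psi>: "\<And>i. i < n \<Longrightarrow> \<psi> i \<in> strip_C1 a"
    and neg: "\<And>c. nonzero_coeffs n c \<Longrightarrow> strip_energy a D w (lin_comb n c \<psi>) < 0"
    and N: "\<And>j. 1 \<le> j \<Longrightarrow> binds w (threshold (sqrt D * pi / (2 * a)) j) (N j)"
    and N_max: "\<And>j k. 1 \<le> j \<Longrightarrow> binds w (threshold (sqrt D * pi / (2 * a)) j) k \<Longrightarrow> k \<le> N j"
  shows "\<exists>K. n \<le> (\<Sum>j=1..K. N j)"
proof -
  let ?t = "\<lambda>j. threshold (sqrt D * pi / (2 * a)) j"
  obtain C where C: "\<And>s. w s \<le> C"
    using bounded_borel_bound[OF compact_borel_bounded[OF potential_compact[OF w]]] by (metis abs_le_D1 real_norm_def)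
  let ?k = "pi / (2 * a)"
  have k: "?k > 0" using a by simp
  have KC: "C \<le> D * (((real K + 1 / 2) * pi / (2 * a))\<^sup>2 - ?k\<^sup>2)" if "K \<ge> 1" "C / (D * ?k\<^sup>2) + 1 \<le> real K" for K :: nat
  proof -
    have "D * ?k\<^sup>2 > 0" using D k by (intro mult_pos_pos zero_less_power)
    moreover have "C / (D * ?k\<^sup>2) \<le> real K - 1" using that(2) by simp
    ultimately have "C \<le> (D * ?k\<^sup>2) * (real K - 1)" by (simp only: pos_divide_le_eq mult.commute)
    also have "\<dots> \<le> (D * ?k\<^sup>2) * ((real K + 1 / 2)\<^sup>2 - 1)"
    proof (intro mult_left_mono)
      have "real K * 1 \<le> (real K + 1 / 2) * (real K + 1 / 2)" using that(1) by (intro mult_mono) auto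
      then show "real K - 1 \<le> (real K + 1 / 2)\<^sup>2 - 1" by (simp add: power2_eq_square)
    qed (use D in simp)
    also have "\<dots> = D * (((real K + 1 / 2) * pi / (2 * a))\<^sup>2 - ?k\<^sup>2)"
    proof -
      have "(real K + 1 / 2) * pi / (2 * a) = (real K + 1 / 2) * ?k" by simp
      then show ?thesis by (simp only: power_mult_distrib) (simp add: algebra_simps)
    qed
    finally show ?thesis .
  qed
  obtain K :: nat where K: "K \<ge> 1" "C / (D * ?k\<^sup>2) + 1 \<le> real K"
    by (meson real_arch_simple linear of_nat_le_iff order_trans le_max_iff_disj of_nat_mono max.cobounded1 max.cobounded2)
  obtain \<phi> where \<phi>: "\<And>j b. 1 \<le> j \<Longrightarrow> b < N j \<Longrightarrow> \<phi> j b \<in> C1_compact"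
      "\<And>j. 1 \<le> j \<Longrightarrow> negative_system (schrodinger_form (?t j) w) (N j) (\<phi> j)"
    using N unfolding binds_def by metis
  define I where "I = Sigma {1..K} (\<lambda>j. {..<N j})"
  have cI: "card I = (\<Sum>j=1..K. N j)" unfolding I_def by simp
  have "n \<le> (\<Sum>j=1..K. N j)"
  proof (rule ccontr)
    assume "\<not> ?thesis"
    then have less: "card I < card {..<n}" by (simp add: cI)
    obtain e where e: "bij_betw e {..<card I} I"
      using ex_bij_betw_nat_finite[of I] by (auto simp: I_def atLeast0LessThan)
    let ?q = "\<lambda>j. schrodinger_form (?t j) w"
    obtain c where c: "\<exists>i\<in>{..<n}. c i \<noteq> 0"
      and c0: "\<forall>l<card I. (\<Sum>i\<in>{..<n}. ?q (fst (e l)) (\<phi> (fst (e l)) (snd (e l))) (mode_part a (fst (e l)) (\<psi> i)) * c i) = 0"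
      using homogeneous_system_nontrivial[OF finite_lessThan less,
          of "\<lambda>l i. ?q (fst (e l)) (\<phi> (fst (e l)) (snd (e l))) (mode_part a (fst (e l)) (\<psi> i))"] by blast
    let ?f = "lin_comb n c \<psi>"
    have f: "?f \<in> strip_C1 a" by (rule lin_comb_in[OF function_space_strip_C1 \<psi>])
    have her: "hermitian_form C1_compact (?q j)" for j
      by (rule hermitian_schrodinger_form[OF potential_compact[OF w]])
    have lc: "mode_part a j ?f = lin_comb n c (\<lambda>i. mode_part a j (\<psi> i))" for j
      using \<psi> by (rule mode_part_lin_comb)
    have orth: "?q j (\<phi> j b) (mode_part a j ?f) = 0" if "j \<in> {1..K}" "b < N j" for j b
    proof -
      have "(j, b) \<in> I" using that by (simp add: I_def)
      then have "(j, b) \<in> e ` {..<card I}" using e by (simp add: bij_betw_def)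
      then obtain l where l: "l < card I" "e l = (j, b)" by (metis imageE lessThan_iff)
      have "?q j (\<phi> j b) (mode_part a j ?f) = (\<Sum>i<n. c i * ?q j (\<phi> j b) (mode_part a j (\<psi> i)))"
        unfolding lc
        by (rule linear_functional_lin_comb[OF function_space_C1_compact hermitian_form_linear[OF her \<phi>(1)]])
           (use that \<psi> mode_part_C1(1) in auto)
      also have "\<dots> = 0" using c0[rule_format, OF l(1)] unfolding l(2) by (simp add: mult.commute)
      finally show ?thesis .
    qed
    have "(\<Sum>j=1..K. Re (?q j (mode_part a j ?f) (mode_part a j ?f))) \<le> strip_energy a D w ?f"
      by (rule strip_energy_modes[OF a D w C f KC[OF K]])
    also have "\<dots> < 0" using c by (intro neg) (auto simp: nonzero_coeffs_def)
    finally obtain j where j: "j \<in> {1..K}" "Re (?q j (mode_part a j ?f) (mode_part a j ?f)) < 0"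
      by (meson not_less sum_nonneg)
    have j1: "1 \<le> j" using j(1) by simp
    have \<phi>j: "\<phi> j b \<in> C1_compact" if "b < N j" for b by (rule \<phi>(1)[OF j1 that])
    have oj: "?q j (\<phi> j b) (mode_part a j ?f) = 0" if "b < N j" for b by (rule orth[OF j(1) that])
    have "negative_system (?q j) (Suc (N j)) ((\<phi> j)(N j := mode_part a j ?f))"
      by (rule negative_system_extend[where V = C1_compact and q = "?q j" and n = "N j" and \<psi> = "\<phi> j"
            and f = "mode_part a j ?f"])
        (rule function_space_C1_compact, rule her, erule \<phi>j, rule \<phi>(2)[OF j1], rule mode_part_C1(1)[OF f], rule j(2), erule oj)
    moreover have "((\<phi> j)(N j := mode_part a j ?f)) b \<in> C1_compact" if "b < Suc (N j)" for b
      using \<phi>j[of b] mode_part_C1(1)[OF f] that by (auto simp: less_Suc_eq)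
    ultimately have "binds w (?t j) (Suc (N j))" unfolding binds_def by blast
    then show False using N_max[of j "Suc (N j)"] j(1) by simp
  qed
  then show ?thesis by blast
qed

text \<open>The mode counts \<open>N j\<close> are finite by the spread inequality, so the maximal ones can be chosen.\<close>

lemma strip_count_bound:
  assumes a: "a > 0" and D: "D > 0" and w: "potential w" and pc: "piecewise_continuous w"
    and \<psi>: "\<And>i. i < n \<Longrightarrow> \<psi> i \<in> strip_C1 a"
    and neg: "\<And>c. nonzero_coeffs n c \<Longrightarrow> strip_energy a D w (lin_comb n c \<psi>) < 0"
  shows "real n \<le> 1 + spread w + (\<Sum>j=2..4. excess (threshold (sqrt D * pi / (2 * a)) j) w)"
proof -
  let ?\<alpha> = "sqrt D * pi / (2 * a)"
  have \<alpha>: "?\<alpha> > 0" using a D by simp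
  have bound: "k \<le> nat \<lceil>1 + spread w / 2\<rceil>" if jb: "1 \<le> j" "binds w (threshold ?\<alpha> j) k" for j k
  proof (cases "k = 0")
    case False
    obtain \<phi> where \<phi>: "\<And>i. i < k \<Longrightarrow> \<phi> i \<in> C1_compact" "negative_system (schrodinger_form (threshold ?\<alpha> j) w) k \<phi>"
      using jb(2) by (auto simp: binds_def)
    have "2 * (real k - 1) * (1 + threshold ?\<alpha> j * spread w / (2 * mass w)) \<le> spread w"
      by (rule negative_system_spread[OF w threshold_nonneg[OF \<alpha> jb(1)] \<phi>(1) _ \<phi>(2)]) (use False in auto)
    moreover have "2 * (real k - 1) * 1 \<le> 2 * (real k - 1) * (1 + threshold ?\<alpha> j * spread w / (2 * mass w))"
      using False threshold_nonneg[OF \<alpha> jb(1)] spread_nonneg[OF w] mass_nonneg[OF w]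
      by (intro mult_left_mono) auto
    ultimately have "real k \<le> 1 + spread w / 2" by simp
    then show ?thesis by linarith
  qed simp
  define N where "N j = (GREATEST k. binds w (threshold ?\<alpha> j) k)" for j
  have b0: "binds w k 0" for k by (auto simp: binds_def negative_system_def nonzero_coeffs_def)
  have N: "binds w (threshold ?\<alpha> j) (N j)" if "1 \<le> j" for j
    unfolding N_def by (rule GreatestI_nat[where P = "binds w (threshold ?\<alpha> j)" and k = 0, OF b0]) (rule bound[OF that])
  have N_max: "k \<le> N j" if "1 \<le> j" "binds w (threshold ?\<alpha> j) k" for j k
    unfolding N_def using that(2) bound[OF that(1)] by (rule Greatest_le_nat)
  have "\<exists>K. n \<le> (\<Sum>j=1..K. N j)"
    using a D w \<psi> neg N N_max by (rule strip_count_le_modes)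
  then obtain K where K: "n \<le> (\<Sum>j=1..K. N j)" by blast
  have anti: "N j \<le> N i" if ij: "1 \<le> i" "i \<le> j" for i j
  proof (rule N_max[OF ij(1)])
    have "1 \<le> j" using ij by simp
    then show "binds w (threshold ?\<alpha> i) (N j)"
      by (rule binds_antimono[OF N threshold_nonneg[OF \<alpha> ij(1)] threshold_mono[OF \<alpha> ij(2)] order_refl])
  qed
  have "(\<Sum>j=1..K. real (N j)) \<le> 1 + spread w + excess (threshold ?\<alpha> 2) w + excess (threshold ?\<alpha> 3) w + excess (threshold ?\<alpha> 4) w"
    by (rule mode_count_bound[where N = N and K = K, OF w pc \<alpha>]) (erule (1) anti, erule N)
  moreover have "real n \<le> (\<Sum>j=1..K. real (N j))" using K by (metis of_nat_mono of_nat_sum)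
  ultimately show ?thesis by (simp add: numeral_eq_Suc)
qed

section \<open>Passing to the limit in square-integrable functions\<close>

definition bounded_weight :: "'a measure \<Rightarrow> ('a \<Rightarrow> real) \<Rightarrow> bool" where
  "bounded_weight M m \<longleftrightarrow> m \<in> borel_measurable M \<and> (\<exists>C\<ge>0. \<forall>p\<in>space M. \<bar>m p\<bar> \<le> C)"

definition pairing :: "'a measure \<Rightarrow> ('a \<Rightarrow> real) \<Rightarrow> 'a form" where
  "pairing M m f g = (LINT p|M. of_real (m p) * (cnj (f p) * g p))"

lemma L2_D:
  assumes "f \<in> L2 M"
  shows "f \<in> borel_measurable M" "integrable M (\<lambda>x. (cmod (f x))\<^sup>2)"
  using assms by (auto simp: L2_def)

lemma norm_product_le: "cmod z * cmod w \<le> (cmod z)\<^sup>2 + (cmod w)\<^sup>2"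
proof -
  have "2 * (cmod z * cmod w) \<le> (cmod z)\<^sup>2 + (cmod w)\<^sup>2"
    using sum_squares_bound[of "cmod z" "cmod w"] by (simp add: mult.assoc)
  moreover have "0 \<le> cmod z * cmod w" by simp
  ultimately show ?thesis by linarith
qed

lemma pairing_integrable:
  assumes m: "bounded_weight M m" and f: "f \<in> L2 M" and g: "g \<in> L2 M"
  shows "integrable M (\<lambda>p. of_real (m p) * (cnj (f p) * g p))"
proof -
  obtain C where C: "C \<ge> 0" "\<And>p. p \<in> space M \<Longrightarrow> \<bar>m p\<bar> \<le> C" using m by (auto simp: bounded_weight_def)
  have meas: "(\<lambda>p. complex_of_real (m p) * (cnj (f p) * g p)) \<in> borel_measurable M"
  proof -
    have "m \<in> borel_measurable M" using m by (simp add: bounded_weight_def)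
    then have "(\<lambda>p. complex_of_real (m p)) \<in> borel_measurable M"
      by (rule measurable_compose[OF _ borel_measurable_continuous_onI[OF continuous_on_of_real[OF continuous_on_id]]])
    moreover have "(\<lambda>p. cnj (f p)) \<in> borel_measurable M"
      by (rule measurable_compose[OF L2_D(1)[OF f] borel_measurable_continuous_onI[OF continuous_on_cnj[OF continuous_on_id]]])
    ultimately show ?thesis using L2_D(1)[OF g] by (intro borel_measurable_times)
  qed
  show ?thesis
  proof (rule Bochner_Integration.integrable_bound[OF _ meas])
    show "integrable M (\<lambda>p. C * ((cmod (f p))\<^sup>2 + (cmod (g p))\<^sup>2))"
      by (intro integrable_mult_right Bochner_Integration.integrable_add L2_D(2) f g)
    show "AE p in M. norm (complex_of_real (m p) * (cnj (f p) * g p)) \<le> norm (C * ((cmod (f p))\<^sup>2 + (cmod (g p))\<^sup>2))"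
    proof (rule AE_I2)
      fix p assume "p \<in> space M"
      then have "\<bar>m p\<bar> * (cmod (f p) * cmod (g p)) \<le> C * ((cmod (f p))\<^sup>2 + (cmod (g p))\<^sup>2)"
        using C norm_product_le by (intro mult_mono) auto
      then show "norm (complex_of_real (m p) * (cnj (f p) * g p)) \<le> norm (C * ((cmod (f p))\<^sup>2 + (cmod (g p))\<^sup>2))"
        using C(1) by (simp add: norm_mult)
    qed
  qed
qed

lemma L2_lin:
  assumes f: "f \<in> L2 M" and g: "g \<in> L2 M"
  shows "(\<lambda>x. f x + c * g x) \<in> L2 M"
proof -
  have meas: "(\<lambda>x. f x + c * g x) \<in> borel_measurable M" using L2_D(1)[OF f] L2_D(1)[OF g] by simp
  have "integrable M (\<lambda>x. (cmod (f x + c * g x))\<^sup>2)"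
  proof (rule Bochner_Integration.integrable_bound)
    show "integrable M (\<lambda>x. 2 * ((cmod (f x))\<^sup>2 + (cmod c)\<^sup>2 * (cmod (g x))\<^sup>2))"
      by (intro integrable_mult_right Bochner_Integration.integrable_add L2_D(2) f g)
    show "AE x in M. norm ((cmod (f x + c * g x))\<^sup>2) \<le> norm (2 * ((cmod (f x))\<^sup>2 + (cmod c)\<^sup>2 * (cmod (g x))\<^sup>2))"
    proof (rule AE_I2)
      fix x
      have "(cmod (f x + c * g x))\<^sup>2 \<le> (cmod (f x) + cmod c * cmod (g x))\<^sup>2"
        using norm_triangle_ineq[of "f x" "c * g x"] by (intro power_mono) (auto simp: norm_mult)
      also have "\<dots> \<le> 2 * ((cmod (f x))\<^sup>2 + (cmod c)\<^sup>2 * (cmod (g x))\<^sup>2)"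
        using sum_squares_bound[of "cmod (f x)" "cmod c * cmod (g x)"] by (simp add: power2_sum power_mult_distrib)
      finally show "norm ((cmod (f x + c * g x))\<^sup>2) \<le> norm (2 * ((cmod (f x))\<^sup>2 + (cmod c)\<^sup>2 * (cmod (g x))\<^sup>2))" by simp
    qed
  qed (use meas in simp)
  then show ?thesis using meas by (simp add: L2_def)
qed

lemma function_space_L2: "function_space (L2 M)"
  using L2_lin unfolding function_space_def by (auto simp: L2_def)

lemma hermitian_pairing:
  assumes m: "bounded_weight M m" shows "hermitian_form (L2 M) (pairing M m)"
  unfolding hermitian_form_def linear_functional_def
proof (intro conjI ballI allI)
  fix f g h c assume "f \<in> L2 M" "g \<in> L2 M" "h \<in> L2 M"
  then have i: "integrable M (\<lambda>p. of_real (m p) * (cnj (f p) * g p))" "integrable M (\<lambda>p. of_real (m p) * (cnj (f p) * h p))"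
    using pairing_integrable[OF m] by auto
  have "pairing M m f (\<lambda>p. g p + c * h p) = (LINT p|M. of_real (m p) * (cnj (f p) * g p) + c * (of_real (m p) * (cnj (f p) * h p)))"
    unfolding pairing_def by (simp add: algebra_simps)
  also have "\<dots> = pairing M m f g + c * pairing M m f h"
    unfolding pairing_def using i by simp
  finally show "pairing M m f (\<lambda>p. g p + c * h p) = pairing M m f g + c * pairing M m f h" .
next
  fix f g :: "'a \<Rightarrow> complex"
  show "pairing M m g f = cnj (pairing M m f g)"
    unfolding pairing_def Bochner_Integration.integral_cnj[symmetric]
    by (rule Bochner_Integration.integral_cong) (auto simp: algebra_simps)
qed

lemma pairing_diag: "Re (pairing M m f f) = (LINT p|M. m p * (cmod (f p))\<^sup>2)"
proof -
  have "pairing M m f f = (LINT p|M. complex_of_real (m p * (cmod (f p))\<^sup>2))"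
    unfolding pairing_def of_real_mult complex_norm_square by (simp add: mult.commute)
  then show ?thesis unfolding integral_complex_of_real by simp
qed

text \<open>The difference of the products is split into terms each containing a small factor; the
  arithmetic-geometric inequality with weight \<open>e\<close> replaces Cauchy--Schwarz.\<close>

lemma product_difference_le:
  assumes e: "e > 0"
  shows "cmod (cnj x' * y' - cnj x * y) \<le> (1 / 2 + 1 / (2 * e)) * ((cmod (x' - x))\<^sup>2 + (cmod (y' - y))\<^sup>2)
     + e / 2 * ((cmod x)\<^sup>2 + (cmod y)\<^sup>2)"
proof -
  have am: "r * t \<le> r\<^sup>2 / (2 * e) + e / 2 * t\<^sup>2" for r t :: real
  proof -
    have "0 \<le> (r - e * t)\<^sup>2 / (2 * e)" using e by simp
    also have "\<dots> = r\<^sup>2 / (2 * e) - r * t + e / 2 * t\<^sup>2" using e by (simp add: power2_eq_square field_simps)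
    finally show ?thesis by simp
  qed
  have am1: "r * t \<le> r\<^sup>2 / 2 + t\<^sup>2 / 2" for r t :: real
  proof -
    have "0 \<le> (r - t)\<^sup>2" by simp
    then show ?thesis unfolding power2_diff by simp
  qed
  have "cnj x' * y' - cnj x * y = cnj (x' - x) * (y' - y) + (cnj (x' - x) * y + cnj x * (y' - y))"
    by (simp add: algebra_simps)
  then have "cmod (cnj x' * y' - cnj x * y) \<le> cmod (x' - x) * cmod (y' - y) + (cmod (x' - x) * cmod y + cmod x * cmod (y' - y))"
    using norm_triangle_ineq[of "cnj (x' - x) * (y' - y)" "cnj (x' - x) * y + cnj x * (y' - y)"]
      norm_triangle_ineq[of "cnj (x' - x) * y" "cnj x * (y' - y)"]
    by (simp only: norm_mult complex_mod_cnj)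
  also have "\<dots> \<le> ((cmod (x' - x))\<^sup>2 / 2 + (cmod (y' - y))\<^sup>2 / 2)
      + (((cmod (x' - x))\<^sup>2 / (2 * e) + e / 2 * (cmod y)\<^sup>2) + ((cmod (y' - y))\<^sup>2 / (2 * e) + e / 2 * (cmod x)\<^sup>2))"
    using am[of "cmod (x' - x)" "cmod y"] am[of "cmod (y' - y)" "cmod x"] am1 by (intro add_mono) (auto simp: mult.commute)
  finally show ?thesis by (simp add: algebra_simps)
qed

lemma pairing_tendsto:
  fixes M :: "'a::euclidean_space measure"
  assumes m: "bounded_weight M m" and f: "f \<in> L2 M" and g: "g \<in> L2 M"
    and fn: "\<And>n. fn n \<in> L2 M" "L2_tendsto M fn f" and gn: "\<And>n. gn n \<in> L2 M" "L2_tendsto M gn g"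
  shows "(\<lambda>n. pairing M m (fn n) (gn n)) \<longlonglongrightarrow> pairing M m f g"
proof (rule tendstoI)
  fix e :: real assume e: "e > 0"
  obtain C where C: "C \<ge> 0" "\<And>p. p \<in> space M \<Longrightarrow> \<bar>m p\<bar> \<le> C" using m by (auto simp: bounded_weight_def)
  define S where "S = (LINT p|M. (cmod (f p))\<^sup>2) + (LINT p|M. (cmod (g p))\<^sup>2)"
  define d where "d n = (LINT p|M. (cmod (fn n p - f p))\<^sup>2) + (LINT p|M. (cmod (gn n p - g p))\<^sup>2)" for n
  have S: "S \<ge> 0" unfolding S_def by (intro add_nonneg_nonneg integral_nonneg_AE AE_I2) auto
  define \<epsilon> where "\<epsilon> = e / ((C + 1) * (S + 1))"
  have \<epsilon>: "\<epsilon> > 0" unfolding \<epsilon>_def using e C S by (intro divide_pos_pos mult_pos_pos) auto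
  have diff: "(\<lambda>p. fn n p - f p) \<in> L2 M" "(\<lambda>p. gn n p - g p) \<in> L2 M" for n
    using L2_lin[OF fn(1) f, of n "-1"] L2_lin[OF gn(1) g, of n "-1"] by simp_all
  have bound: "dist (pairing M m (fn n) (gn n)) (pairing M m f g) \<le> C * ((1 / 2 + 1 / (2 * \<epsilon>)) * d n + \<epsilon> / 2 * S)" for n
  proof -
    note i = pairing_integrable[OF m fn(1) gn(1), of n] pairing_integrable[OF m f g]
    let ?B = "\<lambda>p. C * ((1 / 2 + 1 / (2 * \<epsilon>)) * ((cmod (fn n p - f p))\<^sup>2 + (cmod (gn n p - g p))\<^sup>2)
       + \<epsilon> / 2 * ((cmod (f p))\<^sup>2 + (cmod (g p))\<^sup>2))"
    have "dist (pairing M m (fn n) (gn n)) (pairing M m f g)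
        = cmod (LINT p|M. of_real (m p) * (cnj (fn n p) * gn n p) - of_real (m p) * (cnj (f p) * g p))"
      unfolding dist_norm pairing_def using i by simp
    also have "\<dots> \<le> (LINT p|M. ?B p)"
    proof (rule Bochner_Integration.integral_norm_bound_integral)
      show "integrable M (\<lambda>p. of_real (m p) * (cnj (fn n p) * gn n p) - of_real (m p) * (cnj (f p) * g p))"
        using i by (rule Bochner_Integration.integrable_diff)
      show "integrable M ?B"
        by (intro integrable_mult_right Bochner_Integration.integrable_add L2_D(2) f g diff)
      fix p assume p: "p \<in> space M"
      have "norm (of_real (m p) * (cnj (fn n p) * gn n p) - of_real (m p) * (cnj (f p) * g p))
          = \<bar>m p\<bar> * cmod (cnj (fn n p) * gn n p - cnj (f p) * g p)"
        by (simp flip: right_diff_distrib add: norm_mult)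
      also have "\<dots> \<le> ?B p" using C p product_difference_le[OF \<epsilon>] by (intro mult_mono) auto
      finally show "norm (of_real (m p) * (cnj (fn n p) * gn n p) - of_real (m p) * (cnj (f p) * g p)) \<le> ?B p" .
    qed
    also have "(LINT p|M. ?B p) = C * ((1 / 2 + 1 / (2 * \<epsilon>)) * d n + \<epsilon> / 2 * S)"
      unfolding S_def d_def using L2_D(2)[OF f] L2_D(2)[OF g] L2_D(2)[OF diff(1)] L2_D(2)[OF diff(2)] by simp
    finally show ?thesis .
  qed
  have "d \<longlonglongrightarrow> 0 + 0" using fn(2) gn(2) unfolding L2_tendsto_def d_def by (intro tendsto_add)
  then have "(\<lambda>n. C * ((1 / 2 + 1 / (2 * \<epsilon>)) * d n + \<epsilon> / 2 * S)) \<longlonglongrightarrow> C * ((1 / 2 + 1 / (2 * \<epsilon>)) * (0 + 0) + \<epsilon> / 2 * S)"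
    by (intro tendsto_intros)
  moreover have "C * ((1 / 2 + 1 / (2 * \<epsilon>)) * (0 + 0) + \<epsilon> / 2 * S) < e"
  proof -
    have "C * S \<le> (C + 1) * (S + 1)" using C S by (intro mult_mono) auto
    then have "C * S * \<epsilon> \<le> (C + 1) * (S + 1) * \<epsilon>" using \<epsilon> by (intro mult_right_mono) auto
    also have "\<dots> = e" using C S unfolding \<epsilon>_def by simp
    finally show ?thesis using e by (simp add: algebra_simps)
  qed
  ultimately have "\<forall>\<^sub>F n in sequentially. C * ((1 / 2 + 1 / (2 * \<epsilon>)) * d n + \<epsilon> / 2 * S) < e"
    by (rule order_tendstoD(2))
  then show "\<forall>\<^sub>F n in sequentially. dist (pairing M m (fn n) (gn n)) (pairing M m f g) < e"
    by (rule eventually_mono) (use bound in \<open>blast intro: le_less_trans\<close>)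
qed

section \<open>Negative definite matrices\<close>

definition matrix_form :: "nat \<Rightarrow> (nat \<Rightarrow> nat \<Rightarrow> complex) \<Rightarrow> (nat \<Rightarrow> complex) \<Rightarrow> (nat \<Rightarrow> complex) \<Rightarrow> complex" where
  "matrix_form n A c d = (\<Sum>i<n. \<Sum>j<n. cnj (c i) * d j * A i j)"

lemma hermitian_form_matrix:
  assumes V: "function_space V" and B: "hermitian_form V B" and \<psi>: "\<And>i. i < n \<Longrightarrow> \<psi> i \<in> V"
  shows "B (lin_comb n c \<psi>) (lin_comb n d \<psi>) = matrix_form n (\<lambda>i j. B (\<psi> i) (\<psi> j)) c d"
  unfolding matrix_form_def using hermitian_form_both[OF V B \<psi>] by (simp add: mult.assoc)

lemma hermitian_matrix_form:
  assumes "\<And>i j. i < n \<Longrightarrow> j < n \<Longrightarrow> A j i = cnj (A i j)"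
  shows "hermitian_form UNIV (matrix_form n A)"
  unfolding hermitian_form_def linear_functional_def
proof (intro conjI ballI allI)
  fix c d e :: "nat \<Rightarrow> complex" and t
  show "matrix_form n A c (\<lambda>i. d i + t * e i) = matrix_form n A c d + t * matrix_form n A c e"
    unfolding matrix_form_def by (simp add: algebra_simps sum.distrib sum_distrib_left)
  have "matrix_form n A d c = (\<Sum>j<n. \<Sum>i<n. cnj (d i) * c j * A i j)"
    unfolding matrix_form_def by (rule sum.swap)
  also have "\<dots> = (\<Sum>i<n. \<Sum>j<n. cnj (cnj (c i) * d j * A i j))"
  proof (intro sum.cong refl)
    fix i j assume "i \<in> {..<n}" "j \<in> {..<n}"
    then have "A j i = cnj (A i j)" by (intro assms) auto
    then show "cnj (d j) * c i * A j i = cnj (cnj (c i) * d j * A i j)" by (simp only: complex_cnj_mult complex_cnj_cnj mult.commute mult.left_commute)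
  qed
  finally show "matrix_form n A d c = cnj (matrix_form n A c d)" by (simp add: matrix_form_def)
qed

text \<open>Negative definiteness is an open condition. After passing to a basis in which the limit is
  minus the identity, entries within \<open>1 / (2 n)\<close> of it suffice.\<close>

lemma negative_matrix_open:
  fixes A :: "nat \<Rightarrow> nat \<Rightarrow> complex"
  assumes herm: "\<And>i j. i < n \<Longrightarrow> j < n \<Longrightarrow> A j i = cnj (A i j)"
    and neg: "\<And>c. nonzero_coeffs n c \<Longrightarrow> Re (matrix_form n A c c) < 0"
    and lim: "\<And>i j. i < n \<Longrightarrow> j < n \<Longrightarrow> (\<lambda>m. Am m i j) \<longlonglongrightarrow> A i j"
  shows "\<exists>m e. \<forall>c. nonzero_coeffs n c \<longrightarrow>
      Re (matrix_form n (Am m) (\<lambda>i. \<Sum>a<n. c a * e a i) (\<lambda>i. \<Sum>a<n. c a * e a i)) < 0"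
proof -
  let ?V = "UNIV :: (nat \<Rightarrow> complex) set" and ?\<psi> = "\<lambda>i k. if k = i then 1 else (0::complex)"
  let ?A = "\<lambda>i j. - A i j"
  have V: "function_space ?V" by (simp add: function_space_def)
  have B: "hermitian_form ?V (matrix_form n ?A)" 
  proof (rule hermitian_matrix_form)
    show "- A j i = cnj (- A i j)" if "i < n" "j < n" for i j
      unfolding complex_cnj_minus using herm[OF that] by (rule arg_cong)
  qed
  have lc: "lin_comb n c ?\<psi> = (\<lambda>k. if k < n then c k else 0)" for c
    unfolding lin_comb_def by (auto simp: fun_eq_iff if_distrib[of "\<lambda>t. _ * t"] cong: if_cong)
  have mf: "matrix_form n A' (lin_comb n c ?\<psi>) (lin_comb n d ?\<psi>) = matrix_form n A' c d" for A' c d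
    unfolding lc matrix_form_def by (intro sum.cong refl) simp
  have neg': "matrix_form n ?A c d = - matrix_form n A c d" for c d
    unfolding matrix_form_def by (simp add: sum_negf)
  have pos: "Re (matrix_form n ?A (lin_comb n c ?\<psi>) (lin_comb n c ?\<psi>)) > 0" if "nonzero_coeffs n c" for c
    using neg[OF that] unfolding mf neg' by simp
  obtain e where "orthonormal_system (matrix_form n ?A) n (\<lambda>a. lin_comb n (e a) ?\<psi>)"
    using orthonormal_system_exists[OF V B, of n ?\<psi> 0 "\<lambda>_ _. 0" n] pos by auto
  then have e: "matrix_form n A (e a) (e b) = (if a = b then - 1 else 0)" if "a < n" "b < n" for a b
    using that unfolding orthonormal_system_def mf neg' by (auto simp: minus_equation_iff split: if_splits)
  have ev: "\<forall>\<^sub>F m in sequentially. \<forall>a\<in>{..<n}. \<forall>b\<in>{..<n}. cmod (matrix_form n (Am m) (e a) (e b) - matrix_form n A (e a) (e b)) < 1 / (2 * real n)"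
  proof (intro eventually_ball_finite ballI finite_lessThan)
    fix a b assume ab: "a \<in> {..<n}" "b \<in> {..<n}"
    have "(\<lambda>m. matrix_form n (Am m) (e a) (e b)) \<longlonglongrightarrow> matrix_form n A (e a) (e b)"
      unfolding matrix_form_def by (intro tendsto_sum tendsto_mult tendsto_const lim) auto
    then show "\<forall>\<^sub>F m in sequentially. cmod (matrix_form n (Am m) (e a) (e b) - matrix_form n A (e a) (e b)) < 1 / (2 * real n)"
      using ab by (auto simp: tendsto_iff dist_norm)
  qed
  then obtain m where m: "\<And>a b. a < n \<Longrightarrow> b < n \<Longrightarrow>
      cmod (matrix_form n (Am m) (e a) (e b) - matrix_form n A (e a) (e b)) < 1 / (2 * real n)"
    by (auto simp: eventually_sequentially)
  have "Re (matrix_form n (Am m) (\<lambda>i. \<Sum>a<n. c a * e a i) (\<lambda>i. \<Sum>a<n. c a * e a i)) < 0"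
    if c: "nonzero_coeffs n c" for c
  proof -
    let ?E = "\<lambda>A'. \<lambda>a b. matrix_form n A' (e a) (e b)"
    have sum_swap3: "(\<Sum>j<n. \<Sum>a<n. \<Sum>b<n. g j a b) = (\<Sum>a<n. \<Sum>b<n. \<Sum>j<n. g j a b)" for g :: "nat \<Rightarrow> nat \<Rightarrow> nat \<Rightarrow> complex"
    proof -
      have "(\<Sum>j<n. \<Sum>a<n. \<Sum>b<n. g j a b) = (\<Sum>a<n. \<Sum>j<n. \<Sum>b<n. g j a b)" by (rule sum.swap)
      also have "\<dots> = (\<Sum>a<n. \<Sum>b<n. \<Sum>j<n. g j a b)" by (intro sum.cong refl sum.swap)
      finally show ?thesis .
    qed
    have trans: "matrix_form n A' (\<lambda>i. \<Sum>a<n. c a * e a i) (\<lambda>i. \<Sum>a<n. c a * e a i) = matrix_form n (?E A') c c" for A'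
    proof -
      have "matrix_form n A' (\<lambda>i. \<Sum>a<n. c a * e a i) (\<lambda>i. \<Sum>a<n. c a * e a i)
          = (\<Sum>i<n. \<Sum>j<n. \<Sum>a<n. \<Sum>b<n. cnj (c a) * c b * (cnj (e a i) * e b j * A' i j))"
        unfolding matrix_form_def
        by (simp add: cnj_sum sum_distrib_left sum_distrib_right algebra_simps)
      also have "\<dots> = (\<Sum>i<n. \<Sum>a<n. \<Sum>b<n. \<Sum>j<n. cnj (c a) * c b * (cnj (e a i) * e b j * A' i j))"
        by (rule sum.cong[OF refl], rule sum_swap3)
      also have "\<dots> = (\<Sum>a<n. \<Sum>b<n. \<Sum>i<n. \<Sum>j<n. cnj (c a) * c b * (cnj (e a i) * e b j * A' i j))"
        by (rule sum_swap3)
      finally show ?thesis by (simp add: matrix_form_def sum_distrib_left)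
    qed
    define r where "r a b = ?E (Am m) a b - ?E A a b" for a b
    have split: "matrix_form n (?E (Am m)) c c = matrix_form n (?E A) c c + matrix_form n r c c"
      unfolding matrix_form_def r_def by (simp add: sum.distrib[symmetric] algebra_simps)
    have "matrix_form n (?E A) c c = (\<Sum>a<n. \<Sum>b<n. if a = b then - (cnj (c a) * c a) else 0)"
      unfolding matrix_form_def by (intro sum.cong refl) (simp add: e[unfolded matrix_form_def])
    also have "\<dots> = - of_real (\<Sum>a<n. (cmod (c a))\<^sup>2)"
      by (simp add: complex_norm_square mult.commute sum_negf del: of_real_power)
    finally have main: "Re (matrix_form n (?E A) c c) = - (\<Sum>a<n. (cmod (c a))\<^sup>2)" by simp
    have "Re (matrix_form n r c c) \<le> cmod (matrix_form n r c c)" by (rule complex_Re_le_cmod)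
    also have "\<dots> \<le> (\<Sum>a<n. \<Sum>b<n. cmod (c a) * cmod (c b) * cmod (r a b))"
      unfolding matrix_form_def by (intro order_trans[OF norm_sum] sum_mono) (simp add: norm_mult)
    also have "\<dots> \<le> (\<Sum>a<n. \<Sum>b<n. ((cmod (c a))\<^sup>2 + (cmod (c b))\<^sup>2) / 2 * (1 / (2 * real n)))"
    proof (intro sum_mono mult_mono)
      fix a b assume "a \<in> {..<n}" "b \<in> {..<n}"
      then show "cmod (r a b) \<le> 1 / (2 * real n)" unfolding r_def using m by (auto intro: less_imp_le)
      show "cmod (c a) * cmod (c b) \<le> ((cmod (c a))\<^sup>2 + (cmod (c b))\<^sup>2) / 2"
        using sum_squares_bound[of "cmod (c a)" "cmod (c b)"] by simp
    qed auto
    also have "\<dots> = (\<Sum>a<n. (cmod (c a))\<^sup>2) / 2"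
    proof -
      have n: "real n > 0" using c by (auto simp: nonzero_coeffs_def)
      have "(\<Sum>a<n. \<Sum>b<n. ((cmod (c a))\<^sup>2 + (cmod (c b))\<^sup>2) / 2 * (1 / (2 * real n)))
          = (\<Sum>a<n. \<Sum>b<n. (cmod (c a))\<^sup>2 + (cmod (c b))\<^sup>2) / (4 * real n)"
        by (simp add: sum_divide_distrib)
      also have "(\<Sum>a<n. \<Sum>b<n. (cmod (c a))\<^sup>2 + (cmod (c b))\<^sup>2) = 2 * real n * (\<Sum>a<n. (cmod (c a))\<^sup>2)"
        by (simp add: sum.distrib sum_distrib_left mult.assoc)
      finally show ?thesis using n by simp
    qed
    finally have "Re (matrix_form n r c c) \<le> (\<Sum>a<n. (cmod (c a))\<^sup>2) / 2" .
    moreover have "(\<Sum>a<n. (cmod (c a))\<^sup>2) > 0"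
    proof -
      obtain a where "a < n" "c a \<noteq> 0" using c by (auto simp: nonzero_coeffs_def)
      then show ?thesis by (intro sum_pos2[of _ a]) auto
    qed
    ultimately show ?thesis unfolding trans split using main by simp
  qed
  then show ?thesis by blast
qed

section \<open>The effective potential\<close>

lemma waveguide_curvature:
  assumes a: "a > 0" and cw: "curved_waveguide a \<gamma>"
  shows "\<bar>\<gamma> s\<bar> \<le> sup_norm \<gamma>" "delta_minus a \<gamma> > 0" "delta_minus a \<gamma> \<le> 1" "delta_plus a \<gamma> \<ge> 1"
    "\<bar>u\<bar> < a \<Longrightarrow> delta_minus a \<gamma> \<le> 1 + u * \<gamma> s" "\<bar>u\<bar> < a \<Longrightarrow> 1 + u * \<gamma> s \<le> delta_plus a \<gamma>"
proof -
  have b: "bounded (range \<gamma>)" "a * sup_norm \<gamma> < 1" using cw by (auto simp: curved_waveguide_def)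
  obtain C where "\<forall>x\<in>range \<gamma>. norm x \<le> C" using b(1) unfolding bounded_iff by blast
  then have "bdd_above (range (\<lambda>s. \<bar>\<gamma> s\<bar>))" by (intro bdd_aboveI[of _ C]) auto
  then have le: "\<bar>\<gamma> s\<bar> \<le> sup_norm \<gamma>" for s unfolding sup_norm_def by (intro cSUP_upper) auto
  show "\<bar>\<gamma> s\<bar> \<le> sup_norm \<gamma>" by (rule le)
  have nn: "0 \<le> a * sup_norm \<gamma>" using a order_trans[OF abs_ge_zero le[of 0]] by simp
  show "delta_minus a \<gamma> > 0" "delta_minus a \<gamma> \<le> 1" "delta_plus a \<gamma> \<ge> 1"
    using b(2) nn by (simp_all add: delta_minus_def delta_plus_def)
  have "\<bar>u * \<gamma> s\<bar> \<le> a * sup_norm \<gamma>" if "\<bar>u\<bar> < a"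
    unfolding abs_mult using that a le by (intro mult_mono) auto
  then show "\<bar>u\<bar> < a \<Longrightarrow> delta_minus a \<gamma> \<le> 1 + u * \<gamma> s" "\<bar>u\<bar> < a \<Longrightarrow> 1 + u * \<gamma> s \<le> delta_plus a \<gamma>"
    by (simp_all add: delta_minus_def delta_plus_def abs_le_iff)
qed

lemma compact_borel_piecewise:
  fixes f :: "real \<Rightarrow> real"
  assumes P: "finite P" and c: "\<And>s. s \<notin> P \<Longrightarrow> isCont f s" and b: "bounded (f ` (- P))" and z: "\<And>s. R < \<bar>s\<bar> \<Longrightarrow> f s = 0"
  shows "compact_borel f"
proof -
  have "f \<in> borel_measurable borel"
    by (rule borel_measurable_continuous_countable_exceptions[OF countable_finite[OF P]])
       (use c in \<open>simp add: continuous_at_imp_continuous_on\<close>)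
  moreover have "bounded (range f)"
  proof -
    have "range f = f ` (- P) \<union> f ` P" by auto
    then show ?thesis using b P by (simp add: finite_imp_bounded)
  qed
  ultimately show ?thesis using z unfolding compact_borel_def bounded_borel_def bounded_iff by auto
qed

lemma waveguide_regularity:
  assumes cw: "curved_waveguide a \<gamma>"
  shows "\<exists>P. finite P \<and> (\<forall>s. s \<notin> P \<longrightarrow> isCont \<gamma> s \<and> isCont (deriv \<gamma>) s \<and> isCont (deriv (deriv \<gamma>)) s)"
    and "compact_borel \<gamma>" "compact_borel (deriv \<gamma>)" "compact_borel (deriv (deriv \<gamma>))"
proof -
  obtain P where P: "finite P" and d: "\<And>s. s \<notin> P \<Longrightarrow> \<gamma> differentiable (at s)" "\<And>s. s \<notin> P \<Longrightarrow> deriv \<gamma> differentiable (at s)"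
    and c: "continuous_on (- P) (deriv (deriv \<gamma>))" and b: "bounded (deriv \<gamma> ` (- P))" "bounded (deriv (deriv \<gamma>) ` (- P))"
    using cw unfolding curved_waveguide_def piecewise_C2_bounded_derivs_def by auto
  obtain R where R: "\<And>s. R < \<bar>s\<bar> \<Longrightarrow> \<gamma> s = 0" using cw by (auto simp: curved_waveguide_def)
  have zero: "deriv f s = 0" if "\<And>s. R < \<bar>s\<bar> \<Longrightarrow> f s = 0" "R < \<bar>s\<bar>" for f :: "real \<Rightarrow> real" and s
  proof -
    have "open {y. R < \<bar>y::real\<bar>}" by (intro open_Collect_less continuous_intros)
    then have "\<forall>\<^sub>F y in nhds s. y \<in> {y. R < \<bar>y\<bar>}" using that(2) by (intro eventually_nhds_in_open) auto
    then have "\<forall>\<^sub>F y in nhds s. f y = (\<lambda>_. 0) y" by eventually_elim (use that(1) in auto)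
    then have "deriv f s = deriv (\<lambda>_. 0) s" by (rule deriv_cong_ev) simp
    then show ?thesis by simp
  qed
  have c0: "isCont \<gamma> s" "isCont (deriv \<gamma>) s" if "s \<notin> P" for s
    using d that by (auto intro: differentiable_imp_continuous_within)
  have "open (- P)" using P by (simp add: finite_imp_closed open_Compl)
  then have c2: "isCont (deriv (deriv \<gamma>)) s" if "s \<notin> P" for s
    using c that by (simp add: continuous_on_eq_continuous_at)
  show "\<exists>P. finite P \<and> (\<forall>s. s \<notin> P \<longrightarrow> isCont \<gamma> s \<and> isCont (deriv \<gamma>) s \<and> isCont (deriv (deriv \<gamma>)) s)"
    using P c0 c2 by blast
  have z1: "deriv \<gamma> s = 0" if "R < \<bar>s\<bar>" for s using R that by (rule zero)
  have z2: "deriv (deriv \<gamma>) s = 0" if "R < \<bar>s\<bar>" for s using z1 that by (rule zero)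
  have "bounded (\<gamma> ` (- P))" using cw by (auto simp: curved_waveguide_def intro: bounded_subset)
  with P c0(1) show "compact_borel \<gamma>" using R by (rule compact_borel_piecewise)
  show "compact_borel (deriv \<gamma>)" using P c0(2) b(1) z1 by (rule compact_borel_piecewise)
  show "compact_borel (deriv (deriv \<gamma>))" using P c2 b(2) z2 by (rule compact_borel_piecewise)
qed

lemma W_tilde_nonneg: "a > 0 \<Longrightarrow> delta_minus a \<gamma> > 0 \<Longrightarrow> 0 \<le> W_tilde a \<gamma> s"
  unfolding W_tilde_def by (intro add_nonneg_nonneg divide_nonneg_nonneg mult_nonneg_nonneg) auto

lemma W_tilde_potential:
  assumes a: "a > 0" and cw: "curved_waveguide a \<gamma>" and D: "D \<ge> 0"
  shows "potential (\<lambda>s. D * W_tilde a \<gamma> s)" "piecewise_continuous (\<lambda>s. D * W_tilde a \<gamma> s)"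
proof -
  note reg = waveguide_regularity[OF cw]
  have n: "compact_borel (\<lambda>s. (norm (\<gamma> s))\<^sup>2)" "compact_borel (\<lambda>s. (norm (deriv (deriv \<gamma>) s)) ^ 1)" "compact_borel (\<lambda>s. (norm (deriv \<gamma> s))\<^sup>2)"
    by (rule compact_borel_norm[OF reg(2)] compact_borel_norm[OF reg(4)] compact_borel_norm[OF reg(3)]; simp)+
  let ?x = "1 / (4 * (delta_minus a \<gamma>)\<^sup>2)" and ?y = "a / (2 * delta_minus a \<gamma> ^ 3)" and ?z = "5 * a\<^sup>2 / (4 * delta_minus a \<gamma> ^ 4)"
  have "compact_borel (\<lambda>s. ?x * (norm (\<gamma> s))\<^sup>2 + (?y * (norm (deriv (deriv \<gamma>) s)) ^ 1 + ?z * (norm (deriv \<gamma> s))\<^sup>2))"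
    by (rule compact_borel_add[OF compact_borel_mult(2)[OF n(1) bounded_borel_const]
          compact_borel_add[OF compact_borel_mult(2)[OF n(2) bounded_borel_const] compact_borel_mult(2)[OF n(3) bounded_borel_const]]])
  then have "compact_borel (W_tilde a \<gamma>)" by (simp add: W_tilde_def[abs_def] add.assoc)
  then have "compact_borel (\<lambda>s. D * W_tilde a \<gamma> s)" by (rule compact_borel_mult(2)[OF _ bounded_borel_const])
  then show "potential (\<lambda>s. D * W_tilde a \<gamma> s)"
    using W_tilde_nonneg[OF a waveguide_curvature(2)[OF a cw]] D by (auto simp: potential_def)
  obtain P where P: "finite P" "\<And>s. s \<notin> P \<Longrightarrow> isCont \<gamma> s \<and> isCont (deriv \<gamma>) s \<and> isCont (deriv (deriv \<gamma>)) s"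
    using reg(1) by blast
  have "isCont (\<lambda>s. D * W_tilde a \<gamma> s) s" if "s \<notin> P" for s
    unfolding W_tilde_def using P(2)[OF that] waveguide_curvature(2)[OF a cw] by (intro continuous_intros) auto
  then show "piecewise_continuous (\<lambda>s. D * W_tilde a \<gamma> s)" unfolding piecewise_continuous_def using P(1) by blast
qed

lemma effective_potential_le:
  assumes a: "a > 0" and cw: "curved_waveguide a \<gamma>" and u: "\<bar>u\<bar> < a"
  shows "\<bar>effective_potential \<gamma> (s, u)\<bar> \<le> W_tilde a \<gamma> s"
proof -
  let ?h = "1 + u * \<gamma> s" and ?d = "delta_minus a \<gamma>"
  note k = waveguide_curvature[OF a cw]
  have d: "?d > 0" "?d \<le> ?h" using k(2) k(5)[OF u] by auto
  have pw: "?d ^ m \<le> ?h ^ m" for m using d by (intro power_mono) auto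
  have pos: "?d ^ m > 0" for m using d by simp
  have 1: "(\<gamma> s)\<^sup>2 / (4 * ?h\<^sup>2) \<le> (\<gamma> s)\<^sup>2 / (4 * ?d\<^sup>2)" "0 \<le> (\<gamma> s)\<^sup>2 / (4 * ?h\<^sup>2)"
    using pw[of 2] pos[of 2] by (auto intro!: divide_left_mono mult_pos_pos less_le_trans[OF pos pw])
  have h3: "?h ^ 3 > 0" "?h ^ 4 > 0" using less_le_trans[OF pos pw] by blast+
  have 2: "\<bar>u * deriv (deriv \<gamma>) s / (2 * ?h ^ 3)\<bar> \<le> a * \<bar>deriv (deriv \<gamma>) s\<bar> / (2 * ?d ^ 3)"
  proof -
    have "\<bar>u * deriv (deriv \<gamma>) s / (2 * ?h ^ 3)\<bar> = \<bar>u\<bar> * \<bar>deriv (deriv \<gamma>) s\<bar> / (2 * ?h ^ 3)"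
      using h3 by (simp add: abs_mult)
    also have "\<dots> \<le> a * \<bar>deriv (deriv \<gamma>) s\<bar> / (2 * ?d ^ 3)"
      using u a pw[of 3] pos[of 3] by (intro frac_le mult_mono mult_nonneg_nonneg) auto
    finally show ?thesis .
  qed
  have 3: "5 / 4 * (u\<^sup>2 * (deriv \<gamma> s)\<^sup>2 / ?h ^ 4) \<le> 5 * a\<^sup>2 * (deriv \<gamma> s)\<^sup>2 / (4 * ?d ^ 4)" "0 \<le> 5 / 4 * (u\<^sup>2 * (deriv \<gamma> s)\<^sup>2 / ?h ^ 4)"
  proof -
    have "u\<^sup>2 \<le> a\<^sup>2" using u a by (intro abs_le_square_iff[THEN iffD1]) simp
    then have "u\<^sup>2 * (deriv \<gamma> s)\<^sup>2 / ?h ^ 4 \<le> a\<^sup>2 * (deriv \<gamma> s)\<^sup>2 / ?d ^ 4"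
      using pw[of 4] pos[of 4] by (intro frac_le mult_right_mono mult_nonneg_nonneg) auto
    then have "5 / 4 * (u\<^sup>2 * (deriv \<gamma> s)\<^sup>2 / ?h ^ 4) \<le> 5 / 4 * (a\<^sup>2 * (deriv \<gamma> s)\<^sup>2 / ?d ^ 4)"
      by (rule mult_left_mono) simp
    then show "5 / 4 * (u\<^sup>2 * (deriv \<gamma> s)\<^sup>2 / ?h ^ 4) \<le> 5 * a\<^sup>2 * (deriv \<gamma> s)\<^sup>2 / (4 * ?d ^ 4)"
      by (simp only: times_divide_times_eq mult.assoc)
    show "0 \<le> 5 / 4 * (u\<^sup>2 * (deriv \<gamma> s)\<^sup>2 / ?h ^ 4)" using h3 by simp
  qed
  have e: "effective_potential \<gamma> (s, u) = - ((\<gamma> s)\<^sup>2 / (4 * ?h\<^sup>2)) + u * deriv (deriv \<gamma>) s / (2 * ?h ^ 3)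
      - 5 / 4 * (u\<^sup>2 * (deriv \<gamma> s)\<^sup>2 / ?h ^ 4)" by (simp add: effective_potential_def)
  show ?thesis using 1 2 3 unfolding e W_tilde_def abs_le_iff by linarith
qed

abbreviation arc_weight :: "(real \<Rightarrow> real) \<Rightarrow> real \<times> real \<Rightarrow> real" where
  "arc_weight \<gamma> p \<equiv> 1 / (1 + snd p * \<gamma> (fst p))\<^sup>2"

lemma strip_set: "straight_strip a \<inter> space lborel \<in> sets lborel"
proof -
  have "straight_strip a = {p. - a < snd p \<and> snd p < a}" by (auto simp: straight_strip_def)
  moreover have "open {p::real \<times> real. - a < snd p \<and> snd p < a}"
    by (intro open_Collect_conj open_Collect_less continuous_intros)
  ultimately show ?thesis by simp
qed

lemma space_strip: "space (strip_measure a) = straight_strip a"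
  by (simp add: space_restrict_space)

lemma in_strip: "p \<in> straight_strip a \<longleftrightarrow> \<bar>snd p\<bar> < a"
  by (cases p) (auto simp: straight_strip_def abs_less_iff)

lemma strip_measurable: "f \<in> borel_measurable borel \<Longrightarrow> f \<in> borel_measurable (strip_measure a)"
  by (intro measurable_restrict_space1) simp

lemma waveguide_weights:
  assumes a: "a > 0" and cw: "curved_waveguide a \<gamma>"
  shows "bounded_weight (strip_measure a) (arc_weight \<gamma>)"
    "bounded_weight (strip_measure a) (effective_potential \<gamma>)"
    "bounded_weight (strip_measure a) (\<lambda>_. 1)"
proof -
  note reg = waveguide_regularity[OF cw]
  note k = waveguide_curvature[OF a cw]
  have m[measurable]: "(\<lambda>p::real \<times> real. \<gamma> (fst p)) \<in> borel_measurable borel" "(\<lambda>p::real \<times> real. deriv \<gamma> (fst p)) \<in> borel_measurable borel"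
    "(\<lambda>p::real \<times> real. deriv (deriv \<gamma>) (fst p)) \<in> borel_measurable borel" "(\<lambda>p::real \<times> real. snd p) \<in> borel_measurable borel"
    using reg(2-4) by (auto intro: borel_pair_fst borel_pair_snd compact_borel_measurable)
  have m1: "arc_weight \<gamma> \<in> borel_measurable borel" by measurable
  have m2: "effective_potential \<gamma> \<in> borel_measurable borel"
    unfolding effective_potential_def case_prod_beta' by measurable
  have "\<bar>arc_weight \<gamma> p\<bar> \<le> 1 / (delta_minus a \<gamma>)\<^sup>2" if "p \<in> space (strip_measure a)" for p
  proof -
    have "delta_minus a \<gamma> \<le> 1 + snd p * \<gamma> (fst p)" using that by (intro k(5)) (simp add: space_strip in_strip)
    then have "(delta_minus a \<gamma>)\<^sup>2 \<le> (1 + snd p * \<gamma> (fst p))\<^sup>2" using k(2) by (intro power_mono) auto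
    then show ?thesis using k(2) by (simp add: frac_le)
  qed
  then show "bounded_weight (strip_measure a) (arc_weight \<gamma>)"
    unfolding bounded_weight_def using strip_measurable[OF m1] by (intro conjI exI[of _ "1 / (delta_minus a \<gamma>)\<^sup>2"]) auto
  obtain C where C: "C \<ge> 0" "\<And>s. norm (1 * W_tilde a \<gamma> s) \<le> C"
    using bounded_borel_bound[OF compact_borel_bounded[OF potential_compact[OF W_tilde_potential(1)[OF a cw, of 1]]]] by auto
  have "\<bar>effective_potential \<gamma> p\<bar> \<le> C" if "p \<in> space (strip_measure a)" for p
  proof -
    have "\<bar>effective_potential \<gamma> (fst p, snd p)\<bar> \<le> W_tilde a \<gamma> (fst p)"
      using that by (intro effective_potential_le[OF a cw]) (simp add: space_strip in_strip)
    then show ?thesis using C(2)[of "fst p"] by simp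
  qed
  then show "bounded_weight (strip_measure a) (effective_potential \<gamma>)"
    unfolding bounded_weight_def using strip_measurable[OF m2] C(1) by blast
  show "bounded_weight (strip_measure a) (\<lambda>_. 1)" unfolding bounded_weight_def by (auto intro!: exI[of _ 1])
qed

section \<open>Eigenfunctions and the energy form\<close>

text \<open>The gradients are separate arguments, because an element of \<open>H\<^sup>1\<^sub>0\<close> carries weak derivatives that need not
  be its pointwise partial derivatives.\<close>

definition strip_form :: "real \<Rightarrow> (real \<Rightarrow> real) \<Rightarrow> (real \<times> real \<Rightarrow> complex) \<Rightarrow> (real \<times> real \<Rightarrow> complex) \<Rightarrow>
    (real \<times> real \<Rightarrow> complex) \<Rightarrow> (real \<times> real \<Rightarrow> complex) \<Rightarrow> (real \<times> real \<Rightarrow> complex) \<Rightarrow> (real \<times> real \<Rightarrow> complex) \<Rightarrow> complex" where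
  "strip_form a \<gamma> fs fu f gs gu g = pairing (strip_measure a) (arc_weight \<gamma>) fs gs
     + pairing (strip_measure a) (\<lambda>_. 1) fu gu + pairing (strip_measure a) (effective_potential \<gamma>) f g"

abbreviation strip_inner :: "real \<Rightarrow> (real \<times> real) form" where
  "strip_inner a \<equiv> pairing (strip_measure a) (\<lambda>_. 1)"

lemma compact_borel_L2:
  fixes f :: "real \<times> real \<Rightarrow> complex"
  assumes "compact_borel f" shows "f \<in> L2 (strip_measure a)"
proof -
  have "integrable lborel (\<lambda>p. (cmod (f p))\<^sup>2)"
    by (rule compact_borel_integrable[OF compact_borel_norm[OF assms]]) simp
  then have "integrable (strip_measure a) (\<lambda>p. (cmod (f p))\<^sup>2)"
    unfolding integrable_restrict_space[OF strip_set] using strip_set[of a] by (intro integrable_mult_indicator) auto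
  then show ?thesis using strip_measurable[OF compact_borel_measurable[OF assms]] by (simp add: L2_def)
qed

lemma strip_C1_L2:
  assumes "f \<in> strip_C1 a"
  shows "f \<in> L2 (strip_measure a)" "partial_s f \<in> L2 (strip_measure a)" "partial_u f \<in> L2 (strip_measure a)"
  using strip_C1_borel[OF assms] by (auto intro: compact_borel_L2)

text \<open>An eigenfunction together with its weak gradient and a sequence of test functions that approximates it
  in the Sobolev norm.\<close>

definition eigendata :: "real \<Rightarrow> (real \<Rightarrow> real) \<Rightarrow> real \<Rightarrow> (real \<times> real \<Rightarrow> complex) \<Rightarrow> (real \<times> real \<Rightarrow> complex) \<Rightarrow>
    (real \<times> real \<Rightarrow> complex) \<Rightarrow> (nat \<Rightarrow> real \<times> real \<Rightarrow> complex) \<Rightarrow> bool" where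
  "eigendata a \<gamma> E \<phi> gs gu \<eta> \<longleftrightarrow>
     \<phi> \<in> L2 (strip_measure a) \<and> gs \<in> L2 (strip_measure a) \<and> gu \<in> L2 (strip_measure a) \<and>
     (\<forall>n. \<eta> n \<in> strip_C1 a) \<and> L2_tendsto (strip_measure a) \<eta> \<phi> \<and>
     L2_tendsto (strip_measure a) (\<lambda>n. partial_s (\<eta> n)) gs \<and> L2_tendsto (strip_measure a) (\<lambda>n. partial_u (\<eta> n)) gu \<and>
     (\<forall>\<zeta>\<in>test_functions (straight_strip a).
        strip_form a \<gamma> (partial_s \<zeta>) (partial_u \<zeta>) \<zeta> gs gu \<phi> = of_real E * strip_inner a \<zeta> \<phi>) \<and>
     (\<forall>n. \<eta> n \<in> test_functions (straight_strip a))"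

lemma eigendata_exists:
  assumes a: "a > 0" and cw: "curved_waveguide a \<gamma>" and \<phi>: "\<phi> \<in> eigenspace a \<gamma> E"
  shows "\<exists>gs gu \<eta>. eigendata a \<gamma> E \<phi> gs gu \<eta>"
proof -
  note wt = waveguide_weights[OF a cw]
  obtain gs gu where H: "H01_gradient a \<phi> gs gu"
    and weak: "\<And>\<zeta>. \<zeta> \<in> test_functions (straight_strip a) \<Longrightarrow>
           (LINT p|strip_measure a.
              cnj (partial_s \<zeta> p) * gs p / of_real ((1 + snd p * \<gamma> (fst p))\<^sup>2)
              + cnj (partial_u \<zeta> p) * gu p
              + cnj (\<zeta> p) * of_real (effective_potential \<gamma> p) * \<phi> p)
           = (LINT p|strip_measure a. cnj (\<zeta> p) * (of_real E * \<phi> p))"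
    using \<phi> unfolding eigenspace_def hamiltonian_def mem_Collect_eq by blast
  obtain \<eta> where \<eta>: "\<And>n. \<eta> n \<in> test_functions (straight_strip a)" "L2_tendsto (strip_measure a) \<eta> \<phi>"
      "L2_tendsto (strip_measure a) (\<lambda>n. partial_s (\<eta> n)) gs" "L2_tendsto (strip_measure a) (\<lambda>n. partial_u (\<eta> n)) gu"
    and L: "\<phi> \<in> L2 (strip_measure a)" "gs \<in> L2 (strip_measure a)" "gu \<in> L2 (strip_measure a)"
    using H unfolding H01_gradient_def by blast
  have "strip_form a \<gamma> (partial_s \<zeta>) (partial_u \<zeta>) \<zeta> gs gu \<phi> = of_real E * strip_inner a \<zeta> \<phi>"
    if \<zeta>: "\<zeta> \<in> test_functions (straight_strip a)" for \<zeta>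
  proof -
    note z = strip_C1_L2[OF test_function_strip_C1[OF \<zeta>]]
    note i = pairing_integrable[OF wt(1) z(2) L(2)] pairing_integrable[OF wt(3) z(3) L(3)] pairing_integrable[OF wt(2) z(1) L(1)]
    have "strip_form a \<gamma> (partial_s \<zeta>) (partial_u \<zeta>) \<zeta> gs gu \<phi>
        = (LINT p|strip_measure a. of_real (arc_weight \<gamma> p) * (cnj (partial_s \<zeta> p) * gs p)
            + of_real 1 * (cnj (partial_u \<zeta> p) * gu p) + of_real (effective_potential \<gamma> p) * (cnj (\<zeta> p) * \<phi> p))"
      unfolding strip_form_def pairing_def
      by (simp only: Bochner_Integration.integral_add[OF Bochner_Integration.integrable_add[OF i(1,2)] i(3)]
          Bochner_Integration.integral_add[OF i(1,2)])
    also have "\<dots> = (LINT p|strip_measure a.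
              cnj (partial_s \<zeta> p) * gs p / of_real ((1 + snd p * \<gamma> (fst p))\<^sup>2)
              + cnj (partial_u \<zeta> p) * gu p
              + cnj (\<zeta> p) * of_real (effective_potential \<gamma> p) * \<phi> p)"
      by (rule Bochner_Integration.integral_cong) (auto simp: of_real_divide)
    also have "\<dots> = (LINT p|strip_measure a. of_real E * (of_real 1 * (cnj (\<zeta> p) * \<phi> p)))"
      unfolding weak[OF \<zeta>] by (rule Bochner_Integration.integral_cong) auto
    also have "\<dots> = of_real E * strip_inner a \<zeta> \<phi>" unfolding pairing_def by (rule integral_mult_right_zero)
    finally show ?thesis .
  qed
  then show ?thesis unfolding eigendata_def using L \<eta> test_function_strip_C1 by blast
qed

lemma strip_form_tendsto:
  assumes a: "a > 0" and cw: "curved_waveguide a \<gamma>"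
    and "f \<in> L2 (strip_measure a)" "fs \<in> L2 (strip_measure a)" "fu \<in> L2 (strip_measure a)"
      "g \<in> L2 (strip_measure a)" "gs \<in> L2 (strip_measure a)" "gu \<in> L2 (strip_measure a)"
    and "\<And>n. F n \<in> L2 (strip_measure a)" "\<And>n. Fs n \<in> L2 (strip_measure a)" "\<And>n. Fu n \<in> L2 (strip_measure a)"
      "\<And>n. G n \<in> L2 (strip_measure a)" "\<And>n. Gs n \<in> L2 (strip_measure a)" "\<And>n. Gu n \<in> L2 (strip_measure a)"
    and "L2_tendsto (strip_measure a) F f" "L2_tendsto (strip_measure a) Fs fs" "L2_tendsto (strip_measure a) Fu fu"
      "L2_tendsto (strip_measure a) G g" "L2_tendsto (strip_measure a) Gs gs" "L2_tendsto (strip_measure a) Gu gu"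
  shows "(\<lambda>n. strip_form a \<gamma> (Fs n) (Fu n) (F n) (Gs n) (Gu n) (G n)) \<longlonglongrightarrow> strip_form a \<gamma> fs fu f gs gu g"
proof -
  note wt = waveguide_weights[OF a cw]
  show ?thesis unfolding strip_form_def
    by (intro tendsto_add)
       (rule pairing_tendsto[OF wt(1)] pairing_tendsto[OF wt(2)] pairing_tendsto[OF wt(3)]; fact)+
qed

lemma L2_tendsto_const: "L2_tendsto M (\<lambda>_. f) f"
  by (simp add: L2_tendsto_def)

text \<open>Inserting the approximating test functions of one eigenfunction into the weak equation of another.\<close>

lemma eigendata_form:
  assumes a: "a > 0" and cw: "curved_waveguide a \<gamma>"
    and 1: "eigendata a \<gamma> E \<phi> gs gu \<eta>" and 2: "eigendata a \<gamma> F \<psi> hs hu \<zeta>"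
  shows "strip_form a \<gamma> gs gu \<phi> hs hu \<psi> = of_real F * strip_inner a \<phi> \<psi>"
proof -
  have L: "\<phi> \<in> L2 (strip_measure a)" "gs \<in> L2 (strip_measure a)" "gu \<in> L2 (strip_measure a)"
      "\<psi> \<in> L2 (strip_measure a)" "hs \<in> L2 (strip_measure a)" "hu \<in> L2 (strip_measure a)"
    and t: "L2_tendsto (strip_measure a) \<eta> \<phi>" "L2_tendsto (strip_measure a) (\<lambda>n. partial_s (\<eta> n)) gs"
      "L2_tendsto (strip_measure a) (\<lambda>n. partial_u (\<eta> n)) gu"
    and C: "\<And>n. \<eta> n \<in> strip_C1 a"
    and w: "\<And>n. strip_form a \<gamma> (partial_s (\<eta> n)) (partial_u (\<eta> n)) (\<eta> n) hs hu \<psi> = of_real F * strip_inner a (\<eta> n) \<psi>"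
    using 1 2 unfolding eigendata_def by blast+
  note c = strip_C1_L2[OF C]
  have "(\<lambda>n. strip_form a \<gamma> (partial_s (\<eta> n)) (partial_u (\<eta> n)) (\<eta> n) hs hu \<psi>) \<longlonglongrightarrow> strip_form a \<gamma> gs gu \<phi> hs hu \<psi>"
    by (rule strip_form_tendsto[OF a cw L c(1) c(2) c(3) L(4) L(5) L(6) t L2_tendsto_const L2_tendsto_const L2_tendsto_const])
  moreover have "(\<lambda>n. of_real F * strip_inner a (\<eta> n) \<psi>) \<longlonglongrightarrow> of_real F * strip_inner a \<phi> \<psi>"
    by (intro tendsto_mult tendsto_const pairing_tendsto[OF waveguide_weights(3)[OF a cw] L(1) L(4) c(1) t(1) L(4) L2_tendsto_const])
  ultimately show ?thesis unfolding w by (rule LIMSEQ_unique)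
qed

lemma strip_form_sym: "strip_form a \<gamma> gs gu g fs fu f = cnj (strip_form a \<gamma> fs fu f gs gu g)"
proof -
  have "pairing M m g f = cnj (pairing M m f g)" for M m and f g :: "real \<times> real \<Rightarrow> complex"
    unfolding pairing_def Bochner_Integration.integral_cnj[symmetric]
    by (rule Bochner_Integration.integral_cong) (auto simp: algebra_simps)
  then show ?thesis unfolding strip_form_def complex_cnj_add by (intro arg_cong2[where f = "(+)"])
qed

lemma eigenspaces_orthogonal:
  assumes a: "a > 0" and cw: "curved_waveguide a \<gamma>"
    and "\<phi> \<in> eigenspace a \<gamma> E" "\<psi> \<in> eigenspace a \<gamma> F" "E \<noteq> F"
  shows "strip_inner a \<phi> \<psi> = 0"
proof -
  obtain gs gu \<eta> hs hu \<zeta> where d: "eigendata a \<gamma> E \<phi> gs gu \<eta>" "eigendata a \<gamma> F \<psi> hs hu \<zeta>"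
    using eigendata_exists[OF a cw] assms(3,4) by metis
  have L: "\<phi> \<in> L2 (strip_measure a)" "\<psi> \<in> L2 (strip_measure a)" using d by (auto simp: eigendata_def)
  have s: "strip_inner a \<psi> \<phi> = cnj (strip_inner a \<phi> \<psi>)"
    by (rule hermitian_form_sym[OF hermitian_pairing[OF waveguide_weights(3)[OF a cw]] L])
  have "cnj (of_real E * strip_inner a \<psi> \<phi>) = cnj (strip_form a \<gamma> hs hu \<psi> gs gu \<phi>)"
    unfolding eigendata_form[OF a cw d(2) d(1)] ..
  also have "\<dots> = strip_form a \<gamma> gs gu \<phi> hs hu \<psi>" by (rule strip_form_sym[symmetric])
  also have "\<dots> = of_real F * strip_inner a \<phi> \<psi>" by (rule eigendata_form[OF a cw d])
  finally have "of_real E * strip_inner a \<phi> \<psi> = of_real F * strip_inner a \<phi> \<psi>" unfolding s by simp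
  then show ?thesis using assms(5) by simp
qed

lemma strip_inner_pos:
  assumes f: "f \<in> L2 (strip_measure a)" and nz: "\<not> (AE p in strip_measure a. f p = 0)"
  shows "Re (strip_inner a f f) > 0"
proof -
  have e: "Re (strip_inner a f f) = (LINT p|strip_measure a. (cmod (f p))\<^sup>2)" unfolding pairing_diag by simp
  have "(LINT p|strip_measure a. (cmod (f p))\<^sup>2) \<noteq> 0"
    using nz by (subst integral_nonneg_eq_0_iff_AE[OF L2_D(2)[OF f]]) auto
  moreover have "(LINT p|strip_measure a. (cmod (f p))\<^sup>2) \<ge> 0" by (rule integral_nonneg_AE) simp
  ultimately show ?thesis unfolding e by linarith
qed

text \<open>The quadratic form of \<open>H\<^sub>1 - (\<pi> / (2 a))\<^sup>2\<close> on test functions.\<close>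

definition shifted_form :: "real \<Rightarrow> (real \<Rightarrow> real) \<Rightarrow> (real \<times> real) form" where
  "shifted_form a \<gamma> f g = strip_form a \<gamma> (partial_s f) (partial_u f) f (partial_s g) (partial_u g) g
     - of_real ((pi / (2 * a))\<^sup>2) * strip_inner a f g"

lemma hermitian_shifted_form:
  assumes a: "a > 0" and cw: "curved_waveguide a \<gamma>"
  shows "hermitian_form (strip_C1 a) (shifted_form a \<gamma>)"
  unfolding hermitian_form_def
proof (intro conjI ballI)
  note lin = hermitian_form_linear[OF hermitian_pairing, unfolded linear_functional_def, rule_format]
  note wt = waveguide_weights[OF a cw]
  fix f assume f: "f \<in> strip_C1 a"
  note fL = strip_C1_L2[OF f]
  show "linear_functional (strip_C1 a) (shifted_form a \<gamma> f)"
    unfolding linear_functional_def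
  proof (intro ballI allI)
    fix g h c assume g: "g \<in> strip_C1 a" and h: "h \<in> strip_C1 a"
    note gL = strip_C1_L2[OF g] and hL = strip_C1_L2[OF h]
    have 1: "pairing (strip_measure a) (arc_weight \<gamma>) (partial_s f) (\<lambda>p. partial_s g p + c * partial_s h p)
        = pairing (strip_measure a) (arc_weight \<gamma>) (partial_s f) (partial_s g) + c * pairing (strip_measure a) (arc_weight \<gamma>) (partial_s f) (partial_s h)"
      using wt(1) fL(2) gL(2) hL(2) by (rule lin)
    have 2: "strip_inner a (partial_u f) (\<lambda>p. partial_u g p + c * partial_u h p)
        = strip_inner a (partial_u f) (partial_u g) + c * strip_inner a (partial_u f) (partial_u h)"
      using wt(3) fL(3) gL(3) hL(3) by (rule lin)
    have 3: "pairing (strip_measure a) (effective_potential \<gamma>) f (\<lambda>p. g p + c * h p)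
        = pairing (strip_measure a) (effective_potential \<gamma>) f g + c * pairing (strip_measure a) (effective_potential \<gamma>) f h"
      using wt(2) fL(1) gL(1) hL(1) by (rule lin)
    have 4: "strip_inner a f (\<lambda>p. g p + c * h p) = strip_inner a f g + c * strip_inner a f h"
      using wt(3) fL(1) gL(1) hL(1) by (rule lin)
    show "shifted_form a \<gamma> f (\<lambda>p. g p + c * h p) = shifted_form a \<gamma> f g + c * shifted_form a \<gamma> f h"
      unfolding shifted_form_def strip_form_def strip_C1_lin(2)[OF g h] strip_C1_lin(3)[OF g h] 1 2 3 4
      by (simp add: algebra_simps)
  qed
  fix g assume g: "g \<in> strip_C1 a"
  have "strip_inner a g f = cnj (strip_inner a f g)"
    by (rule hermitian_form_sym[OF hermitian_pairing[OF wt(3)] fL(1) strip_C1_L2(1)[OF g]])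
  then show "shifted_form a \<gamma> g f = cnj (shifted_form a \<gamma> f g)"
    unfolding shifted_form_def strip_form_sym[of a \<gamma> "partial_s g" "partial_u g" g] by simp
qed

text \<open>Since \<open>1 + u \<gamma>\<close> is at most \<open>\<delta>\<^sub>+\<close>, multiplying by \<open>\<delta>\<^sub>+\<^sup>2\<close> makes the longitudinal term
  at least the free one; the effective potential is bounded below by \<open>- W_tilde\<close>.\<close>

lemma strip_energy_le_shifted_form:
  assumes a: "a > 0" and cw: "curved_waveguide a \<gamma>" and f: "f \<in> strip_C1 a"
  shows "strip_energy a ((delta_plus a \<gamma>)\<^sup>2) (\<lambda>s. (delta_plus a \<gamma>)\<^sup>2 * W_tilde a \<gamma> s) f
      \<le> (delta_plus a \<gamma>)\<^sup>2 * Re (shifted_form a \<gamma> f f)"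
proof -
  let ?D = "(delta_plus a \<gamma>)\<^sup>2" and ?E = "(pi / (2 * a))\<^sup>2" and ?M = "strip_measure a"
  let ?X = "\<lambda>p. (cmod (partial_s f p))\<^sup>2
     + ?D * ((cmod (partial_u f p))\<^sup>2 - ?E * (cmod (f p))\<^sup>2) - ?D * W_tilde a \<gamma> (fst p) * (cmod (f p))\<^sup>2"
  let ?Y = "\<lambda>p. arc_weight \<gamma> p * (cmod (partial_s f p))\<^sup>2 + 1 * (cmod (partial_u f p))\<^sup>2
     + effective_potential \<gamma> p * (cmod (f p))\<^sup>2 - ?E * (1 * (cmod (f p))\<^sup>2)"
  note fL = strip_C1_L2[OF f] and wt = waveguide_weights[OF a cw]
  have re: "integrable ?M (\<lambda>p. m p * (cmod (g p))\<^sup>2)" if "bounded_weight ?M m" "g \<in> L2 ?M" for m g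
  proof -
    have "(\<lambda>p. of_real (m p) * (cnj (g p) * g p)) = (\<lambda>p. complex_of_real (m p * (cmod (g p))\<^sup>2))"
      unfolding of_real_mult complex_norm_square by (simp add: mult.commute)
    then have "integrable ?M (\<lambda>p. complex_of_real (m p * (cmod (g p))\<^sup>2))"
      using pairing_integrable[OF that(1) that(2) that(2)] by simp
    from integrable_Re[OF this] show ?thesis by simp
  qed
  note i = re[OF wt(1) fL(2)] re[OF wt(3) fL(3)] re[OF wt(2) fL(1)] re[OF wt(3) fL(1)]
  have Y: "integrable ?M ?Y"
    by (intro Bochner_Integration.integrable_add Bochner_Integration.integrable_diff i integrable_mult_right)
  have "Re (shifted_form a \<gamma> f f) = (LINT p|?M. arc_weight \<gamma> p * (cmod (partial_s f p))\<^sup>2) + (LINT p|?M. 1 * (cmod (partial_u f p))\<^sup>2)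
      + (LINT p|?M. effective_potential \<gamma> p * (cmod (f p))\<^sup>2) - ?E * (LINT p|?M. 1 * (cmod (f p))\<^sup>2)"
  proof -
    have reE: "Re (of_real e * z) = e * Re z" for e z by simp
    show ?thesis unfolding shifted_form_def strip_form_def minus_complex.simps plus_complex.simps reE pairing_diag ..
  qed
  also have "\<dots> = (LINT p|?M. ?Y p)"
    using i by simp
  finally have q: "Re (shifted_form a \<gamma> f f) = (LINT p|?M. ?Y p)" .
  have Dpot: "potential (\<lambda>s. ?D * W_tilde a \<gamma> s)" by (rule W_tilde_potential(1)[OF a cw]) simp
  have X: "integrable ?M ?X"
  proof -
    have "bounded_weight ?M (\<lambda>p. ?D * W_tilde a \<gamma> (fst p))"
    proof -
      have b: "bounded_borel (\<lambda>p::real \<times> real. ?D * W_tilde a \<gamma> (fst p))"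
        by (rule bounded_borel_fst[OF compact_borel_bounded[OF potential_compact[OF Dpot]]])
      obtain C where "C \<ge> 0" "\<And>p::real \<times> real. norm (?D * W_tilde a \<gamma> (fst p)) \<le> C"
        using bounded_borel_bound[OF b] by blast
      then show ?thesis unfolding bounded_weight_def using strip_measurable[OF bounded_borelD[OF b]] by auto
    qed
    then have "integrable ?M (\<lambda>p. ?D * W_tilde a \<gamma> (fst p) * (cmod (f p))\<^sup>2)" by (rule re[OF _ fL(1)])
    then show ?thesis using L2_D(2)[OF fL(1)] L2_D(2)[OF fL(2)] L2_D(2)[OF fL(3)]
      by (intro Bochner_Integration.integrable_add Bochner_Integration.integrable_diff integrable_mult_right)
  qed
  have "strip_energy a ?D (\<lambda>s. ?D * W_tilde a \<gamma> s) f = (LINT p|lborel. indicator (straight_strip a) p *\<^sub>R ?X p)"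
    unfolding strip_energy_def
  proof (rule Bochner_Integration.integral_cong[OF refl])
    fix p :: "real \<times> real"
    have "f p = 0 \<and> partial_s f p = 0 \<and> partial_u f p = 0" if "p \<notin> straight_strip a"
      using strip_C1_support[OF f] that by blast
    then show "?X p = indicator (straight_strip a) p *\<^sub>R ?X p" by (cases "p \<in> straight_strip a") auto
  qed
  also have "\<dots> = (LINT p|?M. ?X p)" by (rule integral_restrict_space[OF strip_set, symmetric])
  also have "\<dots> \<le> (LINT p|?M. ?D * ?Y p)"
  proof (rule integral_mono[OF X integrable_mult_right[OF Y]])
    fix p assume "p \<in> space ?M"
    then have u: "\<bar>snd p\<bar> < a" by (simp add: space_strip in_strip)
    let ?h = "1 + snd p * \<gamma> (fst p)"
    have h: "0 < ?h" "?h \<le> delta_plus a \<gamma>"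
      using waveguide_curvature(2)[OF a cw] waveguide_curvature(5,6)[OF a cw u, of "fst p"] by auto
    then have "?h\<^sup>2 \<le> ?D" "?h\<^sup>2 > 0" by (auto intro!: power_mono)
    then have "1 * (cmod (partial_s f p))\<^sup>2 \<le> (?D / ?h\<^sup>2) * (cmod (partial_s f p))\<^sup>2"
      by (intro mult_right_mono) auto
    moreover have "(- W_tilde a \<gamma> (fst p)) * (cmod (f p))\<^sup>2 \<le> effective_potential \<gamma> p * (cmod (f p))\<^sup>2"
      using effective_potential_le[OF a cw u, of "fst p"] by (intro mult_right_mono) auto
    then have "?D * ((- W_tilde a \<gamma> (fst p)) * (cmod (f p))\<^sup>2) \<le> ?D * (effective_potential \<gamma> p * (cmod (f p))\<^sup>2)"
      by (intro mult_left_mono) auto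
    ultimately show "?X p \<le> ?D * ?Y p" by (simp add: algebra_simps)
  qed
  also have "\<dots> = ?D * Re (shifted_form a \<gamma> f f)" unfolding q by (rule integral_mult_right_zero)
  finally show ?thesis .
qed

text \<open>On the span of eigenfunctions with eigenvalues below the threshold the shifted form is minus a
  squared norm: eigenfunctions of different eigenvalues are orthogonal, so the factor
  \<open>(\<pi> / (2 a))\<^sup>2 - E\<close> can be split evenly between the two arguments.\<close>

lemma eigenfunction_count_bound:
  assumes a: "a > 0" and cw: "curved_waveguide a \<gamma>"
    and \<phi>: "\<And>i. i < n \<Longrightarrow> \<phi> i \<in> eigenspace a \<gamma> (E i)" and E: "\<And>i. i < n \<Longrightarrow> E i < (pi / (2 * a))\<^sup>2"
    and ind: "AE_independent (strip_measure a) n \<phi>"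
    and D: "D = (delta_plus a \<gamma>)\<^sup>2" and w: "w = (\<lambda>s. D * W_tilde a \<gamma> s)"
  shows "real n \<le> 1 + spread w + (\<Sum>j=2..4. excess (threshold (sqrt D * pi / (2 * a)) j) w)"
proof -
  let ?E1 = "(pi / (2 * a))\<^sup>2" and ?M = "strip_measure a"
  have "\<forall>i. \<exists>gs gu \<eta>. i < n \<longrightarrow> eigendata a \<gamma> (E i) (\<phi> i) gs gu \<eta>"
    using eigendata_exists[OF a cw \<phi>] by blast
  then obtain gs gu \<eta> where d: "\<And>i. i < n \<Longrightarrow> eigendata a \<gamma> (E i) (\<phi> i) (gs i) (gu i) (\<eta> i)" by metis
  have L: "\<phi> i \<in> L2 ?M" "gs i \<in> L2 ?M" "gu i \<in> L2 ?M" and C: "\<And>m. \<eta> i m \<in> strip_C1 a"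
    and t: "L2_tendsto ?M (\<eta> i) (\<phi> i)" "L2_tendsto ?M (\<lambda>m. partial_s (\<eta> i m)) (gs i)" "L2_tendsto ?M (\<lambda>m. partial_u (\<eta> i m)) (gu i)"
    if "i < n" for i
    using d[OF that] unfolding eigendata_def by blast+
  note wt = waveguide_weights[OF a cw]
  define A where "A i j = strip_form a \<gamma> (gs i) (gu i) (\<phi> i) (gs j) (gu j) (\<phi> j) - of_real ?E1 * strip_inner a (\<phi> i) (\<phi> j)" for i j
  have inner_sym: "strip_inner a (\<phi> j) (\<phi> i) = cnj (strip_inner a (\<phi> i) (\<phi> j))" if "i < n" "j < n" for i j
    by (rule hermitian_form_sym[OF hermitian_pairing[OF wt(3)] L(1)[OF that(1)] L(1)[OF that(2)]])
  have herm: "A j i = cnj (A i j)" if "i < n" "j < n" for i j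
    unfolding A_def strip_form_sym[of a \<gamma> "gs j" "gu j" "\<phi> j"] inner_sym[OF that] by simp
  have A_eq: "A i j = of_real (E j - ?E1) * strip_inner a (\<phi> i) (\<phi> j)" if "i < n" "j < n" for i j
    unfolding A_def eigendata_form[OF a cw d[OF that(1)] d[OF that(2)]] by (simp add: algebra_simps)
  \<comment> \<open>The matrix of the form is minus the Gram matrix of the rescaled eigenfunctions
    \<open>sqrt (E\<^sub>1 - E i) \<phi> i\<close>, which are still independent.\<close>
  have neg: "Re (matrix_form n A c c) < 0" if c: "nonzero_coeffs n c" for c
  proof -
    define e where "e i = of_real (sqrt (?E1 - E i)) * c i" for i
    let ?\<Phi> = "lin_comb n e \<phi>"
    have \<Phi>: "?\<Phi> \<in> L2 ?M" using function_space_L2 L(1) by (rule lin_comb_in)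
    have "strip_inner a ?\<Phi> ?\<Phi> = matrix_form n (\<lambda>i j. strip_inner a (\<phi> i) (\<phi> j)) e e"
      using function_space_L2 hermitian_pairing[OF wt(3)] L(1) by (rule hermitian_form_matrix)
    also have "\<dots> = - matrix_form n A c c"
      unfolding matrix_form_def sum_negf[symmetric]
    proof (intro sum.cong refl)
      fix i j assume "i \<in> {..<n}" "j \<in> {..<n}"
      then have ij: "i < n" "j < n" by auto
      show "cnj (e i) * e j * strip_inner a (\<phi> i) (\<phi> j) = - (cnj (c i) * c j * A i j)"
      proof (cases "E i = E j")
        case True
        have "complex_of_real (sqrt (?E1 - E i)) * of_real (sqrt (?E1 - E j)) = of_real (?E1 - E j)"
          unfolding of_real_mult[symmetric] True using E[OF ij(2)] by simp
        moreover have "cnj (e i) * e j * strip_inner a (\<phi> i) (\<phi> j)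
            = (complex_of_real (sqrt (?E1 - E i)) * of_real (sqrt (?E1 - E j))) * (cnj (c i) * c j * strip_inner a (\<phi> i) (\<phi> j))"
          unfolding e_def by (simp add: mult.assoc mult.left_commute)
        ultimately have "cnj (e i) * e j * strip_inner a (\<phi> i) (\<phi> j)
            = of_real (?E1 - E j) * (cnj (c i) * c j * strip_inner a (\<phi> i) (\<phi> j))" by (simp only:)
        then show ?thesis unfolding A_eq[OF ij] by (simp add: algebra_simps)
      next
        case False
        then have "strip_inner a (\<phi> i) (\<phi> j) = 0" by (rule eigenspaces_orthogonal[OF a cw \<phi>[OF ij(1)] \<phi>[OF ij(2)]])
        then show ?thesis unfolding A_eq[OF ij] by simp
      qed
    qed
    finally have "strip_inner a ?\<Phi> ?\<Phi> = - matrix_form n A c c" .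
    moreover have "Re (strip_inner a ?\<Phi> ?\<Phi>) > 0"
    proof (rule strip_inner_pos[OF \<Phi>], rule notI)
      assume "AE p in ?M. ?\<Phi> p = 0"
      then have z: "\<And>i. i < n \<Longrightarrow> e i = 0" using ind unfolding AE_independent_def lin_comb_def by blast
      obtain i where i: "i < n" "c i \<noteq> 0" using c by (auto simp: nonzero_coeffs_def)
      show False using z[OF i(1)] i E[OF i(1)] unfolding e_def by simp
    qed
    ultimately show ?thesis by simp
  qed
  have lim: "(\<lambda>m. shifted_form a \<gamma> (\<eta> i m) (\<eta> j m)) \<longlonglongrightarrow> A i j" if "i < n" "j < n" for i j
    unfolding A_def shifted_form_def
  proof (intro tendsto_diff tendsto_mult tendsto_const)
    note ci = strip_C1_L2[OF C[OF that(1)]] and cj = strip_C1_L2[OF C[OF that(2)]]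
    show "(\<lambda>m. strip_form a \<gamma> (partial_s (\<eta> i m)) (partial_u (\<eta> i m)) (\<eta> i m) (partial_s (\<eta> j m)) (partial_u (\<eta> j m)) (\<eta> j m))
        \<longlonglongrightarrow> strip_form a \<gamma> (gs i) (gu i) (\<phi> i) (gs j) (gu j) (\<phi> j)"
      by (rule strip_form_tendsto[OF a cw L[OF that(1)] L[OF that(2)] ci(1) ci(2) ci(3) cj(1) cj(2) cj(3) t[OF that(1)] t[OF that(2)]])
    show "(\<lambda>m. strip_inner a (\<eta> i m) (\<eta> j m)) \<longlonglongrightarrow> strip_inner a (\<phi> i) (\<phi> j)"
      by (rule pairing_tendsto[OF wt(3) L(1)[OF that(1)] L(1)[OF that(2)] ci(1) t(1)[OF that(1)] cj(1) t(1)[OF that(2)]])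
  qed
  have "\<exists>m e. \<forall>c. nonzero_coeffs n c \<longrightarrow>
      Re (matrix_form n ((\<lambda>m i j. shifted_form a \<gamma> (\<eta> i m) (\<eta> j m)) m) (\<lambda>i. \<Sum>b<n. c b * e b i) (\<lambda>i. \<Sum>b<n. c b * e b i)) < 0"
    using herm neg lim by (rule negative_matrix_open)
  then obtain m e where me: "\<And>c. nonzero_coeffs n c \<Longrightarrow>
      Re (matrix_form n (\<lambda>i j. shifted_form a \<gamma> (\<eta> i m) (\<eta> j m)) (\<lambda>i. \<Sum>b<n. c b * e b i) (\<lambda>i. \<Sum>b<n. c b * e b i)) < 0"
    by blast
  define \<theta> where "\<theta> b = lin_comb n (e b) (\<lambda>i. \<eta> i m)" for b
  have \<theta>: "\<theta> b \<in> strip_C1 a" for b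
    unfolding \<theta>_def using function_space_strip_C1 C by (rule lin_comb_in)
  have D1: "D > 0" using waveguide_curvature(4)[OF a cw] unfolding D by simp
  have "strip_energy a D w (lin_comb n c \<theta>) < 0" if c: "nonzero_coeffs n c" for c
  proof -
    let ?F = "lin_comb n c \<theta>" and ?c = "\<lambda>i. \<Sum>b<n. c b * e b i"
    have F: "?F \<in> strip_C1 a" using function_space_strip_C1 \<theta> by (rule lin_comb_in)
    have eq: "?F = lin_comb n ?c (\<lambda>i. \<eta> i m)"
      unfolding \<theta>_def[abs_def] by (rule lin_comb_lin_comb)
    have "shifted_form a \<gamma> ?F ?F = matrix_form n (\<lambda>i j. shifted_form a \<gamma> (\<eta> i m) (\<eta> j m)) ?c ?c"
      unfolding eq using function_space_strip_C1 hermitian_shifted_form[OF a cw] C by (rule hermitian_form_matrix)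
    then have "Re (shifted_form a \<gamma> ?F ?F) < 0" using me[OF c] by simp
    then have "D * Re (shifted_form a \<gamma> ?F ?F) < 0" using D1 by (simp add: mult_pos_neg)
    then show ?thesis using strip_energy_le_shifted_form[OF a cw F] unfolding w D by linarith
  qed
  moreover have "potential w" "piecewise_continuous w"
    unfolding w using D1 by (auto intro: W_tilde_potential[OF a cw])
  ultimately show ?thesis using strip_count_bound[where \<psi> = \<theta> and n = n, OF a D1 _ _ \<theta>] by blast
qed

section \<open>Counting eigenvalues\<close>

lemma pairing_AE_zero: "AE p in M. g p = 0 \<Longrightarrow> pairing M m f g = 0"
  unfolding pairing_def by (rule integral_eq_zero_AE) auto

text \<open>Suppose a combination vanishes almost everywhere, and keep only its part in one eigenspace. By
  orthogonality, the squared norm of this part is its inner product with the whole combination, that is 0.\<close>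

lemma eigenspaces_independent:
  assumes a: "a > 0" and cw: "curved_waveguide a \<gamma>"
    and \<Phi>: "\<And>E k. E \<in> F \<Longrightarrow> k < N E \<Longrightarrow> \<Phi> E k \<in> eigenspace a \<gamma> E"
    and ind: "\<And>E. E \<in> F \<Longrightarrow> AE_independent (strip_measure a) (N E) (\<Phi> E)"
    and e: "bij_betw e {..<n} (Sigma F (\<lambda>E. {..<N E}))"
  shows "AE_independent (strip_measure a) n (\<lambda>i. \<Phi> (fst (e i)) (snd (e i)))"
  unfolding AE_independent_def
proof (intro allI impI)
  let ?\<phi> = "\<lambda>i. \<Phi> (fst (e i)) (snd (e i))" and ?M = "strip_measure a"
  fix c i0 assume ae: "AE x in ?M. (\<Sum>i<n. c i * ?\<phi> i x) = 0" and i0: "i0 < n"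
  have ei: "fst (e i) \<in> F" "snd (e i) < N (fst (e i))" if "i < n" for i
  proof -
    have "e i \<in> Sigma F (\<lambda>E. {..<N E})" using bij_betwE[OF e] that by blast
    then show "fst (e i) \<in> F" "snd (e i) < N (fst (e i))" by auto
  qed
  have eig: "?\<phi> i \<in> eigenspace a \<gamma> (fst (e i))" if "i < n" for i by (rule \<Phi>[OF ei[OF that]])
  have L: "?\<phi> i \<in> L2 ?M" if "i < n" for i
    using eigendata_exists[OF a cw eig[OF that]] unfolding eigendata_def by blast
  define E0 where "E0 = fst (e i0)"
  define c' where "c' i = (if fst (e i) = E0 then c i else 0)" for i
  let ?\<Psi> = "lin_comb n c' ?\<phi>" and ?S = "lin_comb n c ?\<phi>"
  have mf: "strip_inner a (lin_comb n d ?\<phi>) (lin_comb n d' ?\<phi>) = matrix_form n (\<lambda>i j. strip_inner a (?\<phi> i) (?\<phi> j)) d d'" for d d'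
    using function_space_L2 hermitian_pairing[OF waveguide_weights(3)[OF a cw]] L by (rule hermitian_form_matrix)
  have "matrix_form n (\<lambda>i j. strip_inner a (?\<phi> i) (?\<phi> j)) c' c' = matrix_form n (\<lambda>i j. strip_inner a (?\<phi> i) (?\<phi> j)) c' c"
    unfolding matrix_form_def
  proof (intro sum.cong refl)
    fix i j assume "i \<in> {..<n}" "j \<in> {..<n}"
    then have ij: "i < n" "j < n" by auto
    show "cnj (c' i) * c' j * strip_inner a (?\<phi> i) (?\<phi> j) = cnj (c' i) * c j * strip_inner a (?\<phi> i) (?\<phi> j)"
    proof (cases "fst (e i) = E0 \<and> fst (e j) \<noteq> E0")
      case True
      then have "fst (e i) \<noteq> fst (e j)" by simp
      then have "strip_inner a (?\<phi> i) (?\<phi> j) = 0"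
        by (rule eigenspaces_orthogonal[OF a cw eig[OF ij(1)] eig[OF ij(2)]])
      then show ?thesis by simp
    qed (auto simp: c'_def)
  qed
  then have "strip_inner a ?\<Psi> ?\<Psi> = strip_inner a ?\<Psi> ?S" unfolding mf .
  also have "\<dots> = 0" by (rule pairing_AE_zero) (use ae in \<open>simp add: lin_comb_def\<close>)
  finally have "strip_inner a ?\<Psi> ?\<Psi> = 0" .
  moreover have "?\<Psi> \<in> L2 ?M" using function_space_L2 L by (rule lin_comb_in)
  ultimately have \<Psi>0: "AE x in ?M. ?\<Psi> x = 0" using strip_inner_pos[of ?\<Psi> a] by auto
  define g where "g k = the_inv_into {..<n} e (E0, k)" for k
  have inj: "inj_on e {..<n}" and im: "e ` {..<n} = Sigma F (\<lambda>E. {..<N E})" using e by (auto simp: bij_betw_def)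
  have E0F: "E0 \<in> F" unfolding E0_def by (rule ei(1)[OF i0])
  have g: "g k < n" "e (g k) = (E0, k)" if "k < N E0" for k
  proof -
    have "(E0, k) \<in> e ` {..<n}" unfolding im using that E0F by simp
    then show "g k < n" "e (g k) = (E0, k)"
      unfolding g_def using the_inv_into_into[OF inj _ subset_refl] f_the_inv_into_f[OF inj] by auto
  qed
  have ge: "g (snd (e i)) = i" if "i < n" "fst (e i) = E0" for i
    unfolding g_def using the_inv_into_f_f[OF inj, of i] that by (metis lessThan_iff prod.collapse)
  have "?\<Psi> x = (\<Sum>k<N E0. c (g k) * \<Phi> E0 k x)" for x
  proof -
    have "?\<Psi> x = (\<Sum>i\<in>{i \<in> {..<n}. fst (e i) = E0}. c i * ?\<phi> i x)"
      unfolding lin_comb_def c'_def by (subst sum.inter_filter) (auto intro!: sum.cong)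
    also have "\<dots> = (\<Sum>k<N E0. c (g k) * \<Phi> E0 k x)"
    proof (rule sum.reindex_bij_witness[where i = g and j = "\<lambda>i. snd (e i)"])
      fix i assume "i \<in> {i \<in> {..<n}. fst (e i) = E0}"
      then have i: "i < n" "fst (e i) = E0" by auto
      show "g (snd (e i)) = i" by (rule ge[OF i])
      show "snd (e i) \<in> {..<N E0}" using ei(2)[OF i(1)] i(2) by simp
      show "c (g (snd (e i))) * \<Phi> E0 (snd (e i)) x = c i * ?\<phi> i x" using ge[OF i] i(2) by simp
    next
      fix k assume "k \<in> {..<N E0}"
      then have k: "k < N E0" by simp
      show "snd (e (g k)) = k" "g k \<in> {i \<in> {..<n}. fst (e i) = E0}" using g[OF k] by auto
    qed
    finally show ?thesis .
  qed
  then have "AE x in ?M. (\<Sum>k<N E0. c (g k) * \<Phi> E0 k x) = 0" using \<Psi>0 by simp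
  then have "\<forall>k<N E0. c (g k) = 0" using ind[OF E0F, unfolded AE_independent_def, rule_format, of "\<lambda>k. c (g k)"] by blast
  then show "c i0 = 0" using ei(2)[OF i0] ge[OF i0] by (metis E0_def)
qed

text \<open>All multiplicities are finite and attained once finite families of independent eigenfunctions
  are bounded in number.\<close>

lemma bound_state_count_le:
  assumes a: "a > 0" and cw: "curved_waveguide a \<gamma>"
    and R: "\<And>n \<phi> E. (\<And>i. i < n \<Longrightarrow> \<phi> i \<in> eigenspace a \<gamma> (E i)) \<Longrightarrow> (\<And>i. i < n \<Longrightarrow> E i < (pi / (2 * a))\<^sup>2) \<Longrightarrow>
      AE_independent (strip_measure a) n \<phi> \<Longrightarrow> real n \<le> R"
  shows "bound_state_count a \<gamma> \<le> ennreal R"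
proof -
  let ?M = "strip_measure a" and ?X = "{E \<in> eigenvalues a \<gamma>. E < (pi / (2 * a))\<^sup>2}"
  define fam where "fam E n \<longleftrightarrow> (\<exists>\<phi>. (\<forall>i<n. \<phi> i \<in> eigenspace a \<gamma> E) \<and> AE_independent ?M n \<phi>)" for E n
  define N where "N E = (GREATEST n. fam E n)" for E
  have fam0: "fam E 0" for E by (auto simp: fam_def AE_independent_def)
  have fam_le: "n \<le> nat \<lceil>R\<rceil>" if E: "E \<in> ?X" and fam: "fam E n" for E n
  proof -
    obtain \<phi> where "\<And>i. i < n \<Longrightarrow> \<phi> i \<in> eigenspace a \<gamma> E" "AE_independent ?M n \<phi>" using fam by (auto simp: fam_def)
    then have "real n \<le> R" using R[of n \<phi> "\<lambda>_. E"] E by blast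
    then show ?thesis by linarith
  qed
  have N: "fam E (N E)" and N_max: "\<And>n. fam E n \<Longrightarrow> n \<le> N E" if E: "E \<in> ?X" for E
  proof -
    show "fam E (N E)" unfolding N_def by (rule GreatestI_nat[where P = "fam E" and k = 0, OF fam0]) (rule fam_le[OF E])
    show "n \<le> N E" if "fam E n" for n
      unfolding N_def using that fam_le[OF E] by (rule Greatest_le_nat)
  qed
  have mult: "eigenvalue_multiplicity a \<gamma> E \<le> of_nat (N E)" if E: "E \<in> ?X" for E
    unfolding eigenvalue_multiplicity_def
  proof (rule Sup_least)
    fix x :: ennreal assume "x \<in> {of_nat n | n. \<exists>\<phi>. (\<forall>i<n. \<phi> i \<in> eigenspace a \<gamma> E) \<and> AE_independent ?M n \<phi>}"
    then obtain n where "x = of_nat n" "fam E n" by (auto simp: fam_def)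
    then show "x \<le> of_nat (N E)" using N_max[OF E] by simp
  qed
  have "\<forall>E. \<exists>\<phi>. E \<in> ?X \<longrightarrow> (\<forall>i<N E. \<phi> i \<in> eigenspace a \<gamma> E) \<and> AE_independent ?M (N E) \<phi>"
    using N unfolding fam_def by blast
  then obtain \<Phi> where \<Phi>: "\<And>E. E \<in> ?X \<Longrightarrow> (\<forall>i<N E. \<Phi> E i \<in> eigenspace a \<gamma> E) \<and> AE_independent ?M (N E) (\<Phi> E)" by metis
  have "sum (eigenvalue_multiplicity a \<gamma>) F \<le> ennreal R" if F: "finite F" "F \<subseteq> ?X" for F
  proof -
    let ?n = "\<Sum>E\<in>F. N E" and ?I = "Sigma F (\<lambda>E. {..<N E})"
    have "card ?I = ?n" using F(1) by simp
    moreover have "finite ?I" using F(1) by simp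
    ultimately obtain e where e: "bij_betw e {..<?n} ?I"
      using ex_bij_betw_nat_finite[of ?I] by (auto simp: atLeast0LessThan)
    have ei: "fst (e i) \<in> F" "snd (e i) < N (fst (e i))" if "i < ?n" for i
    proof -
      have "e i \<in> ?I" using bij_betwE[OF e] that by blast
      then show "fst (e i) \<in> F" "snd (e i) < N (fst (e i))" by auto
    qed
    have "real ?n \<le> R"
    proof (rule R[where \<phi> = "\<lambda>i. \<Phi> (fst (e i)) (snd (e i))" and E = "\<lambda>i. fst (e i)"])
      show "\<Phi> (fst (e i)) (snd (e i)) \<in> eigenspace a \<gamma> (fst (e i))" "fst (e i) < (pi / (2 * a))\<^sup>2" if "i < ?n" for i
        using ei[OF that] \<Phi>[of "fst (e i)"] F(2) by auto
      show "AE_independent ?M ?n (\<lambda>i. \<Phi> (fst (e i)) (snd (e i)))"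
        by (rule eigenspaces_independent[where F = F and N = N, OF a cw _ _ e]) (use \<Phi> F(2) in auto)
    qed
    have "sum (eigenvalue_multiplicity a \<gamma>) F \<le> (\<Sum>E\<in>F. of_nat (N E))"
      using F(2) by (intro sum_mono mult) auto
    also have "\<dots> = ennreal (real ?n)" by (simp add: ennreal_of_nat_eq_real_of_nat)
    also have "\<dots> \<le> ennreal R" using \<open>real ?n \<le> R\<close> by (rule ennreal_leI)
    finally show ?thesis .
  qed
  then show ?thesis unfolding bound_state_count_def
    by (subst nonneg_infsum_complete) (auto intro!: SUP_least)
qed

section \<open>The bound in terms of the curvature\<close>

lemma spread_scaled:
  assumes "D > 0"
  shows "spread (\<lambda>s. D * w s) = D * ((LINT p|lborel. w (fst p) * \<bar>fst p - snd p\<bar> * w (snd p)) / (LINT s|lborel. w s))"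
proof -
  have "(LINT p|lborel. (D * w (fst p)) * \<bar>fst p - snd p\<bar> * (D * w (snd p)))
      = (LINT p|lborel. (D * D) * (w (fst p) * \<bar>fst p - snd p\<bar> * w (snd p)))"
    by (rule Bochner_Integration.integral_cong) (auto simp: algebra_simps)
  also have "\<dots> = (D * D) * (LINT p|lborel. w (fst p) * \<bar>fst p - snd p\<bar> * w (snd p))"
    by (rule integral_mult_right_zero)
  finally show ?thesis unfolding spread_def mass_scaled using assms by (simp add: mass_def)
qed

text \<open>The terms of the theorem exceed the excesses by one factor \<open>\<delta>\<^sub>+\<close>.\<close>

lemma excess_W_tilde:
  assumes a: "a > 0" and cw: "curved_waveguide a \<gamma>" and j: "j \<ge> 2" and D: "D = (delta_plus a \<gamma>)\<^sup>2"
  shows "a * D / (pi * sqrt ((real j)\<^sup>2 - 1)) * (LINT s|lborel. W_tilde_mode a \<gamma> j s)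
     = delta_plus a \<gamma> * excess (threshold (sqrt D * pi / (2 * a)) j) (\<lambda>s. D * W_tilde a \<gamma> s)"
    and "0 \<le> (LINT s|lborel. W_tilde_mode a \<gamma> j s)"
proof -
  let ?d = "delta_plus a \<gamma>" and ?r = "sqrt ((real j)\<^sup>2 - 1)"
  have d: "?d \<ge> 1" by (rule waveguide_curvature(4)[OF a cw])
  have r: "?r > 0" using j by (auto intro!: one_less_power)
  have t: "threshold (sqrt D * pi / (2 * a)) j = ?d * pi / (2 * a) * ?r"
    unfolding threshold_def D using d by simp
  have t2: "(threshold (sqrt D * pi / (2 * a)) j)\<^sup>2 = D * ((pi / (2 * a))\<^sup>2 * ((real j)\<^sup>2 - 1))"
    unfolding t using r by (simp add: power_mult_distrib power_divide D)
  have "max 0 (D * W_tilde a \<gamma> s - (threshold (sqrt D * pi / (2 * a)) j)\<^sup>2) = D * W_tilde_mode a \<gamma> j s" for s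
  proof -
    have "D * W_tilde a \<gamma> s - (threshold (sqrt D * pi / (2 * a)) j)\<^sup>2
        = D * (W_tilde a \<gamma> s + (pi / (2 * a))\<^sup>2 * (1 - (real j)\<^sup>2))" unfolding t2 by (simp add: algebra_simps)
    then show ?thesis unfolding W_tilde_mode_def D by (simp add: max_mult_distrib_left)
  qed
  then have "excess (threshold (sqrt D * pi / (2 * a)) j) (\<lambda>s. D * W_tilde a \<gamma> s)
      = D * (LINT s|lborel. W_tilde_mode a \<gamma> j s) / (2 * (?d * pi / (2 * a) * ?r))"
    unfolding excess_def by (simp add: mass_scaled t) (simp add: mass_def)
  then show "a * D / (pi * ?r) * (LINT s|lborel. W_tilde_mode a \<gamma> j s)
     = ?d * excess (threshold (sqrt D * pi / (2 * a)) j) (\<lambda>s. D * W_tilde a \<gamma> s)"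
    using a d r by (simp add: field_simps)
  show "0 \<le> (LINT s|lborel. W_tilde_mode a \<gamma> j s)"
    by (rule integral_nonneg_AE) (simp add: W_tilde_mode_def)
qed

text \<open>As \<open>W_tilde\<close> is bounded, only finitely many terms of the series are nonzero, so the sum is finite and
  dominates any of its partial sums.\<close>

lemma mode_sum_ge:
  assumes a: "a > 0" and cw: "curved_waveguide a \<gamma>" and D: "D = (delta_plus a \<gamma>)\<^sup>2"
  shows "(\<Sum>j=2..4. excess (threshold (sqrt D * pi / (2 * a)) j) (\<lambda>s. D * W_tilde a \<gamma> s))
     \<le> (\<Sum>\<^sub>\<infinity>j\<in>{2..}. a * D / (pi * sqrt ((real j)\<^sup>2 - 1)) * (LINT s|lborel. W_tilde_mode a \<gamma> j s))"
proof -
  let ?T = "\<lambda>j::nat. a * D / (pi * sqrt ((real j)\<^sup>2 - 1)) * (LINT s|lborel. W_tilde_mode a \<gamma> j s)"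
  let ?x = "\<lambda>j. excess (threshold (sqrt D * pi / (2 * a)) j) (\<lambda>s. D * W_tilde a \<gamma> s)"
  have d: "delta_plus a \<gamma> \<ge> 1" by (rule waveguide_curvature(4)[OF a cw])
  have pot: "potential (\<lambda>s. D * W_tilde a \<gamma> s)" unfolding D by (rule W_tilde_potential(1)[OF a cw]) simp
  have \<alpha>: "sqrt D * pi / (2 * a) > 0" using a d unfolding D by simp
  have x0: "?x j \<ge> 0" if "j \<ge> 2" for j
    using threshold_pos[OF \<alpha> that] by (intro excess_nonneg[OF pot]) simp
  have le: "?x j \<le> ?T j" if j: "j \<ge> 2" for j
    unfolding excess_W_tilde(1)[OF a cw j D] using mult_right_mono[OF d x0[OF j]] by simp
  obtain C where C: "C \<ge> 0" "\<And>s. norm (1 * W_tilde a \<gamma> s) \<le> C"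
    using bounded_borel_bound[OF compact_borel_bounded[OF potential_compact[OF W_tilde_potential(1)[OF a cw, of 1]]]] by auto
  obtain J0 :: nat where J0: "C / (pi / (2 * a))\<^sup>2 + 1 \<le> real J0" using real_arch_simple by blast
  define J where "J = max J0 4"
  have zero: "?T j = 0" if j: "J < j" for j
  proof -
    have "W_tilde_mode a \<gamma> j s = 0" for s
    proof -
      have E: "(pi / (2 * a))\<^sup>2 > 0" using a by simp
      have "C / (pi / (2 * a))\<^sup>2 + 1 \<le> real j * 1" using J0 j unfolding J_def by simp
      also have "\<dots> \<le> (real j)\<^sup>2" unfolding power2_eq_square using j by (intro mult_left_mono) auto
      finally have "C / (pi / (2 * a))\<^sup>2 \<le> (real j)\<^sup>2 - 1" by simp
      then have "C \<le> (pi / (2 * a))\<^sup>2 * ((real j)\<^sup>2 - 1)" using E by (simp only: pos_divide_le_eq mult.commute)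
      moreover have "W_tilde a \<gamma> s \<le> C" using C(2)[of s] by simp
      ultimately show ?thesis unfolding W_tilde_mode_def by (simp add: algebra_simps)
    qed
    then show ?thesis by simp
  qed
  have "infsum ?T {2..} = infsum ?T {2..J}"
  proof (rule infsum_cong_neutral)
    show "?T x = 0" if "x \<in> {2..} - {2..J}" for x
      by (rule zero) (use that in auto)
  qed auto
  also have "\<dots> = (\<Sum>j=2..J. ?T j)" by simp
  finally have "infsum ?T {2..} = (\<Sum>j=2..J. ?T j)" .
  moreover have "(\<Sum>j=2..4. ?x j) \<le> (\<Sum>j=2..4. ?T j)" by (intro sum_mono le) auto
  moreover have "(\<Sum>j=2..4. ?T j) \<le> (\<Sum>j=2..J. ?T j)"
  proof (rule sum_mono2)
    show "0 \<le> ?T j" if "j \<in> {2..J} - {2..4}" for j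
      using that by (intro order_trans[OF x0 le]) auto
  qed (auto simp: J_def)
  ultimately show ?thesis by linarith
qed

theorem proposition3p1:
  fixes a S :: real and \<gamma> :: "real \<Rightarrow> real"
  assumes "a > 0"
    and "curved_waveguide a \<gamma>"
    and "\<exists>s. \<gamma> s \<noteq> 0"
    and "\<exists>k::nat. S = real k + 1 / 2"
  shows "neutral_particle_number S a \<gamma> \<le> ennreal ((2 * S + 1) *
    (1 + (delta_plus a \<gamma>)\<^sup>2 *
           ((LINT p|lborel. W_tilde a \<gamma> (fst p) * \<bar>fst p - snd p\<bar> * W_tilde a \<gamma> (snd p))
            / (LINT s|lborel. W_tilde a \<gamma> s))
       + (\<Sum>\<^sub>\<infinity>j\<in>{2..}. a * (delta_plus a \<gamma>)\<^sup>2 / (pi * sqrt ((real j)\<^sup>2 - 1))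
            * (LINT s|lborel. W_tilde_mode a \<gamma> j s))))"
proof -
  let ?D = "(delta_plus a \<gamma>)\<^sup>2"
  let ?w = "\<lambda>s. ?D * W_tilde a \<gamma> s"
  let ?R = "1 + ?D * ((LINT p|lborel. W_tilde a \<gamma> (fst p) * \<bar>fst p - snd p\<bar> * W_tilde a \<gamma> (snd p))
            / (LINT s|lborel. W_tilde a \<gamma> s))
       + (\<Sum>\<^sub>\<infinity>j\<in>{2..}. a * ?D / (pi * sqrt ((real j)\<^sup>2 - 1)) * (LINT s|lborel. W_tilde_mode a \<gamma> j s))"
  note a = assms(1) and cw = assms(2)
  have D: "?D > 0" using waveguide_curvature(4)[OF a cw] by simp
  have "bound_state_count a \<gamma> \<le> ennreal ?R"
  proof (rule bound_state_count_le[OF a cw])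
    fix n \<phi> E
    assume "\<And>i. i < n \<Longrightarrow> \<phi> i \<in> eigenspace a \<gamma> (E i)" "\<And>i. i < n \<Longrightarrow> E i < (pi / (2 * a))\<^sup>2"
      "AE_independent (strip_measure a) n \<phi>"
    then have "real n \<le> 1 + spread ?w + (\<Sum>j=2..4. excess (threshold (sqrt ?D * pi / (2 * a)) j) ?w)"
      by (rule eigenfunction_count_bound[OF a cw _ _ _ refl refl])
    also have "\<dots> \<le> ?R"
      unfolding spread_scaled[OF D] by (intro add_left_mono mode_sum_ge[OF a cw refl])
    finally show "real n \<le> ?R" .
  qed
  then have "neutral_particle_number S a \<gamma> \<le> ennreal (2 * S + 1) * ennreal ?R"
    unfolding neutral_particle_number_def by (intro mult_left_mono) auto
  also have "\<dots> = ennreal ((2 * S + 1) * ?R)"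
    using assms(4) by (intro ennreal_mult'[symmetric]) auto
  finally show ?thesis .
qed

end
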